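(* Let $K:(-\infty,0)\cup(0,\infty)\to\mathbb{R}$ be an odd, twice differentiable function (in the sense that $K'$ exists and is locally absolutely continuous on $(-\infty,0)\cup(0,\infty)$) which satisfies $$\lim_{x\to\infty}K(x)=\lim_{x\to\infty}K'(x)=0\qquad\text{and}\qquad x^3K''(x)\in L_\infty(\mathbb{R}),$$ and let $$T(f)(x)=\mathrm{P.V.}\int_{\mathbb{R}}K(x-t)f(t)\,dt$$ be the corresponding one-dimensional Calderón–Zygmund convolution operator. Then there is a constant $C_K$, depending only on $K$, such that for every $A_2$ weight $\omega$ on $\mathbb{R}$ and every $f\in L_2(\omega)$, $$\|Tf\|_{L_2(\omega)}\le C_K\,\|\omega\|_{A_2}\,\|f\|_{L_2(\omega)}.$$
   Context: A weight is a locally integrable function $\omega$ on $\mathbb{R}$ that is positive almost everywhere. Its $A_2$ constant is $$\|\omega\|_{A_2}=\sup_I\Bigl(\frac1{|I|}\int_I\omega\,dx\Bigr)\Bigl(\frac1{|I|}\int_I\omega^{-1}\,dx\Bigr),$$ the supremum being over all bounded intervals $I\subset\mathbb{R}$, and $\omega$ is an $A_2$ weight if this is finite. $\|f\|_{L_2(\omega)}^2=\int_{\mathbb{R}}|f|^2\,\omega\,dx$. The principal value is $\mathrm{P.V.}\int_{\mathbb{R}} K(x-t)f(t)\,dt=\lim_{\varepsilon\to0^+}\int_{|x-t|>\varepsilon}K(x-t)f(t)\,dt$ (for almost every $x$). *)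

theory Defs
  imports "HOL-Analysis.Analysis"
begin

definition is_weight :: "(real \<Rightarrow> real) \<Rightarrow> bool" where
  "is_weight \<omega> \<longleftrightarrow>
     (\<forall>S. compact S \<longrightarrow> set_integrable lebesgue S \<omega>) \<and> (AE x in lebesgue. 0 < \<omega> x)"

text \<open>
  The integrals are taken in the extended nonnegative reals, since the reciprocal of a weight
  need not be locally integrable; the constant is then infinite. Whether the endpoints belong to
  the interval is immaterial, so only closed nondegenerate intervals are used.
\<close>

definition A2_constant :: "(real \<Rightarrow> real) \<Rightarrow> ennreal" where
  "A2_constant \<omega> =
     (SUP (a, b) \<in> {(a, b). a < b}.
        ((\<integral>\<^sup>+ x \<in> {a..b}. ennreal (\<omega> x) \<partial>lebesgue) / ennreal (b - a)) *
        ((\<integral>\<^sup>+ x \<in> {a..b}. ennreal (inverse (\<omega> x)) \<partial>lebesgue) / ennreal (b - a)))"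

definition A2_weight :: "(real \<Rightarrow> real) \<Rightarrow> bool" where
  "A2_weight \<omega> \<longleftrightarrow> is_weight \<omega> \<and> A2_constant \<omega> < \<infinity>"

definition weighted_L2 ::
  "(real \<Rightarrow> real) \<Rightarrow> (real \<Rightarrow> 'a::real_normed_vector) set" where
  "weighted_L2 \<omega> =
     {f. f \<in> borel_measurable lebesgue \<and> integrable lebesgue (\<lambda>x. (norm (f x))\<^sup>2 * \<omega> x)}"

definition weighted_L2_norm ::
  "(real \<Rightarrow> real) \<Rightarrow> (real \<Rightarrow> 'a::real_normed_vector) \<Rightarrow> real" where
  "weighted_L2_norm \<omega> f = sqrt (LINT x|lebesgue. (norm (f x))\<^sup>2 * \<omega> x)"

text \<open>
  A division is a finite family of compact intervals with pairwise disjoint interiors; its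
  union need not be all of \<open>S\<close>.
\<close>

definition absolutely_continuous_on :: "real set \<Rightarrow> (real \<Rightarrow> real) \<Rightarrow> bool" where
  "absolutely_continuous_on S g \<longleftrightarrow>
     (\<forall>\<epsilon>>0. \<exists>\<delta>>0. \<forall>d t. d division_of t \<longrightarrow> t \<subseteq> S \<longrightarrow> (\<Sum>J\<in>d. measure lborel J) < \<delta> \<longrightarrow>
        (\<Sum>J\<in>d. \<bar>g (Sup J) - g (Inf J)\<bar>) < \<epsilon>)"

definition locally_absolutely_continuous_on :: "real set \<Rightarrow> (real \<Rightarrow> real) \<Rightarrow> bool" where
  "locally_absolutely_continuous_on U g \<longleftrightarrow>
     (\<forall>a b. {a..b} \<subseteq> U \<longrightarrow> absolutely_continuous_on {a..b} g)"

definition in_L_infinity :: "(real \<Rightarrow> real) \<Rightarrow> bool" where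
  "in_L_infinity g \<longleftrightarrow>
     g \<in> borel_measurable lebesgue \<and> (\<exists>M. AE x in lebesgue. \<bar>g x\<bar> \<le> M)"

definition truncated_convolution ::
  "(real \<Rightarrow> real) \<Rightarrow> (real \<Rightarrow> 'a::{banach, second_countable_topology}) \<Rightarrow> real \<Rightarrow> real \<Rightarrow> 'a" where
  "truncated_convolution K f \<epsilon> x =
     (LINT t:{t. \<bar>x - t\<bar> > \<epsilon>}|lebesgue. K (x - t) *\<^sub>R f t)"

text \<open>
  The Bochner integral of a nonintegrable function is 0 by convention, so the existence of the
  principal value includes the absolute convergence of all truncated integrals.
\<close>

definition principal_value_exists ::
  "(real \<Rightarrow> real) \<Rightarrow> (real \<Rightarrow> 'a::{banach, second_countable_topology}) \<Rightarrow> real \<Rightarrow> bool" where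
  "principal_value_exists K f x \<longleftrightarrow>
     (\<forall>\<epsilon>>0. set_integrable lebesgue {t. \<bar>x - t\<bar> > \<epsilon>} (\<lambda>t. K (x - t) *\<^sub>R f t)) \<and>
     (\<exists>l. ((\<lambda>\<epsilon>. truncated_convolution K f \<epsilon> x) \<longlongrightarrow> l) (at_right 0))"

definition cz_operator ::
  "(real \<Rightarrow> real) \<Rightarrow> (real \<Rightarrow> 'a::{banach, second_countable_topology}) \<Rightarrow> real \<Rightarrow> 'a" where
  "cz_operator K f x = Lim (at_right 0) (\<lambda>\<epsilon>. truncated_convolution K f \<epsilon> x)"

end

theory Submission
  imports Defs "HOL-Library.Nat_Bijection"
begin

text \<open>
  The hypotheses give \<open>\<bar>K x\<bar> \<le> B / \<bar>x\<bar>\<close> and \<open>\<bar>K' x\<bar> \<le> B / x\<^sup>2\<close>. As \<open>K\<close> is odd, its truncated Fourier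
  transforms are uniformly bounded; approximating by trigonometric polynomials of large period, on
  which the operator acts diagonally, bounds the truncated operators on \<open>L\<^sub>2\<close>. Cotlar's inequality
  and the Calderon--Zygmund decomposition then give the weak type (1,1) of the maximal truncation
  \<open>T\<^sup>*\<close>, and hence the principal values.

  For the sharp dependence on the weight, \<open>T\<^sup>* f\<close> is dominated by a sparse operator. On the line no
  dyadic grid is needed: the stopping intervals inside an interval \<open>I\<close> are the components of the
  open set where \<open>T\<^sup>*\<close> or the maximal function of \<open>f\<close>, restricted to the triple of \<open>I\<close>, is large. At
  the endpoints of a component both are small, which controls the passage from \<open>I\<close> to the component.
  A sparse operator is bounded linearly in the \<open>A\<^sub>2\<close> constant by duality, because maximal functions
  with respect to an arbitrary locally finite measure on the line are bounded on \<open>L\<^sub>2\<close> with a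
  universal constant.
\<close>

subsection \<open>Size of the kernel\<close>

text \<open>The A2 constant enters the estimate only once. When the sparse operator is paired with a
  test function, the A2 condition is applied in each summand to a single triple interval; what is
  left is a product of two maximal functions, one for \<open>w dx\<close> and one for
  \<open>w^-1 dx\<close>, and their bounds on L2 do not see the weight. Everything before that is
  unweighted and has to supply weak type (1,1), but for the maximal truncation: the recursion
  compares an interior point of a component with an endpoint, at all truncation levels at once, and
  it needs open stopping sets.

  A function in the weighted space need not be integrable, so the theory for integrable functions
  does not reach it directly. The Hardy--Littlewood operator, applied to the indicator of a unit
  interval and bounded on L2 of the inverse weight, shows that f(t) / (1 + |t|) is integrable. This
  makes the far part of the convolution absolutely convergent, and it lets the estimate on (-N, N)
  pass to the line by Fatou's lemma.\<close>

lemma sum_content_division_le_measure: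
  fixes d :: "real set set"
  assumes d: "d division_of t" and t: "t \<subseteq> U" and U: "U \<in> lmeasurable"
  shows "(\<Sum>J\<in>d. measure lborel J) \<le> measure lebesgue U"
proof -
  have fin: "finite d" using d by auto
  have box: "\<exists>a b. J = {a..b} \<and> a \<le> b" if "J \<in> d" for J
    using cbox_division_memE[OF that d] by (metis box_real(2) atLeastatMost_empty_iff2)
  \<comment> \<open>Passing to interiors costs no measure and makes the members of the division
    disjoint.\<close>
  have "(\<Sum>J\<in>d. measure lborel J) = (\<Sum>J\<in>d. measure lebesgue (interior J))"
  proof (rule sum.cong[OF refl])
    fix J assume "J \<in> d"
    then obtain a b where "J = {a..b}" "a \<le> b" using box by blast
    then show "measure lborel J = measure lebesgue (interior J)" by simp
  qed
  also have "\<dots> = measure lebesgue (\<Union>J\<in>d. interior J)"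
  proof (rule measure_finite_Union[symmetric, OF fin])
    show "interior ` d \<subseteq> sets lebesgue" by auto
    show "disjoint_family_on interior d"
      using division_ofD(5)[OF d] by (auto simp: disjoint_family_on_def)
    fix J assume "J \<in> d"
    then obtain a b where "J = {a..b}" "a \<le> b" using box by blast
    then show "emeasure lebesgue (interior J) \<noteq> \<infinity>" by simp
  qed
  also have "\<dots> \<le> measure lebesgue U"
  proof (rule measure_mono_fmeasurable)
    show "(\<Union>J\<in>d. interior J) \<subseteq> U"
      using division_ofD(2)[OF d] t interior_subset by blast
    show "(\<Union>J\<in>d. interior J) \<in> sets lebesgue"
      by (rule lebesgue_openin[of UNIV]) auto
  qed (rule U)
  finally show ?thesis .
qed

text \<open>A gauge argument. Where the derivative bound holds, it controls the increment of
  \<open>g\<close> over every sufficiently short interval around the point. The exceptional points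
  form a null set, which lies in an open set of measure below the \<open>\<delta>\<close> of
  absolute continuity, so the intervals tagged there contribute at most \<open>\<eta>\<close>
  altogether. A fine tagged division combines the two.\<close>

lemma absolutely_continuous_bounded_derivative:
  fixes g :: "real \<Rightarrow> real"
  assumes ab: "a \<le> b" and ac: "absolutely_continuous_on {a..b} g"
    and D: "AE x in lebesgue. x \<in> {a..b} \<longrightarrow> (\<exists>D. (g has_field_derivative D) (at x) \<and> \<bar>D\<bar> \<le> B)"
  shows "\<bar>g b - g a\<bar> \<le> B * (b - a)"
proof (rule field_le_epsilon)
  fix e :: real assume "e > 0"
  define \<eta> where "\<eta> = e / (b - a + 1)"
  have \<eta>: "\<eta> > 0" using ab \<open>e > 0\<close> by (auto simp: \<eta>_def)
  have "\<eta> * (b - a + 1) = e" using ab by (simp add: \<eta>_def)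
  then have \<eta>e: "\<eta> * (b - a) + \<eta> = e" by (simp add: algebra_simps)
  obtain \<delta> where \<delta>: "\<delta> > 0" and acd: "\<And>d t. d division_of t \<Longrightarrow> t \<subseteq> {a..b} \<Longrightarrow>
      (\<Sum>J\<in>d. measure lborel J) < \<delta> \<Longrightarrow> (\<Sum>J\<in>d. \<bar>g (Sup J) - g (Inf J)\<bar>) < \<eta>"
    using ac \<eta> unfolding absolutely_continuous_on_def by metis
  obtain N where N: "N \<in> null_sets lebesgue"
    and ND: "\<And>x. x \<notin> N \<Longrightarrow> x \<in> {a..b} \<Longrightarrow> \<exists>D. (g has_field_derivative D) (at x) \<and> \<bar>D\<bar> \<le> B"
    using D by (auto elim!: AE_E3)
  obtain U where U: "open U" "N \<subseteq> U" "U - N \<in> lmeasurable" "emeasure lebesgue (U - N) < ennreal \<delta>"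
    using sets_lebesgue_outer_open[of N \<delta>] N \<delta> by auto
  have emU: "emeasure lebesgue U < ennreal \<delta>"
    using U(1,4) N by (metis borel_open emeasure_Diff_null_set sets_completionI_sets sets_lborel)
  have Um: "U \<in> lmeasurable"
  proof (rule fmeasurableI)
    show "emeasure lebesgue U < \<infinity>" using emU ennreal_less_top[of \<delta>] by (metis infinity_ennreal_def order.strict_trans)
  qed (use U(1) in simp)
  have mU: "measure lebesgue U < \<delta>"
    using emU Um \<delta> by (simp add: emeasure_eq_measure2 ennreal_less_iff)
  \<comment> \<open>The radius of the gauge at \<open>x\<close>: it keeps exceptional points inside
    \<open>U\<close>, and at all others it is so small that difference quotients stay below
    \<open>B + \<eta>\<close>.\<close>
  have "\<exists>r>0. (x \<in> N \<longrightarrow> ball x r \<subseteq> U) \<and>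
      (x \<notin> N \<longrightarrow> x \<in> {a..b} \<longrightarrow> (\<forall>y\<in>ball x r. \<bar>g y - g x\<bar> \<le> (B + \<eta>) * \<bar>y - x\<bar>))" for x
  proof (cases "x \<in> N")
    case True
    then show ?thesis using U openE by blast
  next
    case False
    show ?thesis
    proof (cases "x \<in> {a..b}")
      case True
      obtain D where D: "(g has_field_derivative D) (at x)" "\<bar>D\<bar> \<le> B" using ND False True by blast
      have "(g has_derivative (*) D) (at x)" using D(1) by (simp add: has_field_derivative_def)
      then obtain r where r: "r > 0" "\<And>y. norm (y - x) < r \<Longrightarrow> norm (g y - g x - D * (y - x)) \<le> \<eta> * norm (y - x)"
        using \<eta> unfolding has_derivative_at_alt by blast
      have "\<bar>g y - g x\<bar> \<le> (B + \<eta>) * \<bar>y - x\<bar>" if "y \<in> ball x r" for y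
      proof -
        have "\<bar>g y - g x - D * (y - x)\<bar> \<le> \<eta> * \<bar>y - x\<bar>"
          using r(2)[of y] that by (simp add: dist_real_def abs_minus_commute)
        moreover have "\<bar>D * (y - x)\<bar> \<le> B * \<bar>y - x\<bar>" using D(2) by (simp add: abs_mult mult_right_mono)
        ultimately show ?thesis by (simp add: algebra_simps)
      qed
      then show ?thesis using r(1) False by blast
    next
      case False
      with \<open>x \<notin> N\<close> show ?thesis by (intro exI[of _ 1]) auto
    qed
  qed
  then obtain r where r: "\<And>x. r x > 0" "\<And>x. x \<in> N \<Longrightarrow> ball x (r x) \<subseteq> U"
     "\<And>x y. x \<notin> N \<Longrightarrow> x \<in> {a..b} \<Longrightarrow> y \<in> ball x (r x) \<Longrightarrow> \<bar>g y - g x\<bar> \<le> (B + \<eta>) * \<bar>y - x\<bar>"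
    by metis
  have "gauge (\<lambda>x. ball x (r x))" using r(1) by (simp add: gauge_ball_dependent)
  then obtain p where p: "p tagged_division_of {a..b}" and fine: "(\<lambda>x. ball x (r x)) fine p"
    by (rule fine_division_exists_real)
  have finp: "finite p" using p by auto
  have pbox: "\<exists>u v. k = {u..v} \<and> u \<le> x \<and> x \<le> v \<and> a \<le> u \<and> v \<le> b" if xk: "(x,k) \<in> p" for x k
  proof -
    obtain u v where "k = {u..v}" using tagged_division_ofD(4)[OF p xk] by auto
    moreover have "x \<in> k" "k \<subseteq> {a..b}" using tagged_division_ofD(2,3)[OF p xk] by auto
    ultimately show ?thesis by auto
  qed
  \<comment> \<open>With the value 0 at the empty set, where \<open>Sup\<close> and
    \<open>Inf\<close> are unspecified, \<open>F\<close> vanishes on every interval with empty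
    interior, as \<open>sum.over_tagged_division_lemma\<close> demands.\<close>
  define F where "F = (\<lambda>k. if k = {} then 0 else \<bar>g (Sup k) - g (Inf k)\<bar>)"
  define p1 where "p1 = {z\<in>p. fst z \<notin> N}"
  define p2 where "p2 = {z\<in>p. fst z \<in> N}"
  have split: "p = p1 \<union> p2" "p1 \<inter> p2 = {}" by (auto simp: p1_def p2_def)
  have "\<bar>g b - g a\<bar> = \<bar>\<Sum>(x,k)\<in>p. g (Sup k) - g (Inf k)\<bar>"
    using additive_tagged_division_1[OF ab p, of g] by simp
  also have "\<dots> \<le> (\<Sum>(x,k)\<in>p. F k)"
    unfolding split_beta
    by (rule order_trans[OF sum_abs]) (auto intro!: sum_mono simp: F_def dest!: pbox)
  also have "\<dots> = (\<Sum>(x,k)\<in>p1. F k) + (\<Sum>(x,k)\<in>p2. F k)"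
    using split finp by (metis finite_Un sum.union_disjoint)
  also have "(\<Sum>(x,k)\<in>p1. F k) \<le> (\<Sum>(x,k)\<in>p1. (B + \<eta>) * measure lborel k)"
  proof (rule sum_mono, clarify)
    fix x k assume xk: "(x,k) \<in> p1"
    then have xp: "(x,k) \<in> p" "x \<notin> N" by (auto simp: p1_def)
    then obtain u v where uv: "k = {u..v}" "u \<le> x" "x \<le> v" "a \<le> u" "v \<le> b" using pbox by blast
    have "k \<subseteq> ball x (r x)" using fine xp(1) by (auto simp: fine_def)
    then have "\<bar>g u - g x\<bar> \<le> (B + \<eta>) * \<bar>u - x\<bar>" "\<bar>g v - g x\<bar> \<le> (B + \<eta>) * \<bar>v - x\<bar>"
      using r(3)[OF xp(2), of u] r(3)[OF xp(2), of v] uv by (simp_all add: subset_eq)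
    then have "\<bar>g v - g u\<bar> \<le> (B + \<eta>) * (v - u)" using uv by (simp add: algebra_simps)
    then show "F k \<le> (B + \<eta>) * measure lborel k" using uv by (simp add: F_def)
  qed
  also have "\<dots> = (B + \<eta>) * (\<Sum>(x,k)\<in>p1. measure lborel k)"
    by (simp add: sum_distrib_left split_beta)
  also have "\<dots> \<le> (B + \<eta>) * (b - a)"
  proof (cases "a = b")
    case True
    have "measure lborel k = 0" if "(x,k) \<in> p1" for x k
      using pbox[of x k] that True by (auto simp: p1_def)
    then have "(\<Sum>(x,k)\<in>p1. measure lborel k) = 0" by (intro sum.neutral) auto
    then show ?thesis using True by simp
  next
    case False
    \<comment> \<open>A negative bound could hold at no point, so the whole interval would be
      exceptional, hence null.\<close>
    have "B \<ge> 0"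
    proof (rule ccontr)
      assume "\<not> B \<ge> 0"
      then have "{a..b} \<subseteq> N" using ND by fastforce
      then have "emeasure lebesgue {a..b} \<le> emeasure lebesgue N" using N by (intro emeasure_mono) auto
      then have "ennreal (b - a) \<le> 0" using N ab by (auto simp: null_sets_def)
      then show False using ab False by (simp add: ennreal_eq_0_iff)
    qed
    have "(\<Sum>(x,k)\<in>p1. measure lborel k) \<le> (\<Sum>(x,k)\<in>p. measure lborel k)"
      unfolding split_beta using finp by (intro sum_mono2) (auto simp: p1_def)
    also have "\<dots> = b - a"
      using additive_content_tagged_division[of p a b] p ab by (simp add: split_beta)
    finally show ?thesis using \<open>B \<ge> 0\<close> \<eta> by (intro mult_left_mono) auto
  qed
  also have "(\<Sum>(x,k)\<in>p2. F k) \<le> \<eta>"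
  proof -
    have pt: "p2 tagged_partial_division_of {a..b}"
      using p tagged_partial_division_subset[of p "{a..b}" p2] unfolding tagged_division_of_def
      by (auto simp: p2_def)
    have td: "p2 tagged_division_of \<Union>(snd ` p2)"
      using pt by (rule tagged_partial_division_of_Union_self)
    have div: "snd ` p2 division_of \<Union>(snd ` p2)" by (rule division_of_tagged_division[OF td])
    have "(\<Sum>(x,k)\<in>p2. F k) = sum F (snd ` p2)"
    proof (rule sum.over_tagged_division_lemma[OF td])
      fix u v :: real assume "box u v = {}"
      then have "v \<le> u" by (simp add: box_eq_empty)
      then show "F (cbox u v) = 0" by (cases "u = v") (auto simp: F_def)
    qed
    also have "\<dots> = (\<Sum>J\<in>snd ` p2. \<bar>g (Sup J) - g (Inf J)\<bar>)"
      using division_ofD(3)[OF div] by (intro sum.cong) (auto simp: F_def)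
    also have "\<dots> < \<eta>"
    proof (rule acd[OF div])
      show sub: "\<Union>(snd ` p2) \<subseteq> {a..b}" using pbox by (fastforce simp: p2_def)
      have "\<Union>(snd ` p2) \<subseteq> U"
      proof clarsimp
        fix y x k assume "(x,k) \<in> p2" "y \<in> k"
        then show "y \<in> U" using fine r(2)[of x] by (force simp: p2_def fine_def)
      qed
      then have "(\<Sum>J\<in>snd ` p2. measure lborel J) \<le> measure lebesgue U"
        by (rule sum_content_division_le_measure[OF div _ Um])
      with mU show "(\<Sum>J\<in>snd ` p2. measure lborel J) < \<delta>" by simp
    qed
    finally show ?thesis by simp
  qed
  finally show "\<bar>g b - g a\<bar> \<le> B * (b - a) + e" using \<eta>e by (simp add: algebra_simps)
qed

lemma absolutely_continuous_on_imp_continuous_on: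
  assumes ac: "absolutely_continuous_on {a..b} g"
  shows "continuous_on {a..b} g"
proof (rule continuous_onI)
  fix x e :: real assume x: "x \<in> {a..b}" and "e > 0"
  then obtain \<delta> where \<delta>: "\<delta> > 0" and acd: "\<And>d t. d division_of t \<Longrightarrow> t \<subseteq> {a..b} \<Longrightarrow>
      (\<Sum>J\<in>d. measure lborel J) < \<delta> \<Longrightarrow> (\<Sum>J\<in>d. \<bar>g (Sup J) - g (Inf J)\<bar>) < e"
    using ac unfolding absolutely_continuous_on_def by metis
  have *: "\<bar>g v - g u\<bar> < e" if "u \<in> {a..b}" "v \<in> {a..b}" "u \<le> v" "v - u < \<delta>" for u v
    using acd[of "{{u..v}}" "{u..v}"] that by (auto intro!: division_of_self[where 'a=real, simplified])
  show "\<exists>d>0. \<forall>x'\<in>{a..b}. dist x' x < d \<longrightarrow> dist (g x') (g x) \<le> e"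
  proof (intro exI conjI ballI impI)
    fix y assume "y \<in> {a..b}" "dist y x < \<delta>"
    then show "dist (g y) (g x) \<le> e"
      using *[of x y] *[of y x] x by (cases "x \<le> y") (auto simp: dist_real_def)
  qed (rule \<delta>)
qed

text \<open>Telescoping along x, 2x, 4x, ...: as \<open>p \<ge> 1\<close>, the increments are
  dominated by a geometric series of ratio 1/2, and the remaining term \<open>h (2 ^ n * x)\<close>
  tends to 0. This stands in for integrating a derivative out to infinity.\<close>

lemma abs_le_of_halving:
  fixes h :: "real \<Rightarrow> real"
  assumes lim: "(h \<longlongrightarrow> 0) at_top" and C: "C \<ge> 0" and p: "p \<ge> 1"
    and step: "\<And>x. x > 0 \<Longrightarrow> \<bar>h x - h (2 * x)\<bar> \<le> C / x ^ p" and x: "x > 0"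
  shows "\<bar>h x\<bar> \<le> 2 * C / x ^ p"
proof -
  have iter: "\<bar>h x\<bar> \<le> \<bar>h (2 ^ n * x)\<bar> + 2 * C / x ^ p" if "x > 0" for n x
    using that
  proof (induction n arbitrary: x)
    case 0
    then show ?case using C by simp
  next
    case (Suc n)
    have "\<bar>h x\<bar> \<le> \<bar>h (2 * x)\<bar> + C / x ^ p" using step[OF Suc.prems] by linarith
    also have "\<bar>h (2 * x)\<bar> \<le> \<bar>h (2 ^ n * (2 * x))\<bar> + 2 * C / (2 * x) ^ p"
      using Suc.IH[of "2 * x"] Suc.prems by simp
    also have "2 * C / (2 * x) ^ p \<le> C / x ^ p"
    proof -
      have "(2::real) \<le> 2 ^ p" using p self_le_power[of "2::real" p] by simp
      then have "2 * C \<le> C * 2 ^ p" using C mult_right_mono[of 2 "2 ^ p" C] by (simp add: mult.commute)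
      then show ?thesis using Suc.prems by (simp add: power_mult_distrib divide_simps)
    qed
    finally show ?case by (simp add: algebra_simps)
  qed
  have "filterlim (\<lambda>n. x * 2 ^ n) at_top sequentially"
    by (rule filterlim_tendsto_pos_mult_at_top[OF tendsto_const x])
      (auto intro!: filterlim_at_infinity_imp_filterlim_at_top filterlim_realpow_sequentially_gt1)
  then have "filterlim (\<lambda>n. 2 ^ n * x) at_top sequentially" by (simp add: mult.commute)
  then have "(\<lambda>n. \<bar>h (2 ^ n * x)\<bar> + 2 * C / x ^ p) \<longlonglongrightarrow> \<bar>0\<bar> + 2 * C / x ^ p"
    by (intro tendsto_intros tendsto_rabs filterlim_compose[OF lim])
  then show ?thesis using iter[OF x] by (intro LIMSEQ_le_const[of _ "2 * C / x ^ p"]) auto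
qed

text \<open>Two rounds of dyadic telescoping. The bound on x^3 K'' makes the increment of K' over
  [x, 2x] at most M / x^2, whence |K'| is at most 2M / x^2; the mean value theorem turns this into
  increments of K of size 2M / x, whence |K| is at most 4M / x. Oddness carries both bounds to the
  negative half-line.\<close>

lemma kernel_size_bounds:
  fixes K :: "real \<Rightarrow> real"
  assumes odd: "\<And>x. x \<noteq> 0 \<Longrightarrow> K (- x) = - K x"
    and diff: "\<And>x. x \<noteq> 0 \<Longrightarrow> K differentiable (at x)"
    and ac: "locally_absolutely_continuous_on (- {0}) (deriv K)"
    and lim: "(K \<longlongrightarrow> 0) at_top"
    and lim': "(deriv K \<longlongrightarrow> 0) at_top"
    and diff2: "AE x in lebesgue. deriv K differentiable (at x)"
    and bound: "in_L_infinity (\<lambda>x. x ^ 3 * deriv (deriv K) x)"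
  shows "\<exists>B>0. \<forall>x. x \<noteq> 0 \<longrightarrow> \<bar>K x\<bar> \<le> B / \<bar>x\<bar> \<and> \<bar>deriv K x\<bar> \<le> B / x\<^sup>2"
proof -
  obtain M0 where "AE x in lebesgue. \<bar>x ^ 3 * deriv (deriv K) x\<bar> \<le> M0"
    using bound by (auto simp: in_L_infinity_def)
  then have M: "AE x in lebesgue. \<bar>x ^ 3 * deriv (deriv K) x\<bar> \<le> max 0 M0" by eventually_elim auto
  define M where "M = max 0 M0"
  have M0: "M \<ge> 0" by (simp add: M_def)
  have K': "(K has_field_derivative deriv K x) (at x)" if "x \<noteq> 0" for x
    using diff[OF that] DERIV_deriv_iff_real_differentiable by blast
  have "\<bar>deriv K x - deriv K (2 * x)\<bar> \<le> M / x\<^sup>2" if "x > 0" for x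
  proof -
    have "\<bar>deriv K (2 * x) - deriv K x\<bar> \<le> M / x ^ 3 * (2 * x - x)"
    proof (rule absolutely_continuous_bounded_derivative)
      show "absolutely_continuous_on {x..2 * x} (deriv K)"
        using ac that unfolding locally_absolutely_continuous_on_def by force
      show "AE y in lebesgue. y \<in> {x..2 * x} \<longrightarrow>
          (\<exists>D. (deriv K has_field_derivative D) (at y) \<and> \<bar>D\<bar> \<le> M / x ^ 3)"
        using M diff2
      proof eventually_elim
        case (elim y)
        show ?case
        proof
          assume y: "y \<in> {x..2 * x}"
          have "\<bar>deriv (deriv K) y\<bar> * x ^ 3 \<le> \<bar>deriv (deriv K) y\<bar> * y ^ 3"
            using y that by (intro mult_left_mono power_mono) auto
          also have "\<dots> \<le> M" using elim(1) y that by (simp add: abs_mult M_def mult.commute)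
          finally have "\<bar>deriv (deriv K) y\<bar> \<le> M / x ^ 3" using that by (simp add: field_simps)
          then show "\<exists>D. (deriv K has_field_derivative D) (at y) \<and> \<bar>D\<bar> \<le> M / x ^ 3"
            using elim(2) DERIV_deriv_iff_real_differentiable by blast
        qed
      qed
    qed (use that in auto)
    also have "\<dots> = M / x\<^sup>2" using that by (simp add: field_simps eval_nat_numeral)
    finally show ?thesis by simp
  qed
  then have b': "\<bar>deriv K x\<bar> \<le> 2 * M / x\<^sup>2" if "x > 0" for x
    using abs_le_of_halving[OF lim' M0, of 2] that by simp
  have "\<bar>K x - K (2 * x)\<bar> \<le> (2 * M) / x ^ 1" if x: "x > 0" for x
  proof -
    obtain z where z: "z > x" "z < 2 * x" "K (2 * x) - K x = (2 * x - x) * deriv K z"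
      using MVT2[of x "2 * x" K "deriv K"] K' x by force
    have "\<bar>deriv K z\<bar> \<le> 2 * M / z\<^sup>2" using b' z x by simp
    also have "\<dots> \<le> 2 * M / x\<^sup>2"
      using z x M0 by (intro divide_left_mono power_mono mult_pos_pos) auto
    finally have "x * \<bar>deriv K z\<bar> \<le> x * (2 * M / x\<^sup>2)" using x by (intro mult_left_mono) auto
    then show ?thesis using z x abs_minus_commute[of "K x"] by (simp add: abs_mult power2_eq_square)
  qed
  then have b: "\<bar>K x\<bar> \<le> 4 * M / x" if "x > 0" for x
    using abs_le_of_halving[OF lim, of "2 * M" 1 x] that M0 by simp
  have odd': "deriv K (- x) = deriv K x" if "x \<noteq> 0" for x
  proof -
    have "((\<lambda>y. - K (- y)) has_field_derivative deriv K (- x)) (at x)"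
      using DERIV_minus[OF DERIV_mirror[THEN iffD1, OF K'[of "- x"]]] that by simp
    moreover have "eventually (\<lambda>y. - K (- y) = K y) (nhds x)"
      using t1_space_nhds[OF that] odd by (auto elim!: eventually_mono)
    ultimately have "(K has_field_derivative deriv K (- x)) (at x)"
      by (subst (asm) DERIV_cong_ev[OF refl _ refl]) auto
    then show ?thesis by (metis DERIV_imp_deriv)
  qed
  \<comment> \<open>\<open>4 * M\<close> serves both bounds; the summand 1 keeps the constant
    positive when \<open>M = 0\<close>.\<close>
  show ?thesis
  proof (intro exI[of _ "4 * M + 1"] conjI allI impI)
    fix x :: real assume x: "x \<noteq> 0"
    have "\<bar>K x\<bar> \<le> 4 * M / \<bar>x\<bar>" using b[of "\<bar>x\<bar>"] odd[OF x] x by (cases "x > 0") auto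
    then show "\<bar>K x\<bar> \<le> (4 * M + 1) / \<bar>x\<bar>" using x by (simp add: field_simps)
    have "\<bar>deriv K x\<bar> \<le> 2 * M / x\<^sup>2" using b'[of "\<bar>x\<bar>"] odd'[OF x] x by (cases "x > 0") auto
    also have "\<dots> \<le> (4 * M + 1) / x\<^sup>2" using M0 by (intro divide_right_mono) auto
    finally show "\<bar>deriv K x\<bar> \<le> (4 * M + 1) / x\<^sup>2" .
  qed (use M0 in simp)
qed

subsection \<open>Maximal functions of locally finite measures\<close>

text \<open>The uncentred maximal function. Over open intervals every superlevel set is a union of
  open intervals, hence open for every \<open>\<mu>\<close> and \<open>\<phi>\<close>. A null
  interval contributes 0 / 0 = 0.\<close>

definition hl_max :: "real measure \<Rightarrow> (real \<Rightarrow> ennreal) \<Rightarrow> real \<Rightarrow> ennreal" where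
  "hl_max \<mu> \<phi> x =
     (SUP (a, b)\<in>{(a, b). a < x \<and> x < b}. (\<integral>\<^sup>+t\<in>{a<..<b}. \<phi> t \<partial>\<mu>) / emeasure \<mu> {a<..<b})"

lemma hl_max_ge:
  "a < x \<Longrightarrow> x < b \<Longrightarrow> (\<integral>\<^sup>+t\<in>{a<..<b}. \<phi> t \<partial>\<mu>) / emeasure \<mu> {a<..<b} \<le> hl_max \<mu> \<phi> x"
  unfolding hl_max_def by (rule SUP_upper2[of "(a,b)"]) auto

lemma less_hl_max_iff:
  "l < hl_max \<mu> \<phi> x \<longleftrightarrow>
     (\<exists>a b. a < x \<and> x < b \<and> l < (\<integral>\<^sup>+t\<in>{a<..<b}. \<phi> t \<partial>\<mu>) / emeasure \<mu> {a<..<b})"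
  unfolding hl_max_def by (auto simp: less_SUP_iff)

lemma hl_max_superlevel_eq:
  "{x. l < hl_max \<mu> \<phi> x} =
     (\<Union>(a, b)\<in>{(a, b). l < (\<integral>\<^sup>+t\<in>{a<..<b}. \<phi> t \<partial>\<mu>) / emeasure \<mu> {a<..<b}}. {a<..<b})"
  unfolding less_hl_max_iff by fastforce

lemma open_hl_max_superlevel: "open {x. l < hl_max \<mu> \<phi> x}"
  unfolding hl_max_superlevel_eq by (intro open_UN) auto

lemma borel_measurable_hl_max [measurable]: "hl_max \<mu> \<phi> \<in> borel_measurable borel"
  by (rule borel_measurableI_greater) (simp add: open_hl_max_superlevel)

lemma ennreal_half_add_half: "x / 2 + x / 2 = (x::ennreal)"
proof -
  have "x / 2 + x / 2 = x * 2 / 2" by (simp add: add_divide_distrib_ennreal[symmetric] mult_2_right)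
  also have "\<dots> = x" by (rule ennreal_mult_divide_eq) auto
  finally show ?thesis .
qed

text \<open>
  In a minimal subcover no point lies in three intervals: among any three, one is contained in the
  union of the one reaching furthest to the left and the one reaching furthest to the right.
\<close>
lemma interval_cover_multiplicity_le_2:
  fixes F :: "(real \<times> real) set"
  assumes "finite F"
  shows "\<exists>G\<subseteq>F. (\<Union>(a,b)\<in>G. {a<..<b}) = (\<Union>(a,b)\<in>F. {a<..<b}) \<and>
    (\<forall>x. card {(a,b)\<in>G. x \<in> {a<..<b}} \<le> 2)"
  using assms
proof (induction F rule: finite_psubset_induct)
  case (psubset F)
  show ?case
  proof (cases "\<forall>x. card {(a,b)\<in>F. x \<in> {a<..<b}} \<le> 2")
    case True
    then show ?thesis by blast
  next
    case False
    then obtain x where x: "card {(a,b)\<in>F. x \<in> {a<..<b}} > 2" by (auto simp: not_le)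
    define S where "S = {(a,b)\<in>F. x \<in> {a<..<b}}"
    have finS: "finite S" and S3: "card S > 2" using x psubset.hyps by (auto simp: S_def intro: card_ge_0_finite)
    then have "S \<noteq> {}" by auto
    obtain i where i: "i \<in> S" "\<And>k. k \<in> S \<Longrightarrow> fst i \<le> fst k"
      using finS \<open>S \<noteq> {}\<close> by (metis arg_min_if_finite not_le)
    obtain j where j: "j \<in> S" "\<And>k. k \<in> S \<Longrightarrow> snd k \<le> snd j"
    proof -
      have "Max (snd ` S) \<in> snd ` S" using finS \<open>S \<noteq> {}\<close> by (intro Max_in) auto
      then obtain j where "j \<in> S" "snd j = Max (snd ` S)" by (metis imageE)
      then show ?thesis using that[of j] finS by auto
    qed
    have "\<not> S \<subseteq> {i,j}"
    proof
      assume "S \<subseteq> {i,j}"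
      then have "card S \<le> card {i,j}" by (intro card_mono) auto
      also have "\<dots> \<le> 2" by (simp add: card_insert_if)
      finally show False using S3 by simp
    qed
    then obtain k where k: "k \<in> S" "k \<noteq> i" "k \<noteq> j" by blast
    have sub: "{fst k<..<snd k} \<subseteq> {fst i<..<snd i} \<union> {fst j<..<snd j}"
    proof
      fix y assume y: "y \<in> {fst k<..<snd k}"
      have "fst i \<le> fst k" "snd k \<le> snd j" using i j k by auto
      moreover have "x < snd i" "fst j < x" using i(1) j(1) by (auto simp: S_def)
      ultimately show "y \<in> {fst i<..<snd i} \<union> {fst j<..<snd j}" using y by force
    qed
    have SF: "S \<subseteq> F" by (auto simp: S_def)
    have "F - {k} \<subset> F" using k SF by blast
    then obtain G where G: "G \<subseteq> F - {k}" "(\<Union>(a,b)\<in>G. {a<..<b}) = (\<Union>(a,b)\<in>F-{k}. {a<..<b})"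
      "\<forall>x. card {(a,b)\<in>G. x \<in> {a<..<b}} \<le> 2"
      using psubset.IH by meson
    have "(\<Union>(a,b)\<in>F-{k}. {a<..<b}) = (\<Union>(a,b)\<in>F. {a<..<b})"
    proof (intro equalityI subsetI)
      fix y assume "y \<in> (\<Union>(a,b)\<in>F. {a<..<b})"
      then obtain l where l: "l \<in> F" "y \<in> {fst l<..<snd l}" by auto
      have ij: "i \<in> F - {k}" "j \<in> F - {k}" using i j k SF by auto
      have "\<exists>l'\<in>F - {k}. y \<in> {fst l'<..<snd l'}"
        proof (cases "l = k")
        case True
        then have "y \<in> {fst i<..<snd i} \<union> {fst j<..<snd j}" using l(2) sub by blast
        then show ?thesis using ij by blast
      next
        case False
        then show ?thesis using l by blast
      qed
      then show "y \<in> (\<Union>(a,b)\<in>F-{k}. {a<..<b})" unfolding split_beta by blast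
    qed auto
    then show ?thesis using G by (intro exI[of _ G]) auto
  qed
qed

lemma layer_cake_le:
  fixes y :: ennreal
  shows "(\<integral>\<^sup>+l. indicator {l. 0 < l \<and> ennreal l < y} l \<partial>lborel) \<le> y"
proof (cases y)
  case (real r)
  then have "{l. 0 < l \<and> ennreal l < y} = {0<..<r}" by (auto simp: ennreal_less_iff)
  then show ?thesis using real by simp
qed simp

text \<open>For finite \<open>y\<close> this is the integral of 2l from 0 to \<open>y\<close>; for
  \<open>y = \<infinity>\<close> the integral dominates the one for each finite height n.\<close>

lemma layer_cake_square:
  fixes y :: ennreal
  shows "(\<integral>\<^sup>+l. ennreal (2 * l) * indicator {l. 0 < l \<and> ennreal l < y} l \<partial>lborel) = y\<^sup>2"
proof -
  have fin: "(\<integral>\<^sup>+l. ennreal (2 * l) * indicator {l. 0 < l \<and> ennreal l < ennreal r} l \<partial>lborel) = (ennreal r)\<^sup>2" if "r \<ge> 0" for r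
  proof -
    have "(\<integral>\<^sup>+l. ennreal (2 * l) * indicator {l. 0 < l \<and> ennreal l < ennreal r} l \<partial>lborel)
      = (\<integral>\<^sup>+l. ennreal (2 * l) * indicator {0..r} l \<partial>lborel)"
    proof (rule nn_integral_cong_AE)
      show "AE l in lborel. ennreal (2 * l) * indicator {l. 0 < l \<and> ennreal l < ennreal r} l
          = ennreal (2 * l) * indicator {0..r} l"
        using AE_lborel_singleton[of r] AE_lborel_singleton[of 0]
      proof eventually_elim
        case (elim l)
        then show ?case using that by (auto simp: indicator_def ennreal_less_iff)
      qed
    qed
    also have "\<dots> = r\<^sup>2 - 0\<^sup>2"
      using that by (intro nn_integral_FTC_Icc) (auto intro!: derivative_eq_intros)
    finally show ?thesis using that by (simp add: ennreal_power)
  qed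
  show ?thesis
  proof (cases y)
    case (real r)
    then show ?thesis using fin by simp
  next
    case top
    have "of_nat n \<le> (\<integral>\<^sup>+l. ennreal (2 * l) * indicator {l. 0 < l \<and> ennreal l < y} l \<partial>lborel)" for n
    proof -
      have "(of_nat n :: ennreal) \<le> (of_nat n)\<^sup>2"
        by (metis of_nat_mono of_nat_power power2_nat_le_imp_le power2_eq_square le_square)
      also have "\<dots> = (\<integral>\<^sup>+l. ennreal (2 * l) * indicator {l. 0 < l \<and> ennreal l < ennreal (real n)} l \<partial>lborel)"
        by (simp add: fin ennreal_of_nat_eq_real_of_nat)
      also have "\<dots> \<le> (\<integral>\<^sup>+l. ennreal (2 * l) * indicator {l. 0 < l \<and> ennreal l < y} l \<partial>lborel)"
        by (intro nn_integral_mono mult_left_mono) (auto simp: indicator_def top)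
      finally show ?thesis .
    qed
    then have "(SUP n. of_nat n) \<le> (\<integral>\<^sup>+l. ennreal (2 * l) * indicator {l. 0 < l \<and> ennreal l < y} l \<partial>lborel)"
      by (intro SUP_least) auto
    then have "(\<integral>\<^sup>+l. ennreal (2 * l) * indicator {l. 0 < l \<and> ennreal l < y} l \<partial>lborel) = top"
      by (simp add: ennreal_SUP_of_nat_eq_top top_unique)
    then show ?thesis using top by (simp add: power2_eq_square)
  qed
qed

text \<open>The measure may fail to be doubling and may vanish on intervals. Covering by intervals
  of the line with multiplicity two replaces doubling, and this is why the constants below are the
  same for all such measures.\<close>

locale locally_finite_measure =
  fixes \<mu> :: "real measure"
  assumes sets_eq [measurable_cong]: "sets \<mu> = sets borel"
    and finite_interval: "\<And>a b. emeasure \<mu> {a<..<b} < \<infinity>"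
begin

lemma space_eq [simp]: "space \<mu> = UNIV"
  using sets_eq_imp_space_eq[OF sets_eq] by simp

lemma sigma_finite: "sigma_finite_measure \<mu>"
proof
  show "\<exists>A. countable A \<and> A \<subseteq> sets \<mu> \<and> \<Union>A = space \<mu> \<and> (\<forall>a\<in>A. emeasure \<mu> a \<noteq> \<infinity>)"
  proof (intro exI conjI)
    show "countable (range (\<lambda>n::nat. {- real n<..<real n}))" by simp
    show "\<Union>(range (\<lambda>n::nat. {- real n<..<real n})) = space \<mu>"
    proof -
      have "\<exists>n::nat. - real n < x \<and> x < real n" for x
        using reals_Archimedean2[of "\<bar>x\<bar>"] by (force simp: abs_less_iff)
      then show ?thesis by auto
    qed
  qed (use finite_interval sets_eq in \<open>auto simp: less_top\<close>)
qed

lemma mult_emeasure_le_of_less_average: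
  assumes "l < (\<integral>\<^sup>+t\<in>{a<..<b}. \<phi> t \<partial>\<mu>) / emeasure \<mu> {a<..<b}"
  shows "l * emeasure \<mu> {a<..<b} \<le> (\<integral>\<^sup>+t\<in>{a<..<b}. \<phi> t \<partial>\<mu>)"
proof (cases "emeasure \<mu> {a<..<b} = 0")
  case False
  let ?m = "emeasure \<mu> {a<..<b}"
  have "l * ?m \<le> ?m * ((\<integral>\<^sup>+t\<in>{a<..<b}. \<phi> t \<partial>\<mu>) / ?m)"
    using mult_right_mono[OF less_imp_le[OF assms], of ?m] by (simp add: mult.commute)
  also have "\<dots> = (\<integral>\<^sup>+t\<in>{a<..<b}. \<phi> t \<partial>\<mu>) * ?m / ?m"
    by (simp add: ennreal_times_divide mult.commute)
  also have "\<dots> = (\<integral>\<^sup>+t\<in>{a<..<b}. \<phi> t \<partial>\<mu>)"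
    using False finite_interval[of a b] by (intro ennreal_mult_divide_eq) auto
  finally show ?thesis .
qed simp

text \<open>After thinning the family to multiplicity at most two with the same union, the averages
  can be added up; the factor 2 is the multiplicity.\<close>

lemma weak_type_finite:
  assumes [measurable]: "\<phi> \<in> borel_measurable borel" and F: "finite F"
    and avg: "\<And>a b. (a,b) \<in> F \<Longrightarrow> l * emeasure \<mu> {a<..<b} \<le> (\<integral>\<^sup>+t\<in>{a<..<b}. \<phi> t \<partial>\<mu>)"
  shows "l * emeasure \<mu> (\<Union>(a,b)\<in>F. {a<..<b}) \<le> 2 * (\<integral>\<^sup>+t. \<phi> t \<partial>\<mu>)"
proof -
  obtain G where G0: "G \<subseteq> F \<and> (\<Union>(a,b)\<in>G. {a<..<b}) = (\<Union>(a,b)\<in>F. {a<..<b}) \<and>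
    (\<forall>x. card {(a,b)\<in>G. x \<in> {a<..<b}} \<le> 2)"
    using interval_cover_multiplicity_le_2[OF F] by (rule exE)
  have G: "G \<subseteq> F" "(\<Union>(a,b)\<in>G. {a<..<b}) = (\<Union>(a,b)\<in>F. {a<..<b})"
    by (rule conjunct1[OF G0], rule conjunct1[OF conjunct2[OF G0]])
  have mult: "card {(a,b)\<in>G. x \<in> {a<..<b}} \<le> 2" for x
    using conjunct2[OF conjunct2[OF G0]] by (rule spec)
  have finG: "finite G" using G(1) F finite_subset by blast
  have "l * emeasure \<mu> (\<Union>(a,b)\<in>G. {a<..<b}) \<le> l * (\<Sum>(a,b)\<in>G. emeasure \<mu> {a<..<b})"
    unfolding split_beta
    by (intro mult_left_mono emeasure_subadditive_finite) (auto simp: finG sets_eq)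
  also have "\<dots> = (\<Sum>(a,b)\<in>G. l * emeasure \<mu> {a<..<b})" by (simp add: sum_distrib_left split_beta)
  also have "\<dots> \<le> (\<Sum>(a,b)\<in>G. \<integral>\<^sup>+t\<in>{a<..<b}. \<phi> t \<partial>\<mu>)"
    using avg G(1) by (intro sum_mono) auto
  also have "\<dots> = (\<integral>\<^sup>+t. (\<Sum>(a,b)\<in>G. \<phi> t * indicator {a<..<b} t) \<partial>\<mu>)"
    unfolding split_beta by (subst nn_integral_sum) auto
  also have "\<dots> \<le> (\<integral>\<^sup>+t. 2 * \<phi> t \<partial>\<mu>)"
  proof (rule nn_integral_mono)
    fix t
    have "(\<Sum>(a,b)\<in>G. \<phi> t * indicator {a<..<b} t) = (\<Sum>z\<in>{(a,b)\<in>G. t \<in> {a<..<b}}. \<phi> t)"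
      by (rule sum.mono_neutral_cong_right[OF finG]) (auto simp: indicator_def)
    also have "\<dots> = of_nat (card {(a,b)\<in>G. t \<in> {a<..<b}}) * \<phi> t" by simp
    also have "\<dots> \<le> of_nat 2 * \<phi> t" by (intro mult_right_mono of_nat_mono mult) auto
    finally show "(\<Sum>(a,b)\<in>G. \<phi> t * indicator {a<..<b} t) \<le> 2 * \<phi> t" by simp
  qed
  also have "\<dots> = 2 * (\<integral>\<^sup>+t. \<phi> t \<partial>\<mu>)" by (rule nn_integral_cmult) simp
  finally show ?thesis by (simp add: G(2))
qed

text \<open>The superlevel set is a union of intervals of large average. By Lindelof countably many
  of them suffice, and these are exhausted by finite unions, on which the bound is uniform.\<close>

theorem hl_max_weak_type:
  assumes phi [measurable]: "\<phi> \<in> borel_measurable borel"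
  shows "l * emeasure \<mu> {x. l < hl_max \<mu> \<phi> x} \<le> 2 * (\<integral>\<^sup>+t. \<phi> t \<partial>\<mu>)"
proof -
  define R where "R = {(a, b). l < (\<integral>\<^sup>+t\<in>{a<..<b}. \<phi> t \<partial>\<mu>) / emeasure \<mu> {a<..<b}}"
  define I where "I = (\<lambda>(a::real, b). {a<..<b})"
  have eq: "{x. l < hl_max \<mu> \<phi> x} = \<Union>(I ` R)"
    unfolding hl_max_superlevel_eq R_def I_def by auto
  have "open S" if "S \<in> I ` R" for S using that by (auto simp: I_def)
  then obtain F' where F': "F' \<subseteq> I ` R" "countable F'" "\<Union>F' = \<Union>(I ` R)"
    by (rule Lindelof)
  then obtain R' where R': "countable R'" "R' \<subseteq> R" "F' = I ` R'"
    by (meson countable_subset_image)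
  show ?thesis
  proof (cases "R' = {}")
    case True
    then show ?thesis using F' R' eq by simp
  next
    case False
    define A where "A = (\<lambda>n::nat. \<Union>(I ` (from_nat_into R' ` {..n})))"
    have UA: "(\<Union>n. A n) = {x. l < hl_max \<mu> \<phi> x}"
    proof -
      have "(\<Union>n. A n) = \<Union>(I ` range (from_nat_into R'))" by (auto simp: A_def)
      then show ?thesis using eq F'(3) R'(3) range_from_nat_into[OF False R'(1)] by simp
    qed
    have Am: "range A \<subseteq> sets \<mu>" by (auto simp: A_def I_def sets_eq split_beta intro!: borel_open)
    have "incseq A" by (fastforce simp: incseq_def A_def)
    have "l * emeasure \<mu> {x. l < hl_max \<mu> \<phi> x} = (SUP n. l * emeasure \<mu> (A n))"
      unfolding UA[symmetric] SUP_emeasure_incseq[OF Am \<open>incseq A\<close>, symmetric]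
      by (rule SUP_mult_left_ennreal)
    also have "\<dots> \<le> 2 * (\<integral>\<^sup>+t. \<phi> t \<partial>\<mu>)"
    proof (rule SUP_least)
      fix n
      have "from_nat_into R' m \<in> R" for m using from_nat_into[OF False] R'(2) by auto
      then show "l * emeasure \<mu> (A n) \<le> 2 * (\<integral>\<^sup>+t. \<phi> t \<partial>\<mu>)"
        unfolding A_def I_def
      proof (intro weak_type_finite phi)
        fix a b assume "(a, b) \<in> from_nat_into R' ` {..n}"
        then have "(a, b) \<in> R" using \<open>\<And>m. from_nat_into R' m \<in> R\<close> by (metis imageE)
        then show "l * emeasure \<mu> {a<..<b} \<le> (\<integral>\<^sup>+t\<in>{a<..<b}. \<phi> t \<partial>\<mu>)"
          by (auto simp: R_def intro: mult_emeasure_le_of_less_average)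
      qed simp
    qed
    finally show ?thesis .
  qed
qed

text \<open>The part of \<open>\<phi>\<close> not exceeding \<open>l / 2\<close> adds at most
  \<open>l / 2\<close> to any average, so the large part must contribute the rest. This is the
  splitting behind interpolation between weak type (1,1) and the trivial supremum bound.\<close>

lemma hl_max_truncate:
  assumes [measurable]: "\<phi> \<in> borel_measurable borel" and l: "l < \<infinity>" "l < hl_max \<mu> \<phi> x"
  shows "l / 2 < hl_max \<mu> (\<lambda>t. \<phi> t * indicator {t. l / 2 < \<phi> t} t) x"
proof -
  obtain a b where ab: "a < x" "x < b" "l < (\<integral>\<^sup>+t\<in>{a<..<b}. \<phi> t \<partial>\<mu>) / emeasure \<mu> {a<..<b}"
    using l by (auto simp: less_hl_max_iff)
  let ?m = "emeasure \<mu> {a<..<b}"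
  let ?\<psi> = "\<lambda>t. \<phi> t * indicator {t. l / 2 < \<phi> t} t"
  have "(\<integral>\<^sup>+t\<in>{a<..<b}. \<phi> t \<partial>\<mu>) \<le> (\<integral>\<^sup>+t. (?\<psi> t * indicator {a<..<b} t + l / 2 * indicator {a<..<b} t) \<partial>\<mu>)"
    by (intro nn_integral_mono) (auto simp: indicator_def not_less)
  also have "\<dots> = (\<integral>\<^sup>+t\<in>{a<..<b}. ?\<psi> t \<partial>\<mu>) + l / 2 * ?m"
    by (subst nn_integral_add) (auto simp: nn_integral_cmult_indicator sets_eq)
  finally have "(\<integral>\<^sup>+t\<in>{a<..<b}. \<phi> t \<partial>\<mu>) / ?m \<le> ((\<integral>\<^sup>+t\<in>{a<..<b}. ?\<psi> t \<partial>\<mu>) + l / 2 * ?m) / ?m"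
    by (rule divide_right_mono_ennreal)
  also have "\<dots> = (\<integral>\<^sup>+t\<in>{a<..<b}. ?\<psi> t \<partial>\<mu>) / ?m + l / 2 * (?m / ?m)"
    by (simp add: add_divide_distrib_ennreal ennreal_times_divide)
  also have "\<dots> \<le> (\<integral>\<^sup>+t\<in>{a<..<b}. ?\<psi> t \<partial>\<mu>) / ?m + l / 2 * 1"
  proof (intro add_left_mono mult_left_mono)
    show "?m / ?m \<le> 1"
      using finite_interval[of a b] by (cases "?m = 0") (auto simp: ennreal_divide_self)
  qed simp
  finally have "l < (\<integral>\<^sup>+t\<in>{a<..<b}. ?\<psi> t \<partial>\<mu>) / ?m + l / 2"
    using ab(3) by (simp only: mult_1_right)
  also have "\<dots> \<le> hl_max \<mu> ?\<psi> x + l / 2" by (intro add_right_mono hl_max_ge ab)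
  finally have *: "l / 2 + l / 2 < hl_max \<mu> ?\<psi> x + l / 2"
    by (simp add: ennreal_half_add_half)
  then show ?thesis by (meson add_right_mono not_le)
qed

text \<open>Marcinkiewicz interpolation: layer cake formula, weak type at each height l for the part
  of \<open>\<phi>\<close> above l / 2, then Fubini. The constant is 16 = 4 * 2 * 2: from 2l = 4 (l
  / 2), from the weak type, and from the range l < 2 \<open>\<phi> t\<close> of heights.\<close>

theorem hl_max_strong_type:
  assumes [measurable]: "\<phi> \<in> borel_measurable borel"
  shows "(\<integral>\<^sup>+x. (hl_max \<mu> \<phi> x)\<^sup>2 \<partial>\<mu>) \<le> 16 * (\<integral>\<^sup>+t. (\<phi> t)\<^sup>2 \<partial>\<mu>)"
proof -
  interpret sigma_finite_measure \<mu> by (rule sigma_finite)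
  interpret pair_sigma_finite lborel \<mu> ..
  let ?M = "hl_max \<mu> \<phi>"
  let ?\<psi> = "\<lambda>l t. \<phi> t * indicator {t. ennreal l / 2 < \<phi> t} t"
  have level: "ennreal (2 * l) * emeasure \<mu> {x. ennreal l < ?M x} \<le> 8 * (\<integral>\<^sup>+t. ?\<psi> l t \<partial>\<mu>)" if "l > 0" for l
  proof -
    have [measurable]: "?\<psi> l \<in> borel_measurable borel" by measurable
    have "ennreal (2 * l) * emeasure \<mu> {x. ennreal l < ?M x}
        \<le> ennreal (2 * l) * emeasure \<mu> {x. ennreal l / 2 < hl_max \<mu> (?\<psi> l) x}"
      by (intro mult_left_mono emeasure_mono)
        (auto simp: sets_eq intro!: hl_max_truncate borel_open open_hl_max_superlevel)
    also have "\<dots> = 4 * (ennreal l / 2) * emeasure \<mu> {x. ennreal l / 2 < hl_max \<mu> (?\<psi> l) x}"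
    proof -
      have "4 * (ennreal l / 2) = ennreal 4 * ennreal (l / 2)" using that divide_ennreal[of l 2] by simp
      also have "\<dots> = ennreal (4 * (l / 2))"
        using that by (intro ennreal_mult[symmetric]) auto
      finally show ?thesis by simp
    qed
    also have "4 * (ennreal l / 2) * emeasure \<mu> {x. ennreal l / 2 < hl_max \<mu> (?\<psi> l) x}
        \<le> 4 * (2 * (\<integral>\<^sup>+t. ?\<psi> l t \<partial>\<mu>))"
      unfolding mult.assoc by (intro mult_left_mono hl_max_weak_type) auto
    finally show ?thesis by (simp add: mult.assoc[symmetric])
  qed
  have meas [measurable]: "Measurable.pred (lborel \<Otimes>\<^sub>M \<mu>) (\<lambda>z. ennreal (fst z) < ?M (snd z))"
    "Measurable.pred (lborel \<Otimes>\<^sub>M \<mu>) (\<lambda>z. ennreal (fst z) / 2 < \<phi> (snd z))"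
    by measurable
  have "(\<integral>\<^sup>+x. (?M x)\<^sup>2 \<partial>\<mu>) = (\<integral>\<^sup>+x. \<integral>\<^sup>+l. ennreal (2 * l) * indicator {l. 0 < l \<and> ennreal l < ?M x} l \<partial>lborel \<partial>\<mu>)"
    by (simp add: layer_cake_square)
  also have "\<dots> = (\<integral>\<^sup>+l. \<integral>\<^sup>+x. ennreal (2 * l) * indicator {l. 0 < l \<and> ennreal l < ?M x} l \<partial>\<mu> \<partial>lborel)"
    by (rule Fubini[where f = "\<lambda>z. ennreal (2 * fst z) * indicator {l. 0 < l \<and> ennreal l < ?M (snd z)} (fst z)", simplified]) measurable
  also have "\<dots> = (\<integral>\<^sup>+l. indicator {0<..} l * (ennreal (2 * l) * emeasure \<mu> {x. ennreal l < ?M x}) \<partial>lborel)"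
  proof (rule nn_integral_cong)
    fix l :: real
    have "(\<integral>\<^sup>+x. ennreal (2 * l) * indicator {l. 0 < l \<and> ennreal l < ?M x} l \<partial>\<mu>)
       = (\<integral>\<^sup>+x. (indicator {0<..} l * ennreal (2 * l)) * indicator {x. ennreal l < ?M x} x \<partial>\<mu>)"
      by (intro nn_integral_cong) (auto simp: indicator_def)
    also have "\<dots> = (indicator {0<..} l * ennreal (2 * l)) * emeasure \<mu> {x. ennreal l < ?M x}"
      by (intro nn_integral_cmult_indicator) (simp add: sets_eq borel_open open_hl_max_superlevel)
    finally show "(\<integral>\<^sup>+x. ennreal (2 * l) * indicator {l. 0 < l \<and> ennreal l < ?M x} l \<partial>\<mu>)
       = indicator {0<..} l * (ennreal (2 * l) * emeasure \<mu> {x. ennreal l < ?M x})" by (simp add: mult.assoc)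
  qed
  also have "\<dots> \<le> (\<integral>\<^sup>+l. indicator {0<..} l * (8 * (\<integral>\<^sup>+t. ?\<psi> l t \<partial>\<mu>)) \<partial>lborel)"
    by (intro nn_integral_mono) (auto simp: indicator_def[of "{0<..}"] level)
  also have "\<dots> = (\<integral>\<^sup>+l. \<integral>\<^sup>+t. indicator {0<..} l * (8 * ?\<psi> l t) \<partial>\<mu> \<partial>lborel)"
    by (subst nn_integral_cmult, simp, subst nn_integral_cmult) simp_all
  also have "\<dots> = (\<integral>\<^sup>+t. \<integral>\<^sup>+l. indicator {0<..} l * (8 * ?\<psi> l t) \<partial>lborel \<partial>\<mu>)"
    by (rule Fubini[symmetric, where f = "\<lambda>(l, t). indicator {0<..} l * (8 * ?\<psi> l t)", simplified]) measurable
  also have "\<dots> = (\<integral>\<^sup>+t. 8 * \<phi> t * (\<integral>\<^sup>+l. indicator {l. 0 < l \<and> ennreal l < 2 * \<phi> t} l \<partial>lborel) \<partial>\<mu>)"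
  proof (rule nn_integral_cong)
    fix t
    have half: "ennreal l / 2 < \<phi> t \<longleftrightarrow> ennreal l < 2 * \<phi> t" if "l > 0" for l
    proof -
      have l2: "ennreal l / 2 = ennreal (l / 2)" using that divide_ennreal[of l 2] by simp
      show ?thesis
      proof (cases "\<phi> t")
        case (real r)
        then have "2 * \<phi> t = ennreal (2 * r)" by (simp add: ennreal_mult)
        then show ?thesis using real that by (simp only: l2) (auto simp: ennreal_less_iff)
      next
        case top
        then show ?thesis by (simp add: l2 ennreal_mult_top)
      qed
    qed
    have "(\<integral>\<^sup>+l. indicator {0<..} l * (8 * ?\<psi> l t) \<partial>lborel)
      = (\<integral>\<^sup>+l. 8 * \<phi> t * indicator {l. 0 < l \<and> ennreal l < 2 * \<phi> t} l \<partial>lborel)"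
      by (intro nn_integral_cong) (auto simp: indicator_def half)
    also have "\<dots> = 8 * \<phi> t * (\<integral>\<^sup>+l. indicator {l. 0 < l \<and> ennreal l < 2 * \<phi> t} l \<partial>lborel)"
      by (rule nn_integral_cmult) simp
    finally show "(\<integral>\<^sup>+l. indicator {0<..} l * (8 * ?\<psi> l t) \<partial>lborel)
      = 8 * \<phi> t * (\<integral>\<^sup>+l. indicator {l. 0 < l \<and> ennreal l < 2 * \<phi> t} l \<partial>lborel)" .
  qed
  also have "\<dots> \<le> (\<integral>\<^sup>+t. 16 * (\<phi> t)\<^sup>2 \<partial>\<mu>)"
  proof (rule nn_integral_mono)
    fix t
    have "8 * \<phi> t * (\<integral>\<^sup>+l. indicator {l. 0 < l \<and> ennreal l < 2 * \<phi> t} l \<partial>lborel) \<le> 8 * \<phi> t * (2 * \<phi> t)"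
      by (intro mult_left_mono layer_cake_le) auto
    also have "\<dots> = 16 * (\<phi> t)\<^sup>2" by (simp add: power2_eq_square mult_ac)
    finally show "8 * \<phi> t * (\<integral>\<^sup>+l. indicator {l. 0 < l \<and> ennreal l < 2 * \<phi> t} l \<partial>lborel) \<le> 16 * (\<phi> t)\<^sup>2" .
  qed
  also have "\<dots> = 16 * (\<integral>\<^sup>+t. (\<phi> t)\<^sup>2 \<partial>\<mu>)" by (rule nn_integral_cmult) simp
  finally show ?thesis .
qed

end

section \<open>Reflection and finite sums of Lebesgue integrals\<close>

lemma integral_reflect_lborel:
  fixes f :: "real \<Rightarrow> 'a::{banach, second_countable_topology}"
  shows "(LBINT t. f t) = (LBINT s. f (x - s))"
  using lborel_integral_real_affine[of "-1" f x] by simp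

lemma set_lebesgue_integral_sum:
  fixes f :: "'i \<Rightarrow> 'a \<Rightarrow> 'b::{banach, second_countable_topology}"
  assumes "\<And>i. i \<in> I \<Longrightarrow> set_integrable M A (f i)"
  shows "(LINT x:A|M. (\<Sum>i\<in>I. f i x)) = (\<Sum>i\<in>I. LINT x:A|M. f i x)"
  using assms unfolding set_integrable_def set_lebesgue_integral_def scaleR_sum_right
  by (rule Bochner_Integration.integral_sum)

lemma set_integrable_sum:
  fixes f :: "'i \<Rightarrow> 'a \<Rightarrow> 'b::{banach, second_countable_topology}"
  assumes "\<And>i. i \<in> I \<Longrightarrow> set_integrable M A (f i)"
  shows "set_integrable M A (\<lambda>x. \<Sum>i\<in>I. f i x)"
  using assms unfolding set_integrable_def scaleR_sum_right by (rule Bochner_Integration.integrable_sum)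

subsection \<open>Trigonometric polynomials\<close>

lemma integral_cis_period:
  assumes w: "w > 0" and n: "n \<in> \<int>"
  shows "(LBINT x:{-pi/w..pi/w}. cis (n * (w * x))) = (if n = 0 then 2 * pi / w else 0)"
proof (cases "n = 0")
  case True
  then show ?thesis using w by (simp add: set_lebesgue_integral_def scaleR_conv_of_real)
next
  case False
  have le: "-pi/w \<le> pi/w" using w by (simp add: field_simps)
  have D: "((\<lambda>x. cis (n * (w * x)) / (\<i> * (n * w))) has_vector_derivative cis (n * (w * x))) (at x within S)" for x S
  proof -
    define k where "k = \<i> * (n * w)"
    have "k \<noteq> 0" using False w by (simp add: k_def)
    then have "((\<lambda>z. exp (k * z) / k) has_field_derivative exp (k * of_real x)) (at (of_real x))"
      by (auto intro!: derivative_eq_intros)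
    then have "((\<lambda>x. exp (k * of_real x) / k) has_vector_derivative exp (k * of_real x)) (at x within S)"
      by (rule has_vector_derivative_real_field)
    moreover have "cis (n * (w * x)) = exp (k * of_real x)" for x
      by (simp add: cis_conv_exp k_def mult_ac)
    ultimately show ?thesis by (simp add: k_def)
  qed
  have "((\<lambda>x. cis (n * (w * x))) has_integral
     (cis (n * (w * (pi/w))) / (\<i> * (n * w)) - cis (n * (w * (-pi/w))) / (\<i> * (n * w)))) {-pi/w..pi/w}"
    by (rule fundamental_theorem_of_calculus[OF le]) (rule D)
  moreover have "cis (n * (w * (pi/w))) = cis (n * (w * (-pi/w)))"
  proof -
    have "n * (w * (pi/w)) = n * pi" "n * (w * (-pi/w)) = - (n * pi)" using w by auto
    moreover have "sin (n * pi) = 0" using n by (metis sin_times_pi_eq_0)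
    ultimately show ?thesis by (simp add: complex_eq_iff)
  qed
  ultimately have "integral {-pi/w..pi/w} (\<lambda>x. cis (n * (w * x))) = 0" by (auto simp: integral_unique)
  moreover have "set_integrable lborel {-pi/w..pi/w} (\<lambda>x. cis (n * (w * x)))"
    by (intro borel_integrable_atLeastAtMost' continuous_intros)
  ultimately show ?thesis using False by (simp add: set_borel_integral_eq_integral)
qed

text \<open>The frequencies run from \<open>- N\<close> to \<open>d - N\<close>: this is
  \<open>cis (- N w x)\<close> times a polynomial of degree at most \<open>d\<close> in
  \<open>cis (w x)\<close>, the shape in which polynomial approximation on the circle delivers
  it.\<close>

definition trig_poly :: "real \<Rightarrow> nat \<Rightarrow> nat \<Rightarrow> (nat \<Rightarrow> complex) \<Rightarrow> real \<Rightarrow> complex" where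
  "trig_poly w N d c x = (\<Sum>i\<le>d. c i * cis ((real i - real N) * (w * x)))"

lemma continuous_on_trig_poly [continuous_intros]: "continuous_on S (trig_poly w N d c)"
  unfolding trig_poly_def cis_conv_exp by (intro continuous_intros)

lemma borel_measurable_trig_poly [measurable]: "trig_poly w N d c \<in> borel_measurable borel"
  by (intro borel_measurable_continuous_onI continuous_intros)

lemma parseval_trig_poly:
  assumes w: "w > 0"
  shows "(LBINT x:{-pi/w..pi/w}. (cmod (trig_poly w N d c x))\<^sup>2) = 2 * pi / w * (\<Sum>i\<le>d. (cmod (c i))\<^sup>2)"
proof -
  let ?I = "{-pi/w..pi/w}"
  have sq: "complex_of_real ((cmod (trig_poly w N d c x))\<^sup>2) =
    (\<Sum>i\<le>d. \<Sum>j\<le>d. c i * cnj (c j) * cis ((real i - real j) * (w * x)))" for x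
    unfolding complex_norm_square trig_poly_def cnj_sum sum_product
    by (intro sum.cong refl) (simp add: cis_cnj cis_mult algebra_simps)
  have int: "set_integrable lborel ?I (\<lambda>x. cis ((real i - real j) * (w * x)))" for i j
    by (intro borel_integrable_atLeastAtMost' continuous_intros)
  have "complex_of_real (LBINT x:?I. (cmod (trig_poly w N d c x))\<^sup>2)
    = (LBINT x:?I. complex_of_real ((cmod (trig_poly w N d c x))\<^sup>2))"
    by (rule set_integral_complex_of_real[symmetric])
  also have "\<dots> = (LBINT x:?I. (\<Sum>i\<le>d. \<Sum>j\<le>d. c i * cnj (c j) * cis ((real i - real j) * (w * x))))"
    by (simp only: sq)
  also have "\<dots> = (\<Sum>i\<le>d. \<Sum>j\<le>d. c i * cnj (c j) * (LBINT x:?I. cis ((real i - real j) * (w * x))))"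
    using int by (simp add: set_lebesgue_integral_sum set_integrable_sum)
  also have "\<dots> = (\<Sum>i\<le>d. \<Sum>j\<le>d. c i * cnj (c j) * (if real i - real j = 0 then 2 * pi / w else 0))"
    by (intro sum.cong refl arg_cong2[where f="(*)"] integral_cis_period w) auto
  also have "\<dots> = (\<Sum>i\<le>d. \<Sum>j\<le>d. if i = j then c i * cnj (c i) * (2 * pi / w) else 0)"
    by (intro sum.cong refl) auto
  also have "\<dots> = (\<Sum>i\<le>d. c i * cnj (c i) * (2 * pi / w))" by simp
  also have "\<dots> = complex_of_real (2 * pi / w * (\<Sum>i\<le>d. (cmod (c i))\<^sup>2))"
    by (simp add: complex_norm_square sum_distrib_left mult_ac del: of_real_power)
  finally show ?thesis by (simp only: of_real_eq_iff)
qed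

text \<open>On the unit circle the conjugate of z is 1 / z, so a polynomial in the real and
  imaginary parts is a Laurent polynomial in z, and the factor in front of \<open>poly\<close>
  clears the negative powers. In a sum, multiplication by powers of z brings both terms to a common
  such factor.\<close>

lemma real_polynomial_function_on_circle:
  assumes "real_polynomial_function (q :: complex \<Rightarrow> real)"
  shows "\<exists>N P. \<forall>t. complex_of_real (q (cis t)) = cis (- (real N * t)) * poly P (cis t)"
  using assms
proof induction
  case (linear h)
  interpret h: bounded_linear h by fact
  \<comment> \<open>Euler's formulas: the constant and the quadratic coefficient belong to
    \<open>cis (- t)\<close> and \<open>cis t\<close> in
    \<open>cos t * h 1 + sin t * h \<i>\<close>.\<close>
  have "complex_of_real (h (cis t)) = cis (- (real 1 * t)) *
      poly [: (h 1 + \<i> * h \<i>) / 2, 0, (h 1 - \<i> * h \<i>) / 2 :] (cis t)" for t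
  proof -
    have "cis t = cos t *\<^sub>R 1 + sin t *\<^sub>R \<i>" by (simp add: complex_eq_iff)
    then have h: "h (cis t) = cos t * h 1 + sin t * h \<i>" by (simp add: h.add h.scaleR)
    have 1: "cis (- (real 1 * t)) * (cis t * cis t) = cis t" unfolding cis_mult by simp
    have "cis (- (real 1 * t)) * poly [: (h 1 + \<i> * h \<i>) / 2, 0, (h 1 - \<i> * h \<i>) / 2 :] (cis t)
       = cis (- (real 1 * t)) * ((h 1 + \<i> * h \<i>) / 2) + (cis (- (real 1 * t)) * (cis t * cis t)) * ((h 1 - \<i> * h \<i>) / 2)"
      by (simp add: algebra_simps)
    also have "\<dots> = complex_of_real (cos t * h 1 + sin t * h \<i>)"
      unfolding 1 by (simp add: complex_eq_iff field_simps)
    finally show ?thesis by (simp add: h)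
  qed
  then show ?case by blast
next
  case (const c)
  show ?case by (rule exI[of _ 0], rule exI[of _ "[:complex_of_real c:]"]) simp
next
  case (add f g)
  then obtain N P M Q where *: "\<And>t. complex_of_real (f (cis t)) = cis (- (real N * t)) * poly P (cis t)"
    "\<And>t. complex_of_real (g (cis t)) = cis (- (real M * t)) * poly Q (cis t)" by metis
  have "complex_of_real (f (cis t) + g (cis t)) = cis (- (real (N + M) * t)) * poly (monom 1 M * P + monom 1 N * Q) (cis t)" for t
  proof -
    have 1: "cis (- (real (N + M) * t)) * cis t ^ M = cis (- (real N * t))"
      unfolding Complex.DeMoivre cis_mult by (simp add: algebra_simps)
    have 2: "cis (- (real (N + M) * t)) * cis t ^ N = cis (- (real M * t))"
      unfolding Complex.DeMoivre cis_mult by (simp add: algebra_simps)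
    have "cis (- (real (N + M) * t)) * poly (monom 1 M * P + monom 1 N * Q) (cis t) =
      (cis (- (real (N + M) * t)) * cis t ^ M) * poly P (cis t) + (cis (- (real (N + M) * t)) * cis t ^ N) * poly Q (cis t)"
      by (simp add: poly_monom algebra_simps)
    then show ?thesis unfolding 1 2 by (simp add: *)
  qed
  then show ?case by blast
next
  case (mult f g)
  then obtain N P M Q where *: "\<And>t. complex_of_real (f (cis t)) = cis (- (real N * t)) * poly P (cis t)"
    "\<And>t. complex_of_real (g (cis t)) = cis (- (real M * t)) * poly Q (cis t)" by metis
  have "complex_of_real (f (cis t) * g (cis t)) = cis (- (real (N + M) * t)) * poly (P * Q) (cis t)" for t
  proof -
    have 1: "cis (- (real (N + M) * t)) = cis (- (real N * t)) * cis (- (real M * t))"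
      by (simp add: cis_mult algebra_simps)
    show ?thesis unfolding 1 by (simp add: *)
  qed
  then show ?case by blast
qed

lemma polynomial_function_on_circle:
  assumes g: "polynomial_function (g :: complex \<Rightarrow> complex)"
  shows "\<exists>N P. \<forall>t. g (cis t) = cis (- (real N * t)) * poly P (cis t)"
proof -
  have "real_polynomial_function (Re \<circ> g)" "real_polynomial_function (Im \<circ> g)"
    using g bounded_linear_Re bounded_linear_Im unfolding polynomial_function_def by blast+
  then obtain N P M Q where *: "\<And>t. complex_of_real (Re (g (cis t))) = cis (- (real N * t)) * poly P (cis t)"
    "\<And>t. complex_of_real (Im (g (cis t))) = cis (- (real M * t)) * poly Q (cis t)"
    using real_polynomial_function_on_circle by (metis o_apply)
  have "g (cis t) = cis (- (real (N + M) * t)) * poly (monom 1 M * P + monom \<i> N * Q) (cis t)" for t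
  proof -
    have 1: "cis (- (real (N + M) * t)) * cis t ^ M = cis (- (real N * t))"
      unfolding Complex.DeMoivre cis_mult by (simp add: algebra_simps)
    have 2: "cis (- (real (N + M) * t)) * cis t ^ N = cis (- (real M * t))"
      unfolding Complex.DeMoivre cis_mult by (simp add: algebra_simps)
    have "cis (- (real (N + M) * t)) * poly (monom 1 M * P + monom \<i> N * Q) (cis t) =
      (cis (- (real (N + M) * t)) * cis t ^ M) * poly P (cis t) + \<i> * ((cis (- (real (N + M) * t)) * cis t ^ N) * poly Q (cis t))"
      by (simp add: poly_monom algebra_simps)
    then show ?thesis unfolding 1 2 by (simp add: *[symmetric] complex_eq)
  qed
  then show ?thesis by blast
qed

text \<open>\<open>f\<close> is transplanted to the unit circle by \<open>Arg\<close>. The jump of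
  \<open>Arg\<close> at -1 does no harm: since \<open>A * w < pi\<close>, the transplant vanishes
  near -1. Stone--Weierstrass applies to the continuous function so obtained.\<close>

lemma trig_poly_approximation:
  fixes f :: "real \<Rightarrow> complex"
  assumes f: "continuous_on UNIV f" and supp: "\<And>x. \<bar>x\<bar> \<ge> A \<Longrightarrow> f x = 0"
    and w: "w > 0" "A * w < pi" "A > 0" and e: "e > 0"
  shows "\<exists>N d c. \<forall>x. - pi < w * x \<and> w * x \<le> pi \<longrightarrow> cmod (f x - trig_poly w N d c x) < e"
proof -
  define F where "F = (\<lambda>z. f (Arg z / w))"
  let ?S = "sphere (0::complex) 1"
  have "continuous (at z within ?S) F" if z: "z \<in> ?S" for z
  proof (cases "z \<in> \<real>\<^sub>\<le>\<^sub>0")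
    case False
    then have "isCont Arg z" by (rule continuous_at_Arg)
    moreover have "isCont f y" for y using f by (simp add: continuous_on_eq_continuous_at)
    ultimately have "isCont (\<lambda>z. f (Arg z / w)) z"
      by (intro isCont_o2[of z "\<lambda>z. Arg z / w" f]) (use w in \<open>auto intro!: continuous_intros\<close>)
    then show ?thesis unfolding F_def by (rule continuous_at_imp_continuous_at_within)
  next
    case True
    then have "z = -1" using z by (auto simp: complex_nonpos_Reals_iff cmod_eq_Re complex_eq_iff)
    \<comment> \<open>To the left of the vertical line through \<open>cis (A * w)\<close> the
      argument exceeds \<open>A * w\<close> in absolute value; this open half-plane contains
      -1.\<close>
    have "F y = 0" if "y \<in> {y. Re y < cos (A * w)}" "y \<in> ?S" for y
    proof -
      have "Re y = cos (Arg y)" using that(2) using that(2) cos_Arg[of y] by (cases "y = 0") auto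
      then have "cos \<bar>Arg y\<bar> < cos (A * w)" using that(1) by simp
      then have "A * w < \<bar>Arg y\<bar>"
        using cos_monotone_0_pi_le[of "\<bar>Arg y\<bar>" "A * w"] w Arg_bounded[of y] by (auto simp: not_less[symmetric])
      then show ?thesis unfolding F_def using w by (intro supp) (simp add: field_simps)
    qed
    moreover have "z \<in> {y. Re y < cos (A * w)}"
      using \<open>z = -1\<close> w cos_monotone_0_pi[of "A * w" pi] by simp
    moreover have "open {y. Re y < cos (A * w)}" by (rule open_halfspace_Re_lt)
    ultimately have "eventually (\<lambda>y. F y = 0) (at z within ?S)" "F z = 0"
      using z by (auto simp: eventually_at_topological)
    then show ?thesis unfolding continuous_within by (simp add: tendsto_eventually)
  qed
  then have contF: "continuous_on ?S F" by (simp add: continuous_on_eq_continuous_within)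
  obtain g where g0: "polynomial_function g \<and> (\<forall>z\<in>?S. cmod (F z - g z) < e)"
    using Stone_Weierstrass_polynomial_function[OF compact_sphere contF e] by (rule exE)
  then have g: "polynomial_function g" "\<And>z. z \<in> ?S \<Longrightarrow> cmod (F z - g z) < e" by simp_all
  obtain N P where NP: "\<And>t. g (cis t) = cis (- (real N * t)) * poly P (cis t)"
    using polynomial_function_on_circle[OF g(1)] by blast
  show ?thesis
  proof (intro exI allI impI)
    fix x assume x: "- pi < w * x \<and> w * x \<le> pi"
    have "F (cis (w * x)) = f x" using x w by (simp add: F_def Arg_cis)
    moreover have "g (cis (w * x)) = trig_poly w N (degree P) (coeff P) x"
      unfolding NP poly_altdef trig_poly_def sum_distrib_left
    proof (intro sum.cong refl)
      fix i
      have "cis (- (real N * (w * x))) * cis (w * x) ^ i = cis ((real i - real N) * (w * x))"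
        unfolding Complex.DeMoivre cis_mult by (simp add: algebra_simps)
      then show "cis (- (real N * (w * x))) * (coeff P i * cis (w * x) ^ i) = coeff P i * cis ((real i - real N) * (w * x))"
        by (simp add: mult_ac)
    qed
    ultimately show "cmod (f x - trig_poly w N (degree P) (coeff P) x) < e"
      using g(2)[of "cis (w * x)"] by simp
  qed
qed

subsection \<open>Truncated kernels\<close>

text \<open>The size bounds on the kernel and its derivative, with \<open>B\<close> as a parameter,
  so that every later constant is an explicit expression in \<open>B\<close>. Continuity of the
  derivative serves integration by parts.\<close>

locale cz_kernel =
  fixes K :: "real \<Rightarrow> real" and B :: real
  assumes odd: "x \<noteq> 0 \<Longrightarrow> K (- x) = - K x"
    and deriv: "x \<noteq> 0 \<Longrightarrow> (K has_field_derivative deriv K x) (at x)"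
    and continuous_deriv: "0 < a \<Longrightarrow> continuous_on {a..b} (deriv K)"
    and B_pos: "B > 0"
    and size: "x \<noteq> 0 \<Longrightarrow> \<bar>K x\<bar> \<le> B / \<bar>x\<bar>"
    and size_deriv: "x \<noteq> 0 \<Longrightarrow> \<bar>deriv K x\<bar> \<le> B / x\<^sup>2"
begin

lemma isCont_K: "x \<noteq> 0 \<Longrightarrow> isCont K x"
  using deriv DERIV_isCont by blast

lemma measurable_K [measurable]: "K \<in> borel_measurable borel"
proof -
  have "(\<lambda>x. if x \<in> {0} then K x else K x) \<in> borel_measurable borel"
  proof (intro borel_measurable_continuous_on_if)
    show "continuous_on (- {0}) K"
      by (intro continuous_at_imp_continuous_on ballI isCont_K) auto
  qed auto
  then show ?thesis by simp
qed

text \<open>On the segment from \<open>x\<close> to \<open>y\<close> all points have absolute value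
  at least \<open>\<bar>x\<bar> / 2\<close>, so the derivative is at most B / (x / 2)^2
  there.\<close>

lemma K_lipschitz:
  assumes x: "x \<noteq> 0" and h: "\<bar>y - x\<bar> \<le> \<bar>x\<bar> / 2"
  shows "\<bar>K y - K x\<bar> \<le> 4 * B * \<bar>y - x\<bar> / x\<^sup>2"
proof -
  have ns: "z \<noteq> 0 \<and> \<bar>x\<bar> / 2 \<le> \<bar>z\<bar>" if "z \<in> closed_segment x y" for z
  proof -
    have "\<bar>z - x\<bar> \<le> \<bar>y - x\<bar>" using segment_bound1[OF that] by simp
    then show ?thesis using h x by linarith
  qed
  have "norm (K y - K x) \<le> (4 * B / x\<^sup>2) * norm (y - x)"
  proof (rule field_differentiable_bound[of "closed_segment x y"])
    fix z assume z: "z \<in> closed_segment x y"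
    show "(K has_field_derivative deriv K z) (at z within closed_segment x y)"
      using deriv ns[OF z] has_field_derivative_at_within by blast
    have "\<bar>deriv K z\<bar> \<le> B / z\<^sup>2" using size_deriv ns[OF z] by blast
    also have "\<dots> \<le> B / (\<bar>x\<bar> / 2)\<^sup>2"
      using ns[OF z] x B_pos abs_le_square_iff[of "\<bar>x\<bar> / 2" z]
      by (intro divide_left_mono) auto
    finally show "norm (deriv K z) \<le> 4 * B / x\<^sup>2" by (simp add: power_divide mult.commute)
  qed auto
  then show ?thesis by simp
qed

lemma continuous_on_K: "0 < a \<Longrightarrow> continuous_on {a..b} K"
  by (intro continuous_at_imp_continuous_on ballI isCont_K) auto

text \<open>Below the scale \<open>1 / \<xi>\<close> the inequality |sin z| <= |z| cancels the
  singularity: the integrand is at most \<open>B * \<xi>\<close>.\<close>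

lemma sin_integral_near:
  assumes "0 < a" "a \<le> b" "\<xi> > 0" "b * \<xi> \<le> 1"
  shows "\<bar>integral {a..b} (\<lambda>s. K s * sin (\<xi> * s))\<bar> \<le> B"
proof -
  have "norm (integral {a..b} (\<lambda>s. K s * sin (\<xi> * s))) \<le> integral {a..b} (\<lambda>s. B * \<xi>)"
  proof (rule integral_norm_bound_integral)
    show "(\<lambda>s. K s * sin (\<xi> * s)) integrable_on {a..b}"
      using assms by (intro integrable_continuous_interval continuous_intros continuous_on_K)
    fix s assume s: "s \<in> {a..b}"
    have "\<bar>K s\<bar> * \<bar>sin (\<xi> * s)\<bar> \<le> B / s * (\<xi> * s)"
      using size[of s] abs_sin_x_le_abs_x[of "\<xi> * s"] s assms B_pos
      by (intro mult_mono) (auto simp: abs_mult)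
    then show "norm (K s * sin (\<xi> * s)) \<le> B * \<xi>" using s assms by (simp add: abs_mult)
  qed auto
  also have "\<dots> = B * ((b - a) * \<xi>)" using assms by simp
  also have "\<dots> \<le> B * (b * \<xi>)" using assms B_pos by (intro mult_left_mono mult_right_mono) auto
  also have "\<dots> \<le> B * 1" using assms B_pos by (intro mult_left_mono) auto
  finally show ?thesis by simp
qed

text \<open>Above the scale \<open>1 / \<xi>\<close> the oscillation is exploited by integrating by
  parts. The two boundary terms and the integral of K' cos / \<open>\<xi>\<close> are at most
  \<open>B\<close> each.\<close>

lemma sin_integral_far:
  assumes "0 < a" "a \<le> b" "\<xi> > 0" "1 \<le> a * \<xi>"
  shows "\<bar>integral {a..b} (\<lambda>s. K s * sin (\<xi> * s))\<bar> \<le> 3 * B"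
proof -
  let ?G = "\<lambda>s. - K s * cos (\<xi> * s) / \<xi>"
  let ?r = "\<lambda>s. deriv K s * cos (\<xi> * s) / \<xi>"
  have "((\<lambda>s. K s * sin (\<xi> * s) - ?r s) has_integral (?G b - ?G a)) {a..b}"
  proof (rule fundamental_theorem_of_calculus)
    fix s assume s: "s \<in> {a..b}"
    have "(?G has_field_derivative K s * sin (\<xi> * s) - ?r s) (at s)"
      using s assms deriv[of s] by (auto intro!: derivative_eq_intros simp: field_simps)
    then show "(?G has_vector_derivative K s * sin (\<xi> * s) - ?r s) (at s within {a..b})"
      by (simp add: has_real_derivative_iff_has_vector_derivative has_vector_derivative_at_within)
  qed (use assms in simp)
  moreover have r: "?r integrable_on {a..b}"
    using assms by (intro integrable_continuous_interval continuous_intros continuous_deriv) auto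
  ultimately have "((\<lambda>s. (K s * sin (\<xi> * s) - ?r s) + ?r s) has_integral
      (?G b - ?G a) + integral {a..b} ?r) {a..b}"
    by (intro has_integral_add integrable_integral)
  then have eq: "integral {a..b} (\<lambda>s. K s * sin (\<xi> * s)) = (?G b - ?G a) + integral {a..b} ?r"
    by (simp add: integral_unique)
  have G: "\<bar>?G s\<bar> \<le> B" if "a \<le> s" for s
  proof -
    have "1 \<le> s * \<xi>" using assms that mult_right_mono[of a s \<xi>] by linarith
    have "\<bar>K s\<bar> * \<bar>cos (\<xi> * s)\<bar> \<le> B / s * 1"
      using size[of s] that assms B_pos by (intro mult_mono) auto
    then have "\<bar>K s\<bar> * \<bar>cos (\<xi> * s)\<bar> / \<xi> \<le> B / s * 1 / \<xi>"
      using assms by (intro divide_right_mono) auto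
    then have "\<bar>?G s\<bar> \<le> B / s / \<xi>" using assms by (simp add: abs_mult)
    also have "\<dots> = B / (s * \<xi>)" by simp
    also have "\<dots> \<le> B / 1" using \<open>1 \<le> s * \<xi>\<close> B_pos by (intro divide_left_mono) auto
    finally show ?thesis by simp
  qed
  have FT: "((\<lambda>s. B / s\<^sup>2 / \<xi>) has_integral (- B / b / \<xi> - (- B / a / \<xi>))) {a..b}"
  proof (rule fundamental_theorem_of_calculus)
    fix s assume s: "s \<in> {a..b}"
    have "((\<lambda>s. - B / s / \<xi>) has_field_derivative B / s\<^sup>2 / \<xi>) (at s)"
      using s assms by (auto intro!: derivative_eq_intros simp: field_simps power2_eq_square)
    then show "((\<lambda>s. - B / s / \<xi>) has_vector_derivative B / s\<^sup>2 / \<xi>) (at s within {a..b})"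
      by (simp add: has_real_derivative_iff_has_vector_derivative has_vector_derivative_at_within)
  qed (use assms in simp)
  have "norm (integral {a..b} ?r) \<le> integral {a..b} (\<lambda>s. B / s\<^sup>2 / \<xi>)"
  proof (rule integral_norm_bound_integral[OF r])
    show "(\<lambda>s. B / s\<^sup>2 / \<xi>) integrable_on {a..b}" using FT by blast
    fix s assume s: "s \<in> {a..b}"
    have "\<bar>deriv K s\<bar> * \<bar>cos (\<xi> * s)\<bar> \<le> B / s\<^sup>2 * 1"
      using size_deriv[of s] s assms B_pos by (intro mult_mono) auto
    then have "\<bar>deriv K s\<bar> * \<bar>cos (\<xi> * s)\<bar> / \<xi> \<le> B / s\<^sup>2 / \<xi>"
      using assms by (intro divide_right_mono) auto
    then show "norm (?r s) \<le> B / s\<^sup>2 / \<xi>" using assms by (simp add: abs_mult)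
  qed
  also have "\<dots> = - B / b / \<xi> - (- B / a / \<xi>)" using FT by (rule integral_unique)
  also have "\<dots> \<le> B / (a * \<xi>)" using assms B_pos by simp
  also have "\<dots> \<le> B / 1" using assms B_pos by (intro divide_left_mono) auto
  finally have "\<bar>integral {a..b} ?r\<bar> \<le> B" by simp
  then show ?thesis using eq G[of a] G[of b] assms by linarith
qed

text \<open>The interval is cut at \<open>1 / \<xi>\<close>, where the oscillation sets in;
  \<open>B\<close> comes from below and \<open>3 * B\<close> from above. A negative frequency only
  changes the sign.\<close>

lemma sin_integral_bound:
  assumes "0 < a" "a \<le> b"
  shows "\<bar>integral {a..b} (\<lambda>s. K s * sin (\<xi> * s))\<bar> \<le> 4 * B"
proof -
  have pos: "\<bar>integral {a..b} (\<lambda>s. K s * sin (\<xi> * s))\<bar> \<le> 4 * B" if \<xi>: "\<xi> > 0" for \<xi>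
  proof (cases "b * \<xi> \<le> 1")
    case True
    then show ?thesis using sin_integral_near[of a b \<xi>] assms \<xi> B_pos by simp
  next
    case False
    show ?thesis
    proof (cases "1 \<le> a * \<xi>")
      case True
      then show ?thesis using sin_integral_far[of a b \<xi>] assms \<xi> B_pos by simp
    next
      case False
      define c where "c = 1 / \<xi>"
      have c: "a \<le> c" "c \<le> b" "c * \<xi> = 1" "c > 0"
        using False \<open>\<not> b * \<xi> \<le> 1\<close> \<xi> by (auto simp: c_def field_simps)
      have "integral {a..c} (\<lambda>s. K s * sin (\<xi> * s)) + integral {c..b} (\<lambda>s. K s * sin (\<xi> * s))
          = integral {a..b} (\<lambda>s. K s * sin (\<xi> * s))"
        using c assms by (intro Henstock_Kurzweil_Integration.integral_combine
            integrable_continuous_interval continuous_intros continuous_on_K) auto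
      then show ?thesis
        using sin_integral_near[of a c \<xi>] sin_integral_far[of c b \<xi>] assms c \<xi> by simp
    qed
  qed
  consider "\<xi> > 0" | "\<xi> = 0" | "- \<xi> > 0" by linarith
  then show ?thesis
  proof cases
    case 3
    then show ?thesis using pos[of "- \<xi>"] by simp
  qed (use pos B_pos in auto)
qed

text \<open>The upper cut makes the kernel bounded with bounded support, so that it can be convolved
  with trigonometric polynomials, which do not decay. The strict inequality at
  \<open>\<delta>\<close> agrees with the one in the truncated integrals.\<close>

definition cut_kernel :: "real \<Rightarrow> real \<Rightarrow> real \<Rightarrow> real" where
  "cut_kernel \<delta> R s = indicator {s. \<delta> < \<bar>s\<bar> \<and> \<bar>s\<bar> \<le> R} s * K s"

lemma measurable_cut_kernel [measurable]: "cut_kernel \<delta> R \<in> borel_measurable borel"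
  unfolding cut_kernel_def by measurable

lemma cut_kernel_bound: "\<delta> > 0 \<Longrightarrow> \<bar>cut_kernel \<delta> R s\<bar> \<le> B / \<delta>"
proof -
  assume "\<delta> > 0"
  then have "\<bar>K s\<bar> \<le> B / \<delta>" if "\<delta> < \<bar>s\<bar>"
    using size[of s] that B_pos by (intro order_trans[OF size] divide_left_mono) auto
  then show ?thesis using B_pos \<open>\<delta> > 0\<close> by (auto simp: cut_kernel_def indicator_def)
qed

lemma integrable_cut_kernel_mult:
  fixes g :: "real \<Rightarrow> complex"
  assumes "\<delta> > 0" and [measurable]: "g \<in> borel_measurable borel"
    and g: "\<And>s. \<bar>s\<bar> \<le> R \<Longrightarrow> cmod (g s) \<le> M"
  shows "integrable lborel (\<lambda>s. complex_of_real (cut_kernel \<delta> R s) * g s)"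
proof (rule Bochner_Integration.integrable_bound)
  show "integrable lborel (\<lambda>s. (B / \<delta> * M) * indicator {-R..R} s)"
    by (intro integrable_mult_right integrable_real_indicator emeasure_bounded_finite) auto
  show "AE s in lborel. norm (complex_of_real (cut_kernel \<delta> R s) * g s) \<le> norm ((B / \<delta> * M) * indicator {-R..R} s)"
  proof (rule AE_I2)
    fix s
    show "norm (complex_of_real (cut_kernel \<delta> R s) * g s) \<le> norm ((B / \<delta> * M) * indicator {-R..R} s)"
    proof (cases "\<bar>s\<bar> \<le> R")
      case True
      then have "\<bar>cut_kernel \<delta> R s\<bar> * cmod (g s) \<le> B / \<delta> * M"
        using cut_kernel_bound[OF assms(1), of R s] g[OF True] B_pos assms(1)
        by (intro mult_mono) auto
      then have "\<bar>cut_kernel \<delta> R s\<bar> * cmod (g s) \<le> \<bar>B / \<delta> * M\<bar>" by linarith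
      then show ?thesis using True by (simp add: norm_mult indicator_def abs_le_iff)
    qed (simp add: cut_kernel_def)
  qed
qed measurable

text \<open>Oddness removes the cosine part of the Fourier transform and doubles the sine part, so
  that twice \<open>4 * B\<close> remains, uniformly in \<open>\<delta>\<close>, \<open>R\<close>
  and \<open>\<xi>\<close>.\<close>

lemma multiplier_bound:
  assumes \<delta>: "0 < \<delta>" "\<delta> \<le> R"
  shows "cmod (LBINT s. complex_of_real (cut_kernel \<delta> R s) * cis (- (\<xi> * s))) \<le> 8 * B"
proof -
  let ?k = "cut_kernel \<delta> R"
  let ?I = "LBINT s. complex_of_real (?k s) * cis (- (\<xi> * s))"
  have [measurable]: "cis \<in> borel_measurable borel"
    unfolding cis_conv_exp by (intro borel_measurable_continuous_onI continuous_intros)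
  have int: "integrable lborel (\<lambda>s. complex_of_real (?k s) * (cis (- (\<xi> * s)) * indicator S s))"
    if "S \<in> sets borel" for S
    using that by (intro integrable_cut_kernel_mult[OF \<delta>(1), where M=1]) (auto simp: norm_mult indicator_def)
  have int': "integrable lborel (\<lambda>s. complex_of_real (?k s) * (cis (\<xi> * s) * indicator S s))"
    if "S \<in> sets borel" for S
    using that by (intro integrable_cut_kernel_mult[OF \<delta>(1), where M=1]) (auto simp: norm_mult indicator_def)
  have odd_k: "?k (- s) = - ?k s" for s using odd[of s] \<delta> by (auto simp: cut_kernel_def indicator_def)
  have "?I = (LBINT s. complex_of_real (?k s) * (cis (- (\<xi> * s)) * indicator {0<..} s) + complex_of_real (?k s) * (cis (- (\<xi> * s)) * indicator {..<0} s))"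
    using \<delta> by (intro Bochner_Integration.integral_cong refl) (auto simp: indicator_def cut_kernel_def)
  also have "\<dots> = (LBINT s. complex_of_real (?k s) * (cis (- (\<xi> * s)) * indicator {0<..} s)) + (LBINT s. complex_of_real (?k s) * (cis (- (\<xi> * s)) * indicator {..<0} s))"
    by (intro Bochner_Integration.integral_add int) auto
  also have "(LBINT s. complex_of_real (?k s) * (cis (- (\<xi> * s)) * indicator {..<0} s)) = (LBINT s. - (complex_of_real (?k s) * (cis (\<xi> * s) * indicator {0<..} s)))"
    by (subst integral_reflect_lborel[of _ 0]) (intro Bochner_Integration.integral_cong refl, auto simp: odd_k indicator_def)
  also have "(LBINT s. complex_of_real (?k s) * (cis (- (\<xi> * s)) * indicator {0<..} s)) + \<dots> =
    (LBINT s. complex_of_real (?k s) * (cis (- (\<xi> * s)) * indicator {0<..} s) + - (complex_of_real (?k s) * (cis (\<xi> * s) * indicator {0<..} s)))"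
    by (intro Bochner_Integration.integral_add[symmetric] int Bochner_Integration.integrable_minus int') auto
  also have "\<dots> = (LBINT s. (-2 * \<i>) * complex_of_real (indicator {\<delta><..R} s * (K s * sin (\<xi> * s))))"
    using \<delta> by (intro Bochner_Integration.integral_cong refl)
      (auto simp: indicator_def cut_kernel_def complex_eq_iff)
  also have "\<dots> = (-2 * \<i>) * complex_of_real (LBINT s. indicator {\<delta><..R} s * (K s * sin (\<xi> * s)))"
    by (subst integral_complex_of_real[symmetric]) (rule integral_mult_right_zero)
  finally have "cmod ?I = 2 * \<bar>LBINT s. indicator {\<delta><..R} s * (K s * sin (\<xi> * s))\<bar>"
    by (simp add: norm_mult)
  also have "(LBINT s. indicator {\<delta><..R} s * (K s * sin (\<xi> * s))) = (LBINT s:{\<delta>..R}. K s * sin (\<xi> * s))"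
    unfolding set_lebesgue_integral_def
  proof (rule integral_cong_AE)
    show "AE s in lborel. indicator {\<delta><..R} s * (K s * sin (\<xi> * s)) = indicator {\<delta>..R} s *\<^sub>R (K s * sin (\<xi> * s))"
      using AE_lborel_singleton[of \<delta>] by eventually_elim (auto simp: indicator_def)
  qed measurable
  also have "\<dots> = integral {\<delta>..R} (\<lambda>s. K s * sin (\<xi> * s))"
    using \<delta> by (intro set_borel_integral_eq_integral borel_integrable_atLeastAtMost' continuous_intros continuous_on_K)
  finally show ?thesis using sin_integral_bound[OF \<delta>, of \<xi>] by simp
qed

end

lemma nn_integral_le_of_intervals:
  assumes [measurable]: "g \<in> borel_measurable borel"
    and le: "\<And>n::nat. (\<integral>\<^sup>+x\<in>{- real n..real n}. g x \<partial>lborel) \<le> C"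
  shows "(\<integral>\<^sup>+x. g x \<partial>lborel) \<le> C"
proof -
  have sup: "(SUP n. g x * indicator {- real n..real n} x) = g x" for x
  proof (rule antisym)
    show "(SUP n. g x * indicator {- real n..real n} x) \<le> g x"
      by (rule SUP_least) (auto simp: indicator_def)
    obtain n where "\<bar>x\<bar> \<le> real n" using real_arch_simple by blast
    then show "g x \<le> (SUP n. g x * indicator {- real n..real n} x)"
      by (intro SUP_upper2[of n]) (auto simp: indicator_def abs_le_iff)
  qed
  have "(\<integral>\<^sup>+x. g x \<partial>lborel) = (\<integral>\<^sup>+x. (SUP n. g x * indicator {- real n..real n} x) \<partial>lborel)"
    by (simp only: sup)
  also have "\<dots> = (SUP n. \<integral>\<^sup>+x. g x * indicator {- real n..real n} x \<partial>lborel)"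
    by (intro nn_integral_monotone_convergence_SUP)
      (auto simp: incseq_def le_fun_def indicator_def)
  also have "\<dots> \<le> C" by (intro SUP_least le)
  finally show ?thesis .
qed

lemma square_perturbation:
  fixes a b e M :: real
  assumes "\<bar>a - b\<bar> \<le> e" "0 \<le> a" "a \<le> M"
  shows "a\<^sup>2 \<le> b\<^sup>2 + 2 * e * M"
proof -
  have "a\<^sup>2 - b\<^sup>2 \<le> 2 * a * (a - b)"
    using zero_le_power2[of "a - b"] by (simp add: power2_eq_square algebra_simps)
  also have "\<dots> \<le> 2 * a * e" using assms by (intro mult_left_mono) auto
  also have "\<dots> \<le> 2 * M * e" using assms by (intro mult_right_mono mult_left_mono) auto
  finally show ?thesis by (simp add: mult_ac)
qed

section \<open>The truncated operators on continuous functions of compact support\<close>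

context cz_kernel
begin

text \<open>The counterpart of \<open>truncated_convolution\<close> over Borel measure, where the
  measurability and convergence arguments are carried out. The two agree at every point once
  \<open>f\<close> is replaced by a Borel representative.\<close>

definition trunc :: "(real \<Rightarrow> complex) \<Rightarrow> real \<Rightarrow> real \<Rightarrow> complex" where
  "trunc f \<epsilon> x = (LBINT t:{t. \<epsilon> < \<bar>x - t\<bar>}. K (x - t) *\<^sub>R f t)"

lemma truncated_bound:
  assumes "\<epsilon> > 0"
  shows "norm (indicator {t. \<epsilon> < \<bar>x - t\<bar>} t *\<^sub>R K (x - t) *\<^sub>R f t) \<le> B / \<epsilon> * cmod (f t)"
proof (cases "\<epsilon> < \<bar>x - t\<bar>")
  case True
  then have "\<bar>K (x - t)\<bar> \<le> B / \<epsilon>"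
    using size[of "x - t"] assms B_pos by (intro order_trans[OF size] divide_left_mono) auto
  then have "\<bar>K (x - t)\<bar> * cmod (f t) \<le> B / \<epsilon> * cmod (f t)" by (intro mult_right_mono) auto
  then show ?thesis using True by simp
qed (use assms B_pos in simp)

lemma trunc_integrable:
  fixes f :: "real \<Rightarrow> complex"
  assumes f: "integrable lborel f" and e: "\<epsilon> > 0"
  shows "set_integrable lborel {t. \<epsilon> < \<bar>x - t\<bar>} (\<lambda>t. K (x - t) *\<^sub>R f t)"
  unfolding set_integrable_def
proof (rule Bochner_Integration.integrable_bound)
  show "integrable lborel (\<lambda>t. B / \<epsilon> * cmod (f t))" using f by auto
  show "(\<lambda>t. indicat_real {t. \<epsilon> < \<bar>x - t\<bar>} t *\<^sub>R K (x - t) *\<^sub>R f t) \<in> borel_measurable lborel"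
    using borel_measurable_integrable[OF f] by measurable
  show "AE t in lborel. norm (indicat_real {t. \<epsilon> < \<bar>x - t\<bar>} t *\<^sub>R K (x - t) *\<^sub>R f t) \<le> norm (B / \<epsilon> * cmod (f t))"
    unfolding real_norm_def by (intro AE_I2 order_trans[OF truncated_bound[OF e] abs_ge_self])
qed

lemma norm_trunc_le:
  assumes f: "integrable lborel f" and e: "\<epsilon> > 0"
  shows "cmod (trunc f \<epsilon> x) \<le> B / \<epsilon> * (LBINT t. cmod (f t))"
proof -
  have "cmod (trunc f \<epsilon> x) \<le> (LBINT t. norm (indicat_real {t. \<epsilon> < \<bar>x - t\<bar>} t *\<^sub>R K (x - t) *\<^sub>R f t))"
    unfolding trunc_def set_lebesgue_integral_def by (rule integral_norm_bound)
  also have "\<dots> \<le> (LBINT t. B / \<epsilon> * cmod (f t))"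
  proof (rule integral_mono)
    show "integrable lborel (\<lambda>t. norm (indicat_real {t. \<epsilon> < \<bar>x - t\<bar>} t *\<^sub>R K (x - t) *\<^sub>R f t))"
      using trunc_integrable[OF f e, of x] unfolding set_integrable_def by (rule integrable_norm)
  qed (use f truncated_bound[OF e] in auto)
  finally show ?thesis by simp
qed

lemma trunc_add:
  assumes "integrable lborel f" "integrable lborel g" "\<epsilon> > 0"
  shows "trunc (\<lambda>t. f t + g t) \<epsilon> x = trunc f \<epsilon> x + trunc g \<epsilon> x"
  unfolding trunc_def scaleR_add_right using assms by (intro set_integral_add trunc_integrable)

lemma trunc_diff:
  assumes "integrable lborel f" "integrable lborel g" "\<epsilon> > 0"
  shows "trunc (\<lambda>t. f t - g t) \<epsilon> x = trunc f \<epsilon> x - trunc g \<epsilon> x"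
  unfolding trunc_def scaleR_diff_right using assms by (intro set_integral_diff trunc_integrable)

text \<open>Dominated convergence: the sharp cutoff is discontinuous in the centre only for
  \<open>t = x - \<epsilon>\<close> and \<open>t = x + \<epsilon>\<close>, two points of measure
  zero. This continuity is what makes the superlevel sets of the maximal truncation open.\<close>

lemma continuous_on_trunc:
  assumes f: "integrable lborel f" and e: "\<epsilon> > 0"
  shows "continuous_on UNIV (trunc f \<epsilon>)"
proof (rule continuous_on_sequentiallyI)
  fix u :: "nat \<Rightarrow> real" and x assume u: "u \<longlonglongrightarrow> x"
  have [measurable]: "f \<in> borel_measurable lborel" using f by (rule borel_measurable_integrable)
  show "(\<lambda>n. trunc f \<epsilon> (u n)) \<longlonglongrightarrow> trunc f \<epsilon> x"
    unfolding trunc_def set_lebesgue_integral_def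
  proof (rule integral_dominated_convergence[where w="\<lambda>t. B / \<epsilon> * cmod (f t)"])
    show "AE t in lborel. (\<lambda>n. indicat_real {t. \<epsilon> < \<bar>u n - t\<bar>} t *\<^sub>R K (u n - t) *\<^sub>R f t)
        \<longlonglongrightarrow> indicat_real {t. \<epsilon> < \<bar>x - t\<bar>} t *\<^sub>R K (x - t) *\<^sub>R f t"
      using AE_lborel_singleton[of "x - \<epsilon>"] AE_lborel_singleton[of "x + \<epsilon>"]
    proof eventually_elim
      case (elim t)
      then have ne: "\<bar>x - t\<bar> \<noteq> \<epsilon>" by auto
      have lim: "(\<lambda>n. \<bar>u n - t\<bar>) \<longlonglongrightarrow> \<bar>x - t\<bar>" by (intro tendsto_intros u)
      show ?case
      proof (cases "\<epsilon> < \<bar>x - t\<bar>")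
        case True
        have "(\<lambda>n. K (u n - t) *\<^sub>R f t) \<longlonglongrightarrow> K (x - t) *\<^sub>R f t"
          using True e by (intro tendsto_intros isCont_tendsto_compose[OF isCont_K] u) auto
        moreover have "eventually (\<lambda>n. \<epsilon> < \<bar>u n - t\<bar>) sequentially"
          using order_tendstoD(1)[OF lim True] .
        then have "eventually (\<lambda>n. K (u n - t) *\<^sub>R f t = indicat_real {t. \<epsilon> < \<bar>u n - t\<bar>} t *\<^sub>R K (u n - t) *\<^sub>R f t) sequentially"
          by eventually_elim simp
        ultimately show ?thesis using True by (simp add: Lim_transform_eventually)
      next
        case False
        then have "eventually (\<lambda>n. \<bar>u n - t\<bar> < \<epsilon>) sequentially"
          using order_tendstoD(2)[OF lim, of \<epsilon>] ne by auto
        then have "eventually (\<lambda>n. indicat_real {t. \<epsilon> < \<bar>u n - t\<bar>} t *\<^sub>R K (u n - t) *\<^sub>R f t = 0) sequentially"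
          by eventually_elim simp
        then show ?thesis using False by (simp add: tendsto_eventually)
      qed
    qed
    show "AE t in lborel. norm (indicat_real {t. \<epsilon> < \<bar>u n - t\<bar>} t *\<^sub>R K (u n - t) *\<^sub>R f t) \<le> B / \<epsilon> * cmod (f t)" for n
      by (intro AE_I2 truncated_bound e)
    show "integrable lborel (\<lambda>t. B / \<epsilon> * cmod (f t))" using f by simp
  qed measurable
qed

lemma borel_measurable_trunc:
  "integrable lborel f \<Longrightarrow> \<epsilon> > 0 \<Longrightarrow> trunc f \<epsilon> \<in> borel_measurable borel"
  by (intro borel_measurable_continuous_onI continuous_on_trunc)

lemma cut_conv_bound:
  fixes g :: "real \<Rightarrow> complex"
  assumes "\<delta> > 0" "R \<ge> 0" "M \<ge> 0" and [measurable]: "g \<in> borel_measurable borel"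
    and g: "\<And>s. \<bar>s\<bar> \<le> R \<Longrightarrow> cmod (g s) \<le> M"
  shows "cmod (LBINT s. complex_of_real (cut_kernel \<delta> R s) * g s) \<le> B / \<delta> * (2 * R) * M"
proof -
  have "cmod (LBINT s. complex_of_real (cut_kernel \<delta> R s) * g s) \<le> (LBINT s. cmod (complex_of_real (cut_kernel \<delta> R s) * g s))"
    by (rule integral_norm_bound)
  also have "\<dots> \<le> (LBINT s. B / \<delta> * M * indicator {-R..R} s)"
  proof (rule integral_mono)
    show "integrable lborel (\<lambda>s. cmod (complex_of_real (cut_kernel \<delta> R s) * g s))"
      using assms by (intro integrable_norm integrable_cut_kernel_mult[where M=M])
    show "integrable lborel (\<lambda>s. (B / \<delta> * M) * indicator {-R..R} s)"
      by (intro integrable_mult_right integrable_real_indicator emeasure_bounded_finite) auto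
    fix s
    show "cmod (complex_of_real (cut_kernel \<delta> R s) * g s) \<le> B / \<delta> * M * indicator {-R..R} s"
    proof (cases "\<bar>s\<bar> \<le> R")
      case True
      then have "\<bar>cut_kernel \<delta> R s\<bar> * cmod (g s) \<le> B / \<delta> * M"
        using cut_kernel_bound[OF assms(1), of R s] g[OF True] B_pos assms(1)
        by (intro mult_mono) auto
      then show ?thesis using True by (simp add: norm_mult indicator_def abs_le_iff)
    qed (use assms B_pos in \<open>simp add: cut_kernel_def\<close>)
  qed
  finally show ?thesis using assms by (simp add: mult_ac)
qed

lemma trunc_eq_cut_conv:
  assumes supp: "\<And>x. \<bar>x\<bar> \<ge> A \<Longrightarrow> f x = 0" and x: "\<bar>x\<bar> \<le> X" and R: "X + A \<le> R"
  shows "trunc f \<delta> x = (LBINT s. complex_of_real (cut_kernel \<delta> R s) * f (x - s))"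
  unfolding trunc_def set_lebesgue_integral_def
proof (subst integral_reflect_lborel[of _ x], intro Bochner_Integration.integral_cong refl)
  fix s
  have "f (x - s) = 0" if "\<bar>s\<bar> > R" using that x R by (intro supp) linarith
  then show "indicat_real {t. \<delta> < \<bar>x - t\<bar>} (x - s) *\<^sub>R K (x - (x - s)) *\<^sub>R f (x - s) = complex_of_real (cut_kernel \<delta> R s) * f (x - s)"
    by (cases "\<bar>s\<bar> > R") (auto simp: cut_kernel_def indicator_def scaleR_conv_of_real)
qed

lemma cut_conv_trig_poly:
  assumes "\<delta> > 0"
  shows "(LBINT s. complex_of_real (cut_kernel \<delta> R s) * trig_poly w N d c (x - s))
    = trig_poly w N d (\<lambda>i. c i * (LBINT s. complex_of_real (cut_kernel \<delta> R s) * cis (- ((real i - real N) * w * s)))) x"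
proof -
  have [measurable]: "cis \<in> borel_measurable borel"
    unfolding cis_conv_exp by (intro borel_measurable_continuous_onI continuous_intros)
  have int: "integrable lborel (\<lambda>s. complex_of_real (cut_kernel \<delta> R s) * cis (- ((real i - real N) * w * s)))" for i
    by (intro integrable_cut_kernel_mult[OF assms, where M=1]) auto
  have "complex_of_real (cut_kernel \<delta> R s) * trig_poly w N d c (x - s) =
    (\<Sum>i\<le>d. (c i * cis ((real i - real N) * (w * x))) * (complex_of_real (cut_kernel \<delta> R s) * cis (- ((real i - real N) * w * s))))" for s
  proof -
    have "cis ((real i - real N) * (w * (x - s))) = cis ((real i - real N) * (w * x)) * cis (- ((real i - real N) * w * s))" for i
      unfolding cis_mult by (simp add: algebra_simps)
    then show ?thesis unfolding trig_poly_def sum_distrib_left by (intro sum.cong refl) simp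
  qed
  then have "(LBINT s. complex_of_real (cut_kernel \<delta> R s) * trig_poly w N d c (x - s)) =
    (\<Sum>i\<le>d. LBINT s. (c i * cis ((real i - real N) * (w * x))) * (complex_of_real (cut_kernel \<delta> R s) * cis (- ((real i - real N) * w * s))))"
    using int by (simp only:) (intro Bochner_Integration.integral_sum integrable_mult_right int)
  also have "\<dots> = trig_poly w N d (\<lambda>i. c i * (LBINT s. complex_of_real (cut_kernel \<delta> R s) * cis (- ((real i - real N) * w * s)))) x"
    unfolding trig_poly_def by (subst integral_mult_right_zero) (simp only: mult_ac)
  finally show ?thesis .
qed

lemma set_integrable_square:
  fixes g :: "real \<Rightarrow> complex"
  assumes "continuous_on UNIV g"
  shows "set_integrable lborel {a..b} (\<lambda>x. (cmod (g x))\<^sup>2)"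
  by (intro borel_integrable_atLeastAtMost' continuous_intros continuous_on_subset[OF assms]) auto

lemma set_integral_square_add:
  fixes g :: "real \<Rightarrow> complex"
  assumes "continuous_on UNIV g" "P \<ge> 0"
  shows "(LBINT x:{-P..P}. (cmod (g x))\<^sup>2 + C) = (LBINT x:{-P..P}. (cmod (g x))\<^sup>2) + 2 * P * C"
proof -
  have "set_integrable lborel {-P..P} (\<lambda>x. C)" by (intro borel_integrable_atLeastAtMost' continuous_intros)
  then have "(LBINT x:{-P..P}. (cmod (g x))\<^sup>2 + C) = (LBINT x:{-P..P}. (cmod (g x))\<^sup>2) + (LBINT x:{-P..P}. C)"
    by (intro set_integral_add set_integrable_square assms)
  also have "(LBINT x:{-P..P}. C) = 2 * P * C" using assms by (simp add: set_lebesgue_integral_def)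
  finally show ?thesis .
qed

lemma nn_set_integral_eq:
  fixes g :: "real \<Rightarrow> real"
  assumes "set_integrable lborel S g" "\<And>x. g x \<ge> 0"
  shows "(\<integral>\<^sup>+x\<in>S. ennreal (g x) \<partial>lborel) = ennreal (LBINT x:S. g x)"
proof -
  have "(\<integral>\<^sup>+x\<in>S. ennreal (g x) \<partial>lborel) = (\<integral>\<^sup>+x. ennreal (indicator S x *\<^sub>R g x) \<partial>lborel)"
    by (intro nn_integral_cong) (auto simp: indicator_def)
  then show ?thesis
    using assms unfolding set_integrable_def set_lebesgue_integral_def
    by (simp add: nn_integral_eq_integral)
qed

text \<open>For \<open>\<bar>x\<bar> \<le> X\<close> only the kernel below distance \<open>R\<close> and the values of \<open>f\<close> on \<open>{-P..P}\<close> matter, so \<open>f\<close> can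
  be replaced by an approximating trigonometric polynomial of period \<open>2 * P\<close>; Parseval applies to it.\<close>
lemma trunc_L2_interval:
  assumes f: "continuous_on UNIV f" and supp: "\<And>x. \<bar>x\<bar> \<ge> A \<Longrightarrow> f x = 0"
    and A: "A > 0" and \<delta>: "\<delta> > 0" and X: "X \<ge> 0"
  shows "(\<integral>\<^sup>+x\<in>{-X..X}. ennreal ((cmod (trunc f \<delta> x))\<^sup>2) \<partial>lborel)
    \<le> ennreal ((8 * B)\<^sup>2) * (\<integral>\<^sup>+x. ennreal ((cmod (f x))\<^sup>2) \<partial>lborel)"
proof -
  \<comment> \<open>\<open>R\<close> exceeds every distance from a point of {-X..X} to the support,
    so the upper cut is invisible; \<open>P\<close> is so large that \<open>x - s\<close> with
    \<open>\<bar>s\<bar> \<le> R\<close> stays strictly inside one period.\<close>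
  define R where "R = X + A + \<delta>"
  define P where "P = X + R + 1"
  define w where "w = pi / P"
  have P: "P > 0" "A < P" using A X \<delta> by (auto simp: P_def R_def)
  have w: "w > 0" "A * w < pi" "pi / w = P" using P by (auto simp: w_def field_simps)
  have "compact (f ` {-A..A})"
    by (intro compact_continuous_image continuous_on_subset[OF f]) auto
  then obtain M where "\<forall>z\<in>f ` {-A..A}. cmod z \<le> M" using compact_imp_bounded bounded_iff by metis
  then have "cmod (f x) \<le> max M 1" for x
    using supp[of x] by (cases "\<bar>x\<bar> \<le> A") (auto simp: le_max_iff_disj abs_le_iff minus_le_iff)
  then obtain M where M: "\<And>x. cmod (f x) \<le> M" "M \<ge> 1" by (metis max.cobounded2)
  define \<kappa> where "\<kappa> = B / \<delta> * (2 * R)"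
  have \<kappa>: "\<kappa> \<ge> 0" using B_pos \<delta> A X by (simp add: \<kappa>_def R_def)
  define Sf where "Sf = (LBINT x:{-P..P}. (cmod (f x))\<^sup>2)"
  have [measurable]: "f \<in> borel_measurable borel" using f by (rule borel_measurable_continuous_onI)
  \<comment> \<open>The coefficient of \<open>e\<close> in the total error: first from passing
    between the squares of \<open>p\<close> and \<open>f\<close> over a period, then from passing
    from the truncation to \<open>q\<close>. The summand 1 makes \<open>D\<close> positive.\<close>
  define D where "D = (8 * B)\<^sup>2 * (2 * P * (2 * M + 1)) + 2 * P * (2 * \<kappa> * (\<kappa> * M)) + 1"
  have D: "D > 0" using P M \<kappa> by (auto simp: D_def intro!: add_nonneg_pos)
  have step: "(\<integral>\<^sup>+x\<in>{-X..X}. ennreal ((cmod (trunc f \<delta> x))\<^sup>2) \<partial>lborel) \<le> ennreal ((8 * B)\<^sup>2 * Sf) + ennreal (D * e)"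
    if e: "0 < e" "e \<le> 1" for e
  proof -
    obtain N d c where p0: "\<forall>x. - pi < w * x \<and> w * x \<le> pi \<longrightarrow> cmod (f x - trig_poly w N d c x) < e"
      using trig_poly_approximation[OF f supp w(1,2) A e(1)] by blast
    define p where "p = trig_poly w N d c"
    \<comment> \<open>Only the half-open period is covered, as \<open>Arg\<close> takes values in
      (-pi, pi]; the missing point \<open>- P\<close> is null when squares are integrated.\<close>
    have p: "cmod (f x - p x) \<le> e" if "- P < x" "x \<le> P" for x
    proof -
      have "- pi < w * x \<and> w * x \<le> pi"
      proof -
        have "pi * (- P) < pi * x" using that by (intro mult_strict_left_mono) auto
        moreover have "pi * x \<le> pi * P" using that by (intro mult_left_mono) auto
        ultimately show ?thesis using P by (simp add: w_def field_simps)
      qed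
      then show ?thesis using p0 unfolding p_def by (simp add: less_imp_le)
    qed
    define m where "m = (\<lambda>i. LBINT s. complex_of_real (cut_kernel \<delta> R s) * cis (- ((real i - real N) * w * s)))"
    define q where "q = trig_poly w N d (\<lambda>i. c i * m i)"
    have [measurable]: "p \<in> borel_measurable borel" "q \<in> borel_measurable borel"
      unfolding p_def q_def by measurable
    have cp: "continuous_on UNIV p" "continuous_on UNIV q" unfolding p_def q_def by (intro continuous_intros)+
    have mb: "cmod (m i) \<le> 8 * B" for i
      unfolding m_def using multiplier_bound[of \<delta> R "(real i - real N) * w"] \<delta> A X by (simp add: R_def)
    have pt: "(cmod (trunc f \<delta> x))\<^sup>2 \<le> (cmod (q x))\<^sup>2 + 2 * (\<kappa> * e) * (\<kappa> * M)" if x: "\<bar>x\<bar> \<le> X" for x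
    proof (rule square_perturbation)
      have R': "R \<ge> 0" "X + A \<le> R" using A X \<delta> by (auto simp: R_def)
      have t: "trunc f \<delta> x = (LBINT s. complex_of_real (cut_kernel \<delta> R s) * f (x - s))"
        by (rule trunc_eq_cut_conv[OF supp x R'(2)])
      have q': "q x = (LBINT s. complex_of_real (cut_kernel \<delta> R s) * p (x - s))"
        unfolding q_def p_def m_def by (rule cut_conv_trig_poly[OF \<delta>, symmetric])
      have near: "cmod (f (x - s) - p (x - s)) \<le> e" if "\<bar>s\<bar> \<le> R" for s
        using that x by (intro p) (auto simp: P_def)
      have pbd: "cmod (p (x - s)) \<le> M + 1" if "\<bar>s\<bar> \<le> R" for s
        using near[OF that] M(1)[of "x - s"] e norm_triangle_sub[of "p (x - s)" "f (x - s)"]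
        by (simp add: norm_minus_commute)
      have "trunc f \<delta> x - q x = (LBINT s. complex_of_real (cut_kernel \<delta> R s) * f (x - s) - complex_of_real (cut_kernel \<delta> R s) * p (x - s))"
        unfolding t q'
        by (intro Bochner_Integration.integral_diff[symmetric] integrable_cut_kernel_mult[OF \<delta>, where M=M]
            integrable_cut_kernel_mult[OF \<delta>, where M="M+1"] M pbd) auto
      also have "\<dots> = (LBINT s. complex_of_real (cut_kernel \<delta> R s) * (f (x - s) - p (x - s)))"
        by (simp add: right_diff_distrib)
      finally have "cmod (trunc f \<delta> x - q x) \<le> \<kappa> * e"
        unfolding \<kappa>_def using e near R' by (simp only:) (intro cut_conv_bound \<delta>, auto)
      then show "\<bar>cmod (trunc f \<delta> x) - cmod (q x)\<bar> \<le> \<kappa> * e"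
        using norm_triangle_ineq3[of "trunc f \<delta> x" "q x"] by linarith
      show "cmod (trunc f \<delta> x) \<le> \<kappa> * M"
        unfolding \<kappa>_def t using M R' by (intro cut_conv_bound \<delta>) auto
    qed simp
    have "(\<integral>\<^sup>+x\<in>{-X..X}. ennreal ((cmod (trunc f \<delta> x))\<^sup>2) \<partial>lborel)
      \<le> (\<integral>\<^sup>+x\<in>{-P..P}. ennreal ((cmod (q x))\<^sup>2 + 2 * (\<kappa> * e) * (\<kappa> * M)) \<partial>lborel)"
    proof (rule nn_integral_mono)
      fix x
      show "ennreal ((cmod (trunc f \<delta> x))\<^sup>2) * indicator {-X..X} x \<le>
          ennreal ((cmod (q x))\<^sup>2 + 2 * (\<kappa> * e) * (\<kappa> * M)) * indicator {-P..P} x"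
      proof (cases "\<bar>x\<bar> \<le> X")
        case True
        then have "x \<in> {-X..X}" "x \<in> {-P..P}" using \<delta> A X by (auto simp: P_def R_def)
        then show ?thesis using pt[OF True] by (simp add: ennreal_leI)
      qed (auto simp: indicator_def)
    qed
    also have "\<dots> = ennreal (LBINT x:{-P..P}. (cmod (q x))\<^sup>2 + 2 * (\<kappa> * e) * (\<kappa> * M))"
      using cp \<kappa> e M by (intro nn_set_integral_eq borel_integrable_atLeastAtMost' continuous_intros
          continuous_on_subset[OF cp(2)]) auto
    also have "(LBINT x:{-P..P}. (cmod (q x))\<^sup>2 + 2 * (\<kappa> * e) * (\<kappa> * M)) =
       (LBINT x:{-P..P}. (cmod (q x))\<^sup>2) + 2 * P * (2 * (\<kappa> * e) * (\<kappa> * M))"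
      using P by (intro set_integral_square_add cp) auto
    also have "(LBINT x:{-P..P}. (cmod (q x))\<^sup>2) = 2 * pi / w * (\<Sum>i\<le>d. (cmod (c i * m i))\<^sup>2)"
      using parseval_trig_poly[OF w(1), of N d "\<lambda>i. c i * m i"] w(3) by (simp add: q_def)
    also have "\<dots> \<le> 2 * pi / w * (\<Sum>i\<le>d. (8 * B)\<^sup>2 * (cmod (c i))\<^sup>2)"
      using w(1) mb unfolding norm_mult power_mult_distrib[of "cmod _"] mult.commute[of "(8 * B)\<^sup>2"]
      by (intro mult_left_mono sum_mono power_mono) auto
    also have "\<dots> = (8 * B)\<^sup>2 * (LBINT x:{-P..P}. (cmod (p x))\<^sup>2)"
      using parseval_trig_poly[OF w(1), of N d c] w(3) by (simp add: p_def sum_distrib_left mult_ac)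
    also have "(LBINT x:{-P..P}. (cmod (p x))\<^sup>2) \<le> (LBINT x:{-P..P}. (cmod (f x))\<^sup>2 + (2 * M + 1) * e)"
    proof (rule set_integral_mono_AE)
      show "AE x in lborel. x \<in> {-P..P} \<longrightarrow> (cmod (p x))\<^sup>2 \<le> (cmod (f x))\<^sup>2 + (2 * M + 1) * e"
        using AE_lborel_singleton[of "-P"]
      proof eventually_elim
        case (elim x)
        show ?case
        proof
          assume x: "x \<in> {-P..P}"
          have "cmod (p x) \<le> cmod (f x) + e"
            using p[of x] elim x norm_triangle_sub[of "p x" "f x"] by (simp add: norm_minus_commute)
          then have "(cmod (p x))\<^sup>2 \<le> (cmod (f x) + e)\<^sup>2" by (intro power_mono) auto
          also have "\<dots> = (cmod (f x))\<^sup>2 + (2 * cmod (f x) + e) * e" by (simp add: power2_eq_square algebra_simps)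
          also have "\<dots> \<le> (cmod (f x))\<^sup>2 + (2 * M + 1) * e"
            using M e by (intro add_left_mono mult_right_mono add_mono) auto
          finally show "(cmod (p x))\<^sup>2 \<le> (cmod (f x))\<^sup>2 + (2 * M + 1) * e" .
        qed
      qed
    qed (intro set_integrable_square cp f borel_integrable_atLeastAtMost' continuous_intros continuous_on_subset[OF f] subset_UNIV)+
    also have "(LBINT x:{-P..P}. (cmod (f x))\<^sup>2 + (2 * M + 1) * e) = Sf + 2 * P * ((2 * M + 1) * e)"
      using P unfolding Sf_def by (intro set_integral_square_add f) auto
    finally have "(\<integral>\<^sup>+x\<in>{-X..X}. ennreal ((cmod (trunc f \<delta> x))\<^sup>2) \<partial>lborel)
      \<le> ennreal ((8 * B)\<^sup>2 * (Sf + 2 * P * ((2 * M + 1) * e)) + 2 * P * (2 * (\<kappa> * e) * (\<kappa> * M)))"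
      by (simp add: ennreal_leI mult_left_mono)
    also have "\<dots> \<le> ennreal ((8 * B)\<^sup>2 * Sf + D * e)"
      using e by (intro ennreal_leI) (simp add: D_def algebra_simps)
    also have "\<dots> = ennreal ((8 * B)\<^sup>2 * Sf) + ennreal (D * e)"
      using D e by (intro ennreal_plus) (auto simp: Sf_def set_lebesgue_integral_def intro!: mult_nonneg_nonneg Bochner_Integration.integral_nonneg)
    finally show ?thesis .
  qed
  have "(\<integral>\<^sup>+x\<in>{-X..X}. ennreal ((cmod (trunc f \<delta> x))\<^sup>2) \<partial>lborel) \<le> ennreal ((8 * B)\<^sup>2 * Sf)"
  proof (rule ennreal_le_epsilon)
    fix \<eta> :: real assume "\<eta> > 0"
    define e where "e = min 1 (\<eta> / D)"
    have e: "0 < e" "e \<le> 1" "D * e \<le> \<eta>" using D \<open>\<eta> > 0\<close> by (auto simp: e_def min_def field_simps)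
    show "(\<integral>\<^sup>+x\<in>{-X..X}. ennreal ((cmod (trunc f \<delta> x))\<^sup>2) \<partial>lborel) \<le> ennreal ((8 * B)\<^sup>2 * Sf) + ennreal \<eta>"
      using order_trans[OF step[OF e(1,2)] add_left_mono[OF ennreal_leI[OF e(3)]]] .
  qed
  also have "ennreal ((8 * B)\<^sup>2 * Sf) = ennreal ((8 * B)\<^sup>2) * ennreal Sf"
    by (rule ennreal_mult') simp
  also have "ennreal Sf = (\<integral>\<^sup>+x\<in>{-P..P}. ennreal ((cmod (f x))\<^sup>2) \<partial>lborel)"
    unfolding Sf_def by (intro nn_set_integral_eq[symmetric] set_integrable_square f) auto
  also have "ennreal ((8 * B)\<^sup>2) * \<dots> \<le> ennreal ((8 * B)\<^sup>2) * (\<integral>\<^sup>+x. ennreal ((cmod (f x))\<^sup>2) \<partial>lborel)"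
    by (intro mult_left_mono nn_integral_mono) (auto simp: indicator_def)
  finally show ?thesis .
qed

end

subsection \<open>Density of Lipschitz functions\<close>

text \<open>Lipschitz rather than merely continuous: combined with the oddness of the kernel it
  gives convergence of the truncations at every point, with a rate.\<close>

definition lipschitz_compact_support :: "(real \<Rightarrow> complex) \<Rightarrow> bool" where
  "lipschitz_compact_support h \<longleftrightarrow>
     (\<exists>L. \<forall>x y. cmod (h x - h y) \<le> L * \<bar>x - y\<bar>) \<and> (\<exists>A. \<forall>x. A \<le> \<bar>x\<bar> \<longrightarrow> h x = 0)"

lemma lipschitz_compact_supportD:
  assumes "lipschitz_compact_support h"
  shows "\<exists>L A. 0 \<le> L \<and> 0 < A \<and> (\<forall>x y. cmod (h x - h y) \<le> L * \<bar>x - y\<bar>) \<and> (\<forall>x. A \<le> \<bar>x\<bar> \<longrightarrow> h x = 0)"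
proof -
  obtain L A where LA: "\<And>x y. cmod (h x - h y) \<le> L * \<bar>x - y\<bar>" "\<And>x. A \<le> \<bar>x\<bar> \<Longrightarrow> h x = 0"
    using assms unfolding lipschitz_compact_support_def by auto
  have "0 \<le> L" using LA(1)[of 1 0] norm_ge_zero[of "h 1 - h 0"] by (auto simp del: norm_ge_zero)
  moreover have "h x = 0" if "max A 1 \<le> \<bar>x\<bar>" for x using LA(2)[of x] that by auto
  ultimately show ?thesis using LA(1) by (intro exI[of _ L] exI[of _ "max A 1"]) auto
qed

lemma continuous_on_lipschitz_compact_support:
  assumes "lipschitz_compact_support h"
  shows "continuous_on UNIV h"
proof -
  obtain L A where L: "L \<ge> 0" "A > 0" "\<And>x y. cmod (h x - h y) \<le> L * \<bar>x - y\<bar>" "\<And>x. A \<le> \<bar>x\<bar> \<Longrightarrow> h x = 0"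
    using lipschitz_compact_supportD[OF assms] by blast
  then have "L-lipschitz_on UNIV h" by (intro lipschitz_onI) (auto simp: dist_norm)
  then show ?thesis by (rule lipschitz_on_continuous_on)
qed

lemma integrable_lipschitz_compact_support:
  assumes "lipschitz_compact_support h"
  shows "integrable lborel h"
proof -
  obtain L A where A: "L \<ge> 0" "A > 0" "\<And>x y. cmod (h x - h y) \<le> L * \<bar>x - y\<bar>" "\<And>x. A \<le> \<bar>x\<bar> \<Longrightarrow> h x = 0"
    using lipschitz_compact_supportD[OF assms] by blast
  have "set_integrable lborel {-A..A} h"
    by (intro borel_integrable_atLeastAtMost' continuous_on_subset[OF continuous_on_lipschitz_compact_support[OF assms]]) auto
  moreover have "indicator {-A..A} x *\<^sub>R h x = h x" for x
    using A(4)[of x] by (cases "A \<le> \<bar>x\<bar>") (auto simp: indicator_def)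
  ultimately show ?thesis by (simp add: set_integrable_def)
qed

lemma lipschitz_compact_support_add:
  assumes "lipschitz_compact_support f" "lipschitz_compact_support g"
  shows "lipschitz_compact_support (\<lambda>x. f x + g x)"
proof -
  obtain L A where f: "L \<ge> 0" "A > 0" "\<And>x y. cmod (f x - f y) \<le> L * \<bar>x - y\<bar>" "\<And>x. A \<le> \<bar>x\<bar> \<Longrightarrow> f x = 0"
    using lipschitz_compact_supportD[OF assms(1)] by blast
  obtain L' A' where g: "L' \<ge> 0" "A' > 0" "\<And>x y. cmod (g x - g y) \<le> L' * \<bar>x - y\<bar>" "\<And>x. A' \<le> \<bar>x\<bar> \<Longrightarrow> g x = 0"
    using lipschitz_compact_supportD[OF assms(2)] by blast
  have "cmod (f x + g x - (f y + g y)) \<le> (L + L') * \<bar>x - y\<bar>" for x y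
  proof -
    have "f x + g x - (f y + g y) = (f x - f y) + (g x - g y)" by simp
    then have "cmod (f x + g x - (f y + g y)) \<le> cmod (f x - f y) + cmod (g x - g y)"
      by (simp only: norm_triangle_ineq)
    then show ?thesis using f(3)[of x y] g(3)[of x y] by (simp add: distrib_right)
  qed
  moreover have "f x + g x = 0" if "max A A' \<le> \<bar>x\<bar>" for x using f(4)[of x] g(4)[of x] that by simp
  ultimately show ?thesis unfolding lipschitz_compact_support_def by blast
qed

text \<open>Since the integral of a nonintegrable function is 0, the predicate carries its intended
  meaning only for integrable \<open>f\<close>.\<close>

definition L1_approximable :: "(real \<Rightarrow> complex) \<Rightarrow> bool" where
  "L1_approximable f \<longleftrightarrow>
     (\<forall>e>0. \<exists>h. lipschitz_compact_support h \<and> (LBINT t. cmod (f t - h t)) < e)"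

lemma L1_approximableD:
  "L1_approximable f \<Longrightarrow> e > 0 \<Longrightarrow> \<exists>h. lipschitz_compact_support h \<and> (LBINT t. cmod (f t - h t)) < e"
  by (simp add: L1_approximable_def)

lemma integral_norm_triangle:
  fixes f g h :: "real \<Rightarrow> complex"
  assumes "integrable lborel f" "integrable lborel g" "integrable lborel h"
  shows "(LBINT t. cmod (f t - h t)) \<le> (LBINT t. cmod (f t - g t)) + (LBINT t. cmod (g t - h t))"
proof -
  have "(LBINT t. cmod (f t - h t)) \<le> (LBINT t. cmod (f t - g t) + cmod (g t - h t))"
  proof (rule integral_mono)
    fix t
    show "cmod (f t - h t) \<le> cmod (f t - g t) + cmod (g t - h t)"
      using norm_triangle_ineq[of "f t - g t" "g t - h t"] by simp
  qed (use assms in auto)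
  also have "\<dots> = (LBINT t. cmod (f t - g t)) + (LBINT t. cmod (g t - h t))"
    using assms by (intro Bochner_Integration.integral_add) auto
  finally show ?thesis .
qed

lemma L1_approximable_limit:
  assumes f: "integrable lborel f"
    and g: "\<And>n. integrable lborel (g n)" "\<And>n. L1_approximable (g n)"
    and lim: "(\<lambda>n. LBINT t. cmod (f t - g n t)) \<longlonglongrightarrow> 0"
  shows "L1_approximable f"
  unfolding L1_approximable_def
proof (intro allI impI)
  fix e :: real assume e: "e > 0"
  then have "eventually (\<lambda>n. (LBINT t. cmod (f t - g n t)) < e / 2) sequentially"
    using lim by (intro order_tendstoD) auto
  then obtain n where n: "(LBINT t. cmod (f t - g n t)) < e / 2"
    by (auto simp: eventually_sequentially)
  have "\<exists>h. lipschitz_compact_support h \<and> (LBINT t. cmod (g n t - h t)) < e / 2"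
    using e by (intro L1_approximableD g(2)) simp
  then obtain h where h: "lipschitz_compact_support h" "(LBINT t. cmod (g n t - h t)) < e / 2" by blast
  have "(LBINT t. cmod (f t - h t)) < e"
    using integral_norm_triangle[OF f g(1)[of n] integrable_lipschitz_compact_support[OF h(1)]] n h(2) by linarith
  then show "\<exists>h. lipschitz_compact_support h \<and> (LBINT t. cmod (f t - h t)) < e" using h(1) by blast
qed

lemma L1_tendsto_dominated:
  fixes f :: "real \<Rightarrow> complex"
  assumes [measurable]: "f \<in> borel_measurable borel" "\<And>n. g n \<in> borel_measurable borel"
    and w: "integrable lborel w" and dom: "\<And>n x. cmod (f x - g n x) \<le> w x"
    and lim: "\<And>x. (\<lambda>n. g n x) \<longlonglongrightarrow> f x"
  shows "(\<lambda>n. LBINT t. cmod (f t - g n t)) \<longlonglongrightarrow> 0"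
proof -
  have "(\<lambda>n. integral\<^sup>L lborel (\<lambda>t. cmod (f t - g n t))) \<longlonglongrightarrow> (LBINT t::real. 0)"
  proof (rule integral_dominated_convergence[where w=w])
    show "AE t in lborel. (\<lambda>n. cmod (f t - g n t)) \<longlonglongrightarrow> 0"
    proof (rule AE_I2)
      fix t
      have "(\<lambda>n. cmod (f t - g n t)) \<longlonglongrightarrow> cmod (f t - f t)" by (intro tendsto_intros lim)
      then show "(\<lambda>n. cmod (f t - g n t)) \<longlonglongrightarrow> 0" by simp
    qed
  qed (use dom w in auto)
  then show ?thesis by simp
qed

text \<open>The functions max 0 (1 - (n + 1) dist(x, C)) are Lipschitz, vanish at distance 1 from
  \<open>C\<close>, and converge to the indicator because \<open>C\<close> is closed.\<close>

lemma L1_approximable_compact: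
  assumes C: "compact C"
  shows "L1_approximable (\<lambda>x. indicator C x *\<^sub>R c)"
proof (cases "C = {}")
  case True
  have "lipschitz_compact_support (\<lambda>x. 0)" by (auto simp: lipschitz_compact_support_def intro: exI[of _ 0])
  then show ?thesis unfolding L1_approximable_def using True by (auto intro!: exI[of _ "\<lambda>x. 0"])
next
  case False
  obtain r where r: "r > 0" "\<And>x. x \<in> C \<Longrightarrow> \<bar>x\<bar> \<le> r"
    using compact_imp_bounded[OF C] unfolding bounded_pos by auto
  define \<phi> where "\<phi> = (\<lambda>n::nat. \<lambda>x. max 0 (1 - (real n + 1) * infdist x C))"
  have inf: "infdist x C \<ge> 1" if "r + 1 \<le> \<bar>x\<bar>" for x
  proof -
    have "1 \<le> dist x y" if "y \<in> C" for y
      using r(2)[OF that] \<open>r + 1 \<le> \<bar>x\<bar>\<close> unfolding dist_real_def by linarith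
    then show ?thesis using False by (simp add: infdist_notempty cINF_greatest)
  qed
  have supp: "\<phi> n x = 0" if "r + 1 \<le> \<bar>x\<bar>" for n x
  proof -
    have "1 * 1 \<le> (real n + 1) * infdist x C" using inf[OF that] by (intro mult_mono) auto
    then show ?thesis by (simp add: \<phi>_def)
  qed
  have lip: "\<bar>\<phi> n x - \<phi> n y\<bar> \<le> (real n + 1) * \<bar>x - y\<bar>" for n x y
  proof -
    have "\<bar>infdist x C - infdist y C\<bar> \<le> \<bar>x - y\<bar>"
      using infdist_triangle_abs[of x C y] by (simp add: dist_real_def)
    then have "(real n + 1) * \<bar>infdist x C - infdist y C\<bar> \<le> (real n + 1) * \<bar>x - y\<bar>" by (intro mult_left_mono) auto
    moreover have "\<bar>\<phi> n x - \<phi> n y\<bar> \<le> \<bar>(real n + 1) * infdist x C - (real n + 1) * infdist y C\<bar>"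
      unfolding \<phi>_def by linarith
    moreover have "\<bar>(real n + 1) * infdist x C - (real n + 1) * infdist y C\<bar> = (real n + 1) * \<bar>infdist x C - infdist y C\<bar>"
      by (simp add: abs_mult flip: right_diff_distrib)
    ultimately show ?thesis by linarith
  qed
  have nice: "lipschitz_compact_support (\<lambda>x. \<phi> n x *\<^sub>R c)" for n
    unfolding lipschitz_compact_support_def
  proof (intro conjI exI allI impI)
    fix x y
    show "cmod (\<phi> n x *\<^sub>R c - \<phi> n y *\<^sub>R c) \<le> ((real n + 1) * cmod c) * \<bar>x - y\<bar>"
      using mult_right_mono[OF lip[of n x y], of "cmod c"] by (simp flip: scaleR_diff_left add: mult_ac)
    show "\<phi> n x *\<^sub>R c = 0" if "r + 1 \<le> \<bar>x\<bar>" using supp[OF that] by simp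
  qed
  have [measurable]: "C \<in> sets borel" using C by (simp add: borel_compact)
  have lim: "(\<lambda>n. LBINT t. cmod (indicator C t *\<^sub>R c - \<phi> n t *\<^sub>R c)) \<longlonglongrightarrow> 0"
  proof (rule L1_tendsto_dominated[where w="\<lambda>x. cmod c * indicator {-(r+1)..r+1} x"])
    show "integrable lborel (\<lambda>x. cmod c * indicator {-(r+1)..r+1} x)"
      by (intro integrable_mult_right integrable_real_indicator emeasure_bounded_finite) auto
    show "(\<lambda>x. \<phi> n x *\<^sub>R c) \<in> borel_measurable borel" for n
      using continuous_on_lipschitz_compact_support[OF nice] by (rule borel_measurable_continuous_onI)
    fix n x
    have "\<bar>indicator C x - \<phi> n x\<bar> \<le> (indicator {-(r+1)..r+1} x :: real)"
      using supp[of x n] r(2)[of x] infdist_nonneg[of x C]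
      by (cases "r + 1 \<le> \<bar>x\<bar>") (auto simp: \<phi>_def indicator_def)
    then have "\<bar>indicator C x - \<phi> n x\<bar> * cmod c \<le> indicator {-(r+1)..r+1} x * cmod c" by (intro mult_right_mono) auto
    then show "cmod (indicator C x *\<^sub>R c - \<phi> n x *\<^sub>R c) \<le> cmod c * indicator {-(r+1)..r+1} x"
      by (simp flip: scaleR_diff_left add: mult_ac)
  next
    fix x
    have "(\<lambda>n. \<phi> n x) \<longlonglongrightarrow> indicator C x"
    proof (cases "x \<in> C")
      case False
      then have pos: "infdist x C > 0"
        using C \<open>C \<noteq> {}\<close> by (simp add: compact_imp_closed infdist_pos_not_in_closed)
      obtain N :: nat where N: "1 / infdist x C \<le> real N" using real_arch_simple by blast
      have "\<phi> n x = 0" if "n \<ge> N" for n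
      proof -
        have "1 / infdist x C \<le> real n + 1" using N that by simp
        then have "1 \<le> (real n + 1) * infdist x C" using pos by (simp add: field_simps)
        then show ?thesis by (simp add: \<phi>_def)
      qed
      then show ?thesis using False by (auto intro!: tendsto_eventually eventually_sequentiallyI)
    qed (simp add: \<phi>_def)
    then show "(\<lambda>n. \<phi> n x *\<^sub>R c) \<longlonglongrightarrow> indicator C x *\<^sub>R c" by (intro tendsto_intros)
  qed measurable
  have appr: "L1_approximable (\<lambda>x. \<phi> n x *\<^sub>R c)" for n
    unfolding L1_approximable_def using nice[of n] by (auto intro!: exI[of _ "\<lambda>x. \<phi> n x *\<^sub>R c"])
  show ?thesis
  proof (rule L1_approximable_limit[OF _ _ appr lim])
    show "integrable lborel (\<lambda>x. indicat_real C x *\<^sub>R c)"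
      using C by (intro integrable_indicator emeasure_compact_finite) auto
    show "integrable lborel (\<lambda>x. \<phi> n x *\<^sub>R c)" for n
      by (rule integrable_lipschitz_compact_support[OF nice])
  qed
qed

text \<open>Inner regularity provides closed subsets of almost full measure, and intersecting these
  with bounded intervals makes them compact.\<close>

lemma L1_approximable_indicator:
  assumes A [measurable]: "A \<in> sets borel" and fin: "emeasure lborel A < \<infinity>"
  shows "L1_approximable (\<lambda>x. indicator A x *\<^sub>R c)"
proof -
  have closed: "L1_approximable (\<lambda>x. indicator T x *\<^sub>R c)" if T: "closed T" "T \<subseteq> A" for T
  proof (rule L1_approximable_limit)
    have [measurable]: "T \<in> sets borel" using T by simp
    have finT: "emeasure lborel T < \<infinity>" using order.strict_trans1[OF emeasure_mono[OF T(2), of lborel] fin] A by simp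
    show "integrable lborel (\<lambda>x. indicator T x *\<^sub>R c)" using finT by (intro integrable_indicator) auto
    fix n :: nat
    have comp: "compact (T \<inter> {- real n..real n})" using T(1) by (intro closed_Int_compact) auto
    then show "L1_approximable (\<lambda>x. indicator (T \<inter> {- real n..real n}) x *\<^sub>R c)"
      by (rule L1_approximable_compact)
    show "integrable lborel (\<lambda>x. indicator (T \<inter> {- real n..real n}) x *\<^sub>R c)"
      using comp by (intro integrable_indicator emeasure_compact_finite) (auto simp: borel_compact)
  next
    have [measurable]: "T \<in> sets borel" using T by simp
    have finT: "emeasure lborel T < \<infinity>" using order.strict_trans1[OF emeasure_mono[OF T(2), of lborel] fin] A by simp
    show "(\<lambda>n. LBINT t. cmod (indicator T t *\<^sub>R c - indicator (T \<inter> {- real n..real n}) t *\<^sub>R c)) \<longlonglongrightarrow> 0"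
    proof (rule L1_tendsto_dominated[where w="\<lambda>x. cmod c * indicator T x"])
      show "integrable lborel (\<lambda>x. cmod c * indicator T x)"
        using finT by (intro integrable_mult_right integrable_real_indicator) auto
      fix x :: real
      obtain N :: nat where N: "\<bar>x\<bar> \<le> real N" using real_arch_simple by blast
      have "indicator (T \<inter> {- real n..real n}) x = (indicator T x :: real)" if "n \<ge> N" for n
        using N that by (auto simp: indicator_def)
      then show "(\<lambda>n. indicator (T \<inter> {- real n..real n}) x *\<^sub>R c) \<longlonglongrightarrow> indicator T x *\<^sub>R c"
        by (auto intro!: tendsto_eventually eventually_sequentiallyI[of N])
    qed (auto simp: indicator_def)
  qed
  have "\<exists>T. closed T \<and> T \<subseteq> A \<and> emeasure lborel (A - T) < ennreal (1 / (real n + 1))" for n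
  proof -
    have "A \<in> sets lebesgue" "1 / (real n + 1) > 0" using A by auto
    then obtain T where T: "closed T" "T \<subseteq> A" "emeasure lebesgue (A - T) < ennreal (1 / (real n + 1))"
      by (rule sets_lebesgue_inner_closed)
    moreover have "A - T \<in> sets lborel" using A T(1) by auto
    ultimately show ?thesis by (intro exI[of _ T]) simp
  qed
  then obtain T where T: "\<And>n. closed (T n)" "\<And>n. T n \<subseteq> A" "\<And>n. emeasure lborel (A - T n) < ennreal (1 / (real n + 1))"
    by metis
  have [measurable]: "T n \<in> sets borel" for n using T(1) by simp
  have finT: "emeasure lborel (T n) < \<infinity>" for n using order.strict_trans1[OF emeasure_mono[OF T(2), of lborel] fin] by simp
  show ?thesis
  proof (rule L1_approximable_limit)
    show "integrable lborel (\<lambda>x. indicator A x *\<^sub>R c)" using fin by (intro integrable_indicator) auto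
    show "integrable lborel (\<lambda>x. indicator (T n) x *\<^sub>R c)" for n using finT by (intro integrable_indicator) auto
    show "L1_approximable (\<lambda>x. indicator (T n) x *\<^sub>R c)" for n by (intro closed T)
    have bnd: "(LBINT t. cmod (indicator A t *\<^sub>R c - indicator (T n) t *\<^sub>R c)) \<le> cmod c * (1 / (real n + 1))" for n
    proof -
      have "(LBINT t. cmod (indicator A t *\<^sub>R c - indicator (T n) t *\<^sub>R c)) = (LBINT t. cmod c * indicator (A - T n) t)"
        using T(2)[of n] by (intro Bochner_Integration.integral_cong refl) (auto simp: indicator_def)
      also have "\<dots> = cmod c * measure lborel (A - T n)" by simp
      also have "measure lborel (A - T n) \<le> 1 / (real n + 1)"
        unfolding measure_def using T(3)[of n] by (intro enn2real_leI) auto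
      finally show ?thesis by (simp add: mult_left_mono)
    qed
    have lim0: "(\<lambda>n. cmod c * (1 / (real n + 1))) \<longlonglongrightarrow> 0"
      using LIMSEQ_inverse_real_of_nat
      by (intro tendsto_mult_right_zero) (simp add: inverse_eq_divide add.commute)
    show "(\<lambda>n. LBINT t. cmod (indicator A t *\<^sub>R c - indicator (T n) t *\<^sub>R c)) \<longlonglongrightarrow> 0"
      by (rule tendsto_sandwich[OF _ _ tendsto_const lim0]; intro always_eventually allI bnd Bochner_Integration.integral_nonneg norm_ge_zero)
  qed
qed

theorem L1_approximable_integrable:
  assumes "integrable lborel f"
  shows "L1_approximable f"
  using assms
proof (induction rule: integrable_induct)
  case (base A c)
  then show ?case by (intro L1_approximable_indicator) auto
next
  case (add f g)
  show ?case
    unfolding L1_approximable_def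
  proof (intro allI impI)
    fix e :: real assume e: "e > 0"
    have "\<exists>h. lipschitz_compact_support h \<and> (LBINT t. cmod (f t - h t)) < e / 2"
      "\<exists>h. lipschitz_compact_support h \<and> (LBINT t. cmod (g t - h t)) < e / 2"
      using e by (intro L1_approximableD add.IH; simp)+
    then obtain h k where h: "lipschitz_compact_support h" "(LBINT t. cmod (f t - h t)) < e / 2"
      and k: "lipschitz_compact_support k" "(LBINT t. cmod (g t - k t)) < e / 2" by blast
    note [simp] = integrable_lipschitz_compact_support[OF h(1)] integrable_lipschitz_compact_support[OF k(1)]
    have "(LBINT t. cmod (f t + g t - (h t + k t))) \<le> (LBINT t. cmod (f t - h t) + cmod (g t - k t))"
    proof (rule integral_mono)
      fix t
      have "f t + g t - (h t + k t) = (f t - h t) + (g t - k t)" by simp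
      then show "cmod (f t + g t - (h t + k t)) \<le> cmod (f t - h t) + cmod (g t - k t)"
        by (simp only: norm_triangle_ineq)
    qed (use add in auto)
    also have "\<dots> = (LBINT t. cmod (f t - h t)) + (LBINT t. cmod (g t - k t))"
      using add by (intro Bochner_Integration.integral_add) auto
    finally have "(LBINT t. cmod (f t + g t - (h t + k t))) < e" using h k by linarith
    then show "\<exists>h. lipschitz_compact_support h \<and> (LBINT t. cmod (f t + g t - h t)) < e"
      using lipschitz_compact_support_add[OF h(1) k(1)] by blast
  qed
next
  case (lim f s)
  have "(\<lambda>n. LBINT t. cmod (f t - s n t)) \<longlonglongrightarrow> 0"
  proof (rule L1_tendsto_dominated[where w="\<lambda>x. 3 * cmod (f x)"])
    show "cmod (f x - s n x) \<le> 3 * cmod (f x)" for n x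
      using lim(3)[of x n] norm_triangle_ineq4[of "f x" "s n x"] by simp
  qed (use lim borel_measurable_integrable[of lborel] in auto)
  then show ?case using lim by (intro L1_approximable_limit[of f s]) auto
qed

lemma L1_approximating_sequence:
  assumes "integrable lborel f"
  obtains h where "\<And>n. lipschitz_compact_support (h n)"
    "\<And>n::nat. (LBINT t. cmod (f t - h n t)) < 1 / (real n + 1)"
proof -
  have "\<exists>h. lipschitz_compact_support h \<and> (LBINT t. cmod (f t - h t)) < 1 / (real n + 1)" for n
    using L1_approximable_integrable[OF assms] unfolding L1_approximable_def by simp
  then show ?thesis using that by metis
qed

section \<open>Consequences of a bound on the Lebesgue maximal function at a point\<close>

interpretation lborel: locally_finite_measure lborel
  by unfold_locales (auto simp: emeasure_lborel_box_finite[where 'a=real, simplified])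

lemma hl_max_lborel_integral_le:
  assumes "hl_max lborel \<phi> x \<le> ennreal m" "a < x" "x < b" "m \<ge> 0"
  shows "(\<integral>\<^sup>+t\<in>{a<..<b}. \<phi> t \<partial>lborel) \<le> ennreal (m * (b - a))"
proof -
  let ?I = "\<integral>\<^sup>+t\<in>{a<..<b}. \<phi> t \<partial>lborel"
  have ab: "b - a > 0" using assms by simp
  have "?I / ennreal (b - a) \<le> ennreal m"
    using order_trans[OF hl_max_ge[OF assms(2,3), of lborel \<phi>] assms(1)] ab by simp
  then have "?I / ennreal (b - a) * ennreal (b - a) \<le> ennreal m * ennreal (b - a)" by (rule mult_right_mono) simp
  moreover have "?I / ennreal (b - a) * ennreal (b - a) = ?I"
  proof -
    have "?I / ennreal (b - a) * ennreal (b - a) = ?I * ennreal (b - a) / ennreal (b - a)"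
      by (simp add: ennreal_divide_times ennreal_times_divide mult.commute)
    also have "\<dots> = ?I" using ab by (intro ennreal_mult_divide_eq) auto
    finally show ?thesis .
  qed
  ultimately show ?thesis using assms ab by (simp add: ennreal_mult)
qed

text \<open>The tail integral is split into the shells \<open>2 ^ k * r < \<bar>x - t\<bar> \<le> 2 ^ (k + 1) * r\<close>.\<close>
lemma hl_max_tail_bound:
  assumes [measurable]: "\<phi> \<in> borel_measurable borel"
    and m: "hl_max lborel \<phi> x \<le> ennreal m" "m \<ge> 0" and r: "r > 0"
  shows "(\<integral>\<^sup>+t\<in>{t. r < \<bar>x - t\<bar>}. \<phi> t * ennreal (1 / (x - t)\<^sup>2) \<partial>lborel) \<le> ennreal (16 * m / r)"
proof -
  \<comment> \<open>An open interval about \<open>x\<close> of twice the outer radius of the k-th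
    shell, so that it contains the closed outer boundary. With the factor \<open>c k\<close> its
    contribution is 8 m / r times 2^-k.\<close>
  define S where "S = (\<lambda>k::nat. {x - 2 ^ (k + 2) * r<..<x + 2 ^ (k + 2) * r})"
  define c where "c = (\<lambda>k::nat. 1 / (2 ^ k * r)\<^sup>2)"
  have [measurable]: "S k \<in> sets borel" for k by (simp add: S_def)
  have pt: "\<phi> t * ennreal (1 / (x - t)\<^sup>2) * indicator {t. r < \<bar>x - t\<bar>} t \<le> (\<Sum>k. ennreal (c k) * (\<phi> t * indicator (S k) t))" for t
  proof (cases "r < \<bar>x - t\<bar>")
    case True
    have "\<exists>k. \<bar>x - t\<bar> \<le> 2 ^ (k + 1) * r"
    proof -
      obtain k where "\<bar>x - t\<bar> / r < 2 ^ k" using real_arch_pow[of 2 "\<bar>x - t\<bar> / r"] by auto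
      then have "\<bar>x - t\<bar> < 2 ^ k * r" using r by (simp add: field_simps)
      also have "\<dots> \<le> 2 ^ (k + 1) * r" using r by simp
      finally show ?thesis by (intro exI[of _ k]) simp
    qed
    define k where "k = (LEAST k. \<bar>x - t\<bar> \<le> 2 ^ (k + 1) * r)"
    have k1: "\<bar>x - t\<bar> \<le> 2 ^ (k + 1) * r" unfolding k_def by (rule LeastI_ex) fact
    have k2: "2 ^ k * r \<le> \<bar>x - t\<bar>"
    proof (cases k)
      case 0
      then show ?thesis using True by simp
    next
      case (Suc j)
      then have "\<not> \<bar>x - t\<bar> \<le> 2 ^ (j + 1) * r" using not_less_Least[of j "\<lambda>k. \<bar>x - t\<bar> \<le> 2 ^ (k + 1) * r"] unfolding k_def by simp
      then show ?thesis using Suc by simp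
    qed
    have "2 ^ (k + 1) * r < 2 ^ (k + 2) * r" using r by simp
    then have "\<bar>x - t\<bar> < 2 ^ (k + 2) * r" using k1 by linarith
    then have "t \<in> S k" unfolding S_def by (simp only: greaterThanLessThan_iff) linarith
    have "(2 ^ k * r)\<^sup>2 \<le> (x - t)\<^sup>2" using k2 r by (intro power_mono[of _ "\<bar>x - t\<bar>" 2, simplified]) auto
    then have "1 / (x - t)\<^sup>2 \<le> c k" unfolding c_def using r True by (intro divide_left_mono) (auto intro!: mult_pos_pos)
    then have "\<phi> t * ennreal (1 / (x - t)\<^sup>2) \<le> \<phi> t * ennreal (c k)" by (intro mult_left_mono ennreal_leI) auto
    also have "\<dots> = ennreal (c k) * (\<phi> t * indicator (S k) t)" using \<open>t \<in> S k\<close> by (simp add: mult.commute)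
    also have "\<dots> \<le> (\<Sum>k. ennreal (c k) * (\<phi> t * indicator (S k) t))"
      using sum_le_suminf[of "\<lambda>k. ennreal (c k) * (\<phi> t * indicator (S k) t)" "{k}"] by simp
    finally show ?thesis using True by simp
  qed simp
  have "(\<integral>\<^sup>+t\<in>{t. r < \<bar>x - t\<bar>}. \<phi> t * ennreal (1 / (x - t)\<^sup>2) \<partial>lborel)
      \<le> (\<integral>\<^sup>+t. (\<Sum>k. ennreal (c k) * (\<phi> t * indicator (S k) t)) \<partial>lborel)"
    by (intro nn_integral_mono pt)
  also have "\<dots> = (\<Sum>k. \<integral>\<^sup>+t. ennreal (c k) * (\<phi> t * indicator (S k) t) \<partial>lborel)"
    by (intro nn_integral_suminf) measurable
  also have "\<dots> = (\<Sum>k. ennreal (c k) * (\<integral>\<^sup>+t\<in>S k. \<phi> t \<partial>lborel))"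
    by (subst nn_integral_cmult) auto
  also have "\<dots> \<le> (\<Sum>k. ennreal (8 * m / r * (1 / 2) ^ k))"
  proof (intro suminf_le summableI)
    fix k
    have "ennreal (c k) * (\<integral>\<^sup>+t\<in>S k. \<phi> t \<partial>lborel) \<le> ennreal (c k) * ennreal (m * ((x + 2 ^ (k + 2) * r) - (x - 2 ^ (k + 2) * r)))"
      unfolding S_def using r by (intro mult_left_mono hl_max_lborel_integral_le[OF m(1) _ _ m(2)]) auto
    also have "\<dots> = ennreal (c k * (m * ((x + 2 ^ (k + 2) * r) - (x - 2 ^ (k + 2) * r))))"
      using r m by (intro ennreal_mult[symmetric]) (auto simp: c_def)
    also have "c k * (m * ((x + 2 ^ (k + 2) * r) - (x - 2 ^ (k + 2) * r))) = 8 * m / r * (1 / 2) ^ k"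
      using r by (simp add: c_def field_simps power2_eq_square)
    finally show "ennreal (c k) * (\<integral>\<^sup>+t\<in>S k. \<phi> t \<partial>lborel) \<le> ennreal (8 * m / r * (1 / 2) ^ k)" .
  qed
  also have "\<dots> = ennreal (\<Sum>k. 8 * m / r * (1 / 2) ^ k)"
    using m r by (intro suminf_ennreal2 summable_mult summable_geometric) auto
  also have "(\<Sum>k. 8 * m / r * (1 / 2) ^ k) = 16 * m / r"
    by (subst suminf_mult) (auto simp: suminf_geometric summable_geometric)
  finally show ?thesis .
qed

lemma hl_max_const_le: "hl_max lborel (\<lambda>_. 1) x \<le> 1"
  unfolding hl_max_def
proof (rule SUP_least, clarify)
  fix a b assume "a < x" "x < b"
  then show "(\<integral>\<^sup>+t\<in>{a<..<b}. 1 \<partial>lborel) / emeasure lborel {a<..<b} \<le> 1"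
    by (simp add: ennreal_divide_self)
qed

text \<open>Cauchy--Schwarz for averages, in the additive form t <= s / 2 + t^2 / (2 s).\<close>

lemma hl_max_le_of_square:
  assumes [measurable]: "\<phi> \<in> borel_measurable borel" and s: "s > 0"
    and sq: "hl_max lborel (\<lambda>t. ennreal ((\<phi> t)\<^sup>2)) x \<le> ennreal (s\<^sup>2)" and nonneg: "\<And>t. \<phi> t \<ge> 0"
  shows "hl_max lborel (\<lambda>t. ennreal (\<phi> t)) x \<le> ennreal s"
  unfolding hl_max_def
proof (rule SUP_least, clarify)
  fix a b assume ab: "a < x" "x < b"
  have "(\<integral>\<^sup>+t\<in>{a<..<b}. ennreal (\<phi> t) \<partial>lborel) \<le> (\<integral>\<^sup>+t. (ennreal (s / 2) * indicator {a<..<b} t + ennreal (1 / (2 * s)) * (ennreal ((\<phi> t)\<^sup>2) * indicator {a<..<b} t)) \<partial>lborel)"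
  proof (rule nn_integral_mono)
    fix t
    have "\<phi> t \<le> s / 2 + 1 / (2 * s) * (\<phi> t)\<^sup>2"
    proof -
      have "0 \<le> (\<phi> t - s)\<^sup>2" by simp
      then have "2 * s * \<phi> t \<le> s\<^sup>2 + (\<phi> t)\<^sup>2" by (simp add: power2_eq_square algebra_simps)
      then show ?thesis using s by (simp add: field_simps power2_eq_square)
    qed
    then have "ennreal (\<phi> t) \<le> ennreal (s / 2 + 1 / (2 * s) * (\<phi> t)\<^sup>2)" by (rule ennreal_leI)
    also have "\<dots> = ennreal (s / 2) + ennreal (1 / (2 * s)) * ennreal ((\<phi> t)\<^sup>2)"
      using s by (subst ennreal_plus) (auto simp: ennreal_mult[symmetric])
    finally show "ennreal (\<phi> t) * indicator {a<..<b} t \<le> ennreal (s / 2) * indicator {a<..<b} t + ennreal (1 / (2 * s)) * (ennreal ((\<phi> t)\<^sup>2) * indicator {a<..<b} t)"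
      by (auto simp: indicator_def)
  qed
  also have "\<dots> = ennreal (s / 2) * ennreal (b - a) + ennreal (1 / (2 * s)) * (\<integral>\<^sup>+t\<in>{a<..<b}. ennreal ((\<phi> t)\<^sup>2) \<partial>lborel)"
    using ab by (subst nn_integral_add) (auto simp: nn_integral_cmult nn_integral_cmult_indicator)
  also have "\<dots> \<le> ennreal (s / 2) * ennreal (b - a) + ennreal (1 / (2 * s)) * ennreal (s\<^sup>2 * (b - a))"
    by (intro add_left_mono mult_left_mono hl_max_lborel_integral_le[OF sq] ab) auto
  also have "\<dots> = ennreal (s / 2 * (b - a) + 1 / (2 * s) * (s\<^sup>2 * (b - a)))"
    using s ab by (subst ennreal_plus) (auto simp: ennreal_mult[symmetric])
  also have "s / 2 * (b - a) + 1 / (2 * s) * (s\<^sup>2 * (b - a)) = s * (b - a)"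
    using s by (simp add: field_simps power2_eq_square)
  finally have "(\<integral>\<^sup>+t\<in>{a<..<b}. ennreal (\<phi> t) \<partial>lborel) / ennreal (b - a) \<le> ennreal (s * (b - a)) / ennreal (b - a)"
    by (rule divide_right_mono_ennreal)
  also have "\<dots> = ennreal s" using s ab by (simp add: divide_ennreal)
  finally show "(\<integral>\<^sup>+t\<in>{a<..<b}. ennreal (\<phi> t) \<partial>lborel) / emeasure lborel {a<..<b} \<le> ennreal s"
    using ab by simp
qed

context cz_kernel
begin

lemma trunc_tendsto:
  assumes f: "integrable lborel f" and g: "\<And>n. integrable lborel (g n)"
    and lim: "(\<lambda>n. LBINT t. cmod (f t - g n t)) \<longlonglongrightarrow> 0" and e: "\<epsilon> > 0"
  shows "(\<lambda>n. trunc (g n) \<epsilon> x) \<longlonglongrightarrow> trunc f \<epsilon> x"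
proof -
  have "(\<lambda>n. trunc f \<epsilon> x - trunc (g n) \<epsilon> x) \<longlonglongrightarrow> 0"
  proof (rule Lim_null_comparison)
    show "\<forall>\<^sub>F n in sequentially. norm (trunc f \<epsilon> x - trunc (g n) \<epsilon> x) \<le> B / \<epsilon> * (LBINT t. cmod (f t - g n t))"
    proof (intro always_eventually allI)
      fix n
      have "trunc f \<epsilon> x - trunc (g n) \<epsilon> x = trunc (\<lambda>t. f t - g n t) \<epsilon> x"
        by (rule trunc_diff[OF f g e, symmetric])
      then show "norm (trunc f \<epsilon> x - trunc (g n) \<epsilon> x) \<le> B / \<epsilon> * (LBINT t. cmod (f t - g n t))"
        using norm_trunc_le[OF Bochner_Integration.integrable_diff[OF f g[of n]] e, of x] by simp
    qed
    show "(\<lambda>n. B / \<epsilon> * (LBINT t. cmod (f t - g n t))) \<longlonglongrightarrow> 0"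
      using tendsto_mult_right_zero[OF lim] .
  qed
  from tendsto_diff[OF tendsto_const[of "trunc f \<epsilon> x"] this] show ?thesis by simp
qed

text \<open>Convergence in L1 gives convergence of the truncations at every point, and Fatou's lemma
  does the rest. The bound \<open>C n\<close> may vary because the approximants need not respect the
  L2 norm of \<open>f\<close> exactly.\<close>

lemma trunc_L2_limit:
  assumes f: "integrable lborel f" and g: "\<And>n. integrable lborel (g n)"
    and lim: "(\<lambda>n. LBINT t. cmod (f t - g n t)) \<longlonglongrightarrow> 0" and d: "\<delta> > 0"
    and C: "\<And>n. (\<integral>\<^sup>+x. ennreal ((cmod (trunc (g n) \<delta> x))\<^sup>2) \<partial>lborel) \<le> C n" "C \<longlonglongrightarrow> C'"
  shows "(\<integral>\<^sup>+x. ennreal ((cmod (trunc f \<delta> x))\<^sup>2) \<partial>lborel) \<le> C'"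
proof -
  have [measurable]: "trunc (g n) \<delta> \<in> borel_measurable borel" for n using g d by (rule borel_measurable_trunc)
  have "ennreal ((cmod (trunc f \<delta> x))\<^sup>2) = liminf (\<lambda>n. ennreal ((cmod (trunc (g n) \<delta> x))\<^sup>2))" for x
  proof -
    have "(\<lambda>n. ennreal ((cmod (trunc (g n) \<delta> x))\<^sup>2)) \<longlonglongrightarrow> ennreal ((cmod (trunc f \<delta> x))\<^sup>2)"
      by (intro tendsto_intros tendsto_ennrealI trunc_tendsto[OF f g lim d])
    then show ?thesis by (rule lim_imp_Liminf[OF sequentially_bot, symmetric])
  qed
  then have "(\<integral>\<^sup>+x. ennreal ((cmod (trunc f \<delta> x))\<^sup>2) \<partial>lborel) \<le> liminf (\<lambda>n. \<integral>\<^sup>+x. ennreal ((cmod (trunc (g n) \<delta> x))\<^sup>2) \<partial>lborel)"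
    by (simp only:) (intro nn_integral_liminf, measurable)
  also have "\<dots> \<le> liminf C" by (intro Liminf_mono always_eventually allI C(1))
  also have "\<dots> = C'" using C(2) by (simp add: lim_imp_Liminf)
  finally show ?thesis .
qed

lemma trunc_L2_continuous:
  assumes f: "continuous_on UNIV f" and supp: "\<And>x. \<bar>x\<bar> \<ge> A \<Longrightarrow> f x = 0"
    and A: "A > 0" and \<delta>: "\<delta> > 0" and int: "integrable lborel f"
  shows "(\<integral>\<^sup>+x. ennreal ((cmod (trunc f \<delta> x))\<^sup>2) \<partial>lborel)
    \<le> ennreal ((8 * B)\<^sup>2) * (\<integral>\<^sup>+x. ennreal ((cmod (f x))\<^sup>2) \<partial>lborel)"
proof (rule nn_integral_le_of_intervals)
  show "(\<lambda>x. ennreal ((cmod (trunc f \<delta> x))\<^sup>2)) \<in> borel_measurable borel"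
    using borel_measurable_trunc[OF int \<delta>] by measurable
qed (intro trunc_L2_interval[OF f supp A \<delta>], auto)

text \<open>The metric projection onto a disc. Composing with it imposes the bound \<open>c\<close>
  while Lipschitz constant and support are preserved, and it does not increase the distance to a
  function already bounded by \<open>c\<close>.\<close>

lemma clamp_properties:
  fixes z w :: complex
  assumes "c > 0"
  defines "P \<equiv> closest_point (cball 0 c)"
  shows "cmod (P z) \<le> c" "cmod (P z - P w) \<le> cmod (z - w)" "cmod w \<le> c \<Longrightarrow> P w = w"
proof -
  have cb: "convex (cball (0::complex) c)" "closed (cball (0::complex) c)" "cball (0::complex) c \<noteq> {}"
    using assms by auto
  show "cmod (P z) \<le> c" using closest_point_in_set[OF cb(2,3), of z] by (simp add: P_def)
  show "cmod (P z - P w) \<le> cmod (z - w)" using closest_point_lipschitz[OF cb, of z w] by (simp add: P_def dist_norm)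
  show "cmod w \<le> c \<Longrightarrow> P w = w" by (simp add: P_def closest_point_self)
qed

text \<open>Closeness in L1 does not control L2 norms in general. For approximants \<open>g\<close>
  clamped at height \<open>c\<close> it does, since |g|^2 <= |f|^2 + 2 c |f - g|.\<close>

lemma trunc_L2_bounded:
  assumes f: "integrable lborel f" and c: "\<And>x. cmod (f x) \<le> c" "c > 0" and \<delta>: "\<delta> > 0"
  shows "(\<integral>\<^sup>+x. ennreal ((cmod (trunc f \<delta> x))\<^sup>2) \<partial>lborel)
    \<le> ennreal ((8 * B)\<^sup>2) * (\<integral>\<^sup>+x. ennreal ((cmod (f x))\<^sup>2) \<partial>lborel)"
proof -
  obtain h where h: "\<And>n. lipschitz_compact_support (h n)" "\<And>n::nat. (LBINT t. cmod (f t - h n t)) < 1 / (real n + 1)"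
    using L1_approximating_sequence[OF f] by metis
  define P where "P = closest_point (cball (0::complex) c)"
  note P = clamp_properties[OF c(2), folded P_def]
  define g where "g = (\<lambda>n x. P (h n x))"
  have g: "lipschitz_compact_support (g n)" for n
  proof -
    obtain L A where L: "0 \<le> L" "0 < A" "\<And>x y. cmod (h n x - h n y) \<le> L * \<bar>x - y\<bar>" "\<And>x. A \<le> \<bar>x\<bar> \<Longrightarrow> h n x = 0"
      using lipschitz_compact_supportD[OF h(1)[of n]] by blast
    have "cmod (g n x - g n y) \<le> L * \<bar>x - y\<bar>" for x y
      unfolding g_def using order_trans[OF P(2) L(3)] .
    moreover have "g n x = 0" if "A \<le> \<bar>x\<bar>" for x
      unfolding g_def using L(4)[OF that] P(3)[of 0] c(2) by simp
    ultimately show ?thesis unfolding lipschitz_compact_support_def by blast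
  qed
  note gi = integrable_lipschitz_compact_support[OF g] and hi = integrable_lipschitz_compact_support[OF h(1)]
  have [measurable]: "f \<in> borel_measurable borel" "\<And>n. g n \<in> borel_measurable borel"
    using borel_measurable_integrable[OF f] borel_measurable_integrable[OF gi] by auto
  have close: "cmod (f t - g n t) \<le> cmod (f t - h n t)" for n t
    unfolding g_def using P(2)[of "f t" "h n t"] P(3)[OF c(1)] by simp
  have L1: "(LBINT t. cmod (f t - g n t)) \<le> 1 / (real n + 1)" for n
  proof -
    have "(LBINT t. cmod (f t - g n t)) \<le> (LBINT t. cmod (f t - h n t))"
      using f gi hi by (intro integral_mono close) auto
    then show ?thesis using h(2)[of n] by simp
  qed
  have inv: "(\<lambda>n. 1 / (real n + 1)) \<longlonglongrightarrow> 0"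
    using LIMSEQ_inverse_real_of_nat by (simp add: inverse_eq_divide add.commute)
  have lim: "(\<lambda>n. LBINT t. cmod (f t - g n t)) \<longlonglongrightarrow> 0"
    by (rule tendsto_sandwich[OF _ _ tendsto_const inv]; intro always_eventually allI L1 Bochner_Integration.integral_nonneg norm_ge_zero)
  have "(\<integral>\<^sup>+x. ennreal ((cmod (trunc f \<delta> x))\<^sup>2) \<partial>lborel) \<le> ennreal ((8 * B)\<^sup>2) * ((\<integral>\<^sup>+x. ennreal ((cmod (f x))\<^sup>2) \<partial>lborel) + ennreal (2 * c * 0))"
  proof (rule trunc_L2_limit[OF f gi lim \<delta>])
    show "(\<lambda>n. ennreal ((8 * B)\<^sup>2) * ((\<integral>\<^sup>+x. ennreal ((cmod (f x))\<^sup>2) \<partial>lborel) + ennreal (2 * c * (1 / (real n + 1)))))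
      \<longlonglongrightarrow> ennreal ((8 * B)\<^sup>2) * ((\<integral>\<^sup>+x. ennreal ((cmod (f x))\<^sup>2) \<partial>lborel) + ennreal (2 * c * 0))"
      by (intro ennreal_tendsto_cmult tendsto_add tendsto_const tendsto_ennrealI tendsto_mult inv) simp
    fix n
    obtain A where A: "0 < A" "\<And>x. A \<le> \<bar>x\<bar> \<Longrightarrow> g n x = 0" using lipschitz_compact_supportD[OF g[of n]] by blast
    have "(\<integral>\<^sup>+x. ennreal ((cmod (trunc (g n) \<delta> x))\<^sup>2) \<partial>lborel) \<le> ennreal ((8 * B)\<^sup>2) * (\<integral>\<^sup>+x. ennreal ((cmod (g n x))\<^sup>2) \<partial>lborel)"
      by (rule trunc_L2_continuous[OF continuous_on_lipschitz_compact_support[OF g] A(2,1) \<delta> gi])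
    also have "(\<integral>\<^sup>+x. ennreal ((cmod (g n x))\<^sup>2) \<partial>lborel) \<le> (\<integral>\<^sup>+x. (ennreal ((cmod (f x))\<^sup>2) + ennreal (2 * c * cmod (f x - g n x))) \<partial>lborel)"
    proof (rule nn_integral_mono)
      fix x
      have "\<bar>cmod (g n x) - cmod (f x)\<bar> \<le> cmod (f x - g n x)"
        using norm_triangle_ineq3[of "f x" "g n x"] by linarith
      moreover have "cmod (g n x) \<le> c" unfolding g_def by (rule P)
      ultimately have "(cmod (g n x))\<^sup>2 \<le> (cmod (f x))\<^sup>2 + 2 * cmod (f x - g n x) * c"
        by (intro square_perturbation) auto
      then have "ennreal ((cmod (g n x))\<^sup>2) \<le> ennreal ((cmod (f x))\<^sup>2 + 2 * c * cmod (f x - g n x))"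
        by (intro ennreal_leI) (simp add: mult_ac)
      then show "ennreal ((cmod (g n x))\<^sup>2) \<le> ennreal ((cmod (f x))\<^sup>2) + ennreal (2 * c * cmod (f x - g n x))"
        using c(2) by simp
    qed
    also have "\<dots> = (\<integral>\<^sup>+x. ennreal ((cmod (f x))\<^sup>2) \<partial>lborel) + (\<integral>\<^sup>+x. ennreal (2 * c * cmod (f x - g n x)) \<partial>lborel)"
      by (rule nn_integral_add) auto
    also have "(\<integral>\<^sup>+x. ennreal (2 * c * cmod (f x - g n x)) \<partial>lborel) = ennreal (2 * c * (LBINT t. cmod (f t - g n t)))"
      using f gi c(2) by (subst nn_integral_eq_integral) auto
    also have "\<dots> \<le> ennreal (2 * c * (1 / (real n + 1)))" using L1[of n] c(2) by (intro ennreal_leI mult_left_mono) auto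
    finally show "(\<integral>\<^sup>+x. ennreal ((cmod (trunc (g n) \<delta> x))\<^sup>2) \<partial>lborel)
      \<le> ennreal ((8 * B)\<^sup>2) * ((\<integral>\<^sup>+x. ennreal ((cmod (f x))\<^sup>2) \<partial>lborel) + ennreal (2 * c * (1 / (real n + 1))))"
      by (simp add: mult_left_mono)
  qed
  then show ?thesis by simp
qed

text \<open>Setting \<open>f\<close> to 0 where it exceeds \<open>n + 1\<close> reduces to bounded
  functions, converging in L1 with squares dominated by those of \<open>f\<close>. The right-hand
  side may be infinite.\<close>

theorem trunc_L2:
  assumes f: "integrable lborel f" and \<delta>: "\<delta> > 0"
  shows "(\<integral>\<^sup>+x. ennreal ((cmod (trunc f \<delta> x))\<^sup>2) \<partial>lborel)
    \<le> ennreal ((8 * B)\<^sup>2) * (\<integral>\<^sup>+x. ennreal ((cmod (f x))\<^sup>2) \<partial>lborel)"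
proof -
  have [measurable]: "f \<in> borel_measurable borel" using borel_measurable_integrable[OF f] by simp
  define g where "g = (\<lambda>n::nat. \<lambda>x. if cmod (f x) \<le> real n + 1 then f x else 0)"
  have [measurable]: "g n \<in> borel_measurable borel" for n unfolding g_def by measurable
  have gf: "cmod (g n x) \<le> cmod (f x)" for n x by (simp add: g_def)
  have gi: "integrable lborel (g n)" for n
    by (rule Bochner_Integration.integrable_bound[OF f]) (auto simp: gf)
  have lim: "(\<lambda>n. LBINT t. cmod (f t - g n t)) \<longlonglongrightarrow> 0"
  proof (rule L1_tendsto_dominated[where w="\<lambda>x. cmod (f x)"])
    fix x
    obtain N :: nat where N: "cmod (f x) \<le> real N" using real_arch_simple by blast
    have "g n x = f x" if "n \<ge> N" for n using N that by (simp add: g_def)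
    then show "(\<lambda>n. g n x) \<longlonglongrightarrow> f x" by (auto intro!: tendsto_eventually eventually_sequentiallyI[of N])
  qed (use f in \<open>auto simp: g_def\<close>)
  show ?thesis
  proof (rule trunc_L2_limit[OF f gi lim \<delta>])
    fix n
    have "(\<integral>\<^sup>+x. ennreal ((cmod (trunc (g n) \<delta> x))\<^sup>2) \<partial>lborel) \<le> ennreal ((8 * B)\<^sup>2) * (\<integral>\<^sup>+x. ennreal ((cmod (g n x))\<^sup>2) \<partial>lborel)"
      by (rule trunc_L2_bounded[OF gi, of n "real n + 1"]) (auto simp: g_def \<delta>)
    also have "\<dots> \<le> ennreal ((8 * B)\<^sup>2) * (\<integral>\<^sup>+x. ennreal ((cmod (f x))\<^sup>2) \<partial>lborel)"
      by (intro mult_left_mono nn_integral_mono ennreal_leI power_mono gf) auto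
    finally show "(\<integral>\<^sup>+x. ennreal ((cmod (trunc (g n) \<delta> x))\<^sup>2) \<partial>lborel) \<le> ennreal ((8 * B)\<^sup>2) * (\<integral>\<^sup>+x. ennreal ((cmod (f x))\<^sup>2) \<partial>lborel)" .
  qed simp
qed

end

section \<open>The maximal truncation and Cotlar's inequality\<close>

lemma ennreal_combination:
  "0 \<le> a \<Longrightarrow> 0 \<le> b \<Longrightarrow> 0 \<le> c \<Longrightarrow> 2 * ennreal a + 2 * (ennreal b * ennreal c) = ennreal (2 * a + 2 * (b * c))"
  by (simp add: ennreal_mult)

context cz_kernel
begin

definition tmax :: "(real \<Rightarrow> complex) \<Rightarrow> real \<Rightarrow> ennreal" where
  "tmax f x = (SUP \<epsilon>\<in>{0<..}. ennreal (cmod (trunc f \<epsilon> x)))"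

lemma tmax_ge: "\<epsilon> > 0 \<Longrightarrow> ennreal (cmod (trunc f \<epsilon> x)) \<le> tmax f x"
  unfolding tmax_def by (rule SUP_upper) simp

lemma less_tmax_iff: "l < tmax f x \<longleftrightarrow> (\<exists>\<epsilon>>0. l < ennreal (cmod (trunc f \<epsilon> x)))"
  unfolding tmax_def by (auto simp: less_SUP_iff)

lemma open_trunc_superlevel:
  assumes "integrable lborel f" "\<epsilon> > 0"
  shows "open {x. l < ennreal (cmod (trunc f \<epsilon> x))}"
proof (rule open_Collect_less)
  show "continuous_on UNIV (\<lambda>x. ennreal (cmod (trunc f \<epsilon> x)))"
    by (intro continuous_on_ennreal continuous_intros continuous_on_trunc assms)
qed (rule continuous_on_const)

lemma open_tmax_superlevel:
  assumes "integrable lborel f"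
  shows "open {x. l < tmax f x}"
proof -
  have "{x. l < tmax f x} = (\<Union>\<epsilon>\<in>{0<..}. {x. l < ennreal (cmod (trunc f \<epsilon> x))})"
    by (auto simp: less_tmax_iff)
  then show ?thesis using open_trunc_superlevel[OF assms] by auto
qed

lemma tmax_triangle:
  assumes "integrable lborel f" "integrable lborel g"
  shows "tmax (\<lambda>t. f t + g t) x \<le> tmax f x + tmax g x"
  unfolding tmax_def[of "\<lambda>t. f t + g t"]
proof (rule SUP_least)
  fix \<epsilon> :: real assume "\<epsilon> \<in> {0<..}"
  then have e: "\<epsilon> > 0" by simp
  have "ennreal (cmod (trunc (\<lambda>t. f t + g t) \<epsilon> x)) \<le> ennreal (cmod (trunc f \<epsilon> x) + cmod (trunc g \<epsilon> x))"
    unfolding trunc_add[OF assms e] by (intro ennreal_leI norm_triangle_ineq)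
  also have "\<dots> = ennreal (cmod (trunc f \<epsilon> x)) + ennreal (cmod (trunc g \<epsilon> x))" by simp
  also have "\<dots> \<le> tmax f x + tmax g x" by (intro add_mono tmax_ge e)
  finally show "ennreal (cmod (trunc (\<lambda>t. f t + g t) \<epsilon> x)) \<le> tmax f x + tmax g x" .
qed

lemma far_difference_integrable:
  fixes f :: "real \<Rightarrow> complex"
  assumes f: "integrable lborel f" and r: "r > 0" and xy: "\<bar>x - y\<bar> \<le> r"
  shows "set_integrable lborel {t. 2 * r < \<bar>x - t\<bar>} (\<lambda>t. K (y - t) *\<^sub>R f t)"
proof -
  have int: "set_integrable lborel {t. r < \<bar>y - t\<bar>} (\<lambda>t. K (y - t) *\<^sub>R f t)"
    by (rule trunc_integrable[OF f r])
  have sub: "{t. 2 * r < \<bar>x - t\<bar>} \<subseteq> {t. r < \<bar>y - t\<bar>}"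
  proof (intro Collect_mono impI)
    fix t assume "2 * r < \<bar>x - t\<bar>"
    then show "r < \<bar>y - t\<bar>" using xy by argo
  qed
  show ?thesis by (rule set_integrable_subset[OF int _ sub]) simp
qed

text \<open>Beyond distance \<open>2 * r\<close> from \<open>x\<close> the two kernels differ by at
  most 4 B r / (x - t)^2. The tail estimate at radius \<open>2 * r\<close> contributes 16 m / (2 r),
  which makes the product 32 B m.\<close>

lemma far_difference_bound:
  fixes f :: "real \<Rightarrow> complex"
  assumes f: "integrable lborel f" and r: "r > 0" and xy: "\<bar>x - y\<bar> \<le> r"
    and m: "hl_max lborel (\<lambda>t. ennreal (cmod (f t))) x \<le> ennreal m" "m \<ge> 0"
  shows "cmod (LBINT t:{t. 2 * r < \<bar>x - t\<bar>}. (K (x - t) - K (y - t)) *\<^sub>R f t) \<le> 32 * B * m"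
proof -
  have [measurable]: "f \<in> borel_measurable borel" using borel_measurable_integrable[OF f] by simp
  let ?S = "{t. 2 * r < \<bar>x - t\<bar>}"
  let ?g = "\<lambda>t. indicator ?S t *\<^sub>R ((K (x - t) - K (y - t)) *\<^sub>R f t)"
  have int: "integrable lborel ?g"
    using set_integral_diff(1)[OF far_difference_integrable[OF f r, of x x] far_difference_integrable[OF f r xy]] r
    by (simp add: set_integrable_def scaleR_diff_left)
  have pt: "ennreal (cmod (?g t)) \<le> ennreal (4 * B * r) * (ennreal (cmod (f t)) * ennreal (1 / (x - t)\<^sup>2) * indicator ?S t)" for t
  proof (cases "t \<in> ?S")
    case True
    then have "2 * r < \<bar>x - t\<bar>" by simp
    then have "x - t \<noteq> 0" "\<bar>x - y\<bar> \<le> \<bar>x - t\<bar> / 2" using r xy by auto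
    then have "x - t \<noteq> 0" "\<bar>(y - t) - (x - t)\<bar> \<le> \<bar>x - t\<bar> / 2" by (simp_all add: abs_minus_commute)
    then have "\<bar>K (y - t) - K (x - t)\<bar> \<le> 4 * B * \<bar>(y - t) - (x - t)\<bar> / (x - t)\<^sup>2" by (rule K_lipschitz)
    also have "\<dots> \<le> 4 * B * r / (x - t)\<^sup>2"
      using xy B_pos by (intro divide_right_mono mult_left_mono) auto
    finally have "\<bar>K (x - t) - K (y - t)\<bar> * cmod (f t) \<le> 4 * B * r / (x - t)\<^sup>2 * cmod (f t)"
      by (intro mult_right_mono) (auto simp: abs_minus_commute)
    then have "ennreal (cmod (?g t)) \<le> ennreal (4 * B * r * (cmod (f t) * (1 / (x - t)\<^sup>2)))"
      using True by (intro ennreal_leI) (simp add: mult_ac)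
    also have "\<dots> = ennreal (4 * B * r) * (ennreal (cmod (f t)) * ennreal (1 / (x - t)\<^sup>2))"
      using B_pos r by (subst ennreal_mult[symmetric], simp, simp, subst ennreal_mult[symmetric]) auto
    finally show ?thesis using True by simp
  qed simp
  have "ennreal (cmod (LBINT t:?S. (K (x - t) - K (y - t)) *\<^sub>R f t)) \<le> (\<integral>\<^sup>+t. ennreal (cmod (?g t)) \<partial>lborel)"
    unfolding set_lebesgue_integral_def by (rule integral_norm_bound_ennreal[OF int])
  also have "\<dots> \<le> (\<integral>\<^sup>+t. ennreal (4 * B * r) * (ennreal (cmod (f t)) * ennreal (1 / (x - t)\<^sup>2) * indicator ?S t) \<partial>lborel)"
    by (intro nn_integral_mono pt)
  also have "\<dots> = ennreal (4 * B * r) * (\<integral>\<^sup>+t\<in>?S. ennreal (cmod (f t)) * ennreal (1 / (x - t)\<^sup>2) \<partial>lborel)"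
    by (rule nn_integral_cmult) measurable
  also have "\<dots> \<le> ennreal (4 * B * r) * ennreal (16 * m / (2 * r))"
    using r by (intro mult_left_mono hl_max_tail_bound[OF _ m]) auto
  also have "\<dots> = ennreal (32 * B * m)"
    using B_pos r m by (simp flip: ennreal_mult add: field_simps)
  finally show ?thesis using B_pos m by (simp add: ennreal_le_iff)
qed

text \<open>Up to the kernel difference, the truncation at \<open>x\<close> is the operator at the
  nearby point \<open>y\<close> applied to \<open>f\<close> minus its part near \<open>x\<close>. On
  the far part the cutoff at \<open>\<delta>\<close> around \<open>y\<close> is never active, since
  \<open>\<epsilon> < \<bar>x - t\<bar>\<close> forces \<open>\<delta> < \<bar>y - t\<bar>\<close>.
  Working with a \<open>\<delta>\<close>-truncation keeps all integrals absolutely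
  convergent.\<close>

lemma trunc_comparison:
  assumes f: "integrable lborel f" and d: "\<delta> > 0" "2 * \<delta> \<le> \<epsilon>" and xy: "\<bar>x - y\<bar> \<le> \<epsilon> / 2"
    and m: "hl_max lborel (\<lambda>t. ennreal (cmod (f t))) x \<le> ennreal m" "m \<ge> 0"
  shows "cmod (trunc f \<epsilon> x) \<le> 32 * B * m + cmod (trunc f \<delta> y)
    + cmod (trunc (\<lambda>t. indicator {t. \<bar>x - t\<bar> \<le> \<epsilon>} t *\<^sub>R f t) \<delta> y)"
proof -
  let ?F = "\<lambda>t. indicator {t. \<bar>x - t\<bar> \<le> \<epsilon>} t *\<^sub>R f t"
  let ?S = "{t. 2 * (\<epsilon> / 2) < \<bar>x - t\<bar>}"
  have e: "\<epsilon> / 2 > 0" using d by simp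
  have F: "integrable lborel ?F" by (intro integrable_mult_indicator f) simp
  have "trunc f \<epsilon> x = (LBINT t:?S. (K (x - t) - K (y - t)) *\<^sub>R f t + K (y - t) *\<^sub>R f t)"
    by (simp add: trunc_def flip: scaleR_add_left)
  also have "\<dots> = (LBINT t:?S. (K (x - t) - K (y - t)) *\<^sub>R f t) + (LBINT t:?S. K (y - t) *\<^sub>R f t)"
    using far_difference_integrable[OF f e, of x x] far_difference_integrable[OF f e xy] e
    by (intro set_integral_add) (auto simp: scaleR_diff_left intro!: set_integral_diff)
  also have "(LBINT t:?S. K (y - t) *\<^sub>R f t) = trunc (\<lambda>t. f t - ?F t) \<delta> y"
    unfolding trunc_def set_lebesgue_integral_def
  proof (intro Bochner_Integration.integral_cong refl)
    fix t
    have "\<delta> < \<bar>y - t\<bar>" if "\<epsilon> < \<bar>x - t\<bar>" using d xy that by linarith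
    then show "indicat_real ?S t *\<^sub>R K (y - t) *\<^sub>R f t = indicat_real {t. \<delta> < \<bar>y - t\<bar>} t *\<^sub>R K (y - t) *\<^sub>R (f t - ?F t)"
      by (auto simp: indicator_def)
  qed
  also have "\<dots> = trunc f \<delta> y - trunc ?F \<delta> y" by (rule trunc_diff[OF f F d(1)])
  finally have "cmod (trunc f \<epsilon> x) \<le> cmod (LBINT t:?S. (K (x - t) - K (y - t)) *\<^sub>R f t) + cmod (trunc f \<delta> y - trunc ?F \<delta> y)"
    by (simp only: norm_triangle_ineq)
  also have "\<dots> \<le> 32 * B * m + (cmod (trunc f \<delta> y) + cmod (trunc ?F \<delta> y))"
    by (intro add_mono far_difference_bound[OF f e xy m] norm_triangle_ineq4)
  finally show ?thesis by simp
qed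

text \<open>If the value at \<open>x\<close> were larger, then at every \<open>y\<close> within
  \<open>\<epsilon> / 2\<close> either the \<open>\<delta>\<close>-truncation of \<open>f\<close> or
  that of its near part would be large. Squaring and integrating over these \<open>y\<close>
  contradicts the maximal bound for the former and the L2 bound for the latter. Maximal functions of
  squares appear because only L2 bounds for the truncations are at hand here.\<close>

lemma cotlar_inequality:
  assumes f: "integrable lborel f" and d: "\<delta> > 0" "2 * \<delta> \<le> \<epsilon>" and s: "s > 0"
    and h1: "hl_max lborel (\<lambda>t. ennreal ((cmod (f t))\<^sup>2)) x \<le> ennreal (s\<^sup>2)"
    and h2: "hl_max lborel (\<lambda>t. ennreal ((cmod (trunc f \<delta> t))\<^sup>2)) x \<le> ennreal (s\<^sup>2)"
  shows "cmod (trunc f \<epsilon> x) \<le> (2 + 52 * B) * s"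
proof (rule ccontr)
  assume contr: "\<not> ?thesis"
  have [measurable]: "f \<in> borel_measurable borel" using borel_measurable_integrable[OF f] by simp
  define r where "r = \<epsilon> / 2"
  have r: "r > 0" "\<epsilon> = 2 * r" using d by (auto simp: r_def)
  define F where "F = (\<lambda>t. indicator {t. \<bar>x - t\<bar> \<le> \<epsilon>} t *\<^sub>R f t)"
  have F: "integrable lborel F" unfolding F_def by (intro integrable_mult_indicator f) simp
  have [measurable]: "F \<in> borel_measurable borel" unfolding F_def by measurable
  have [measurable]: "trunc f \<delta> \<in> borel_measurable borel" "trunc F \<delta> \<in> borel_measurable borel"
    by (intro borel_measurable_trunc f F d)+
  have m: "hl_max lborel (\<lambda>t. ennreal (cmod (f t))) x \<le> ennreal s"
    by (rule hl_max_le_of_square[OF _ s h1]) auto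
  \<comment> \<open>What remains of \<open>(2 + 52 * B) * s\<close> after the kernel difference has
    taken \<open>32 * B * s\<close>.\<close>
  define a where "a = (2 + 20 * B) * s"
  have a: "a > 0" using s B_pos by (simp add: a_def)
  have pt: "ennreal (a\<^sup>2) \<le> 2 * ennreal ((cmod (trunc f \<delta> y))\<^sup>2) + 2 * ennreal ((cmod (trunc F \<delta> y))\<^sup>2)"
    if y: "y \<in> {x - r<..<x + r}" for y
  proof -
    have "\<bar>x - y\<bar> \<le> \<epsilon> / 2" using y r by auto
    then have "cmod (trunc f \<epsilon> x) \<le> 32 * B * s + cmod (trunc f \<delta> y) + cmod (trunc F \<delta> y)"
      unfolding F_def using s by (intro trunc_comparison[OF f d _ m]) auto
    then have le: "a \<le> cmod (trunc f \<delta> y) + cmod (trunc F \<delta> y)"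
      using contr by (simp add: a_def algebra_simps)
    have "a\<^sup>2 \<le> (cmod (trunc f \<delta> y) + cmod (trunc F \<delta> y))\<^sup>2" using le a by (intro power_mono) auto
    also have "\<dots> \<le> 2 * (cmod (trunc f \<delta> y))\<^sup>2 + 2 * (cmod (trunc F \<delta> y))\<^sup>2"
      using zero_le_power2[of "cmod (trunc f \<delta> y) - cmod (trunc F \<delta> y)"]
      by (simp add: power2_eq_square algebra_simps)
    finally have "ennreal (a\<^sup>2) \<le> ennreal (2 * (cmod (trunc f \<delta> y))\<^sup>2 + 2 * (cmod (trunc F \<delta> y))\<^sup>2)"
      by (rule ennreal_leI)
    then show ?thesis by (simp add: ennreal_mult)
  qed
  have "ennreal (a\<^sup>2 * (2 * r)) = (\<integral>\<^sup>+y\<in>{x - r<..<x + r}. ennreal (a\<^sup>2) \<partial>lborel)"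
    using r by (simp add: nn_integral_cmult_indicator ennreal_mult)
  also have "\<dots> \<le> (\<integral>\<^sup>+y. 2 * (ennreal ((cmod (trunc f \<delta> y))\<^sup>2) * indicator {x - r<..<x + r} y) + 2 * ennreal ((cmod (trunc F \<delta> y))\<^sup>2) \<partial>lborel)"
    using pt by (intro nn_integral_mono) (auto simp: indicator_def)
  also have "\<dots> = 2 * (\<integral>\<^sup>+y\<in>{x - r<..<x + r}. ennreal ((cmod (trunc f \<delta> y))\<^sup>2) \<partial>lborel) + 2 * (\<integral>\<^sup>+y. ennreal ((cmod (trunc F \<delta> y))\<^sup>2) \<partial>lborel)"
    by (subst nn_integral_add) (auto simp: nn_integral_cmult)
  also have "\<dots> \<le> 2 * ennreal (s\<^sup>2 * ((x + r) - (x - r))) + 2 * (ennreal ((8 * B)\<^sup>2) * ennreal (s\<^sup>2 * ((x + 3 * r) - (x - 3 * r))))"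
  proof (intro add_mono mult_left_mono)
    show "(\<integral>\<^sup>+y\<in>{x - r<..<x + r}. ennreal ((cmod (trunc f \<delta> y))\<^sup>2) \<partial>lborel) \<le> ennreal (s\<^sup>2 * ((x + r) - (x - r)))"
      using r by (intro hl_max_lborel_integral_le[OF h2]) auto
    \<comment> \<open>The near part lives on the closed interval of radius \<open>2 * r\<close>; the
      radius \<open>3 * r\<close> gives an open interval containing it.\<close>
    have "(\<integral>\<^sup>+y. ennreal ((cmod (F y))\<^sup>2) \<partial>lborel) \<le> (\<integral>\<^sup>+y\<in>{x - 3 * r<..<x + 3 * r}. ennreal ((cmod (f y))\<^sup>2) \<partial>lborel)"
      using r by (intro nn_integral_mono) (auto simp: F_def indicator_def)
    also have "\<dots> \<le> ennreal (s\<^sup>2 * ((x + 3 * r) - (x - 3 * r)))"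
      using r by (intro hl_max_lborel_integral_le[OF h1]) auto
    finally show "(\<integral>\<^sup>+y. ennreal ((cmod (trunc F \<delta> y))\<^sup>2) \<partial>lborel) \<le> ennreal ((8 * B)\<^sup>2) * ennreal (s\<^sup>2 * ((x + 3 * r) - (x - 3 * r)))"
      by (intro order_trans[OF trunc_L2[OF F d(1)]] mult_left_mono) auto
  qed auto
  also have "\<dots> = ennreal (2 * (s\<^sup>2 * ((x + r) - (x - r))) + 2 * ((8 * B)\<^sup>2 * (s\<^sup>2 * ((x + 3 * r) - (x - 3 * r)))))"
    using r by (intro ennreal_combination) auto
  finally have "a\<^sup>2 * (2 * r) \<le> 2 * (s\<^sup>2 * ((x + r) - (x - r))) + 2 * ((8 * B)\<^sup>2 * (s\<^sup>2 * ((x + 3 * r) - (x - 3 * r))))"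
    using r by (subst (asm) ennreal_le_iff) auto
  then have "a\<^sup>2 * (2 * r) \<le> ((2 + 384 * B\<^sup>2) * s\<^sup>2) * (2 * r)"
    by (simp add: algebra_simps power_mult_distrib)
  then have "a\<^sup>2 \<le> (2 + 384 * B\<^sup>2) * s\<^sup>2" using r by (simp only: mult_le_cancel_right_pos mult_pos_pos zero_less_numeral)
  \<comment> \<open>384 = 2 * 64 * 3 comes from the L2 bound over the interval of radius
    \<open>3 * r\<close>; the coefficient 20 in \<open>a\<close> is chosen so that its square 400
    exceeds it.\<close>
  moreover have "(2 + 384 * B\<^sup>2) * s\<^sup>2 < a\<^sup>2"
  proof -
    have "2 + 384 * B\<^sup>2 < (2 + 20 * B)\<^sup>2" using B_pos by (simp add: power2_eq_square algebra_simps add_pos_pos)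
    then show ?thesis unfolding a_def power_mult_distrib using s by (intro mult_strict_right_mono) auto
  qed
  ultimately show False by simp
qed

text \<open>Cotlar's inequality needs one \<open>\<delta>\<close> at most half of every level
  considered, so the levels from \<open>1 / (n + 1)\<close> on are treated together with half that
  value as \<open>\<delta>\<close>, and then n grows. The superlevel set is covered by those of two
  maximal functions of squares; weak type (1,1) for these gives 2 + 2 (8B)^2.\<close>

lemma tmax_weak_type_2:
  assumes f: "integrable lborel f" and s: "s > 0"
  shows "ennreal (s\<^sup>2) * emeasure lborel {x. ennreal ((2 + 52 * B) * s) < tmax f x}
    \<le> ennreal (2 + 128 * B\<^sup>2) * (\<integral>\<^sup>+x. ennreal ((cmod (f x))\<^sup>2) \<partial>lborel)"
proof -
  have [measurable]: "f \<in> borel_measurable borel" using borel_measurable_integrable[OF f] by simp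
  let ?c = "ennreal ((2 + 52 * B) * s)"
  let ?I = "\<integral>\<^sup>+x. ennreal ((cmod (f x))\<^sup>2) \<partial>lborel"
  define E where "E = (\<lambda>n::nat. \<Union>\<epsilon>\<in>{1 / (real n + 1)..}. {x. ?c < ennreal (cmod (trunc f \<epsilon> x))})"
  have openE: "open (E n)" for n
    unfolding E_def
  proof (intro open_UN ballI open_trunc_superlevel f)
    fix \<epsilon> assume "\<epsilon> \<in> {1 / (real n + 1)..}"
    moreover have "1 / (real n + 1) > 0" by simp
    ultimately show "\<epsilon> > 0" by (meson atLeast_iff order.strict_trans2)
  qed
  have UE: "{x. ?c < tmax f x} = (\<Union>n. E n)"
  proof (intro equalityI subsetI)
    fix x assume "x \<in> {x. ?c < tmax f x}"
    then obtain \<epsilon> where e: "\<epsilon> > 0" "?c < ennreal (cmod (trunc f \<epsilon> x))" by (auto simp: less_tmax_iff)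
    obtain n where "inverse (real (Suc n)) < \<epsilon>" using reals_Archimedean[OF e(1)] by blast
    then have "\<epsilon> \<in> {1 / (real n + 1)..}" by (simp add: inverse_eq_divide add.commute)
    then show "x \<in> (\<Union>n. E n)" unfolding E_def using e(2) by blast
  next
    fix x assume "x \<in> (\<Union>n. E n)"
    then obtain n \<epsilon> where "1 / (real n + 1) \<le> \<epsilon>" "?c < ennreal (cmod (trunc f \<epsilon> x))" by (auto simp: E_def)
    moreover have "1 / (real n + 1) > 0" by simp
    ultimately have "\<epsilon> > 0" by (meson order.strict_trans2)
    then show "x \<in> {x. ?c < tmax f x}" using \<open>?c < ennreal (cmod (trunc f \<epsilon> x))\<close> by (auto simp: less_tmax_iff)
  qed
  have inc: "incseq E"
  proof (rule incseq_SucI)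
    fix n
    have "1 / (real (Suc n) + 1) \<le> 1 / (real n + 1)" by (simp add: field_simps)
    then have "{1 / (real n + 1)..} \<subseteq> {1 / (real (Suc n) + 1)..}" by auto
    then show "E n \<subseteq> E (Suc n)" unfolding E_def by (intro UN_mono) auto
  qed
  have En: "ennreal (s\<^sup>2) * emeasure lborel (E n) \<le> ennreal (2 + 128 * B\<^sup>2) * ?I" for n
  proof -
    define \<delta> where "\<delta> = 1 / (real n + 1) / 2"
    have d: "\<delta> > 0" "2 * \<delta> = 1 / (real n + 1)" by (simp_all add: \<delta>_def field_simps)
    have [measurable]: "trunc f \<delta> \<in> borel_measurable borel" by (rule borel_measurable_trunc[OF f d(1)])
    let ?A = "{x. ennreal (s\<^sup>2) < hl_max lborel (\<lambda>t. ennreal ((cmod (f t))\<^sup>2)) x}"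
    let ?A' = "{x. ennreal (s\<^sup>2) < hl_max lborel (\<lambda>t. ennreal ((cmod (trunc f \<delta> t))\<^sup>2)) x}"
    have sub: "E n \<subseteq> ?A \<union> ?A'"
    proof
      fix x assume "x \<in> E n"
      then obtain \<epsilon> where e: "1 / (real n + 1) \<le> \<epsilon>" "?c < ennreal (cmod (trunc f \<epsilon> x))" by (auto simp: E_def)
      have "2 * \<delta> \<le> \<epsilon>" using e(1) d(2) by simp
      have "\<not> cmod (trunc f \<epsilon> x) \<le> (2 + 52 * B) * s"
        using e(2) by (meson ennreal_leI not_le)
      then show "x \<in> ?A \<union> ?A'"
        using cotlar_inequality[OF f d(1) \<open>2 * \<delta> \<le> \<epsilon>\<close> s, of x] by (auto simp: not_le[symmetric])
    qed
    have meas: "?A \<in> sets lborel" "?A' \<in> sets lborel" using open_hl_max_superlevel by auto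
    have "emeasure lborel (E n) \<le> emeasure lborel (?A \<union> ?A')" by (rule emeasure_mono[OF sub]) (use meas in auto)
    also have "\<dots> \<le> emeasure lborel ?A + emeasure lborel ?A'" by (rule emeasure_subadditive[OF meas])
    finally have "ennreal (s\<^sup>2) * emeasure lborel (E n) \<le> ennreal (s\<^sup>2) * (emeasure lborel ?A + emeasure lborel ?A')"
      by (rule mult_left_mono) simp
    also have "\<dots> \<le> 2 * ?I + 2 * (\<integral>\<^sup>+x. ennreal ((cmod (trunc f \<delta> x))\<^sup>2) \<partial>lborel)"
      unfolding distrib_left by (intro add_mono lborel.hl_max_weak_type) auto
    also have "\<dots> \<le> 2 * ?I + 2 * (ennreal ((8 * B)\<^sup>2) * ?I)"
      by (intro add_left_mono mult_left_mono trunc_L2[OF f d(1)]) auto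
    also have "\<dots> = (2 + 2 * ennreal ((8 * B)\<^sup>2)) * ?I" by (simp add: distrib_right mult.assoc)
    also have "2 + 2 * ennreal ((8 * B)\<^sup>2) = ennreal (2 + 2 * (8 * B)\<^sup>2)"
      by (simp add: ennreal_mult)
    also have "2 + 2 * (8 * B)\<^sup>2 = 2 + 128 * B\<^sup>2" by (simp add: power_mult_distrib)
    finally show ?thesis .
  qed
  have "ennreal (s\<^sup>2) * emeasure lborel {x. ?c < tmax f x} = (SUP n. ennreal (s\<^sup>2) * emeasure lborel (E n))"
  proof -
    have "range E \<subseteq> sets lborel" using openE by auto
    from SUP_emeasure_incseq[OF this inc] show ?thesis
      unfolding UE by (simp only: SUP_mult_left_ennreal[symmetric])
  qed
  also have "\<dots> \<le> ennreal (2 + 128 * B\<^sup>2) * ?I" by (intro SUP_least En)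
  finally show ?thesis .
qed

end

subsection \<open>The Calderon--Zygmund decomposition\<close>

lemma connected_open_finite_measure_interval:
  fixes C :: "real set"
  assumes C: "open C" "connected C" "C \<noteq> {}" and fin: "emeasure lborel C < \<infinity>"
  shows "\<exists>a b. a < b \<and> C = {a<..<b}"
proof -
  have conv: "z \<in> C" if "x \<in> C" "y \<in> C" "x \<le> z" "z \<le> y" for x y z
    using C(2) that by (meson connected_iff_interval)
  have meas: "C \<in> sets lborel" using C(1) by simp
  obtain x where x: "x \<in> C" using C(3) by blast
  have above: "bdd_above C"
  proof (rule ccontr)
    assume "\<not> bdd_above C"
    then have "{x..x + real n} \<subseteq> C" for n
    proof -
      obtain y where "y \<in> C" "x + real n \<le> y" using \<open>\<not> bdd_above C\<close> by (meson bdd_aboveI linear)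
      then show ?thesis using conv[OF x] by auto
    qed
    then have "of_nat n \<le> emeasure lborel C" for n
      using emeasure_mono[of "{x..x + real n}" C lborel] meas by (simp add: ennreal_of_nat_eq_real_of_nat)
    then have "(SUP n. of_nat n) \<le> emeasure lborel C" by (intro SUP_least) auto
    then show False using fin by (simp add: ennreal_SUP_of_nat_eq_top top_unique)
  qed
  have below: "bdd_below C"
  proof (rule ccontr)
    assume "\<not> bdd_below C"
    then have "{x - real n..x} \<subseteq> C" for n
    proof -
      obtain y where "y \<in> C" "y \<le> x - real n" using \<open>\<not> bdd_below C\<close> by (meson bdd_belowI linear)
      then show ?thesis using conv[OF _ x] by auto
    qed
    then have "of_nat n \<le> emeasure lborel C" for n
      using emeasure_mono[of "{x - real n..x}" C lborel] meas by (simp add: ennreal_of_nat_eq_real_of_nat)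
    then have "(SUP n. of_nat n) \<le> emeasure lborel C" by (intro SUP_least) auto
    then show False using fin by (simp add: ennreal_SUP_of_nat_eq_top top_unique)
  qed
  have nb: "Inf C < y \<and> y < Sup C" if "y \<in> C" for y
  proof -
    obtain e where e: "e > 0" "cball y e \<subseteq> C" using C(1) \<open>y \<in> C\<close> open_contains_cball[of C] by auto
    have "y - e \<in> cball y e" "y + e \<in> cball y e" using e(1) by (auto simp: dist_real_def)
    then have "y - e \<in> C" "y + e \<in> C" using e(2) by auto
    then have "Inf C \<le> y - e" "y + e \<le> Sup C" using cInf_lower[OF _ below] cSup_upper[OF _ above] by simp_all
    then show ?thesis using e(1) by linarith
  qed
  have "C = {Inf C<..<Sup C}"
  proof (intro equalityI subsetI)
    fix y assume y: "y \<in> {Inf C<..<Sup C}"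
    have "\<exists>u\<in>C. u < y" using y by (intro cInf_lessD C(3)) simp
    moreover have "\<exists>v\<in>C. y < v" using y by (intro less_cSupD C(3)) simp
    ultimately obtain u v where "u \<in> C" "u < y" "v \<in> C" "y < v" by blast
    then show "y \<in> C" using conv[of u v y] by simp
  qed (use nb in auto)
  moreover have "Inf C < Sup C" using nb[OF x] by linarith
  ultimately show ?thesis by blast
qed

text \<open>An endpoint of a component cannot belong to \<open>U\<close>, since adjoining it would
  give a larger connected subset. The components are numbered by all naturals, with empty intervals
  at surplus indices; hence the endpoint clause is restricted to \<open>a n < b n\<close>.\<close>

lemma open_set_component_intervals:
  fixes U :: "real set"
  assumes U: "open U" and fin: "emeasure lborel U < \<infinity>"
  shows "\<exists>a b :: nat \<Rightarrow> real. (\<forall>n. a n \<le> b n) \<and> U = (\<Union>n. {a n<..<b n}) \<and>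
    disjoint_family (\<lambda>n. {a n<..<b n}) \<and> (\<forall>n. a n < b n \<longrightarrow> a n \<notin> U \<and> b n \<notin> U)"
proof -
  let ?C = "components U"
  have iv: "\<exists>a b. a < b \<and> C = {a<..<b} \<and> a \<notin> U \<and> b \<notin> U" if C: "C \<in> ?C" for C
  proof -
    have op: "open C" using U C by (rule open_components)
    have "emeasure lborel C \<le> emeasure lborel U"
      using in_components_subset[OF C] U by (intro emeasure_mono) auto
    then have "emeasure lborel C < \<infinity>" using fin by (rule order.strict_trans1)
    then obtain a b where ab: "a < b" "C = {a<..<b}"
      using connected_open_finite_measure_interval[OF op in_components_connected[OF C] in_components_nonempty[OF C]] by blast
    have no: "y \<notin> U" if y: "y \<notin> C" "y \<in> closure C" for y
    proof
      assume yU: "y \<in> U"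
      have "connected (insert y C)"
        by (rule connected_intermediate_closure[OF in_components_connected[OF C]]) (use y closure_subset in auto)
      then have "insert y C \<subseteq> C"
        using yU in_components_subset[OF C] in_components_nonempty[OF C] by (intro components_maximal[OF C]) auto
      then show False using y(1) by blast
    qed
    have "a \<notin> U" "b \<notin> U" using ab by (intro no; simp)+
    then show ?thesis using ab by blast
  qed
  have disj: "C \<inter> D = {}" if "C \<in> ?C" "D \<in> ?C" "C \<noteq> D" for C D
    using components_nonoverlap[of C U D] that by blast
  have cnt: "countable ?C"
  proof (rule countable_disjoint_open_subsets)
    show "\<And>S. S \<in> ?C \<Longrightarrow> open S" using U by (rule open_components)
    show "disjoint ?C" using disj by (auto simp: pairwise_def disjnt_def)
  qed
  define I where "I = (\<lambda>n. if n \<in> to_nat_on ?C ` ?C then from_nat_into ?C n else {})"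
  have I_to: "I (to_nat_on ?C C) = C" if "C \<in> ?C" for C
    unfolding I_def using that from_nat_into_to_nat_on[OF cnt that] by simp
  have I_in: "I n \<in> ?C" if "I n \<noteq> {}" for n
  proof -
    have "n \<in> to_nat_on ?C ` ?C" using that unfolding I_def by (rule contrapos_np) simp
    then obtain C where "C \<in> ?C" "n = to_nat_on ?C C" by (rule imageE)
    then show ?thesis using I_to by simp
  qed
  have UI: "U = (\<Union>n. I n)"
  proof (intro equalityI subsetI)
    fix x assume "x \<in> U"
    then obtain C where C: "C \<in> ?C" "x \<in> C" using Union_components[of U] by blast
    then have "x \<in> I (to_nat_on ?C C)" by (simp add: I_to)
    then show "x \<in> (\<Union>n. I n)" by blast
  next
    fix x assume "x \<in> (\<Union>n. I n)"
    then obtain n where "x \<in> I n" by blast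
    then show "x \<in> U" using I_in[of n] in_components_subset[of "I n" U] by blast
  qed
  have dI: "I m \<inter> I n = {}" if "m \<noteq> n" for m n
  proof (rule ccontr)
    assume ne: "I m \<inter> I n \<noteq> {}"
    then have *: "I m \<noteq> {}" "I n \<noteq> {}" by auto
    have "m \<in> to_nat_on ?C ` ?C" using *(1) unfolding I_def by (rule contrapos_np) simp
    moreover have "n \<in> to_nat_on ?C ` ?C" using *(2) unfolding I_def by (rule contrapos_np) simp
    ultimately obtain C D where CD: "C \<in> ?C" "m = to_nat_on ?C C" "D \<in> ?C" "n = to_nat_on ?C D" by blast
    then have "C \<noteq> D" using that by auto
    then show False using disj[OF CD(1,3)] ne by (simp add: CD(2,4) I_to[OF CD(1)] I_to[OF CD(3)])
  qed
  have "\<exists>a b. a \<le> b \<and> I n = {a<..<b} \<and> (a < b \<longrightarrow> a \<notin> U \<and> b \<notin> U)" for n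
  proof (cases "I n = {}")
    case True
    then show ?thesis by (intro exI[of _ 0]) auto
  next
    case False
    then show ?thesis using iv[OF I_in[OF False]] by (metis less_imp_le)
  qed
  then obtain a b where ab: "\<And>n. a n \<le> b n" "\<And>n. I n = {a n<..<b n}" "\<And>n. a n < b n \<longrightarrow> a n \<notin> U \<and> b n \<notin> U"
    by metis
  have I_eq: "I = (\<lambda>n. {a n<..<b n})" using ab(2) by (rule ext)
  show ?thesis
  proof (intro exI conjI)
    show "U = (\<Union>n. {a n<..<b n})" using UI unfolding I_eq .
    show "disjoint_family (\<lambda>n. {a n<..<b n})"
      unfolding I_eq[symmetric] disjoint_family_on_def using dI by simp
  qed (use ab in auto)
qed

lemma ennreal_norm_suminf_le:
  fixes c :: "nat \<Rightarrow> 'a::banach"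
  shows "ennreal (norm (suminf c)) \<le> (\<Sum>n. ennreal (norm (c n)))"
proof (cases "summable (\<lambda>n. norm (c n))")
  case True
  have "ennreal (norm (suminf c)) \<le> ennreal (\<Sum>n. norm (c n))" by (intro ennreal_leI summable_norm True)
  also have "\<dots> = (\<Sum>n. ennreal (norm (c n)))" using True by (intro suminf_ennreal2[symmetric]) auto
  finally show ?thesis .
next
  case False
  have "(\<Sum>n. ennreal (norm (c n))) = top" by (rule summable_iff_suminf_neq_top) (use False in auto)
  then show ?thesis by simp
qed

lemma suminf_indicator_le_1:
  assumes "disjoint_family A"
  shows "(\<Sum>n. indicator (A n) x :: ennreal) \<le> 1"
  using suminf_indicator[OF assms, of x] by (simp add: indicator_def)

context cz_kernel
begin

text \<open>Three positions of the interval relative to the truncation ball around \<open>x\<close>.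
  Outside the ball, the mean zero condition allows subtracting the kernel at the midpoint, which
  gives decay of order two. Inside, the truncation removes the piece. If
  \<open>x + \<epsilon>\<close> or \<open>x - \<epsilon>\<close> falls into the interval,
  cancellation is lost and only the size bound \<open>B / (q - p)\<close> remains, recorded by the
  indicators.\<close>

lemma bad_piece_bound:
  assumes pq: "p < q" and h: "integrable lborel h" and supp: "\<And>t. t \<notin> {p<..<q} \<Longrightarrow> h t = 0"
    and mean: "(LBINT t. h t) = 0" and e: "\<epsilon> > 0"
    and x: "3 * (q - p) / 2 < \<bar>(p + q) / 2 - x\<bar>"
  shows "cmod (trunc h \<epsilon> x) \<le> 2 * B * (q - p) * (LBINT t. cmod (h t)) / ((p + q) / 2 - x)\<^sup>2
    + B / (q - p) * (LBINT t. cmod (h t)) * (indicator {p<..<q} (x + \<epsilon>) + indicator {p<..<q} (x - \<epsilon>))"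
proof -
  define z where "z = (p + q) / 2"
  define \<beta> where "\<beta> = (LBINT t. cmod (h t))"
  have \<beta>: "\<beta> \<ge> 0" by (simp add: \<beta>_def)
  have near: "\<bar>t - z\<bar> \<le> (q - p) / 2" if "t \<in> {p<..<q}" for t
    using that by (auto simp: z_def abs_le_iff field_simps)
  have xz: "3 * (q - p) / 2 < \<bar>x - z\<bar>" using x by (simp add: z_def abs_minus_commute)
  have far: "q - p \<le> \<bar>x - t\<bar>" if "t \<in> {p<..<q}" for t
    using near[OF that] xz by argo
  have nonneg: "0 \<le> 2 * B * (q - p) * \<beta> / (z - x)\<^sup>2" "0 \<le> B / (q - p) * \<beta>"
    using B_pos pq \<beta> by auto
  have nonneg': "0 \<le> B / (q - p) * \<beta> * (indicator {p<..<q} (x + \<epsilon>) + indicator {p<..<q} (x - \<epsilon>))"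
    using nonneg(2) by (intro mult_nonneg_nonneg[OF _ add_nonneg_nonneg]) auto
  show ?thesis
  proof (cases "x + \<epsilon> \<in> {p<..<q} \<or> x - \<epsilon> \<in> {p<..<q}")
    case True
    have "cmod (trunc h \<epsilon> x) \<le> (LBINT t. B / (q - p) * cmod (h t))"
      unfolding trunc_def set_lebesgue_integral_def
    proof (rule Bochner_Integration.integral_norm_bound_integral)
      show "integrable lborel (\<lambda>t. indicat_real {t. \<epsilon> < \<bar>x - t\<bar>} t *\<^sub>R K (x - t) *\<^sub>R h t)"
        using trunc_integrable[OF h e] by (simp add: set_integrable_def)
      fix t
      show "cmod (indicat_real {t. \<epsilon> < \<bar>x - t\<bar>} t *\<^sub>R K (x - t) *\<^sub>R h t) \<le> B / (q - p) * cmod (h t)"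
      proof (cases "t \<in> {p<..<q}")
        case True
        have "x - t \<noteq> 0" using far[OF True] pq by auto
        then have "\<bar>K (x - t)\<bar> \<le> B / \<bar>x - t\<bar>" by (rule size)
        also have "\<dots> \<le> B / (q - p)" using far[OF True] pq B_pos by (intro divide_left_mono) auto
        finally have "\<bar>K (x - t)\<bar> * cmod (h t) \<le> B / (q - p) * cmod (h t)" by (intro mult_right_mono) auto
        then show ?thesis using B_pos pq by (auto simp: indicator_def)
      qed (simp add: supp)
    qed (use h in auto)
    then have "cmod (trunc h \<epsilon> x) \<le> B / (q - p) * \<beta>" by (simp add: \<beta>_def)
    also have "\<dots> = B / (q - p) * \<beta> * 1" by simp
    also have "\<dots> \<le> B / (q - p) * \<beta> * (indicator {p<..<q} (x + \<epsilon>) + indicator {p<..<q} (x - \<epsilon>))"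
      using True by (intro mult_left_mono nonneg(2)) (auto simp: indicator_def)
    finally show ?thesis using nonneg(1) by (simp add: \<beta>_def z_def)
  next
    case False
    have "x \<notin> {p<..<q}" using far[of x] pq by auto
    then have "(\<forall>t\<in>{p<..<q}. \<epsilon> < \<bar>x - t\<bar>) \<or> (\<forall>t\<in>{p<..<q}. \<not> \<epsilon> < \<bar>x - t\<bar>)"
    proof -
      consider "x \<le> p" "x + \<epsilon> \<le> p" | "x \<le> p" "q \<le> x + \<epsilon>" | "q \<le> x" "q \<le> x - \<epsilon>" | "q \<le> x" "x - \<epsilon> \<le> p"
        using False \<open>x \<notin> {p<..<q}\<close> by fastforce
      then show ?thesis by cases auto
    qed
    then show ?thesis
    proof
      assume out: "\<forall>t\<in>{p<..<q}. \<epsilon> < \<bar>x - t\<bar>"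
      have "trunc h \<epsilon> x = (LBINT t. K (x - t) *\<^sub>R h t)"
        unfolding trunc_def set_lebesgue_integral_def
        by (intro Bochner_Integration.integral_cong refl) (use out supp in \<open>auto simp: indicator_def\<close>)
      have int: "integrable lborel (\<lambda>t. K (x - t) *\<^sub>R h t)"
      proof -
        have "indicat_real {t. \<epsilon> < \<bar>x - t\<bar>} t *\<^sub>R K (x - t) *\<^sub>R h t = K (x - t) *\<^sub>R h t" for t
          using out supp[of t] by (cases "t \<in> {p<..<q}") auto
        then show ?thesis using trunc_integrable[OF h e, of x] by (simp only: set_integrable_def)
      qed
      have int2: "integrable lborel (\<lambda>t. K (x - z) *\<^sub>R h t)" using h by simp
      have "trunc h \<epsilon> x = (LBINT t. K (x - t) *\<^sub>R h t) - (LBINT t. K (x - z) *\<^sub>R h t)"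
        by (simp add: \<open>trunc h \<epsilon> x = _\<close> mean)
      also have "\<dots> = (LBINT t. K (x - t) *\<^sub>R h t - K (x - z) *\<^sub>R h t)"
        by (rule Bochner_Integration.integral_diff[OF int int2, symmetric])
      finally have eq: "trunc h \<epsilon> x = (LBINT t. K (x - t) *\<^sub>R h t - K (x - z) *\<^sub>R h t)" .
      have "cmod (trunc h \<epsilon> x) \<le> (LBINT t. 2 * B * (q - p) / (z - x)\<^sup>2 * cmod (h t))"
        unfolding eq
      proof (rule Bochner_Integration.integral_norm_bound_integral)
        fix t
        show "cmod (K (x - t) *\<^sub>R h t - K (x - z) *\<^sub>R h t) \<le> 2 * B * (q - p) / (z - x)\<^sup>2 * cmod (h t)"
        proof (cases "t \<in> {p<..<q}")
          case True
          have d: "\<bar>(x - t) - (x - z)\<bar> \<le> (q - p) / 2" using near[OF True] by (simp add: abs_minus_commute)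
          have "x - z \<noteq> 0" "\<bar>(x - t) - (x - z)\<bar> \<le> \<bar>x - z\<bar> / 2" using d xz pq by auto
          then have "\<bar>K (x - t) - K (x - z)\<bar> \<le> 4 * B * \<bar>(x - t) - (x - z)\<bar> / (x - z)\<^sup>2" by (rule K_lipschitz)
          also have "\<dots> \<le> 4 * B * ((q - p) / 2) / (x - z)\<^sup>2"
            using d B_pos by (intro divide_right_mono mult_left_mono) auto
          also have "\<dots> = 2 * B * (q - p) / (z - x)\<^sup>2" by (simp add: power2_commute)
          finally have "\<bar>K (x - t) - K (x - z)\<bar> * cmod (h t) \<le> 2 * B * (q - p) / (z - x)\<^sup>2 * cmod (h t)"
            by (intro mult_right_mono) auto
          then show ?thesis by (simp flip: scaleR_diff_left)
        qed (simp add: supp)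
      qed (use h int int2 in auto)
      also have "\<dots> = 2 * B * (q - p) * \<beta> / (z - x)\<^sup>2" by (simp add: \<beta>_def)
      finally show ?thesis using nonneg' unfolding \<beta>_def z_def by linarith
    next
      assume inside: "\<forall>t\<in>{p<..<q}. \<not> \<epsilon> < \<bar>x - t\<bar>"
      have "indicat_real {t. \<epsilon> < \<bar>x - t\<bar>} t *\<^sub>R K (x - t) *\<^sub>R h t = 0" for t
        using inside supp[of t] by (cases "t \<in> {p<..<q}") auto
      then have "cmod (trunc h \<epsilon> x) = 0" by (simp only: trunc_def set_lebesgue_integral_def) simp
      then show ?thesis using nonneg(1) nonneg' unfolding \<beta>_def z_def by linarith
    qed
  qed
qed

lemma trunc_suminf:
  assumes h: "\<And>n. integrable lborel (h n)" and pt: "\<And>t. summable (\<lambda>n. cmod (h n t))"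
    and sm: "summable (\<lambda>n. LBINT t. cmod (h n t))" and e: "\<epsilon> > 0"
  shows "integrable lborel (\<lambda>t. \<Sum>n. h n t)" "trunc (\<lambda>t. \<Sum>n. h n t) \<epsilon> x = (\<Sum>n. trunc (h n) \<epsilon> x)"
proof -
  show "integrable lborel (\<lambda>t. \<Sum>n. h n t)"
    by (rule integrable_suminf[OF h _ sm]) (use pt in auto)
  let ?k = "\<lambda>n t. indicat_real {t. \<epsilon> < \<bar>x - t\<bar>} t *\<^sub>R K (x - t) *\<^sub>R h n t"
  have ki: "integrable lborel (?k n)" for n
    using trunc_integrable[OF h e] by (simp add: set_integrable_def)
  have kb: "cmod (?k n t) \<le> B / \<epsilon> * cmod (h n t)" for n t by (rule truncated_bound[OF e])
  have ks: "summable (\<lambda>n. cmod (?k n t))" for t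
    by (rule summable_comparison_test'[OF summable_mult[OF pt[of t], of "B / \<epsilon>"], of 0])
      (simp only: real_norm_def abs_norm_cancel kb)
  have kis: "summable (\<lambda>n. LBINT t. cmod (?k n t))"
  proof (rule summable_comparison_test'[OF summable_mult[OF sm, of "B / \<epsilon>"], of 0])
    fix n
    have "(LBINT t. cmod (?k n t)) \<le> (LBINT t. B / \<epsilon> * cmod (h n t))"
      by (intro integral_mono kb integrable_norm ki integrable_mult_right h)
    then show "norm (LBINT t. cmod (?k n t)) \<le> B / \<epsilon> * (LBINT t. cmod (h n t))" by simp
  qed
  have "trunc (\<lambda>t. \<Sum>n. h n t) \<epsilon> x = (LBINT t. \<Sum>n. ?k n t)"
    unfolding trunc_def set_lebesgue_integral_def
  proof (intro Bochner_Integration.integral_cong refl)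
    fix t
    have s: "summable (\<lambda>n. h n t)" using pt by (rule summable_norm_cancel)
    show "indicat_real {t. \<epsilon> < \<bar>x - t\<bar>} t *\<^sub>R K (x - t) *\<^sub>R (\<Sum>n. h n t) = (\<Sum>n. ?k n t)"
      by (simp only: suminf_scaleR_right[OF s] suminf_scaleR_right[OF summable_scaleR_right[OF s]])
  qed
  also have "\<dots> = (\<Sum>n. LBINT t. ?k n t)"
    by (rule integral_suminf[OF ki _ kis]) (use ks in auto)
  finally show "trunc (\<lambda>t. \<Sum>n. h n t) \<epsilon> x = (\<Sum>n. trunc (h n) \<epsilon> x)"
    by (simp add: trunc_def set_lebesgue_integral_def)
qed

text \<open>Away from the triples of the intervals, the truncation at \<open>\<epsilon>\<close> splits an interval only if it contains
  \<open>x - \<epsilon>\<close> or \<open>x + \<epsilon>\<close>, so at most two of the pieces \<open>h n\<close> lose their cancellation.\<close>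
lemma bad_part_weak_type:
  fixes a b :: "nat \<Rightarrow> real"
  assumes ab: "\<And>n. a n \<le> b n" and disj: "disjoint_family (\<lambda>n. {a n<..<b n})"
    and h: "\<And>n. integrable lborel (h n)" and supp: "\<And>n t. t \<notin> {a n<..<b n} \<Longrightarrow> h n t = 0"
    and mean: "\<And>n. (LBINT t. h n t) = 0"
    and size: "\<And>n. (LBINT t. cmod (h n t)) \<le> 4 * l * (b n - a n)"
    and pt: "\<And>t. summable (\<lambda>n. cmod (h n t))"
    and sm: "summable (\<lambda>n. LBINT t. cmod (h n t))" and l: "l > 0"
  shows "ennreal l * emeasure lborel {x. ennreal ((8 * B + 1) * l) < tmax (\<lambda>t. \<Sum>n. h n t) x}
    \<le> ennreal (3 * l) * (\<Sum>n. ennreal (b n - a n)) + ennreal (32 * B) * (\<Sum>n. ennreal (LBINT t. cmod (h n t)))"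
proof -
  define z where "z = (\<lambda>n. (a n + b n) / 2)"
  define d where "d = (\<lambda>n. b n - a n)"
  define \<beta> where "\<beta> = (\<lambda>n. LBINT t. cmod (h n t))"
  have \<beta>0: "\<beta> n \<ge> 0" for n by (simp add: \<beta>_def)
  have d0: "d n \<ge> 0" for n using ab by (simp add: d_def)
  \<comment> \<open>\<open>H\<close> sums the contributions that keep their cancellation. The tail
    estimate for the constant function 1 bounds the integral of its n-th term by
    \<open>32 * B * \<beta> n\<close>, so Markov's inequality applies to \<open>H\<close>.\<close>
  define H where "H = (\<lambda>x. \<Sum>n. ennreal (2 * B * d n * \<beta> n) * (ennreal (1 / (z n - x)\<^sup>2) * indicator {x. d n < \<bar>z n - x\<bar>} x))"
  have [measurable]: "H \<in> borel_measurable borel" unfolding H_def by measurable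
  define J where "J = (\<lambda>n. {z n - 3 * d n / 2..z n + 3 * d n / 2})"
  let ?g = "\<lambda>t. \<Sum>n. h n t"
  have bound: "ennreal (cmod (trunc ?g \<epsilon> x)) \<le> H x + ennreal (8 * B * l)"
    if xJ: "x \<notin> (\<Union>n. J n)" and e: "\<epsilon> > 0" for x \<epsilon>
  proof -
    have piece: "ennreal (cmod (trunc (h n) \<epsilon> x)) \<le>
      ennreal (2 * B * d n * \<beta> n) * (ennreal (1 / (z n - x)\<^sup>2) * indicator {x. d n < \<bar>z n - x\<bar>} x)
      + ennreal (4 * B * l) * (indicator {a n<..<b n} (x + \<epsilon>) + indicator {a n<..<b n} (x - \<epsilon>))" for n
    proof (cases "d n = 0")
      case True
      then have "h n t = 0" for t using supp[of t n] by (simp add: d_def)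
      then have "trunc (h n) \<epsilon> x = 0" by (simp add: trunc_def)
      then show ?thesis by simp
    next
      case False
      then have dn: "d n > 0" "a n < b n" using d0[of n] by (auto simp: d_def)
      have "x \<notin> J n" using xJ by blast
      then have far: "3 * d n / 2 < \<bar>z n - x\<bar>" unfolding J_def atLeastAtMost_iff by linarith
      then have far': "d n < \<bar>z n - x\<bar>" using dn by linarith
      have "cmod (trunc (h n) \<epsilon> x) \<le> 2 * B * d n * \<beta> n / (z n - x)\<^sup>2
        + B / d n * \<beta> n * (indicator {a n<..<b n} (x + \<epsilon>) + indicator {a n<..<b n} (x - \<epsilon>))"
        unfolding d_def \<beta>_def z_def
        by (rule bad_piece_bound[OF dn(2) h supp mean e]) (use far in \<open>auto simp: d_def z_def\<close>)
      also have "\<dots> \<le> 2 * B * d n * \<beta> n * (1 / (z n - x)\<^sup>2)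
        + 4 * B * l * (indicator {a n<..<b n} (x + \<epsilon>) + indicator {a n<..<b n} (x - \<epsilon>))"
      proof (intro add_mono mult_right_mono)
        have "\<beta> n \<le> 4 * l * d n" using size[of n] by (simp add: \<beta>_def d_def)
        then have "B / d n * \<beta> n \<le> B / d n * (4 * l * d n)" using B_pos dn by (intro mult_left_mono) auto
        then show "B / d n * \<beta> n \<le> 4 * B * l" using dn by simp
      qed auto
      finally have "ennreal (cmod (trunc (h n) \<epsilon> x)) \<le> ennreal (2 * B * d n * \<beta> n * (1 / (z n - x)\<^sup>2)
        + 4 * B * l * (indicator {a n<..<b n} (x + \<epsilon>) + indicator {a n<..<b n} (x - \<epsilon>)))" by (rule ennreal_leI)
      also have "\<dots> = ennreal (2 * B * d n * \<beta> n * (1 / (z n - x)\<^sup>2))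
        + ennreal (4 * B * l * (indicator {a n<..<b n} (x + \<epsilon>) + indicator {a n<..<b n} (x - \<epsilon>)))"
        using B_pos dn \<beta>0[of n] l by (intro ennreal_plus mult_nonneg_nonneg add_nonneg_nonneg) auto
      also have "ennreal (2 * B * d n * \<beta> n * (1 / (z n - x)\<^sup>2)) = ennreal (2 * B * d n * \<beta> n) * ennreal (1 / (z n - x)\<^sup>2)"
        using B_pos dn \<beta>0[of n] by (intro ennreal_mult) auto
      also have "ennreal (4 * B * l * (indicator {a n<..<b n} (x + \<epsilon>) + indicator {a n<..<b n} (x - \<epsilon>)))
        = ennreal (4 * B * l) * ennreal (indicator {a n<..<b n} (x + \<epsilon>) + indicator {a n<..<b n} (x - \<epsilon>))"
        using B_pos l by (intro ennreal_mult) auto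
      also have "ennreal (indicator {a n<..<b n} (x + \<epsilon>) + indicator {a n<..<b n} (x - \<epsilon>)) = indicator {a n<..<b n} (x + \<epsilon>) + indicator {a n<..<b n} (x - \<epsilon>)"
        by (simp add: ennreal_indicator)
      finally show ?thesis using far' by simp
    qed
    have "ennreal (cmod (trunc ?g \<epsilon> x)) \<le> (\<Sum>n. ennreal (cmod (trunc (h n) \<epsilon> x)))"
      unfolding trunc_suminf(2)[OF h pt sm e] by (rule ennreal_norm_suminf_le)
    also have "\<dots> \<le> (\<Sum>n. ennreal (2 * B * d n * \<beta> n) * (ennreal (1 / (z n - x)\<^sup>2) * indicator {x. d n < \<bar>z n - x\<bar>} x)
      + ennreal (4 * B * l) * (indicator {a n<..<b n} (x + \<epsilon>) + indicator {a n<..<b n} (x - \<epsilon>)))"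
      by (intro suminf_le summableI piece)
    also have "\<dots> = H x + (\<Sum>n. ennreal (4 * B * l) * (indicator {a n<..<b n} (x + \<epsilon>) + indicator {a n<..<b n} (x - \<epsilon>)))"
      unfolding H_def by (rule suminf_add[OF summableI summableI, symmetric])
    also have "(\<Sum>n. ennreal (4 * B * l) * (indicator {a n<..<b n} (x + \<epsilon>) + indicator {a n<..<b n} (x - \<epsilon>)))
      = ennreal (4 * B * l) * ((\<Sum>n. indicator {a n<..<b n} (x + \<epsilon>)) + (\<Sum>n. indicator {a n<..<b n} (x - \<epsilon>)))"
      by (subst ennreal_suminf_cmult) (simp only: suminf_add[OF summableI summableI, symmetric])
    also have "H x + \<dots> \<le> H x + ennreal (4 * B * l) * (1 + 1)"
      by (intro add_left_mono mult_left_mono add_mono suminf_indicator_le_1 disj) auto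
    also have "ennreal (4 * B * l) * (1 + 1) = ennreal (8 * B * l)"
    proof -
      have "ennreal (4 * B * l) * (1 + 1) = ennreal (4 * B * l) * ennreal 2" by simp
      also have "\<dots> = ennreal (4 * B * l * 2)" using B_pos l by (intro ennreal_mult[symmetric]) auto
      also have "4 * B * l * 2 = 8 * B * l" by simp
      finally show ?thesis .
    qed
    finally show ?thesis .
  qed
  have sub: "{x. ennreal ((8 * B + 1) * l) < tmax ?g x} \<subseteq> (\<Union>n. J n) \<union> {x. ennreal l \<le> H x}"
  proof
    fix x assume "x \<in> {x. ennreal ((8 * B + 1) * l) < tmax ?g x}"
    then obtain \<epsilon> where e: "\<epsilon> > 0" "ennreal ((8 * B + 1) * l) < ennreal (cmod (trunc ?g \<epsilon> x))"
      by (auto simp: less_tmax_iff)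
    show "x \<in> (\<Union>n. J n) \<union> {x. ennreal l \<le> H x}"
    proof (rule ccontr)
      assume n: "x \<notin> (\<Union>n. J n) \<union> {x. ennreal l \<le> H x}"
      then have "ennreal (cmod (trunc ?g \<epsilon> x)) \<le> H x + ennreal (8 * B * l)" by (intro bound e) auto
      also have "\<dots> \<le> ennreal l + ennreal (8 * B * l)" using n by (intro add_right_mono) auto
      also have "\<dots> = ennreal ((8 * B + 1) * l)" using B_pos l by (simp add: distrib_right flip: ennreal_plus)
      finally show False using e(2) by simp
    qed
  qed
  have "emeasure lborel {x. ennreal ((8 * B + 1) * l) < tmax ?g x} \<le> emeasure lborel ((\<Union>n. J n) \<union> {x. ennreal l \<le> H x})"
    by (rule emeasure_mono[OF sub]) (auto simp: J_def)
  also have "\<dots> \<le> emeasure lborel (\<Union>n. J n) + emeasure lborel {x. ennreal l \<le> H x}"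
    by (intro emeasure_subadditive) (auto simp: J_def)
  finally have "ennreal l * emeasure lborel {x. ennreal ((8 * B + 1) * l) < tmax ?g x}
    \<le> ennreal l * emeasure lborel (\<Union>n. J n) + ennreal l * emeasure lborel {x. ennreal l \<le> H x}"
    by (simp only: distrib_left[symmetric] mult_left_mono zero_le)
  also have "\<dots> \<le> ennreal (3 * l) * (\<Sum>n. ennreal (b n - a n)) + ennreal (32 * B) * (\<Sum>n. ennreal (\<beta> n))"
  proof (rule add_mono)
    have "emeasure lborel (\<Union>n. J n) \<le> (\<Sum>n. emeasure lborel (J n))"
      by (intro emeasure_subadditive_countably) (auto simp: J_def)
    also have "\<dots> = (\<Sum>n. 3 * ennreal (d n))"
    proof (intro suminf_cong)
      fix n
      have "emeasure lborel (J n) = ennreal (3 * d n)"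
        unfolding J_def using d0[of n] by (subst emeasure_lborel_Icc) (auto simp: field_simps)
      then show "emeasure lborel (J n) = 3 * ennreal (d n)" using d0[of n] by (simp add: ennreal_mult)
    qed
    also have "\<dots> = 3 * (\<Sum>n. ennreal (d n))" by (rule ennreal_suminf_cmult)
    finally have "ennreal l * emeasure lborel (\<Union>n. J n) \<le> ennreal l * (3 * (\<Sum>n. ennreal (d n)))"
      by (rule mult_left_mono) simp
    also have "\<dots> = ennreal (3 * l) * (\<Sum>n. ennreal (d n))" using l by (simp add: ennreal_mult mult_ac)
    finally show "ennreal l * emeasure lborel (\<Union>n. J n) \<le> ennreal (3 * l) * (\<Sum>n. ennreal (b n - a n))"
      by (simp add: d_def)
    have "ennreal l * emeasure lborel {x. ennreal l \<le> H x} = (\<integral>\<^sup>+x. ennreal l * indicator {x. ennreal l \<le> H x} x \<partial>lborel)"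
      by (rule nn_integral_cmult_indicator[symmetric]) measurable
    also have "\<dots> \<le> (\<integral>\<^sup>+x. H x \<partial>lborel)" by (intro nn_integral_mono) (auto simp: indicator_def)
    also have "\<dots> = (\<Sum>n. \<integral>\<^sup>+x. ennreal (2 * B * d n * \<beta> n) * (ennreal (1 / (z n - x)\<^sup>2) * indicator {x. d n < \<bar>z n - x\<bar>} x) \<partial>lborel)"
      unfolding H_def by (intro nn_integral_suminf) measurable
    also have "\<dots> \<le> (\<Sum>n. ennreal (32 * B) * ennreal (\<beta> n))"
    proof (intro suminf_le summableI)
      fix n
      show "(\<integral>\<^sup>+x. ennreal (2 * B * d n * \<beta> n) * (ennreal (1 / (z n - x)\<^sup>2) * indicator {x. d n < \<bar>z n - x\<bar>} x) \<partial>lborel) \<le> ennreal (32 * B) * ennreal (\<beta> n)"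
      proof (cases "d n = 0")
        case False
        then have dn: "d n > 0" using d0[of n] by simp
        have "(\<integral>\<^sup>+x. ennreal (2 * B * d n * \<beta> n) * (ennreal (1 / (z n - x)\<^sup>2) * indicator {x. d n < \<bar>z n - x\<bar>} x) \<partial>lborel)
          = ennreal (2 * B * d n * \<beta> n) * (\<integral>\<^sup>+x\<in>{x. d n < \<bar>z n - x\<bar>}. 1 * ennreal (1 / (z n - x)\<^sup>2) \<partial>lborel)"
          by (subst nn_integral_cmult) auto
        also have "\<dots> \<le> ennreal (2 * B * d n * \<beta> n) * ennreal (16 * 1 / d n)"
          by (intro mult_left_mono hl_max_tail_bound dn) (auto simp: hl_max_const_le)
        also have "\<dots> = ennreal (2 * B * d n * \<beta> n * (16 * 1 / d n))"
          using B_pos dn \<beta>0[of n] by (intro ennreal_mult[symmetric]) auto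
        also have "2 * B * d n * \<beta> n * (16 * 1 / d n) = 32 * B * \<beta> n" using dn by simp
        also have "ennreal (32 * B * \<beta> n) = ennreal (32 * B) * ennreal (\<beta> n)"
          using B_pos \<beta>0[of n] by (intro ennreal_mult) auto
        finally show ?thesis .
      qed simp
    qed
    also have "\<dots> = ennreal (32 * B) * (\<Sum>n. ennreal (\<beta> n))" by (rule ennreal_suminf_cmult)
    finally show "ennreal l * emeasure lborel {x. ennreal l \<le> H x} \<le> ennreal (32 * B) * (\<Sum>n. ennreal (\<beta> n))" .
  qed
  finally show ?thesis by (simp add: \<beta>_def)
qed

end

text \<open>For a continuous function this takes the role of the Lebesgue differentiation theorem: a
  value above \<open>l\<close> would persist on a small interval and push its average above
  \<open>l\<close>.\<close>

lemma continuous_le_of_hl_max_le: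
  fixes f :: "real \<Rightarrow> complex"
  assumes f: "continuous_on UNIV f" and l: "l \<ge> 0"
    and m: "hl_max lborel (\<lambda>t. ennreal (cmod (f t))) x \<le> ennreal l"
  shows "cmod (f x) \<le> l"
proof (rule ccontr)
  assume "\<not> cmod (f x) \<le> l"
  then obtain c where c: "l < c" "c < cmod (f x)" using dense by (meson not_le)
  have "open {y. c < cmod (f y)}"
    by (intro open_Collect_less continuous_intros f)
  then obtain e where e: "e > 0" "ball x e \<subseteq> {y. c < cmod (f y)}"
    using c(2) openE[of "{y. c < cmod (f y)}" x] by auto
  have ball: "{x - e<..<x + e} = ball x e" by (auto simp: dist_real_def)
  have "ennreal (c * (2 * e)) = (\<integral>\<^sup>+t\<in>{x - e<..<x + e}. ennreal c \<partial>lborel)"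
    using e c l by (simp add: nn_integral_cmult_indicator ennreal_mult)
  also have "\<dots> \<le> (\<integral>\<^sup>+t\<in>{x - e<..<x + e}. ennreal (cmod (f t)) \<partial>lborel)"
    using e(2) unfolding ball by (intro nn_integral_mono) (auto simp: indicator_def intro!: ennreal_leI less_imp_le)
  also have "\<dots> \<le> ennreal (l * ((x + e) - (x - e)))"
    using e l by (intro hl_max_lborel_integral_le[OF m]) auto
  finally have "c * (2 * e) \<le> l * (2 * e)" using e l by (simp add: ennreal_le_iff)
  then show False using c e by simp
qed

context cz_kernel
begin

text \<open>The decomposition uses the components of the set where the maximal function of
  \<open>f\<close> exceeds \<open>l\<close>. The good part \<open>g\<close> is bounded by
  \<open>2 * l\<close>, and its squared L2 norm is at most 6 l times the L1 norm of
  \<open>f\<close>, so weak type (2,2) yields 12 + 768 B^2. The bad part \<open>b'\<close> yields 6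
  + 64 B. The threshold \<open>3 + 60 * B\<close> is the sum of \<open>2 + 52 * B\<close> for
  \<open>g\<close> and \<open>8 * B + 1\<close> for \<open>b'\<close>. Continuity of
  \<open>f\<close> bounds it off the components.\<close>

lemma tmax_weak_type_1_lipschitz:
  assumes f: "lipschitz_compact_support f" and l: "l > 0"
  shows "ennreal l * emeasure lborel {x. ennreal ((3 + 60 * B) * l) < tmax f x}
    \<le> ennreal (18 + 64 * B + 768 * B\<^sup>2) * (\<integral>\<^sup>+t. ennreal (cmod (f t)) \<partial>lborel)"
proof -
  have cf: "continuous_on UNIV f" and fi: "integrable lborel f"
    using f by (simp_all add: continuous_on_lipschitz_compact_support integrable_lipschitz_compact_support)
  have [measurable]: "f \<in> borel_measurable borel" using borel_measurable_integrable[OF fi] by simp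
  define N where "N = (\<integral>\<^sup>+t. ennreal (cmod (f t)) \<partial>lborel)"
  have Nfin: "N < \<infinity>" using fi unfolding N_def integrable_iff_bounded by simp
  define \<Omega> where "\<Omega> = {x. ennreal l < hl_max lborel (\<lambda>t. ennreal (cmod (f t))) x}"
  have op: "open \<Omega>" unfolding \<Omega>_def by (rule open_hl_max_superlevel)
  have w: "ennreal l * emeasure lborel \<Omega> \<le> 2 * N"
    unfolding \<Omega>_def N_def by (rule lborel.hl_max_weak_type) measurable
  have fin: "emeasure lborel \<Omega> < \<infinity>"
  proof (rule ccontr)
    assume "\<not> emeasure lborel \<Omega> < \<infinity>"
    then have "emeasure lborel \<Omega> = \<infinity>" by (simp add: less_top[symmetric])
    then have "2 * N = \<infinity>" using w l by (simp add: ennreal_mult_top top_unique)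
    then show False using Nfin by (simp add: ennreal_mult_eq_top_iff)
  qed
  obtain a b :: "nat \<Rightarrow> real" where ab0: "(\<forall>n. a n \<le> b n) \<and> \<Omega> = (\<Union>n. {a n<..<b n}) \<and>
    disjoint_family (\<lambda>n. {a n<..<b n}) \<and> (\<forall>n. a n < b n \<longrightarrow> a n \<notin> \<Omega> \<and> b n \<notin> \<Omega>)"
    using open_set_component_intervals[OF op fin] by (elim exE)
  define I where "I = (\<lambda>n. {a n<..<b n})"
  have ab: "\<And>n. a n \<le> b n" and \<Omega>I: "\<Omega> = (\<Union>n. I n)" and disj: "disjoint_family I"
    using ab0 unfolding I_def by simp_all
  have "\<forall>n. a n < b n \<longrightarrow> a n \<notin> \<Omega> \<and> b n \<notin> \<Omega>" using ab0 by (elim conjE)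
  then have ends: "a n \<notin> \<Omega>" if "a n < b n" for n using that by simp
  have uniq: "m = n" if "t \<in> I m" "t \<in> I n" for m n t
    using disj that unfolding disjoint_family_on_def by blast
  have [measurable]: "I n \<in> sets borel" for n by (simp add: I_def)
  define d where "d = (\<lambda>n. b n - a n)"
  have d0: "d n \<ge> 0" for n using ab by (simp add: d_def)
  have mI: "measure lborel (I n) = d n" "emeasure lborel (I n) = ennreal (d n)" for n
    using ab by (simp_all add: I_def d_def)
  define F where "F = (\<lambda>n. LBINT t:I n. cmod (f t))"
  have siF: "set_integrable lborel (I n) (\<lambda>t. cmod (f t))" "set_integrable lborel (I n) f" for n
    unfolding set_integrable_def using fi by (intro integrable_mult_indicator; simp)+
  have F0: "F n \<ge> 0" for n
    unfolding F_def set_lebesgue_integral_def by (intro Bochner_Integration.integral_nonneg) simp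
  have enF: "ennreal (F n) = (\<integral>\<^sup>+t\<in>I n. ennreal (cmod (f t)) \<partial>lborel)" for n
    unfolding F_def by (rule nn_set_integral_eq[OF siF(1), symmetric]) simp
  \<comment> \<open>The left endpoint lies outside \<open>\<Omega>\<close>, and the interval of
    radius \<open>d n\<close> about it contains \<open>I n\<close> and has twice its length.\<close>
  have Fl: "F n \<le> 2 * l * d n" for n
  proof (cases "d n = 0")
    case True
    then have "I n = {}" by (simp add: I_def d_def)
    then show ?thesis using True by (simp add: F_def set_lebesgue_integral_def)
  next
    case False
    then have dn: "d n > 0" "a n < b n" using d0[of n] by (auto simp: d_def)
    have m: "hl_max lborel (\<lambda>t. ennreal (cmod (f t))) (a n) \<le> ennreal l"
      using ends[OF dn(2)] by (simp add: \<Omega>_def)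
    have "ennreal (F n) \<le> (\<integral>\<^sup>+t\<in>{a n - d n<..<b n}. ennreal (cmod (f t)) \<partial>lborel)"
      unfolding enF using dn by (intro nn_integral_mono) (auto simp: I_def indicator_def)
    also have "\<dots> \<le> ennreal (l * (b n - (a n - d n)))"
      using dn l by (intro hl_max_lborel_integral_le[OF m]) auto
    finally show ?thesis using l dn by (simp add: ennreal_le_iff d_def algebra_simps)
  qed
  have sumF: "(\<Sum>n. ennreal (F n)) \<le> N"
  proof -
    have "(\<Sum>n. ennreal (F n)) = (\<integral>\<^sup>+t. (\<Sum>n. ennreal (cmod (f t)) * indicator (I n) t) \<partial>lborel)"
      unfolding enF by (intro nn_integral_suminf[symmetric]) measurable
    also have "\<dots> = (\<integral>\<^sup>+t. ennreal (cmod (f t)) * (\<Sum>n. indicator (I n) t) \<partial>lborel)"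
      by (simp only: ennreal_suminf_cmult)
    also have "\<dots> \<le> (\<integral>\<^sup>+t. ennreal (cmod (f t)) * 1 \<partial>lborel)"
      by (intro nn_integral_mono mult_left_mono suminf_indicator_le_1 disj) simp
    finally show ?thesis by (simp add: N_def)
  qed
  have smF: "summable F"
  proof (rule ccontr)
    assume "\<not> summable F"
    then have "(\<Sum>n. ennreal (F n)) = top" using F0 by (intro summable_iff_suminf_neq_top)
    then show False using sumF Nfin by (simp add: top_unique)
  qed
  define m where "m = (\<lambda>n. inverse (d n) *\<^sub>R (LBINT t:I n. f t))"
  have intf: "cmod (LBINT t:I n. f t) \<le> F n" for n
    unfolding F_def set_lebesgue_integral_def by (rule order_trans[OF integral_norm_bound]) simp
  have m_d: "cmod (m n) * d n \<le> F n" for n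
  proof (cases "d n = 0")
    case False
    then have "cmod (m n) * d n = cmod (LBINT t:I n. f t)" using d0[of n] by (simp add: m_def field_simps)
    then show ?thesis using intf by simp
  qed (use F0 in simp)
  have m_l: "cmod (m n) \<le> 2 * l" for n
  proof (cases "d n = 0")
    case False
    then have "d n > 0" using d0[of n] by simp
    moreover have "cmod (m n) * d n \<le> 2 * l * d n" using m_d[of n] Fl[of n] by linarith
    ultimately show ?thesis by simp
  qed (use l in \<open>simp add: m_def\<close>)
  define h where "h = (\<lambda>n t. indicator (I n) t *\<^sub>R (f t - m n))"
  have supp: "h n t = 0" if "t \<notin> I n" for n t using that by (simp add: h_def)
  have ci: "set_integrable lborel (I n) (\<lambda>t. c)" for n and c :: "'z::{banach, second_countable_topology}"
    unfolding set_integrable_def by (intro integrable_indicator) (auto simp: mI)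
  have hi: "integrable lborel (h n)" for n
    using set_integral_diff(1)[OF siF(2) ci, of n "m n"] unfolding h_def set_integrable_def .
  have mean: "(LBINT t. h n t) = 0" for n
  proof -
    have "(LBINT t. h n t) = (LBINT t:I n. f t) - (LBINT t:I n. m n)"
      using set_integral_diff(2)[OF siF(2) ci, of n "m n"] unfolding h_def set_lebesgue_integral_def .
    also have "(LBINT t:I n. m n) = d n *\<^sub>R m n"
      unfolding set_lebesgue_integral_def by (simp add: mI)
    also have "\<dots> = (LBINT t:I n. f t)"
    proof (cases "d n = 0")
      case True
      then have "I n = {}" by (simp add: I_def d_def)
      then show ?thesis using True by (simp add: set_lebesgue_integral_def)
    qed (simp add: m_def)
    finally show ?thesis by simp
  qed
  have \<beta>F: "(LBINT t. cmod (h n t)) \<le> 2 * F n" for n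
  proof -
    have "(LBINT t. cmod (h n t)) \<le> (LBINT t:I n. cmod (f t) + cmod (m n))"
      unfolding set_lebesgue_integral_def
    proof (rule integral_mono)
      show "integrable lborel (\<lambda>t. indicat_real (I n) t *\<^sub>R (cmod (f t) + cmod (m n)))"
        using set_integral_add(1)[OF siF(1) ci, of n "cmod (m n)"] by (simp add: set_integrable_def)
      show "cmod (h n t) \<le> indicat_real (I n) t *\<^sub>R (cmod (f t) + cmod (m n))" for t
        by (auto simp: h_def indicator_def norm_triangle_ineq4)
    qed (intro integrable_norm hi)
    also have "\<dots> = F n + (LBINT t:I n. cmod (m n))"
      unfolding F_def by (rule set_integral_add(2)[OF siF(1) ci])
    also have "(LBINT t:I n. cmod (m n)) = cmod (m n) * d n"
      unfolding set_lebesgue_integral_def by (simp add: mI)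
    also have "\<dots> \<le> F n" by (rule m_d)
    finally show ?thesis by simp
  qed
  have \<beta>0: "(LBINT t. cmod (h n t)) \<ge> 0" for n by simp
  have pt: "summable (\<lambda>n. cmod (h n t))" for t
  proof (cases "\<exists>n. t \<in> I n")
    case True
    then obtain n where n: "t \<in> I n" by blast
    show ?thesis
    proof (rule summable_finite[of "{n}"])
      fix k assume "k \<notin> {n}"
      then have "t \<notin> I k" using uniq[OF n, of k] by auto
      then show "cmod (h k t) = 0" by (simp add: supp)
    qed simp
  next
    case False
    then have "(\<lambda>n. cmod (h n t)) = (\<lambda>n. 0)" using supp by auto
    then show ?thesis by simp
  qed
  have sm: "summable (\<lambda>n. LBINT t. cmod (h n t))"
    by (rule summable_comparison_test'[OF summable_mult[OF smF, of 2], of 0]) (use \<beta>F in simp)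
  have sum\<beta>: "(\<Sum>n. ennreal (LBINT t. cmod (h n t))) \<le> 2 * N"
  proof -
    have "(\<Sum>n. ennreal (LBINT t. cmod (h n t))) \<le> (\<Sum>n. 2 * ennreal (F n))"
    proof (intro suminf_le summableI)
      fix n
      have "ennreal (LBINT t. cmod (h n t)) \<le> ennreal (2 * F n)" by (intro ennreal_leI \<beta>F)
      then show "ennreal (LBINT t. cmod (h n t)) \<le> 2 * ennreal (F n)" using F0[of n] by (simp add: ennreal_mult)
    qed
    also have "\<dots> = 2 * (\<Sum>n. ennreal (F n))" by (rule ennreal_suminf_cmult)
    also have "\<dots> \<le> 2 * N" by (intro mult_left_mono sumF) simp
    finally show ?thesis .
  qed
  define b' where "b' = (\<lambda>t. \<Sum>n. h n t)"
  have b'i: "integrable lborel b'" unfolding b'_def by (rule trunc_suminf(1)[OF hi pt sm zero_less_one])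
  define g where "g = (\<lambda>t. f t - b' t)"
  have gi: "integrable lborel g" unfolding g_def using fi b'i by simp
  have [measurable]: "b' \<in> borel_measurable borel" "g \<in> borel_measurable borel"
    using borel_measurable_integrable[OF b'i] borel_measurable_integrable[OF gi] by simp_all
  have gb: "cmod (g t) \<le> 2 * l" for t
  proof (cases "\<exists>n. t \<in> I n")
    case True
    then obtain n where n: "t \<in> I n" by blast
    have "b' t = (\<Sum>k\<in>{n}. h k t)"
      unfolding b'_def
    proof (rule suminf_finite)
      fix k assume "k \<notin> {n}"
      then have "t \<notin> I k" using uniq[OF n, of k] by auto
      then show "h k t = 0" by (simp add: supp)
    qed simp
    then have "g t = m n" using n by (simp add: g_def h_def)
    then show ?thesis using m_l by simp
  next
    case False
    then have "h n t = 0" for n using supp by blast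
    then have "g t = f t" by (simp add: g_def b'_def)
    moreover have "t \<notin> \<Omega>" using False unfolding \<Omega>I by blast
    then have "cmod (f t) \<le> l" using l by (intro continuous_le_of_hl_max_le[OF cf]) (auto simp: \<Omega>_def)
    ultimately show ?thesis using l by simp
  qed
  have b'N: "(\<integral>\<^sup>+t. ennreal (cmod (b' t)) \<partial>lborel) \<le> 2 * N"
  proof -
    have [measurable]: "h n \<in> borel_measurable borel" for n using borel_measurable_integrable[OF hi] by simp
    have "(\<integral>\<^sup>+t. ennreal (cmod (b' t)) \<partial>lborel) \<le> (\<integral>\<^sup>+t. (\<Sum>n. ennreal (cmod (h n t))) \<partial>lborel)"
      unfolding b'_def by (intro nn_integral_mono ennreal_norm_suminf_le)
    also have "\<dots> = (\<Sum>n. \<integral>\<^sup>+t. ennreal (cmod (h n t)) \<partial>lborel)" by (intro nn_integral_suminf) measurable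
    also have "\<dots> = (\<Sum>n. ennreal (LBINT t. cmod (h n t)))"
      using hi by (subst nn_integral_eq_integral) auto
    finally show ?thesis using sum\<beta> by (rule order_trans)
  qed
  have gN: "(\<integral>\<^sup>+t. ennreal ((cmod (g t))\<^sup>2) \<partial>lborel) \<le> ennreal (6 * l) * N"
  proof -
    have "(\<integral>\<^sup>+t. ennreal ((cmod (g t))\<^sup>2) \<partial>lborel) \<le> (\<integral>\<^sup>+t. ennreal (2 * l) * (ennreal (cmod (f t)) + ennreal (cmod (b' t))) \<partial>lborel)"
    proof (rule nn_integral_mono)
      fix t
      have "(cmod (g t))\<^sup>2 \<le> 2 * l * (cmod (f t) + cmod (b' t))"
        unfolding power2_eq_square using gb[of t] l norm_triangle_ineq4[of "f t" "b' t"]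
        by (intro mult_mono) (auto simp: g_def)
      then have "ennreal ((cmod (g t))\<^sup>2) \<le> ennreal (2 * l * (cmod (f t) + cmod (b' t)))" by (rule ennreal_leI)
      also have "\<dots> = ennreal (2 * l) * ennreal (cmod (f t) + cmod (b' t))" using l by (intro ennreal_mult) auto
      finally show "ennreal ((cmod (g t))\<^sup>2) \<le> ennreal (2 * l) * (ennreal (cmod (f t)) + ennreal (cmod (b' t)))" by simp
    qed
    also have "\<dots> = ennreal (2 * l) * (N + (\<integral>\<^sup>+t. ennreal (cmod (b' t)) \<partial>lborel))"
      unfolding N_def by (subst nn_integral_cmult, measurable, subst nn_integral_add) auto
    also have "\<dots> \<le> ennreal (2 * l) * (N + 2 * N)" by (intro mult_left_mono add_left_mono b'N) simp
    also have "N + 2 * N = (1 + 2) * N" by (simp only: distrib_right mult_1_left)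
    also have "(1 + 2 :: ennreal) = ennreal 3" by simp
    also have "ennreal (2 * l) * (ennreal 3 * N) = (ennreal (2 * l) * ennreal 3) * N" by (simp only: mult.assoc)
    also have "ennreal (2 * l) * ennreal 3 = ennreal (2 * l * 3)" using l by (intro ennreal_mult[symmetric]) auto
    also have "2 * l * 3 = 6 * l" by simp
    finally show ?thesis .
  qed
  let ?Eg = "{x. ennreal ((2 + 52 * B) * l) < tmax g x}"
  let ?Eb = "{x. ennreal ((8 * B + 1) * l) < tmax b' x}"
  have Eg: "ennreal l * emeasure lborel ?Eg \<le> ennreal (12 + 768 * B\<^sup>2) * N"
  proof -
    have "ennreal l * emeasure lborel ?Eg = ennreal (1 / l) * (ennreal (l\<^sup>2) * emeasure lborel ?Eg)"
    proof -
      have "ennreal l = ennreal (1 / l) * ennreal (l\<^sup>2)"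
        using l by (subst ennreal_mult[symmetric]) (auto simp: power2_eq_square)
      then show ?thesis by (simp only: mult.assoc)
    qed
    also have "\<dots> \<le> ennreal (1 / l) * (ennreal (2 + 128 * B\<^sup>2) * (ennreal (6 * l) * N))"
      by (intro mult_left_mono order_trans[OF tmax_weak_type_2[OF gi l]] gN) auto
    also have "\<dots> = (ennreal (1 / l) * ennreal (2 + 128 * B\<^sup>2) * ennreal (6 * l)) * N" by (simp only: mult.assoc)
    also have "ennreal (1 / l) * ennreal (2 + 128 * B\<^sup>2) * ennreal (6 * l) = ennreal (1 / l * (2 + 128 * B\<^sup>2) * (6 * l))"
      using l by (subst ennreal_mult[symmetric], simp, simp, subst ennreal_mult[symmetric]) auto
    also have "1 / l * (2 + 128 * B\<^sup>2) * (6 * l) = 12 + 768 * B\<^sup>2" using l by simp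
    finally show ?thesis .
  qed
  have Eb: "ennreal l * emeasure lborel ?Eb \<le> ennreal (6 + 64 * B) * N"
  proof -
    have sumd: "(\<Sum>n. ennreal (b n - a n)) = emeasure lborel \<Omega>"
    proof -
      have "(\<Sum>n. emeasure lborel (I n)) = emeasure lborel (\<Union>n. I n)"
        by (intro suminf_emeasure disj) auto
      then show ?thesis by (simp add: mI d_def \<Omega>I)
    qed
    have "(LBINT t. cmod (h n t)) \<le> 4 * l * (b n - a n)" for n
      using \<beta>F[of n] Fl[of n] by (simp add: d_def)
    then have "ennreal l * emeasure lborel ?Eb \<le> ennreal (3 * l) * (\<Sum>n. ennreal (b n - a n)) + ennreal (32 * B) * (\<Sum>n. ennreal (LBINT t. cmod (h n t)))"
      unfolding b'_def
      using disj supp unfolding I_def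
      by (intro bad_part_weak_type[OF ab _ hi _ mean _ pt sm l]) auto
    also have "\<dots> \<le> ennreal 3 * (2 * N) + ennreal (32 * B) * (2 * N)"
    proof (intro add_mono mult_left_mono sum\<beta>)
      have "ennreal (3 * l) * (\<Sum>n. ennreal (b n - a n)) = ennreal 3 * (ennreal l * emeasure lborel \<Omega>)"
        using l by (simp only: sumd ennreal_mult'' mult.assoc)
      also have "\<dots> \<le> ennreal 3 * (2 * N)" by (intro mult_left_mono w) simp
      finally show "ennreal (3 * l) * (\<Sum>n. ennreal (b n - a n)) \<le> ennreal 3 * (2 * N)" .
    qed simp
    also have "\<dots> = (ennreal 3 * ennreal 2 + ennreal (32 * B) * ennreal 2) * N"
      by (simp add: distrib_right mult.assoc)
    also have "ennreal 3 * ennreal 2 + ennreal (32 * B) * ennreal 2 = ennreal (6 + 64 * B)"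
      using B_pos by (simp flip: ennreal_mult ennreal_plus ennreal_numeral)
    finally show ?thesis .
  qed
  have sub: "{x. ennreal ((3 + 60 * B) * l) < tmax f x} \<subseteq> ?Eg \<union> ?Eb"
  proof
    fix x assume x: "x \<in> {x. ennreal ((3 + 60 * B) * l) < tmax f x}"
    show "x \<in> ?Eg \<union> ?Eb"
    proof (rule ccontr)
      assume n: "x \<notin> ?Eg \<union> ?Eb"
      have "tmax f x \<le> tmax g x + tmax b' x"
        using tmax_triangle[OF gi b'i, of x] by (simp add: g_def)
      also have "\<dots> \<le> ennreal ((2 + 52 * B) * l) + ennreal ((8 * B + 1) * l)" using n by (intro add_mono) auto
      also have "\<dots> = ennreal ((3 + 60 * B) * l)"
        using B_pos l by (simp flip: ennreal_plus add: algebra_simps)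
      finally show False using x by simp
    qed
  qed
  have meas: "?Eg \<in> sets lborel" "?Eb \<in> sets lborel"
    using open_tmax_superlevel[OF gi] open_tmax_superlevel[OF b'i] by auto
  have "emeasure lborel {x. ennreal ((3 + 60 * B) * l) < tmax f x} \<le> emeasure lborel (?Eg \<union> ?Eb)"
    by (rule emeasure_mono[OF sub]) (use meas in auto)
  also have "\<dots> \<le> emeasure lborel ?Eg + emeasure lborel ?Eb" by (rule emeasure_subadditive[OF meas])
  finally have "ennreal l * emeasure lborel {x. ennreal ((3 + 60 * B) * l) < tmax f x} \<le> ennreal l * (emeasure lborel ?Eg + emeasure lborel ?Eb)"
    by (rule mult_left_mono) simp
  also have "\<dots> \<le> ennreal (12 + 768 * B\<^sup>2) * N + ennreal (6 + 64 * B) * N"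
    unfolding distrib_left by (intro add_mono Eg Eb)
  also have "\<dots> = (ennreal (12 + 768 * B\<^sup>2) + ennreal (6 + 64 * B)) * N" by (simp only: distrib_right)
  also have "ennreal (12 + 768 * B\<^sup>2) + ennreal (6 + 64 * B) = ennreal (18 + 64 * B + 768 * B\<^sup>2)"
    using B_pos by (subst ennreal_plus[symmetric]) (auto simp: algebra_simps)
  finally show ?thesis by (simp only: N_def)
qed

text \<open>A point of the superlevel set exceeds the threshold strictly at some fixed level, so by
  convergence of the truncations it belongs to the superlevel sets of all late approximants. Fatou's
  lemma transfers the bound.\<close>

theorem tmax_weak_type_1:
  assumes f: "integrable lborel f" and l: "l > 0"
  shows "ennreal l * emeasure lborel {x. ennreal ((3 + 60 * B) * l) < tmax f x}
    \<le> ennreal (18 + 64 * B + 768 * B\<^sup>2) * (\<integral>\<^sup>+t. ennreal (cmod (f t)) \<partial>lborel)"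
proof -
  obtain h where h: "\<And>n. lipschitz_compact_support (h n)" "\<And>n::nat. (LBINT t. cmod (f t - h n t)) < 1 / (real n + 1)"
    using L1_approximating_sequence[OF f] by metis
  note hi = integrable_lipschitz_compact_support[OF h(1)]
  have inv: "(\<lambda>n. 1 / (real n + 1)) \<longlonglongrightarrow> 0"
    using LIMSEQ_inverse_real_of_nat by (simp add: inverse_eq_divide add.commute)
  have lim: "(\<lambda>n. LBINT t. cmod (f t - h n t)) \<longlonglongrightarrow> 0"
    by (rule tendsto_sandwich[OF _ _ tendsto_const inv];
        intro always_eventually allI less_imp_le[OF h(2)] Bochner_Integration.integral_nonneg norm_ge_zero)
  let ?c = "ennreal ((3 + 60 * B) * l)"
  let ?E = "{x. ?c < tmax f x}"
  define E where "E = (\<lambda>n. {x. ?c < tmax (h n) x})"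
  have [measurable]: "E n \<in> sets borel" for n unfolding E_def using open_tmax_superlevel[OF hi] by simp
  have [measurable]: "?E \<in> sets borel" using open_tmax_superlevel[OF f] by simp
  let ?D = "ennreal (18 + 64 * B + 768 * B\<^sup>2)"
  have pt: "ennreal l * indicator ?E x \<le> liminf (\<lambda>n. ennreal l * indicator (E n) x)" for x
  proof (cases "x \<in> ?E")
    case True
    then obtain \<epsilon> where e: "\<epsilon> > 0" "?c < ennreal (cmod (trunc f \<epsilon> x))" by (auto simp: less_tmax_iff)
    have "(\<lambda>n. ennreal (cmod (trunc (h n) \<epsilon> x))) \<longlonglongrightarrow> ennreal (cmod (trunc f \<epsilon> x))"
      by (intro tendsto_ennrealI tendsto_norm trunc_tendsto[OF f hi lim e(1)])
    then have "\<forall>\<^sub>F n in sequentially. ?c < ennreal (cmod (trunc (h n) \<epsilon> x))"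
      using e(2) by (rule order_tendstoD(1))
    then have "\<forall>\<^sub>F n in sequentially. ennreal l * indicator ?E x \<le> ennreal l * indicator (E n) x"
    proof eventually_elim
      case (elim n)
      then have "x \<in> E n" using e(1) by (auto simp: E_def less_tmax_iff)
      then show ?case using True by simp
    qed
    then have "liminf (\<lambda>n. ennreal l * indicator ?E x) \<le> liminf (\<lambda>n. ennreal l * indicator (E n) x)"
      by (rule Liminf_mono)
    then show ?thesis by (simp add: Liminf_const)
  qed simp
  have "ennreal l * emeasure lborel ?E = (\<integral>\<^sup>+x. ennreal l * indicator ?E x \<partial>lborel)"
    by (rule nn_integral_cmult_indicator[symmetric]) measurable
  also have "\<dots> \<le> (\<integral>\<^sup>+x. liminf (\<lambda>n. ennreal l * indicator (E n) x) \<partial>lborel)" by (intro nn_integral_mono pt)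
  also have "\<dots> \<le> liminf (\<lambda>n. \<integral>\<^sup>+x. ennreal l * indicator (E n) x \<partial>lborel)" by (intro nn_integral_liminf) measurable
  also have "\<dots> \<le> liminf (\<lambda>n. ?D * ennreal ((LBINT t. cmod (f t)) + 1 / (real n + 1)))"
  proof (intro Liminf_mono always_eventually allI)
    fix n
    have "(\<integral>\<^sup>+x. ennreal l * indicator (E n) x \<partial>lborel) = ennreal l * emeasure lborel (E n)"
      by (rule nn_integral_cmult_indicator) measurable
    also have "\<dots> \<le> ?D * (\<integral>\<^sup>+t. ennreal (cmod (h n t)) \<partial>lborel)"
      unfolding E_def by (rule tmax_weak_type_1_lipschitz[OF h(1) l])
    also have "(\<integral>\<^sup>+t. ennreal (cmod (h n t)) \<partial>lborel) = ennreal (LBINT t. cmod (h n t))"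
      using hi by (intro nn_integral_eq_integral) auto
    also have "(LBINT t. cmod (h n t)) \<le> (LBINT t. cmod (f t)) + (LBINT t. cmod (f t - h n t))"
      using integral_norm_triangle[of "h n" f "\<lambda>_. 0"] hi f by (simp add: norm_minus_commute)
    then have "?D * ennreal (LBINT t. cmod (h n t)) \<le> ?D * ennreal ((LBINT t. cmod (f t)) + 1 / (real n + 1))"
      using h(2)[of n] by (intro mult_left_mono ennreal_leI) auto
    finally show "(\<integral>\<^sup>+x. ennreal l * indicator (E n) x \<partial>lborel) \<le> ?D * ennreal ((LBINT t. cmod (f t)) + 1 / (real n + 1))" .
  qed
  also have "\<dots> = ?D * ennreal ((LBINT t. cmod (f t)) + 0)"
    by (intro lim_imp_Liminf[OF sequentially_bot] ennreal_tendsto_cmult tendsto_ennrealI tendsto_add tendsto_const inv) simp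
  also have "ennreal ((LBINT t. cmod (f t)) + 0) = (\<integral>\<^sup>+t. ennreal (cmod (f t)) \<partial>lborel)"
    using f by (simp add: nn_integral_eq_integral)
  finally show ?thesis .
qed

end

subsection \<open>Principal values\<close>

lemma converges_at_right_0:
  fixes F :: "real \<Rightarrow> complex"
  assumes C: "\<And>e. e > 0 \<Longrightarrow> \<exists>d>0. \<forall>s t. 0 < s \<longrightarrow> s < d \<longrightarrow> 0 < t \<longrightarrow> t < d \<longrightarrow> cmod (F s - F t) \<le> e"
  shows "\<exists>l. (F \<longlongrightarrow> l) (at_right 0)"
proof -
  define u where "u = (\<lambda>n::nat. 1 / (real n + 1))"
  have u0: "u n > 0" for n by (simp add: u_def)
  have ulim: "u \<longlonglongrightarrow> 0"
    unfolding u_def using LIMSEQ_inverse_real_of_nat by (simp add: inverse_eq_divide add.commute)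
  have "Cauchy (\<lambda>n. F (u n))"
  proof (rule metric_CauchyI)
    fix e :: real assume "e > 0"
    then obtain d where d: "d > 0" "\<And>s t. 0 < s \<Longrightarrow> s < d \<Longrightarrow> 0 < t \<Longrightarrow> t < d \<Longrightarrow> cmod (F s - F t) \<le> e / 2"
      using C[of "e / 2"] by auto
    have "eventually (\<lambda>n. u n < d) sequentially" using order_tendstoD(2)[OF ulim d(1)] .
    then obtain M where M: "\<And>n. n \<ge> M \<Longrightarrow> u n < d" by (auto simp: eventually_sequentially)
    show "\<exists>M. \<forall>m\<ge>M. \<forall>n\<ge>M. dist (F (u m)) (F (u n)) < e"
    proof (intro exI allI impI)
      fix m n assume "M \<le> m" "M \<le> n"
      then have "cmod (F (u m) - F (u n)) \<le> e / 2" by (intro d(2) u0 M)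
      then show "dist (F (u m)) (F (u n)) < e" using \<open>e > 0\<close> by (simp add: dist_norm)
    qed
  qed
  then obtain l where l: "(\<lambda>n. F (u n)) \<longlonglongrightarrow> l" using Cauchy_convergent convergent_def by blast
  have "(F \<longlongrightarrow> l) (at_right 0)"
  proof (rule tendstoI)
    fix e :: real assume "e > 0"
    then obtain d where d: "d > 0" "\<And>s t. 0 < s \<Longrightarrow> s < d \<Longrightarrow> 0 < t \<Longrightarrow> t < d \<Longrightarrow> cmod (F s - F t) \<le> e / 2"
      using C[of "e / 2"] by auto
    have ud: "eventually (\<lambda>n. u n < d) sequentially" using order_tendstoD(2)[OF ulim d(1)] .
    have "dist (F t) l < e" if t: "0 < t" "t < d" for t
    proof -
      have "(\<lambda>n. cmod (F (u n) - F t)) \<longlonglongrightarrow> cmod (l - F t)" by (intro tendsto_intros l)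
      moreover have "eventually (\<lambda>n. cmod (F (u n) - F t) \<le> e / 2) sequentially"
        using ud by eventually_elim (intro d(2) u0 t)
      ultimately have "cmod (l - F t) \<le> e / 2"
        by (intro tendsto_upperbound[where F=sequentially]) auto
      then show ?thesis using \<open>e > 0\<close> by (simp add: dist_norm norm_minus_commute)
    qed
    then show "\<forall>\<^sub>F t in at_right 0. dist (F t) l < e"
      unfolding eventually_at_right_field using d(1) by blast
  qed
  then show ?thesis by blast
qed

context cz_kernel
begin

text \<open>By oddness the kernel has integral zero over the annulus between the two levels, so
  \<open>h t\<close> may be replaced by \<open>h t - h x\<close>, whose Lipschitz bound cancels the
  singularity.\<close>

lemma trunc_difference_lipschitz:
  assumes h: "integrable lborel h" and L: "\<And>y. cmod (h y - h x) \<le> L * \<bar>y - x\<bar>" "L \<ge> 0"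
    and e: "0 < \<epsilon>" "\<epsilon> \<le> \<epsilon>'"
  shows "cmod (trunc h \<epsilon> x - trunc h \<epsilon>' x) \<le> B * L * (2 * \<epsilon>')"
proof -
  let ?S = "{t. \<epsilon> < \<bar>x - t\<bar> \<and> \<bar>x - t\<bar> \<le> \<epsilon>'}"
  have e': "\<epsilon>' > 0" using e by simp
  let ?k = "\<lambda>\<epsilon> t. indicat_real {t. \<epsilon> < \<bar>x - t\<bar>} t *\<^sub>R K (x - t) *\<^sub>R h t"
  have ki: "integrable lborel (?k \<epsilon>)" "integrable lborel (?k \<epsilon>')"
    using trunc_integrable[OF h e(1)] trunc_integrable[OF h e'] by (simp_all add: set_integrable_def)
  have "trunc h \<epsilon> x - trunc h \<epsilon>' x = (LBINT t. ?k \<epsilon> t - ?k \<epsilon>' t)"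
    unfolding trunc_def set_lebesgue_integral_def by (rule Bochner_Integration.integral_diff[OF ki, symmetric])
  also have "\<dots> = (LBINT t. indicat_real ?S t *\<^sub>R K (x - t) *\<^sub>R h t)"
    using e by (intro Bochner_Integration.integral_cong refl) (auto simp: indicator_def)
  finally have d: "trunc h \<epsilon> x - trunc h \<epsilon>' x = (LBINT t. indicat_real ?S t *\<^sub>R K (x - t) *\<^sub>R h t)" .
  have di: "integrable lborel (\<lambda>t. indicat_real ?S t *\<^sub>R K (x - t) *\<^sub>R h t)"
  proof -
    have "(\<lambda>t. indicat_real ?S t *\<^sub>R K (x - t) *\<^sub>R h t) = (\<lambda>t. ?k \<epsilon> t - ?k \<epsilon>' t)"
      using e by (intro ext) (auto simp: indicator_def)
    then show ?thesis using Bochner_Integration.integrable_diff[OF ki] by (simp only:)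
  qed
  have bd: "indicat_real {x - \<epsilon>'..x + \<epsilon>'} t = 1" if "t \<in> ?S" for t using that by (auto simp: abs_le_iff)
  have ci: "integrable lborel (\<lambda>t. indicat_real ?S t *\<^sub>R K (x - t) *\<^sub>R h x)"
  proof (rule Bochner_Integration.integrable_bound)
    show "integrable lborel (\<lambda>t. (B / \<epsilon> * cmod (h x)) * indicat_real {x - \<epsilon>'..x + \<epsilon>'} t)"
      by (intro integrable_mult_right integrable_real_indicator emeasure_bounded_finite) auto
    show "AE t in lborel. norm (indicat_real ?S t *\<^sub>R K (x - t) *\<^sub>R h x) \<le> norm ((B / \<epsilon> * cmod (h x)) * indicat_real {x - \<epsilon>'..x + \<epsilon>'} t)"
    proof (rule AE_I2)
      fix t
      show "norm (indicat_real ?S t *\<^sub>R K (x - t) *\<^sub>R h x) \<le> norm ((B / \<epsilon> * cmod (h x)) * indicat_real {x - \<epsilon>'..x + \<epsilon>'} t)"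
      proof (cases "t \<in> ?S")
        case True
        have "norm (indicat_real {t. \<epsilon> < \<bar>x - t\<bar>} t *\<^sub>R K (x - t) *\<^sub>R (\<lambda>_. h x) t) \<le> B / \<epsilon> * cmod ((\<lambda>_. h x) t)"
          by (rule truncated_bound[OF e(1)])
        also have "\<dots> \<le> \<bar>B / \<epsilon> * cmod (h x)\<bar>" by (rule abs_ge_self)
        finally show ?thesis using True bd[OF True] by simp
      qed simp
    qed
  qed measurable
  have zero: "(LBINT t. indicat_real ?S t *\<^sub>R K (x - t) *\<^sub>R h x) = 0"
  proof -
    let ?g = "\<lambda>s. indicat_real {s. \<epsilon> < \<bar>s\<bar> \<and> \<bar>s\<bar> \<le> \<epsilon>'} s *\<^sub>R K s *\<^sub>R h x"
    have refl_eq: "(LBINT t. indicat_real ?S t *\<^sub>R K (x - t) *\<^sub>R h x) = (LBINT s. ?g s)"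
      by (subst integral_reflect_lborel[of _ x]) (simp add: indicator_def)
    also have "(LBINT s. ?g s) = (LBINT s. ?g (0 - s))" by (rule integral_reflect_lborel)
    also have "\<dots> = (LBINT s. - ?g s)"
      using e by (intro Bochner_Integration.integral_cong refl) (auto simp: indicator_def odd)
    also have "\<dots> = - (LBINT s. ?g s)" by simp
    finally have neg: "(LBINT t. indicat_real ?S t *\<^sub>R K (x - t) *\<^sub>R h x) = - (LBINT s. ?g s)" .
    have "z = 0" if "z = - w" "z = w" for z w :: complex using that by (simp add: complex_eq_iff)
    from this[OF neg refl_eq] show ?thesis .
  qed
  have eq: "trunc h \<epsilon> x - trunc h \<epsilon>' x = (LBINT t. indicat_real ?S t *\<^sub>R K (x - t) *\<^sub>R h t - indicat_real ?S t *\<^sub>R K (x - t) *\<^sub>R h x)"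
    unfolding d by (subst Bochner_Integration.integral_diff[OF di ci]) (simp only: zero diff_zero)
  have "cmod (trunc h \<epsilon> x - trunc h \<epsilon>' x) \<le> (LBINT t. (B * L) * indicat_real {x - \<epsilon>'..x + \<epsilon>'} t)"
    unfolding eq
  proof (rule Bochner_Integration.integral_norm_bound_integral)
    show "integrable lborel (\<lambda>t. (B * L) * indicat_real {x - \<epsilon>'..x + \<epsilon>'} t)"
      by (intro integrable_mult_right integrable_real_indicator emeasure_bounded_finite) auto
    show "integrable lborel (\<lambda>t. indicat_real ?S t *\<^sub>R K (x - t) *\<^sub>R h t - indicat_real ?S t *\<^sub>R K (x - t) *\<^sub>R h x)"
      by (rule Bochner_Integration.integrable_diff[OF di ci])
    fix t
    show "cmod (indicat_real ?S t *\<^sub>R K (x - t) *\<^sub>R h t - indicat_real ?S t *\<^sub>R K (x - t) *\<^sub>R h x) \<le> (B * L) * indicat_real {x - \<epsilon>'..x + \<epsilon>'} t"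
    proof (cases "t \<in> ?S")
      case True
      then have "x - t \<noteq> 0" using e by auto
      have "\<bar>K (x - t)\<bar> * cmod (h t - h x) \<le> B / \<bar>x - t\<bar> * (L * \<bar>t - x\<bar>)"
        using size[OF \<open>x - t \<noteq> 0\<close>] L(1)[of t] B_pos by (intro mult_mono) auto
      also have "\<dots> = B * L" using \<open>x - t \<noteq> 0\<close> by (simp add: abs_minus_commute)
      finally show ?thesis using True bd[OF True] by (simp flip: scaleR_diff_right)
    qed (use B_pos L(2) in simp)
  qed
  also have "\<dots> = (B * L) * (LBINT t. indicat_real {x - \<epsilon>'..x + \<epsilon>'} t)" by (rule integral_mult_right_zero)
  also have "(LBINT t. indicat_real {x - \<epsilon>'..x + \<epsilon>'} t) = 2 * \<epsilon>'" using e' by simp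
  finally show ?thesis .
qed

lemma trunc_cauchy_lipschitz:
  assumes h: "lipschitz_compact_support h" and e: "e > 0"
  shows "\<exists>d>0. \<forall>s t. 0 < s \<longrightarrow> s < d \<longrightarrow> 0 < t \<longrightarrow> t < d \<longrightarrow> cmod (trunc h s x - trunc h t x) \<le> e"
proof -
  obtain L A where LA: "0 \<le> L \<and> 0 < A \<and> (\<forall>x y. cmod (h x - h y) \<le> L * \<bar>x - y\<bar>) \<and> (\<forall>x. A \<le> \<bar>x\<bar> \<longrightarrow> h x = 0)"
    using lipschitz_compact_supportD[OF h] by (elim exE)
  then have L: "0 \<le> L" "\<And>y. cmod (h y - h x) \<le> L * \<bar>y - x\<bar>" by simp_all
  define d where "d = e / (2 * B * L + 1)"
  have p: "2 * B * L + 1 > 0" using B_pos L(1) by (simp add: add_nonneg_pos)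
  have d: "d > 0" "(2 * B * L + 1) * d = e" using e p by (simp_all add: d_def)
  have main: "cmod (trunc h s x - trunc h t x) \<le> e" if "0 < s" "s \<le> t" "t < d" for s t
  proof -
    have "cmod (trunc h s x - trunc h t x) \<le> B * L * (2 * t)"
      by (rule trunc_difference_lipschitz[OF integrable_lipschitz_compact_support[OF h] L(2,1) that(1,2)])
    also have "\<dots> \<le> (2 * B * L + 1) * d"
    proof -
      have "(2 * B * L) * t \<le> (2 * B * L + 1) * d" using that B_pos L(1) by (intro mult_mono) auto
      then show ?thesis by (simp add: mult_ac)
    qed
    finally show ?thesis using d(2) by simp
  qed
  have "cmod (trunc h s x - trunc h t x) \<le> e" if "0 < s" "s < d" "0 < t" "t < d" for s t
    using main[of s t] main[of t s] that by (cases "s \<le> t") (auto simp: norm_minus_commute)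
  then show ?thesis using d(1) by blast
qed

text \<open>Weak type bounds for the maximal truncation of \<open>f - h n\<close> show that, off a
  null set, for each k some \<open>n\<close>, depending on the point, makes it at most a constant
  times 1 / (k + 1). The truncations of \<open>h n\<close> converge everywhere, so those of
  \<open>f\<close> satisfy the Cauchy criterion.\<close>

theorem trunc_converges_AE:
  assumes f: "integrable lborel f"
  shows "AE x in lborel. \<exists>l. ((\<lambda>\<epsilon>. trunc f \<epsilon> x) \<longlongrightarrow> l) (at_right 0)"
proof -
  obtain h where h: "\<And>n. lipschitz_compact_support (h n)" "\<And>n::nat. (LBINT t. cmod (f t - h n t)) < 1 / (real n + 1)"
    using L1_approximating_sequence[OF f] by metis
  note hi = integrable_lipschitz_compact_support[OF h(1)]
  define g where "g = (\<lambda>n t. f t - h n t)"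
  have gi: "integrable lborel (g n)" for n unfolding g_def by (intro Bochner_Integration.integrable_diff f hi)
  let ?c = "3 + 60 * B"
  define D where "D = 18 + 64 * B + 768 * B\<^sup>2"
  have c: "?c > 0" "D \<ge> 0" using B_pos by (auto simp: D_def)
  have AEl: "AE x in lborel. \<exists>n. tmax (g n) x \<le> ennreal (?c * l)" if l: "l > 0" for l
  proof (rule AE_I)
    define E where "E = (\<Inter>n. {x. ennreal (?c * l) < tmax (g n) x})"
    have En: "{x. ennreal (?c * l) < tmax (g n) x} \<in> sets lborel" for n
      using open_tmax_superlevel[OF gi] by simp
    then have E: "E \<in> sets lborel" unfolding E_def by (intro sets.countable_INT) auto
    have le: "ennreal l * emeasure lborel E \<le> ennreal (D * (1 / (real n + 1)))" for n
    proof -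
      have "ennreal l * emeasure lborel E \<le> ennreal l * emeasure lborel {x. ennreal (?c * l) < tmax (g n) x}"
        by (intro mult_left_mono emeasure_mono) (use En in \<open>auto simp: E_def\<close>)
      also have "\<dots> \<le> ennreal D * (\<integral>\<^sup>+t. ennreal (cmod (g n t)) \<partial>lborel)"
        unfolding D_def by (rule tmax_weak_type_1[OF gi l])
      also have "(\<integral>\<^sup>+t. ennreal (cmod (g n t)) \<partial>lborel) = ennreal (LBINT t. cmod (g n t))"
        using gi by (intro nn_integral_eq_integral) auto
      also have "ennreal D * \<dots> = ennreal (D * (LBINT t. cmod (g n t)))"
        using c by (intro ennreal_mult[symmetric]) auto
      also have "\<dots> \<le> ennreal (D * (1 / (real n + 1)))"
        using h(2)[of n] c by (intro ennreal_leI mult_left_mono) (auto simp: g_def)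
      finally show ?thesis .
    qed
    have "(\<lambda>n. ennreal (D * (1 / (real n + 1)))) \<longlonglongrightarrow> ennreal (D * 0)"
      using LIMSEQ_inverse_real_of_nat by (intro tendsto_ennrealI tendsto_mult tendsto_const) (simp add: inverse_eq_divide add.commute)
    then have "ennreal l * emeasure lborel E \<le> ennreal (D * 0)"
      by (rule LIMSEQ_le_const) (use le in blast)
    then have "emeasure lborel E = 0" using l by (simp add: ennreal_eq_0_iff)
    then show "emeasure lborel E = 0" .
    show "E \<in> sets lborel" by (rule E)
    show "{x \<in> space lborel. \<not> (\<exists>n. tmax (g n) x \<le> ennreal (?c * l))} \<subseteq> E"
      unfolding E_def by (auto simp: not_le)
  qed
  have "AE x in lborel. \<forall>k::nat. \<exists>n. tmax (g n) x \<le> ennreal (?c * (1 / (real k + 1)))"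
    unfolding AE_all_countable by (intro allI AEl) simp
  then show ?thesis
  proof eventually_elim
    case (elim x)
    show ?case
    proof (rule converges_at_right_0)
      fix e :: real assume e: "e > 0"
      have "3 * ?c / e > 0" using c e by simp
      obtain k :: nat where k: "3 * ?c / e < real k + 1"
        using reals_Archimedean2[of "3 * ?c / e"] by (metis less_add_one order.strict_trans)
      have ke: "?c * (1 / (real k + 1)) \<le> e / 3" using k e by (simp add: field_simps)
      obtain n where n: "tmax (g n) x \<le> ennreal (?c * (1 / (real k + 1)))" using elim by blast
      have gb: "cmod (trunc f s x - trunc (h n) s x) \<le> e / 3" if s: "s > 0" for s
      proof -
        have "ennreal (cmod (trunc (g n) s x)) \<le> ennreal (e / 3)"
          using tmax_ge[OF s, of "g n" x] n ennreal_leI[OF ke] by (meson order_trans)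
        moreover have "trunc (g n) s x = trunc f s x - trunc (h n) s x"
          unfolding g_def by (rule trunc_diff[OF f hi s])
        ultimately show ?thesis using e by (simp add: ennreal_le_iff)
      qed
      obtain d where d: "d > 0" "\<forall>s t. 0 < s \<longrightarrow> s < d \<longrightarrow> 0 < t \<longrightarrow> t < d \<longrightarrow> cmod (trunc (h n) s x - trunc (h n) t x) \<le> e / 3"
        using trunc_cauchy_lipschitz[OF h(1)[of n], of "e / 3" x] e by auto
      have "cmod (trunc f s x - trunc f t x) \<le> e" if st: "0 < s" "s < d" "0 < t" "t < d" for s t
      proof -
        have "trunc f s x - trunc f t x = (trunc f s x - trunc (h n) s x) + (trunc (h n) s x - trunc (h n) t x) - (trunc f t x - trunc (h n) t x)"
          by simp
        then have "cmod (trunc f s x - trunc f t x) \<le> cmod (trunc f s x - trunc (h n) s x) + cmod (trunc (h n) s x - trunc (h n) t x) + cmod (trunc f t x - trunc (h n) t x)"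
          using norm_triangle_ineq4[of "(trunc f s x - trunc (h n) s x) + (trunc (h n) s x - trunc (h n) t x)" "trunc f t x - trunc (h n) t x"]
            norm_triangle_ineq[of "trunc f s x - trunc (h n) s x" "trunc (h n) s x - trunc (h n) t x"] by simp
        moreover have "cmod (trunc (h n) s x - trunc (h n) t x) \<le> e / 3" using d(2) st by blast
        ultimately show ?thesis using gb[OF st(1)] gb[OF st(3)] by simp
      qed
      then show "\<exists>d>0. \<forall>s t. 0 < s \<longrightarrow> s < d \<longrightarrow> 0 < t \<longrightarrow> t < d \<longrightarrow> cmod (trunc f s x - trunc f t x) \<le> e"
        using d(1) by blast
    qed
  qed
qed

text \<open>The part of \<open>F\<close> within \<open>2 * \<epsilon>\<close> of \<open>y\<close> is
  estimated by size alone at both centres, at most \<open>6 * B * l\<close> each time; the remainder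
  is a kernel difference, at most \<open>32 * B * l\<close>.\<close>

lemma trunc_two_centers:
  assumes F: "integrable lborel F" and e: "\<epsilon> > 0" and xy: "\<bar>x - y\<bar> \<le> \<epsilon>"
    and m: "hl_max lborel (\<lambda>t. ennreal (cmod (F t))) y \<le> ennreal l" "l \<ge> 0"
  shows "cmod (trunc F \<epsilon> x) \<le> cmod (trunc F \<epsilon> y) + 44 * B * l"
proof -
  define G where "G = (\<lambda>t. indicator {t. \<bar>y - t\<bar> \<le> 2 * \<epsilon>} t *\<^sub>R F t)"
  have [measurable]: "F \<in> borel_measurable borel" using borel_measurable_integrable[OF F] by simp
  have G: "integrable lborel G" unfolding G_def by (intro integrable_mult_indicator F) simp
  have D: "integrable lborel (\<lambda>t. F t - G t)" using F G by simp
  have Gb: "(LBINT t. cmod (G t)) \<le> 6 * \<epsilon> * l"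
  proof -
    have "ennreal (LBINT t. cmod (G t)) = (\<integral>\<^sup>+t. ennreal (cmod (G t)) \<partial>lborel)"
      using G by (intro nn_integral_eq_integral[symmetric]) auto
    also have "\<dots> \<le> (\<integral>\<^sup>+t\<in>{y - 3 * \<epsilon><..<y + 3 * \<epsilon>}. ennreal (cmod (F t)) \<partial>lborel)"
      using e by (intro nn_integral_mono) (auto simp: G_def indicator_def)
    also have "\<dots> \<le> ennreal (l * ((y + 3 * \<epsilon>) - (y - 3 * \<epsilon>)))"
      using e m(2) by (intro hl_max_lborel_integral_le[OF m(1)]) auto
    finally show ?thesis using e m(2) by (simp add: ennreal_le_iff mult_ac)
  qed
  have near: "cmod (trunc G \<epsilon> z) \<le> 6 * B * l" for z
  proof -
    have "cmod (trunc G \<epsilon> z) \<le> B / \<epsilon> * (LBINT t. cmod (G t))" by (rule norm_trunc_le[OF G e])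
    also have "\<dots> \<le> B / \<epsilon> * (6 * \<epsilon> * l)" using B_pos e by (intro mult_left_mono Gb) auto
    finally show ?thesis using e by simp
  qed
  have split: "trunc F \<epsilon> z = trunc G \<epsilon> z + trunc (\<lambda>t. F t - G t) \<epsilon> z" for z
    using trunc_add[OF G D e, of z] by simp
  have far: "trunc (\<lambda>t. F t - G t) \<epsilon> z = (LBINT t:{t. 2 * \<epsilon> < \<bar>y - t\<bar>}. K (z - t) *\<^sub>R F t)" if "\<bar>y - z\<bar> \<le> \<epsilon>" for z
    unfolding trunc_def set_lebesgue_integral_def
  proof (intro Bochner_Integration.integral_cong refl)
    fix t
    have "\<epsilon> < \<bar>z - t\<bar>" if "2 * \<epsilon> < \<bar>y - t\<bar>" using that \<open>\<bar>y - z\<bar> \<le> \<epsilon>\<close> by argo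
    then show "indicat_real {t. \<epsilon> < \<bar>z - t\<bar>} t *\<^sub>R K (z - t) *\<^sub>R (F t - G t) = indicat_real {t. 2 * \<epsilon> < \<bar>y - t\<bar>} t *\<^sub>R K (z - t) *\<^sub>R F t"
      by (auto simp: G_def indicator_def)
  qed
  have yx: "\<bar>y - x\<bar> \<le> \<epsilon>" "\<bar>y - y\<bar> \<le> \<epsilon>" using xy e by (simp_all add: abs_minus_commute)
  have "trunc (\<lambda>t. F t - G t) \<epsilon> y - trunc (\<lambda>t. F t - G t) \<epsilon> x = (LBINT t:{t. 2 * \<epsilon> < \<bar>y - t\<bar>}. (K (y - t) - K (x - t)) *\<^sub>R F t)"
    unfolding far[OF yx(1)] far[OF yx(2)] scaleR_diff_left
    by (rule set_integral_diff(2)[OF far_difference_integrable[OF F e yx(2)] far_difference_integrable[OF F e yx(1)], symmetric])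
  then have d: "cmod (trunc (\<lambda>t. F t - G t) \<epsilon> y - trunc (\<lambda>t. F t - G t) \<epsilon> x) \<le> 32 * B * l"
    using far_difference_bound[OF F e yx(1) m] by simp
  have "trunc F \<epsilon> x = trunc F \<epsilon> y - trunc G \<epsilon> y + trunc G \<epsilon> x - (trunc (\<lambda>t. F t - G t) \<epsilon> y - trunc (\<lambda>t. F t - G t) \<epsilon> x)"
    unfolding split[of x] split[of y] by simp
  then have "cmod (trunc F \<epsilon> x) \<le> cmod (trunc F \<epsilon> y) + cmod (trunc G \<epsilon> y) + cmod (trunc G \<epsilon> x) + cmod (trunc (\<lambda>t. F t - G t) \<epsilon> y - trunc (\<lambda>t. F t - G t) \<epsilon> x)"
    by (smt (verit) norm_triangle_ineq norm_triangle_ineq4)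
  then show ?thesis using near[of y] near[of x] d by simp
qed

subsection \<open>Sparse domination\<close>

text \<open>Restriction to the triple of the interval \<open>p\<close>, given by its endpoints.\<close>
definition localized :: "(real \<Rightarrow> complex) \<Rightarrow> real \<times> real \<Rightarrow> real \<Rightarrow> complex" where
  "localized f p t = indicator {2 * fst p - snd p<..<2 * snd p - fst p} t *\<^sub>R f t"

text \<open>\<open>3 + 107 * B\<close> is the loss in passing from an interval to a child. The other
  factor is 4 D + 8 with D the weak type constant: the stopping height in units of the triple
  average, chosen so that the stopping set fills at most a quarter of the interval.\<close>

definition sparse_const :: real where
  "sparse_const = (3 + 107 * B) * (4 * (18 + 64 * B + 768 * B\<^sup>2) + 8)"

definition triple_average :: "(real \<Rightarrow> complex) \<Rightarrow> real \<times> real \<Rightarrow> real" where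
  "triple_average f p = (LBINT t. cmod (localized f p t)) / (snd p - fst p)"

lemma integrable_localized:
  assumes "\<And>a b. set_integrable lborel {a<..<b} f"
  shows "integrable lborel (localized f p)"
  using assms[of "2 * fst p - snd p" "2 * snd p - fst p"] unfolding localized_def set_integrable_def .

text \<open>Let h be the length of the child. For levels at least h the truncation at
  \<open>x\<close> is compared with the one at the endpoint \<open>y\<close>, where everything is
  small: 60 + 44 = 104. For smaller levels, only points within h of \<open>x\<close> distinguish the
  levels \<open>\<epsilon>\<close> and h; they lie in the triple of the child, where both
  localizations agree. The truncation of the child's localization at level h costs another
  \<open>3 * B * l\<close>.\<close>

lemma tmax_localized_child:
  assumes f: "\<And>a b. set_integrable lborel {a<..<b} f"
    and cd: "fst p \<le> c" "c < d" "d \<le> snd p" and x: "x \<in> {c<..<d}" and y: "y = c \<or> y = d"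
    and l: "l \<ge> 0" and T: "tmax (localized f p) y \<le> ennreal ((3 + 60 * B) * l)"
    and M: "hl_max lborel (\<lambda>t. ennreal (cmod (localized f p t))) y \<le> ennreal l"
  shows "tmax (localized f p) x \<le> ennreal ((3 + 107 * B) * l) + tmax (localized f (c, d)) x"
proof -
  let ?F = "localized f p" and ?G = "localized f (c, d)"
  have F: "integrable lborel ?F" and G: "integrable lborel ?G" by (intro integrable_localized f)+
  define h where "h = d - c"
  have h: "h > 0" using cd by (simp add: h_def)
  have xy: "\<bar>x - y\<bar> \<le> h" using x y by (auto simp: h_def)
  have GF: "cmod (?G t) \<le> cmod (?F t)" for t
    using cd by (auto simp: localized_def indicator_def)
  have Ty: "cmod (trunc ?F \<epsilon> y) \<le> (3 + 60 * B) * l" if "\<epsilon> > 0" for \<epsilon>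
    using order_trans[OF tmax_ge[OF that] T] l B_pos by (simp add: ennreal_le_iff)
  have big: "cmod (trunc ?F \<epsilon> x) \<le> (3 + 104 * B) * l" if "\<epsilon> \<ge> h" for \<epsilon>
  proof -
    have e: "\<epsilon> > 0" "\<bar>x - y\<bar> \<le> \<epsilon>" using that h xy by auto
    have "cmod (trunc ?F \<epsilon> x) \<le> cmod (trunc ?F \<epsilon> y) + 44 * B * l"
      by (rule trunc_two_centers[OF F e M l])
    then show ?thesis using Ty[OF e(1)] by (simp add: algebra_simps)
  qed
  have Gh: "cmod (trunc ?G h x) \<le> 3 * B * l"
  proof -
    have "ennreal (LBINT t. cmod (?G t)) = (\<integral>\<^sup>+t. ennreal (cmod (?G t)) \<partial>lborel)"
      using G by (intro nn_integral_eq_integral[symmetric]) auto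
    also have "\<dots> \<le> (\<integral>\<^sup>+t\<in>{c - h<..<d + h}. ennreal (cmod (?F t)) \<partial>lborel)"
    proof (rule nn_integral_mono)
      fix t
      show "ennreal (cmod (?G t)) \<le> ennreal (cmod (?F t)) * indicator {c - h<..<d + h} t"
      proof (cases "t \<in> {c - h<..<d + h}")
        case True
        then show ?thesis using GF[of t] by (simp add: ennreal_leI)
      next
        case False
        then have "?G t = 0" by (auto simp: localized_def h_def)
        then show ?thesis by simp
      qed
    qed
    also have "\<dots> \<le> ennreal (l * ((d + h) - (c - h)))"
      using h y cd l by (intro hl_max_lborel_integral_le[OF M]) auto
    also have "l * ((d + h) - (c - h)) = 3 * h * l" by (simp add: h_def algebra_simps)
    finally have "(LBINT t. cmod (?G t)) \<le> 3 * h * l" using h l by (simp add: ennreal_le_iff)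
    then have "B / h * (LBINT t. cmod (?G t)) \<le> B / h * (3 * h * l)" using B_pos h by (intro mult_left_mono) auto
    then show ?thesis using norm_trunc_le[OF G h, of x] h by simp
  qed
  have main: "cmod (trunc ?F \<epsilon> x) \<le> (3 + 107 * B) * l + cmod (trunc ?G \<epsilon> x)" if e: "\<epsilon> > 0" for \<epsilon>
  proof (cases "\<epsilon> \<ge> h")
    case True
    have "(3 + 104 * B) * l \<le> (3 + 107 * B) * l" using B_pos l by (intro mult_right_mono) auto
    then show ?thesis using big[OF True] norm_ge_zero[of "trunc ?G \<epsilon> x"] by linarith
  next
    case False
    let ?k = "\<lambda>H \<epsilon> t. indicat_real {t. \<epsilon> < \<bar>x - t\<bar>} t *\<^sub>R K (x - t) *\<^sub>R H t"
    have ki: "integrable lborel (?k ?F \<epsilon>)" "integrable lborel (?k ?F h)" "integrable lborel (?k ?G \<epsilon>)" "integrable lborel (?k ?G h)"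
      using trunc_integrable[OF F e] trunc_integrable[OF F h] trunc_integrable[OF G e] trunc_integrable[OF G h]
      by (simp_all only: set_integrable_def)
    have "trunc ?F \<epsilon> x - trunc ?F h x = (LBINT t. ?k ?F \<epsilon> t - ?k ?F h t)"
      unfolding trunc_def set_lebesgue_integral_def by (rule Bochner_Integration.integral_diff[OF ki(1,2), symmetric])
    also have "\<dots> = (LBINT t. ?k ?G \<epsilon> t - ?k ?G h t)"
    proof (intro Bochner_Integration.integral_cong refl)
      fix t
      show "?k ?F \<epsilon> t - ?k ?F h t = ?k ?G \<epsilon> t - ?k ?G h t"
      proof (cases "h < \<bar>x - t\<bar>")
        case True
        then have "\<epsilon> < \<bar>x - t\<bar>" using False by simp
        then show ?thesis using True by simp
      next
        case near: False
        have "t \<in> {2 * c - d<..<2 * d - c}" using near x by (auto simp: h_def)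
        moreover have "t \<in> {2 * fst p - snd p<..<2 * snd p - fst p}" using near x cd by (auto simp: h_def)
        ultimately have "?F t = ?G t" by (simp add: localized_def)
        then show ?thesis by (simp only:)
      qed
    qed
    also have "\<dots> = trunc ?G \<epsilon> x - trunc ?G h x"
      unfolding trunc_def set_lebesgue_integral_def by (rule Bochner_Integration.integral_diff[OF ki(3,4)])
    finally have "trunc ?F \<epsilon> x = trunc ?F h x + trunc ?G \<epsilon> x - trunc ?G h x" by (simp add: diff_eq_eq algebra_simps)
    then have "cmod (trunc ?F \<epsilon> x) \<le> cmod (trunc ?F h x) + cmod (trunc ?G \<epsilon> x) + cmod (trunc ?G h x)"
      using norm_triangle_ineq4[of "trunc ?F h x + trunc ?G \<epsilon> x" "trunc ?G h x"] norm_triangle_ineq[of "trunc ?F h x" "trunc ?G \<epsilon> x"] by simp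
    also have "\<dots> \<le> (3 + 104 * B) * l + cmod (trunc ?G \<epsilon> x) + 3 * B * l"
      by (intro add_mono big Gh order_refl)
    also have "\<dots> = (3 + 107 * B) * l + cmod (trunc ?G \<epsilon> x)" by (simp add: algebra_simps)
    finally show ?thesis .
  qed
  show ?thesis
    unfolding tmax_def[of ?F]
  proof (rule SUP_least)
    fix \<epsilon> :: real assume "\<epsilon> \<in> {0<..}"
    then have e: "\<epsilon> > 0" by simp
    have "ennreal (cmod (trunc ?F \<epsilon> x)) \<le> ennreal ((3 + 107 * B) * l + cmod (trunc ?G \<epsilon> x))"
      by (intro ennreal_leI main e)
    also have "\<dots> = ennreal ((3 + 107 * B) * l) + ennreal (cmod (trunc ?G \<epsilon> x))"
      using B_pos l by (intro ennreal_plus) auto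
    also have "\<dots> \<le> ennreal ((3 + 107 * B) * l) + tmax ?G x" by (intro add_left_mono tmax_ge e)
    finally show "ennreal (cmod (trunc ?F \<epsilon> x)) \<le> ennreal ((3 + 107 * B) * l) + tmax ?G x" .
  qed
qed

text \<open>The last two clauses are the recursion for the maximal truncation: off the children it
  stops, on a child it passes to that child's localization. They hold at every point of the
  interval. Children may be empty, as the indices run over all naturals.\<close>

definition sparse_children :: "(real \<Rightarrow> complex) \<Rightarrow> real \<times> real \<Rightarrow> (nat \<Rightarrow> real \<times> real) \<Rightarrow> bool" where
  "sparse_children f p ch \<longleftrightarrow>
     (\<forall>n. fst (ch n) \<le> snd (ch n) \<and> {fst (ch n)<..<snd (ch n)} \<subseteq> {fst p<..<snd p}) \<and>
     disjoint_family (\<lambda>n. {fst (ch n)<..<snd (ch n)}) \<and>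
     emeasure lborel (\<Union>n. {fst (ch n)<..<snd (ch n)}) \<le> ennreal ((snd p - fst p) / 2) \<and>
     (\<forall>x\<in>{fst p<..<snd p}. x \<notin> (\<Union>n. {fst (ch n)<..<snd (ch n)}) \<longrightarrow>
        tmax (localized f p) x \<le> ennreal (sparse_const * triple_average f p)) \<and>
     (\<forall>n. \<forall>x\<in>{fst (ch n)<..<snd (ch n)}.
        tmax (localized f p) x \<le> ennreal (sparse_const * triple_average f p) + tmax (localized f (ch n)) x)"

text \<open>At a height \<open>l\<close> proportional to the triple average, the weak type bounds
  for the maximal truncation and for the maximal function confine the stopping set to a quarter of
  the interval. Its components are the children, and their endpoints interior to the parent lie
  outside the stopping set.\<close>

lemma sparse_children_exist:
  assumes f: "\<And>a b. set_integrable lborel {a<..<b} f" and p: "fst p \<le> snd p"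
  shows "\<exists>ch. sparse_children f p ch"
proof -
  define F where "F = localized f p"
  define \<alpha> where "\<alpha> = (LBINT t. cmod (F t))"
  define D where "D = 18 + 64 * B + 768 * B\<^sup>2"
  have D: "D > 0" using B_pos by (simp add: D_def add_pos_pos)
  have F: "integrable lborel F" unfolding F_def by (rule integrable_localized[OF f])
  have \<alpha>0: "\<alpha> \<ge> 0" by (simp add: \<alpha>_def)
  show ?thesis
  \<comment> \<open>In the degenerate case the interval is empty or the localization has norm 0 and
    all its truncations vanish; empty children suffice. Otherwise \<open>l\<close> below is
    positive.\<close>
  proof (cases "fst p = snd p \<or> \<alpha> = 0")
    case True
    have small: "tmax F x \<le> 0" if "x \<in> {fst p<..<snd p}" for x
    proof -
      have "\<alpha> = 0" using True that by auto
      then have "cmod (trunc F \<epsilon> x) \<le> 0" if "\<epsilon> > 0" for \<epsilon> using norm_trunc_le[OF F that, of x] by (simp add: \<alpha>_def)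
      then show ?thesis unfolding tmax_def by (intro SUP_least) auto
    qed
    show ?thesis
      by (rule exI[of _ "\<lambda>_. (fst p, fst p)"])
        (use small p in \<open>auto simp: sparse_children_def F_def disjoint_family_on_def intro: order_trans[OF _ zero_le]\<close>)
  next
    case False
    then have ab: "fst p < snd p" and \<alpha>: "\<alpha> > 0" using p \<alpha>0 by auto
    define w where "w = snd p - fst p"
    have w: "w > 0" using ab by (simp add: w_def)
    define l where "l = (4 * D + 8) * \<alpha> / w"
    have l: "l > 0" using D \<alpha> w by (simp add: l_def)
    have lS: "(3 + 107 * B) * l = sparse_const * triple_average f p"
      by (simp add: l_def sparse_const_def triple_average_def D_def \<alpha>_def F_def w_def)
    have lw: "l * (w / 4) = (D + 2) * \<alpha>" using w by (simp add: l_def field_simps)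
    define E1 where "E1 = {x. ennreal ((3 + 60 * B) * l) < tmax F x}"
    define E2 where "E2 = {x. ennreal l < hl_max lborel (\<lambda>t. ennreal (cmod (F t))) x}"
    define \<Omega> where "\<Omega> = {fst p<..<snd p} \<inter> (E1 \<union> E2)"
    have op: "open E1" "open E2" unfolding E1_def E2_def by (intro open_tmax_superlevel F open_hl_max_superlevel)+
    have op\<Omega>: "open \<Omega>" unfolding \<Omega>_def using op by auto
    have [measurable]: "F \<in> borel_measurable borel" using borel_measurable_integrable[OF F] by simp
    have N: "(\<integral>\<^sup>+t. ennreal (cmod (F t)) \<partial>lborel) = ennreal \<alpha>"
      unfolding \<alpha>_def using F by (intro nn_integral_eq_integral) auto
    have e1: "ennreal l * emeasure lborel E1 \<le> ennreal (D * \<alpha>)"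
      using tmax_weak_type_1[OF F l] D \<alpha> unfolding N E1_def D_def by (simp add: ennreal_mult)
    have e2: "ennreal l * emeasure lborel E2 \<le> ennreal (2 * \<alpha>)"
      using lborel.hl_max_weak_type[of "\<lambda>t. ennreal (cmod (F t))" "ennreal l"] \<alpha> unfolding N E2_def by (simp add: ennreal_mult)
    have "emeasure lborel \<Omega> \<le> emeasure lborel (E1 \<union> E2)"
      unfolding \<Omega>_def using op by (intro emeasure_mono) auto
    also have "\<dots> \<le> emeasure lborel E1 + emeasure lborel E2" using op by (intro emeasure_subadditive) auto
    finally have "ennreal l * emeasure lborel \<Omega> \<le> ennreal l * (emeasure lborel E1 + emeasure lborel E2)"
      by (rule mult_left_mono) simp
    also have "\<dots> \<le> ennreal (D * \<alpha>) + ennreal (2 * \<alpha>)" unfolding distrib_left by (intro add_mono e1 e2)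
    also have "\<dots> = ennreal ((D + 2) * \<alpha>)" using D \<alpha> by (subst ennreal_plus[symmetric]) (auto simp: algebra_simps)
    also have "\<dots> = ennreal l * ennreal (w / 4)" unfolding lw[symmetric] using l w by (intro ennreal_mult) auto
    finally have em: "emeasure lborel \<Omega> \<le> ennreal (w / 4)"
      using l by (subst (asm) ennreal_mult_le_mult_iff) auto
    then have fin: "emeasure lborel \<Omega> < \<infinity>" by (rule order.strict_trans1) simp
    obtain c d :: "nat \<Rightarrow> real" where cd0: "(\<forall>n. c n \<le> d n) \<and> \<Omega> = (\<Union>n. {c n<..<d n}) \<and>
      disjoint_family (\<lambda>n. {c n<..<d n}) \<and> (\<forall>n. c n < d n \<longrightarrow> c n \<notin> \<Omega> \<and> d n \<notin> \<Omega>)"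
      using open_set_component_intervals[OF op\<Omega> fin] by (elim exE)
    have c1: "\<forall>n. c n \<le> d n" using cd0 by (elim conjE)
    have c2: "\<Omega> = (\<Union>n. {c n<..<d n})" using cd0 by (elim conjE)
    have c3: "disjoint_family (\<lambda>n. {c n<..<d n})" using cd0 by (elim conjE)
    have c4: "\<forall>n. c n < d n \<longrightarrow> c n \<notin> \<Omega> \<and> d n \<notin> \<Omega>" using cd0 by (elim conjE)
    have sub: "{c n<..<d n} \<subseteq> \<Omega>" for n unfolding c2 by (rule UN_upper) simp
    then have sub': "{c n<..<d n} \<subseteq> {fst p<..<snd p}" for n unfolding \<Omega>_def by blast
    have out: "tmax F y \<le> ennreal ((3 + 60 * B) * l) \<and> hl_max lborel (\<lambda>t. ennreal (cmod (F t))) y \<le> ennreal l"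
      if "y \<in> {fst p<..<snd p}" "y \<notin> \<Omega>" for y
      using that unfolding \<Omega>_def E1_def E2_def by (simp add: not_less)
    have le: "(3 + 60 * B) * l \<le> (3 + 107 * B) * l" using B_pos l by (intro mult_right_mono) auto
    have child: "tmax F x \<le> ennreal ((3 + 107 * B) * l) + tmax (localized f (c n, d n)) x"
      if x: "x \<in> {c n<..<d n}" for n x
    proof -
      have lt: "c n < d n" using x by auto
      have ge: "fst p \<le> c n" "d n \<le> snd p"
        using sub'[of n] lt by (simp_all add: greaterThanLessThan_subseteq_greaterThanLessThan)
      \<comment> \<open>A component sharing both endpoints with its parent would fill it, against
        the bound by a quarter. So one endpoint is interior to the parent, hence outside
        \<open>\<Omega>\<close>, and serves as the point of comparison.\<close>
      have "\<not> (c n \<le> fst p \<and> snd p \<le> d n)"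
      proof
        assume "c n \<le> fst p \<and> snd p \<le> d n"
        then have "{fst p<..<snd p} \<subseteq> \<Omega>" using sub[of n] by auto
        then have "emeasure lborel {fst p<..<snd p} \<le> emeasure lborel \<Omega>" using op\<Omega> by (intro emeasure_mono) auto
        then have "ennreal w \<le> ennreal (w / 4)" using order_trans[OF _ em] ab by (simp add: w_def)
        then show False using w by (simp add: ennreal_le_iff)
      qed
      then obtain y where y: "y = c n \<or> y = d n" "y \<in> {fst p<..<snd p}"
        using ge lt by (metis greaterThanLessThan_iff le_less_trans less_le_trans not_le)
      then have "y \<notin> \<Omega>" using c4 lt by blast
      from out[OF y(2) this] show ?thesis
        unfolding F_def using l by (intro tmax_localized_child[OF f ge(1) lt ge(2) x y(1)]) auto
    qed
    show ?thesis
    proof (rule exI[of _ "\<lambda>n. (c n, d n)"], unfold sparse_children_def fst_conv snd_conv F_def[symmetric] lS[symmetric], intro conjI allI ballI impI)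
      show "c n \<le> d n" for n using c1 by blast
      show "{c n<..<d n} \<subseteq> {fst p<..<snd p}" for n by (rule sub')
      show "disjoint_family (\<lambda>n. {c n<..<d n})" by (rule c3)
      show "emeasure lborel (\<Union>n. {c n<..<d n}) \<le> ennreal ((snd p - fst p) / 2)"
        unfolding c2[symmetric] using w by (intro order_trans[OF em] ennreal_leI) (simp add: w_def)
      show "tmax F x \<le> ennreal ((3 + 107 * B) * l)" if "x \<in> {fst p<..<snd p}" "x \<notin> (\<Union>n. {c n<..<d n})" for x
        using out[OF that(1)] that(2) ennreal_leI[OF le] unfolding c2[symmetric] by (meson order_trans)
      show "tmax F x \<le> ennreal ((3 + 107 * B) * l) + tmax (localized f (c n, d n)) x" if "x \<in> {c n<..<d n}" for x n
        by (rule child[OF that])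
    qed
  qed
qed

end

subsection \<open>The tree of stopping intervals\<close>

text \<open>The path lists child indices with the deepest one first, so the ancestors of a node are
  the suffixes of its path.\<close>

primrec tree_node :: "(real \<times> real \<Rightarrow> nat \<Rightarrow> real \<times> real) \<Rightarrow> real \<times> real \<Rightarrow> nat list \<Rightarrow> real \<times> real" where
  "tree_node ch p [] = p"
| "tree_node ch p (n # s) = ch (tree_node ch p s) n"

locale interval_tree =
  fixes node :: "nat list \<Rightarrow> real \<times> real"
    and I :: "nat list \<Rightarrow> real set"
  defines "I \<equiv> \<lambda>s. {fst (node s)<..<snd (node s)}"
  assumes ordered: "fst (node s) \<le> snd (node s)"
    and nested: "I (n # s) \<subseteq> I s"
    and disjoint: "disjoint_family (\<lambda>n. I (n # s))"
    and halving: "emeasure lborel (\<Union>n. I (n # s)) \<le> ennreal ((snd (node s) - fst (node s)) / 2)"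
begin

definition E :: "nat list \<Rightarrow> real set" where "E s = I s - (\<Union>n. I (n # s))"

lemma borel_I [measurable]: "I s \<in> sets borel" by (simp add: I_def)

lemma borel_E [measurable]: "E s \<in> sets borel" by (simp add: E_def)

lemma I_drop: "I s \<subseteq> I (drop k s)"
proof (induction k arbitrary: s)
  case (Suc k)
  show ?case
  proof (cases s)
    case (Cons n u)
    then show ?thesis using Suc.IH[of u] nested[of n u] by auto
  qed simp
qed simp

lemma same_length_eq:
  assumes "x \<in> I s" "x \<in> I s'" "length s = length s'"
  shows "s = s'"
  using assms
proof (induction s arbitrary: s')
  case (Cons n s)
  then obtain m u where s': "s' = m # u" by (cases s') auto
  have "s = u" using Cons s' nested by (intro Cons.IH) auto
  moreover have "n = m"
    using Cons.prems disjoint[of s] \<open>s = u\<close> unfolding s' disjoint_family_on_def by blast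
  ultimately show ?case using s' by simp
qed simp

lemma E_longer_disjoint:
  assumes x: "x \<in> E s" "x \<in> I s'" and len: "length s < length s'"
  shows False
proof -
  \<comment> \<open>The ancestor \<open>drop (Suc k) s'\<close> stands at the level of
    \<open>s\<close> and contains \<open>x\<close>, so it is \<open>s\<close>; then
    \<open>drop k s'\<close> is a child of \<open>s\<close> containing \<open>x\<close>, which
    \<open>E s\<close> excludes.\<close>
  define k where "k = length s' - length s - 1"
  have k: "k < length s'" "length (drop (Suc k) s') = length s" using len by (auto simp: k_def)
  have xk: "x \<in> I (drop k s')" using x(2) I_drop by blast
  have dk: "drop k s' = s' ! k # drop (Suc k) s'" using k(1) by (simp add: Cons_nth_drop_Suc)
  have "x \<in> I (drop (Suc k) s')" using x(2) I_drop by blast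
  then have "drop (Suc k) s' = s" using x(1) k(2) by (intro same_length_eq) (auto simp: E_def)
  then have "x \<in> I (s' ! k # s)" using xk dk by simp
  then show False using x(1) by (auto simp: E_def)
qed

lemma E_disjoint: "s \<noteq> s' \<Longrightarrow> E s \<inter> E s' = {}"
proof (rule ccontr)
  assume ne: "s \<noteq> s'" "E s \<inter> E s' \<noteq> {}"
  then obtain x where x: "x \<in> E s" "x \<in> E s'" by blast
  then have xI: "x \<in> I s" "x \<in> I s'" by (auto simp: E_def)
  consider "length s = length s'" | "length s < length s'" | "length s' < length s" by linarith
  then show False
  proof cases
    case 1
    then show False using same_length_eq[OF xI] ne by simp
  qed (use E_longer_disjoint x xI in blast)+
qed

lemma emeasure_I_le: "emeasure lborel (I s) \<le> 2 * emeasure lborel (E s)"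
proof -
  define w where "w = snd (node s) - fst (node s)"
  have w: "w \<ge> 0" using ordered[of s] by (simp add: w_def)
  have Iw: "emeasure lborel (I s) = ennreal w" using ordered[of s] by (simp add: I_def w_def)
  have U: "(\<Union>n. I (n # s)) \<subseteq> I s" using nested by blast
  have "emeasure lborel (I s) \<le> emeasure lborel (E s) + emeasure lborel (\<Union>n. I (n # s))"
  proof -
    have "I s = E s \<union> (\<Union>n. I (n # s))" using U by (auto simp: E_def)
    then have "emeasure lborel (I s) = emeasure lborel (E s \<union> (\<Union>n. I (n # s)))" by simp
    also have "\<dots> \<le> emeasure lborel (E s) + emeasure lborel (\<Union>n. I (n # s))"
      by (intro emeasure_subadditive) auto
    finally show ?thesis .
  qed
  also have "\<dots> \<le> emeasure lborel (E s) + ennreal (w / 2)" using halving[of s] by (intro add_left_mono) (simp add: w_def)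
  finally have le: "ennreal w \<le> emeasure lborel (E s) + ennreal (w / 2)" by (simp add: Iw)
  have "ennreal (w / 2) \<le> emeasure lborel (E s)"
  proof (cases "emeasure lborel (E s)")
    case (real r)
    then have "ennreal w \<le> ennreal (r + w / 2)" using le w by (simp add: ennreal_plus)
    then have "w \<le> r + w / 2" using real w by (subst (asm) ennreal_le_iff) auto
    then have "w / 2 \<le> r" by simp
    then show ?thesis using real by (simp add: ennreal_leI)
  qed simp
  then have "2 * ennreal (w / 2) \<le> 2 * emeasure lborel (E s)" by (rule mult_left_mono) simp
  moreover have "2 * ennreal (w / 2) = ennreal w"
    using w by (metis ennreal_mult ennreal_numeral field_sum_of_halves mult_2 zero_le_numeral divide_nonneg_nonneg)
  ultimately show ?thesis by (simp add: Iw)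
qed

lemma E_disjoint_family: "disjoint_family (\<lambda>n. E (list_decode n))"
  unfolding disjoint_family_on_def
proof (intro ballI impI)
  fix m n :: nat assume "m \<noteq> n"
  then have "list_decode m \<noteq> list_decode n" by (metis list_decode_inverse)
  then show "E (list_decode m) \<inter> E (list_decode n) = {}" by (rule E_disjoint)
qed

text \<open>Borel--Cantelli: every interval has at most twice the measure of its set
  \<open>E s\<close>, and these are disjoint subsets of the root, so the measures of all intervals
  of the tree are summable. Hence the recursion terminates at almost every point.\<close>

lemma AE_finite_depth: "AE x in lborel. finite {s. x \<in> I s}"
proof -
  have sumE: "(\<Sum>n. emeasure lborel (E (list_decode n))) \<le> emeasure lborel (I [])"
  proof -
    have "(\<Sum>n. emeasure lborel (E (list_decode n))) = emeasure lborel (\<Union>n. E (list_decode n))"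
      by (intro suminf_emeasure E_disjoint_family) auto
    also have "\<dots> \<le> emeasure lborel (I [])"
    proof (intro emeasure_mono UN_least)
      fix n
      show "E (list_decode n) \<subseteq> I []"
        using I_drop[of "list_decode n" "length (list_decode n)"] by (auto simp: E_def)
    qed simp
    finally show ?thesis .
  qed
  have fin: "emeasure lborel (I s) < \<infinity>" for s using ordered[of s] by (simp add: I_def)
  have "(\<Sum>n. emeasure lborel (I (list_decode n))) \<le> (\<Sum>n. 2 * emeasure lborel (E (list_decode n)))"
    by (intro suminf_le summableI emeasure_I_le)
  also have "\<dots> = 2 * (\<Sum>n. emeasure lborel (E (list_decode n)))" by (rule ennreal_suminf_cmult)
  also have "\<dots> \<le> 2 * emeasure lborel (I [])" by (intro mult_left_mono sumE) simp
  also have "\<dots> < \<infinity>" using fin[of "[]"] by (simp add: ennreal_mult_less_top less_top)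
  finally have "(\<Sum>n. emeasure lborel (I (list_decode n))) < \<infinity>" .
  moreover have "emeasure lborel (I (list_decode n)) = ennreal (measure lborel (I (list_decode n)))" for n
    using fin[of "list_decode n"] by (intro emeasure_eq_ennreal_measure) auto
  ultimately have ne: "(\<Sum>n. ennreal (measure lborel (I (list_decode n)))) \<noteq> top" by (simp add: less_top)
  have "summable (\<lambda>n. measure lborel (I (list_decode n)))"
  proof (rule ccontr)
    assume "\<not> summable (\<lambda>n. measure lborel (I (list_decode n)))"
    from summable_iff_suminf_neq_top[OF _ this] ne show False by simp
  qed
  then have "AE x in lborel. eventually (\<lambda>n. x \<in> space lborel - I (list_decode n)) sequentially"
    using fin by (intro borel_cantelli_AE1) auto
  then show ?thesis
  proof eventually_elim
    case (elim x)
    then obtain N where N: "\<And>n. n \<ge> N \<Longrightarrow> x \<notin> I (list_decode n)" by (auto simp: eventually_sequentially)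
    have "{s. x \<in> I s} \<subseteq> list_decode ` {..<N}"
    proof
      fix s assume "s \<in> {s. x \<in> I s}"
      then have "list_encode s < N" using N[of "list_encode s"] by (auto simp: not_le[symmetric])
      then show "s \<in> list_decode ` {..<N}" by (intro image_eqI[of _ _ "list_encode s"]) auto
    qed
    then show ?case by (rule finite_subset) simp
  qed
qed

text \<open>Descending from the root through the intervals containing \<open>x\<close>, each step
  pays one term \<open>A s\<close>, and the descent ends because only finitely many intervals
  contain \<open>x\<close>. The nodes are enumerated by \<open>list_decode\<close>.\<close>

lemma stopping_sum:
  fixes T A :: "nat list \<Rightarrow> ennreal"
  assumes fin: "finite {s. x \<in> I s}" and x: "x \<in> I []"
    and stop: "\<And>s. x \<in> E s \<Longrightarrow> T s \<le> A s"
    and go: "\<And>s n. x \<in> I (n # s) \<Longrightarrow> T s \<le> A s + T (n # s)"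
  shows "T [] \<le> (\<Sum>n. A (list_decode n) * indicator (I (list_decode n)) x)"
proof -
  let ?W = "{s. x \<in> I s}"
  define M where "M = Max (length ` ?W)"
  have M: "length s \<le> M" if "x \<in> I s" for s using fin that by (auto simp: M_def)
  \<comment> \<open>The claim is generalised to every starting node and proved by induction on the
    depth left below it; each step adds the term for \<open>s\<close>, which is shorter than all
    paths still counted.\<close>
  have "T s \<le> (\<Sum>s'\<in>{s'\<in>?W. length s \<le> length s'}. A s')" if "x \<in> I s" for s
    using that
  proof (induction "M - length s" arbitrary: s rule: less_induct)
    case less
    let ?V = "{s'\<in>?W. length s \<le> length s'}"
    have V: "finite ?V" "s \<in> ?V" using fin less.prems by auto
    show ?case
    proof (cases "x \<in> E s")
      case True
      then have "T s \<le> A s" by (rule stop)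
      also have "\<dots> \<le> sum A ?V" by (rule member_le_sum[OF V(2) _ V(1)]) simp
      finally show ?thesis .
    next
      case False
      then obtain n where n: "x \<in> I (n # s)" using less.prems by (auto simp: E_def)
      have "T s \<le> A s + T (n # s)" by (rule go[OF n])
      also have "T (n # s) \<le> sum A {s'\<in>?W. length (n # s) \<le> length s'}"
        using M[OF n] by (intro less.hyps n) auto
      also have "A s + sum A {s'\<in>?W. length (n # s) \<le> length s'} = sum A (insert s {s'\<in>?W. length (n # s) \<le> length s'})"
        using fin by (subst sum.insert) auto
      also have "\<dots> \<le> sum A ?V" using V by (intro sum_mono2) auto
      finally show ?thesis by (simp add: add_left_mono)
    qed
  qed
  from this[OF x] have "T [] \<le> sum A ?W" by simp
  also have "\<dots> = (\<Sum>s\<in>?W. A s * indicator (I s) x)" by (intro sum.cong) auto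
  also have "\<dots> = (\<Sum>n\<in>list_encode ` ?W. A (list_decode n) * indicator (I (list_decode n)) x)"
    by (subst sum.reindex) (auto simp: inj_list_encode intro: inj_on_subset)
  also have "\<dots> \<le> (\<Sum>n. A (list_decode n) * indicator (I (list_decode n)) x)"
    using fin by (intro sum_le_suminf) auto
  finally show ?thesis .
qed

end

context cz_kernel
begin

text \<open>Children are chosen for every nondegenerate or empty interval at once, which turns the
  existence statement into a tree built by recursion on paths. The stopping sum at almost every
  point of the root is the sparse operator.\<close>

theorem sparse_domination:
  assumes f: "\<And>a b. set_integrable lborel {a<..<b} f" and p: "fst p \<le> snd p"
  obtains Q :: "nat \<Rightarrow> real \<times> real" and E :: "nat \<Rightarrow> real set"
  where "\<And>n. fst (Q n) \<le> snd (Q n)" "\<And>n. E n \<in> sets borel" "\<And>n. E n \<subseteq> {fst (Q n)<..<snd (Q n)}"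
    "\<And>n. emeasure lborel {fst (Q n)<..<snd (Q n)} \<le> 2 * emeasure lborel (E n)" "disjoint_family E"
    "AE x in lborel. x \<in> {fst p<..<snd p} \<longrightarrow> tmax (localized f p) x
       \<le> (\<Sum>n. ennreal (sparse_const * triple_average f (Q n)) * indicator {fst (Q n)<..<snd (Q n)} x)"
proof -
  define ch where "ch = (\<lambda>q. SOME c. sparse_children f q c)"
  have ch: "sparse_children f q (ch q)" if "fst q \<le> snd q" for q
    unfolding ch_def by (rule someI_ex[of "sparse_children f q"]) (rule sparse_children_exist[OF f that])
  define node where "node = tree_node ch p"
  have ord: "fst (node s) \<le> snd (node s)" for s
  proof (induction s)
    case (Cons n s)
    then show ?case using ch[of "node s"] by (simp add: node_def sparse_children_def)
  qed (simp add: node_def p)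
  have sc: "sparse_children f (node s) (\<lambda>n. node (n # s))" for s
    using ch[OF ord[of s]] by (simp add: node_def)
  interpret interval_tree node "\<lambda>s. {fst (node s)<..<snd (node s)}"
    by unfold_locales (use ord sc in \<open>simp_all add: sparse_children_def\<close>)
  define Q where "Q = (\<lambda>n. node (list_decode n))"
  show ?thesis
  proof (rule that[of Q "\<lambda>n. E (list_decode n)"])
    show "AE x in lborel. x \<in> {fst p<..<snd p} \<longrightarrow> tmax (localized f p) x
       \<le> (\<Sum>n. ennreal (sparse_const * triple_average f (Q n)) * indicator {fst (Q n)<..<snd (Q n)} x)"
      using AE_finite_depth
    proof eventually_elim
      case (elim x)
      show ?case
      proof
        assume x: "x \<in> {fst p<..<snd p}"
        let ?T = "\<lambda>s. tmax (localized f (node s)) x"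
        let ?A = "\<lambda>s. ennreal (sparse_const * triple_average f (node s))"
        have "?T [] \<le> (\<Sum>n. ?A (list_decode n) * indicator {fst (node (list_decode n))<..<snd (node (list_decode n))} x)"
        proof (rule stopping_sum[OF elim])
          show "x \<in> {fst (node [])<..<snd (node [])}" using x by (simp add: node_def)
          show "?T s \<le> ?A s" if "x \<in> E s" for s
            using that sc[of s] unfolding sparse_children_def E_def by blast
          show "?T s \<le> ?A s + ?T (n # s)" if "x \<in> {fst (node (n # s))<..<snd (node (n # s))}" for s n
            using that sc[of s] unfolding sparse_children_def by blast
        qed
        then show "tmax (localized f p) x \<le> (\<Sum>n. ennreal (sparse_const * triple_average f (Q n)) * indicator {fst (Q n)<..<snd (Q n)} x)"
          by (simp add: Q_def node_def)
      qed
    qed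
  qed (use ord emeasure_I_le E_disjoint_family in \<open>auto simp: Q_def E_def\<close>)
qed

end

subsection \<open>Weights\<close>

lemma (in locally_finite_measure) nn_integral_le_hl_max:
  assumes "a < x" "x < b"
  shows "(\<integral>\<^sup>+t\<in>{a<..<b}. \<phi> t \<partial>\<mu>) \<le> emeasure \<mu> {a<..<b} * hl_max \<mu> \<phi> x"
proof (cases "emeasure \<mu> {a<..<b} = 0")
  case True
  then have "{a<..<b} \<in> null_sets \<mu>" by (simp add: null_sets_def sets_eq)
  then have "AE t in \<mu>. \<phi> t * indicator {a<..<b} t = 0"
    by (rule AE_mp[OF AE_not_in]) (auto intro!: AE_I2)
  then have "(\<integral>\<^sup>+t\<in>{a<..<b}. \<phi> t \<partial>\<mu>) = (\<integral>\<^sup>+t. 0 \<partial>\<mu>)" by (rule nn_integral_cong_AE)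
  then show ?thesis by simp
next
  case False
  let ?m = "emeasure \<mu> {a<..<b}"
  have "(\<integral>\<^sup>+t\<in>{a<..<b}. \<phi> t \<partial>\<mu>) = (\<integral>\<^sup>+t\<in>{a<..<b}. \<phi> t \<partial>\<mu>) * ?m / ?m"
    using False finite_interval[of a b] by (intro ennreal_mult_divide_eq[symmetric]) auto
  also have "\<dots> = ?m * ((\<integral>\<^sup>+t\<in>{a<..<b}. \<phi> t \<partial>\<mu>) / ?m)" by (simp add: ennreal_times_divide mult.commute)
  also have "\<dots> \<le> ?m * hl_max \<mu> \<phi> x" by (intro mult_left_mono hl_max_ge assms) simp
  finally show ?thesis .
qed

text \<open>\<open>w\<close> is a Borel function and \<open>A\<close> any finite bound for the
  products of averages. Local finiteness of the inverse weight is derived: \<open>w\<close> has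
  positive mass on every interval, so an infinite mass of its inverse would make the product
  infinite.\<close>

locale muckenhoupt_weight =
  fixes w :: "real \<Rightarrow> real" and A :: ennreal
  assumes w_borel [measurable]: "w \<in> borel_measurable borel"
    and w_pos: "AE x in lborel. 0 < w x"
    and w_finite: "(\<integral>\<^sup>+x\<in>{a<..<b}. ennreal (w x) \<partial>lborel) < \<infinity>"
    and A_finite: "A < \<infinity>"
    and A2: "a < b \<Longrightarrow> (\<integral>\<^sup>+x\<in>{a<..<b}. ennreal (w x) \<partial>lborel) / ennreal (b - a) *
        ((\<integral>\<^sup>+x\<in>{a<..<b}. ennreal (inverse (w x)) \<partial>lborel) / ennreal (b - a)) \<le> A"
begin

definition \<mu> :: "real measure" where "\<mu> = density lborel (\<lambda>x. ennreal (w x))"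
definition \<nu> :: "real measure" where "\<nu> = density lborel (\<lambda>x. ennreal (inverse (w x)))"

lemma emeasure_\<mu>: "emeasure \<mu> {a<..<b} = (\<integral>\<^sup>+x\<in>{a<..<b}. ennreal (w x) \<partial>lborel)"
  unfolding \<mu>_def by (rule emeasure_density) auto

lemma emeasure_\<nu>: "emeasure \<nu> {a<..<b} = (\<integral>\<^sup>+x\<in>{a<..<b}. ennreal (inverse (w x)) \<partial>lborel)"
  unfolding \<nu>_def by (rule emeasure_density) auto

lemma A2_product:
  assumes "a < b"
  shows "emeasure \<mu> {a<..<b} * emeasure \<nu> {a<..<b} \<le> A * (ennreal (b - a))\<^sup>2"
proof -
  let ?h = "ennreal (b - a)"
  have cancel: "?h * (z / ?h) = z" for z :: ennreal
  proof -
    have "?h * (z / ?h) = z * ?h / ?h" by (simp add: ennreal_times_divide mult.commute)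
    also have "\<dots> = z" using assms by (intro ennreal_mult_divide_eq) auto
    finally show ?thesis .
  qed
  have "emeasure \<mu> {a<..<b} * emeasure \<nu> {a<..<b} = (?h * (emeasure \<mu> {a<..<b} / ?h)) * (?h * (emeasure \<nu> {a<..<b} / ?h))"
    by (simp only: cancel)
  also have "\<dots> = (emeasure \<mu> {a<..<b} / ?h * (emeasure \<nu> {a<..<b} / ?h)) * ?h\<^sup>2"
    by (simp only: power2_eq_square mult_ac)
  also have "\<dots> \<le> A * ?h\<^sup>2"
    unfolding emeasure_\<mu> emeasure_\<nu> by (intro mult_right_mono A2 assms) simp
  finally show ?thesis .
qed

lemma \<mu>_pos: "a < b \<Longrightarrow> emeasure \<mu> {a<..<b} > 0"
proof (rule ccontr)
  assume ab: "a < b" and "\<not> emeasure \<mu> {a<..<b} > 0"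
  then have "(\<integral>\<^sup>+x\<in>{a<..<b}. ennreal (w x) \<partial>lborel) = 0" by (simp add: emeasure_\<mu>)
  then have "AE x in lborel. ennreal (w x) * indicator {a<..<b} x = 0"
    by (subst (asm) nn_integral_0_iff_AE) auto
  then have "AE x in lborel. x \<notin> {a<..<b}"
    using w_pos by eventually_elim (auto simp: indicator_def split: if_splits)
  then have "{a<..<b} \<in> null_sets lborel" by (subst (asm) AE_iff_null_sets[symmetric]) auto
  then have "emeasure lborel {a<..<b} = 0" by (rule null_setsD1)
  then show False using ab by simp
qed

sublocale \<mu>: locally_finite_measure \<mu>
  by unfold_locales (simp_all only: emeasure_\<mu> w_finite, simp add: \<mu>_def)

sublocale \<nu>: locally_finite_measure \<nu>
proof
  show "sets \<nu> = sets borel" by (simp add: \<nu>_def)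
  fix a b :: real
  show "emeasure \<nu> {a<..<b} < \<infinity>"
  proof (cases "a < b")
    case True
    show ?thesis
    proof (rule ccontr)
      assume "\<not> emeasure \<nu> {a<..<b} < \<infinity>"
      then have "emeasure \<nu> {a<..<b} = top" by (simp add: less_top[symmetric])
      then have "emeasure \<mu> {a<..<b} * emeasure \<nu> {a<..<b} = top"
        using \<mu>_pos[OF True] by (simp add: ennreal_mult_top)
      then have "A * (ennreal (b - a))\<^sup>2 = top" using A2_product[OF True] by (simp add: top_unique)
      then show False using A_finite by (simp add: ennreal_mult_eq_top_iff power_eq_top_ennreal)
    qed
  qed simp
qed

lemma nn_integral_\<mu>: "\<phi> \<in> borel_measurable borel \<Longrightarrow> (\<integral>\<^sup>+x. \<phi> x \<partial>\<mu>) = (\<integral>\<^sup>+x. ennreal (w x) * \<phi> x \<partial>lborel)"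
  unfolding \<mu>_def by (rule nn_integral_density) auto

lemma nn_integral_\<nu>: "\<phi> \<in> borel_measurable borel \<Longrightarrow> (\<integral>\<^sup>+x. \<phi> x \<partial>\<nu>) = (\<integral>\<^sup>+x. ennreal (inverse (w x)) * \<phi> x \<partial>lborel)"
  unfolding \<nu>_def by (rule nn_integral_density) auto

lemma w_inverse: "AE x in lborel. ennreal (w x) * ennreal (inverse (w x)) = 1"
  using w_pos by eventually_elim (simp add: ennreal_mult[symmetric])

text \<open>
  This is the composition bound \<open>M f \<le> [w] M\<^sub>\<nu> (M\<^sub>\<mu> (f / w) w)\<close>, with the two weights interchanged,
  for the Hardy--Littlewood operator \<open>M\<close>.
\<close>
lemma hl_max_composition:
  assumes [measurable]: "\<phi> \<in> borel_measurable borel"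
  shows "hl_max lborel \<phi> x \<le> A * hl_max \<nu> (\<lambda>y. hl_max \<mu> (\<lambda>t. \<phi> t * ennreal (inverse (w t))) y * ennreal (w y)) x"
  unfolding hl_max_def[of lborel]
proof (rule SUP_least, clarify)
  fix a b assume ab: "a < x" "x < b"
  let ?I = "{a<..<b}"
  let ?\<psi> = "\<lambda>t. \<phi> t * ennreal (inverse (w t))"
  let ?h = "ennreal (b - a)"
  let ?N = "hl_max \<nu> (\<lambda>y. hl_max \<mu> ?\<psi> y * ennreal (w y)) x"
  have lt: "a < b" using ab by simp
  have \<phi>\<psi>: "(\<integral>\<^sup>+t\<in>?I. \<phi> t \<partial>lborel) = (\<integral>\<^sup>+t\<in>?I. ?\<psi> t \<partial>\<mu>)"
  proof -
    have "(\<integral>\<^sup>+t\<in>?I. ?\<psi> t \<partial>\<mu>) = (\<integral>\<^sup>+t. ennreal (w t) * (?\<psi> t * indicator ?I t) \<partial>lborel)"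
      by (rule nn_integral_\<mu>) measurable
    also have "\<dots> = (\<integral>\<^sup>+t\<in>?I. \<phi> t \<partial>lborel)"
    proof (rule nn_integral_cong_AE)
      show "AE t in lborel. ennreal (w t) * (?\<psi> t * indicator ?I t) = \<phi> t * indicator ?I t"
        using w_inverse
      proof eventually_elim
        case (elim t)
        have "ennreal (w t) * (?\<psi> t * indicator ?I t) = (ennreal (w t) * ennreal (inverse (w t))) * (\<phi> t * indicator ?I t)"
          by (simp only: mult_ac)
        then show ?case by (simp only: elim mult_1_left)
      qed
    qed
    finally show ?thesis by simp
  qed
  \<comment> \<open>The integral over \<open>?I\<close> is bounded by the mass times the maximal
    function at each \<open>y\<close> in \<open>?I\<close>. Integrating over \<open>y\<close> and
    rewriting the result as an integral against \<open>\<nu>\<close> allows the same step once more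
    at \<open>x\<close>; the two masses then meet in the A2 product.\<close>
  have "?h * (\<integral>\<^sup>+t\<in>?I. \<phi> t \<partial>lborel) = (\<integral>\<^sup>+y\<in>?I. (\<integral>\<^sup>+t\<in>?I. ?\<psi> t \<partial>\<mu>) \<partial>lborel)"
    unfolding \<phi>\<psi> using lt by (subst nn_integral_cmult_indicator) (auto simp: mult.commute)
  also have "\<dots> \<le> (\<integral>\<^sup>+y. emeasure \<mu> ?I * (hl_max \<mu> ?\<psi> y * indicator ?I y) \<partial>lborel)"
  proof (rule nn_integral_mono)
    fix y
    show "(\<integral>\<^sup>+t\<in>?I. ?\<psi> t \<partial>\<mu>) * indicator ?I y \<le> emeasure \<mu> ?I * (hl_max \<mu> ?\<psi> y * indicator ?I y)"
      using \<mu>.nn_integral_le_hl_max[of a y b ?\<psi>] by (auto simp: indicator_def)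
  qed
  also have "\<dots> = emeasure \<mu> ?I * (\<integral>\<^sup>+y\<in>?I. hl_max \<mu> ?\<psi> y \<partial>lborel)" by (rule nn_integral_cmult) measurable
  also have "(\<integral>\<^sup>+y\<in>?I. hl_max \<mu> ?\<psi> y \<partial>lborel) = (\<integral>\<^sup>+y\<in>?I. hl_max \<mu> ?\<psi> y * ennreal (w y) \<partial>\<nu>)"
  proof -
    have "(\<integral>\<^sup>+y\<in>?I. hl_max \<mu> ?\<psi> y * ennreal (w y) \<partial>\<nu>) = (\<integral>\<^sup>+y. ennreal (inverse (w y)) * (hl_max \<mu> ?\<psi> y * ennreal (w y) * indicator ?I y) \<partial>lborel)"
      by (rule nn_integral_\<nu>) measurable
    also have "\<dots> = (\<integral>\<^sup>+y\<in>?I. hl_max \<mu> ?\<psi> y \<partial>lborel)"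
    proof (rule nn_integral_cong_AE)
      show "AE y in lborel. ennreal (inverse (w y)) * (hl_max \<mu> ?\<psi> y * ennreal (w y) * indicator ?I y) = hl_max \<mu> ?\<psi> y * indicator ?I y"
        using w_inverse
      proof eventually_elim
        case (elim y)
        have "ennreal (inverse (w y)) * (hl_max \<mu> ?\<psi> y * ennreal (w y) * indicator ?I y) = (ennreal (w y) * ennreal (inverse (w y))) * (hl_max \<mu> ?\<psi> y * indicator ?I y)"
          by (simp only: mult_ac)
        then show ?case by (simp only: elim mult_1_left)
      qed
    qed
    finally show ?thesis by simp
  qed
  also have "emeasure \<mu> ?I * \<dots> \<le> emeasure \<mu> ?I * (emeasure \<nu> ?I * ?N)"
    by (intro mult_left_mono \<nu>.nn_integral_le_hl_max ab) simp
  also have "\<dots> = (emeasure \<mu> ?I * emeasure \<nu> ?I) * ?N" by (simp only: mult.assoc)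
  also have "\<dots> \<le> (A * ?h\<^sup>2) * ?N" by (intro mult_right_mono A2_product lt) simp
  also have "\<dots> = ?h * (?h * (A * ?N))" by (simp only: power2_eq_square mult_ac)
  finally have "?h * (\<integral>\<^sup>+t\<in>?I. \<phi> t \<partial>lborel) \<le> ?h * (?h * (A * ?N))" .
  then have "(\<integral>\<^sup>+t\<in>?I. \<phi> t \<partial>lborel) \<le> (A * ?N) * ?h"
    using lt by (subst (asm) ennreal_mult_le_mult_iff) (auto simp: mult.commute)
  then have "(\<integral>\<^sup>+t\<in>?I. \<phi> t \<partial>lborel) / ?h \<le> (A * ?N) * ?h / ?h" by (rule divide_right_mono_ennreal)
  also have "\<dots> = A * ?N" using lt by (intro ennreal_mult_divide_eq) auto
  finally show "(\<integral>\<^sup>+t\<in>?I. \<phi> t \<partial>lborel) / emeasure lborel ?I \<le> A * ?N" using lt by simp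
qed

text \<open>The maximal function of the indicator of (0,1) is at least 1 / (2 (1 + |t|)). The
  composition bound with the two strong type inequalities makes it square integrable against the
  inverse weight, since the indicator itself is. By Cauchy--Schwarz, functions in the weighted space
  are then integrable against 1 / (1 + |t|).\<close>

lemma inverse_weight_tail_finite:
  "(\<integral>\<^sup>+t. ennreal (inverse (w t)) * (ennreal (1 / (1 + \<bar>t\<bar>)))\<^sup>2 \<partial>lborel) < \<infinity>"
proof -
  let ?\<chi> = "\<lambda>t::real. indicator {0<..<1} t :: ennreal"
  let ?\<psi> = "\<lambda>t. ?\<chi> t * ennreal (inverse (w t))"
  let ?m = "hl_max lborel ?\<chi>"
  have pt: "ennreal (1 / (1 + \<bar>t\<bar>)) \<le> 2 * ?m t" for t
  proof -
    let ?r = "\<bar>t\<bar> + 1"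
    have "(\<integral>\<^sup>+s\<in>{-?r<..<?r}. ?\<chi> s \<partial>lborel) = (\<integral>\<^sup>+s. ?\<chi> s \<partial>lborel)"
      by (intro nn_integral_cong) (auto simp: indicator_def)
    then have "(\<integral>\<^sup>+s\<in>{-?r<..<?r}. ?\<chi> s \<partial>lborel) = ennreal 1" by simp
    moreover have "emeasure lborel {-?r<..<?r} = ennreal (2 * ?r)" by simp
    ultimately have "ennreal 1 / ennreal (2 * ?r) \<le> ?m t"
      using hl_max_ge[of "-?r" t ?r lborel ?\<chi>] by (auto simp: abs_less_iff)
    then have "2 * (ennreal 1 / ennreal (2 * ?r)) \<le> 2 * ?m t" by (rule mult_left_mono) simp
    moreover have "2 * (ennreal 1 / ennreal (2 * ?r)) = ennreal (2 * (1 / (2 * ?r)))"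
    proof -
      have "2 * (ennreal 1 / ennreal (2 * ?r)) = ennreal 2 * ennreal (1 / (2 * ?r))" by (subst divide_ennreal) auto
      also have "\<dots> = ennreal (2 * (1 / (2 * ?r)))" by (intro ennreal_mult[symmetric]) auto
      finally show ?thesis .
    qed
    moreover have "2 * (1 / (2 * ?r)) = 1 / (1 + \<bar>t\<bar>)" by (simp add: field_simps)
    ultimately show ?thesis by simp
  qed
  let ?N = "\<lambda>y. hl_max \<mu> ?\<psi> y * ennreal (w y)"
  have "(\<integral>\<^sup>+t. ennreal (inverse (w t)) * (ennreal (1 / (1 + \<bar>t\<bar>)))\<^sup>2 \<partial>lborel) = (\<integral>\<^sup>+t. (ennreal (1 / (1 + \<bar>t\<bar>)))\<^sup>2 \<partial>\<nu>)"
    by (rule nn_integral_\<nu>[symmetric]) measurable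
  also have "\<dots> \<le> (\<integral>\<^sup>+t. (2 * A)\<^sup>2 * (hl_max \<nu> ?N t)\<^sup>2 \<partial>\<nu>)"
  proof (rule nn_integral_mono)
    fix t
    have "ennreal (1 / (1 + \<bar>t\<bar>)) \<le> 2 * (A * hl_max \<nu> ?N t)"
      using hl_max_composition[of ?\<chi> t] by (intro order_trans[OF pt] mult_left_mono) auto
    then have "(ennreal (1 / (1 + \<bar>t\<bar>)))\<^sup>2 \<le> (2 * (A * hl_max \<nu> ?N t))\<^sup>2" by (rule power_mono) simp
    also have "\<dots> = (2 * A)\<^sup>2 * (hl_max \<nu> ?N t)\<^sup>2" by (simp only: power_mult_distrib mult.assoc)
    finally show "(ennreal (1 / (1 + \<bar>t\<bar>)))\<^sup>2 \<le> (2 * A)\<^sup>2 * (hl_max \<nu> ?N t)\<^sup>2" .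
  qed
  also have "\<dots> = (2 * A)\<^sup>2 * (\<integral>\<^sup>+t. (hl_max \<nu> ?N t)\<^sup>2 \<partial>\<nu>)" by (rule nn_integral_cmult) measurable
  also have "\<dots> \<le> (2 * A)\<^sup>2 * (16 * (\<integral>\<^sup>+t. (?N t)\<^sup>2 \<partial>\<nu>))"
    by (intro mult_left_mono \<nu>.hl_max_strong_type) auto
  also have "(\<integral>\<^sup>+t. (?N t)\<^sup>2 \<partial>\<nu>) = (\<integral>\<^sup>+t. (hl_max \<mu> ?\<psi> t)\<^sup>2 \<partial>\<mu>)"
  proof -
    have "(\<integral>\<^sup>+t. (?N t)\<^sup>2 \<partial>\<nu>) = (\<integral>\<^sup>+t. ennreal (inverse (w t)) * (?N t)\<^sup>2 \<partial>lborel)"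
      by (rule nn_integral_\<nu>) measurable
    also have "\<dots> = (\<integral>\<^sup>+t. ennreal (w t) * (hl_max \<mu> ?\<psi> t)\<^sup>2 \<partial>lborel)"
    proof (rule nn_integral_cong_AE)
      show "AE t in lborel. ennreal (inverse (w t)) * (?N t)\<^sup>2 = ennreal (w t) * (hl_max \<mu> ?\<psi> t)\<^sup>2"
        using w_inverse
      proof eventually_elim
        case (elim t)
        have "ennreal (inverse (w t)) * (?N t)\<^sup>2 = (ennreal (w t) * ennreal (inverse (w t))) * (ennreal (w t) * (hl_max \<mu> ?\<psi> t)\<^sup>2)"
          by (simp only: power2_eq_square mult_ac)
        then show ?case by (simp only: elim mult_1_left)
      qed
    qed
    also have "\<dots> = (\<integral>\<^sup>+t. (hl_max \<mu> ?\<psi> t)\<^sup>2 \<partial>\<mu>)" by (rule nn_integral_\<mu>[symmetric]) measurable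
    finally show ?thesis .
  qed
  also have "(2 * A)\<^sup>2 * (16 * (\<integral>\<^sup>+t. (hl_max \<mu> ?\<psi> t)\<^sup>2 \<partial>\<mu>)) \<le> (2 * A)\<^sup>2 * (16 * (16 * (\<integral>\<^sup>+t. (?\<psi> t)\<^sup>2 \<partial>\<mu>)))"
    by (intro mult_left_mono \<mu>.hl_max_strong_type) auto
  also have "(\<integral>\<^sup>+t. (?\<psi> t)\<^sup>2 \<partial>\<mu>) = emeasure \<nu> {0<..<1}"
  proof -
    have "(\<integral>\<^sup>+t. (?\<psi> t)\<^sup>2 \<partial>\<mu>) = (\<integral>\<^sup>+t. ennreal (w t) * (?\<psi> t)\<^sup>2 \<partial>lborel)"
      by (rule nn_integral_\<mu>) measurable
    also have "\<dots> = (\<integral>\<^sup>+t. ennreal (inverse (w t)) * indicator {0<..<1} t \<partial>lborel)"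
    proof (rule nn_integral_cong_AE)
      show "AE t in lborel. ennreal (w t) * (?\<psi> t)\<^sup>2 = ennreal (inverse (w t)) * indicator {0<..<1} t"
        using w_inverse
      proof eventually_elim
        case (elim t)
        have "ennreal (w t) * (?\<psi> t)\<^sup>2 = (ennreal (w t) * ennreal (inverse (w t))) * (ennreal (inverse (w t)) * (?\<chi> t)\<^sup>2)"
          by (simp only: power2_eq_square mult_ac)
        also have "(?\<chi> t)\<^sup>2 = ?\<chi> t" by (simp add: indicator_def)
        finally show ?case by (simp only: elim mult_1_left)
      qed
    qed
    finally show ?thesis by (simp only: emeasure_\<nu>)
  qed
  also have "(2 * A)\<^sup>2 * (16 * (16 * emeasure \<nu> {0<..<1})) < \<infinity>"
    using A_finite \<nu>.finite_interval[of 0 1] by (simp add: ennreal_mult_less_top power_less_top_ennreal)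
  finally show ?thesis .
qed

text \<open>At each point of \<open>E\<close> both integrals are bounded by a mass of the triple
  times a maximal function. The A2 condition on the triple, of length 3 (d - c), gives the factor 9,
  and replacing the measure of \<open>E\<close> by that of the interval gives the factor 2.\<close>

lemma sparse_form_summand:
  assumes [measurable]: "\<phi> \<in> borel_measurable borel" "g \<in> borel_measurable borel" "E \<in> sets borel"
    and cd: "c \<le> d" and E: "E \<subseteq> {c<..<d}" "emeasure lborel {c<..<d} \<le> 2 * emeasure lborel E"
  shows "(\<integral>\<^sup>+t\<in>{2 * c - d<..<2 * d - c}. \<phi> t \<partial>\<nu>) / ennreal (d - c) * (\<integral>\<^sup>+t\<in>{c<..<d}. g t \<partial>\<mu>)
    \<le> 18 * A * (\<integral>\<^sup>+x\<in>E. hl_max \<nu> \<phi> x * hl_max \<mu> g x \<partial>lborel)"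
proof (cases "c = d")
  case True
  then show ?thesis by simp
next
  case False
  let ?J = "{2 * c - d<..<2 * d - c}"
  let ?\<alpha> = "\<integral>\<^sup>+t\<in>?J. \<phi> t \<partial>\<nu>" and ?\<gamma> = "\<integral>\<^sup>+t\<in>{c<..<d}. g t \<partial>\<mu>"
  let ?P = "\<lambda>x. hl_max \<nu> \<phi> x * hl_max \<mu> g x"
  let ?l = "ennreal (d - c)"
  have lt: "c < d" using cd False by simp
  have pt: "?\<alpha> * ?\<gamma> * indicator E x \<le> 9 * A * ?l\<^sup>2 * (?P x * indicator E x)" for x
  proof (cases "x \<in> E")
    case True
    then have x: "2 * c - d < x" "x < 2 * d - c" using E(1) lt by auto
    have "?\<gamma> \<le> (\<integral>\<^sup>+t\<in>?J. g t \<partial>\<mu>)"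
      using lt by (intro nn_integral_mono) (auto simp: indicator_def)
    also have "\<dots> \<le> emeasure \<mu> ?J * hl_max \<mu> g x" by (rule \<mu>.nn_integral_le_hl_max[OF x])
    finally have "?\<alpha> * ?\<gamma> \<le> (emeasure \<nu> ?J * hl_max \<nu> \<phi> x) * (emeasure \<mu> ?J * hl_max \<mu> g x)"
      by (intro mult_mono \<nu>.nn_integral_le_hl_max[OF x]) auto
    also have "\<dots> = (emeasure \<mu> ?J * emeasure \<nu> ?J) * ?P x" by (simp only: mult_ac)
    also have "\<dots> \<le> (A * (ennreal ((2 * d - c) - (2 * c - d)))\<^sup>2) * ?P x"
      using lt by (intro mult_right_mono A2_product) auto
    also have "ennreal ((2 * d - c) - (2 * c - d)) = ennreal 3 * ?l"
      using lt by (subst ennreal_mult[symmetric]) (auto simp: algebra_simps)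
    also have "A * (ennreal 3 * ?l)\<^sup>2 = 9 * A * ?l\<^sup>2"
    proof -
      have "(ennreal 3)\<^sup>2 = 9" by (simp add: power2_eq_square flip: ennreal_mult)
      then show ?thesis by (simp only: power_mult_distrib mult_ac)
    qed
    finally show ?thesis using True by simp
  qed simp
  have "?\<alpha> * ?\<gamma> * emeasure lborel E = (\<integral>\<^sup>+x. ?\<alpha> * ?\<gamma> * indicator E x \<partial>lborel)"
    by (rule nn_integral_cmult_indicator[symmetric]) simp
  also have "\<dots> \<le> (\<integral>\<^sup>+x. 9 * A * ?l\<^sup>2 * (?P x * indicator E x) \<partial>lborel)" by (intro nn_integral_mono pt)
  also have "\<dots> = 9 * A * ?l\<^sup>2 * (\<integral>\<^sup>+x\<in>E. ?P x \<partial>lborel)" by (rule nn_integral_cmult) measurable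
  finally have main: "?\<alpha> * ?\<gamma> * emeasure lborel E \<le> 9 * A * ?l\<^sup>2 * (\<integral>\<^sup>+x\<in>E. ?P x \<partial>lborel)" .
  let ?X = "18 * A * (\<integral>\<^sup>+x\<in>E. ?P x \<partial>lborel)"
  have "?l \<le> 2 * emeasure lborel E" using E(2) lt by simp
  then have "?\<alpha> * ?\<gamma> * ?l \<le> ?\<alpha> * ?\<gamma> * (2 * emeasure lborel E)" by (rule mult_left_mono) simp
  also have "\<dots> = 2 * (?\<alpha> * ?\<gamma> * emeasure lborel E)" by (simp only: mult_ac)
  also have "\<dots> \<le> 2 * (9 * A * ?l\<^sup>2 * (\<integral>\<^sup>+x\<in>E. ?P x \<partial>lborel))" by (rule mult_left_mono[OF main]) simp
  also have "\<dots> = (2 * 9) * A * ?l\<^sup>2 * (\<integral>\<^sup>+x\<in>E. ?P x \<partial>lborel)" by (simp only: mult.assoc)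
  also have "\<dots> = ?X * ?l * ?l" by (simp add: power2_eq_square mult_ac)
  finally have "?l * (?\<alpha> * ?\<gamma>) \<le> ?l * (?X * ?l)" by (simp only: mult.commute)
  then have "?\<alpha> * ?\<gamma> \<le> ?X * ?l"
    using lt by (subst (asm) ennreal_mult_le_mult_iff) auto
  then have "?\<alpha> * ?\<gamma> / ?l \<le> ?X * ?l / ?l" by (rule divide_right_mono_ennreal)
  also have "\<dots> = ?X" using lt by (intro ennreal_mult_divide_eq) auto
  finally show ?thesis by (simp add: ennreal_divide_times ennreal_times_divide mult.commute)
qed

text \<open>Cauchy--Schwarz after inserting sqrt(1 / w) sqrt(w) = 1, then the strong type bound for
  each measure; 256 = 16 * 16. The inequality is kept in squared form.\<close>

lemma hl_max_product_bound:
  assumes [measurable]: "\<phi> \<in> borel_measurable borel" "g \<in> borel_measurable borel"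
  shows "(\<integral>\<^sup>+x. hl_max \<nu> \<phi> x * hl_max \<mu> g x \<partial>lborel)\<^sup>2
    \<le> 256 * (\<integral>\<^sup>+t. (\<phi> t)\<^sup>2 \<partial>\<nu>) * (\<integral>\<^sup>+t. (g t)\<^sup>2 \<partial>\<mu>)"
proof -
  let ?u = "\<lambda>x. ennreal (sqrt (inverse (w x)))" and ?v = "\<lambda>x. ennreal (sqrt (w x))"
  have sq: "AE x in lborel. ?u x * ?v x = 1 \<and> (?u x)\<^sup>2 = ennreal (inverse (w x)) \<and> (?v x)\<^sup>2 = ennreal (w x)"
    using w_pos
  proof eventually_elim
    case (elim x)
    then have "sqrt (inverse (w x)) * sqrt (w x) = 1" by (simp flip: real_sqrt_mult)
    then show ?case using elim by (simp add: ennreal_power flip: ennreal_mult)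
  qed
  have "(\<integral>\<^sup>+x. hl_max \<nu> \<phi> x * hl_max \<mu> g x \<partial>lborel) = (\<integral>\<^sup>+x. (hl_max \<nu> \<phi> x * ?u x) * (hl_max \<mu> g x * ?v x) \<partial>lborel)"
  proof (rule nn_integral_cong_AE)
    show "AE x in lborel. hl_max \<nu> \<phi> x * hl_max \<mu> g x = (hl_max \<nu> \<phi> x * ?u x) * (hl_max \<mu> g x * ?v x)"
      using sq
    proof eventually_elim
      case (elim x)
      have "(hl_max \<nu> \<phi> x * ?u x) * (hl_max \<mu> g x * ?v x) = (hl_max \<nu> \<phi> x * hl_max \<mu> g x) * (?u x * ?v x)"
        by (simp only: mult_ac)
      then show ?case using elim by (simp only: mult_1_right)
    qed
  qed
  then have "(\<integral>\<^sup>+x. hl_max \<nu> \<phi> x * hl_max \<mu> g x \<partial>lborel)\<^sup>2 \<le>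
    (\<integral>\<^sup>+x. (hl_max \<nu> \<phi> x * ?u x)\<^sup>2 \<partial>lborel) * (\<integral>\<^sup>+x. (hl_max \<mu> g x * ?v x)\<^sup>2 \<partial>lborel)"
    by (simp only:) (rule Cauchy_Schwarz_nn_integral; measurable)
  also have "(\<integral>\<^sup>+x. (hl_max \<nu> \<phi> x * ?u x)\<^sup>2 \<partial>lborel) = (\<integral>\<^sup>+x. (hl_max \<nu> \<phi> x)\<^sup>2 \<partial>\<nu>)"
  proof -
    have "(\<integral>\<^sup>+x. (hl_max \<nu> \<phi> x)\<^sup>2 \<partial>\<nu>) = (\<integral>\<^sup>+x. ennreal (inverse (w x)) * (hl_max \<nu> \<phi> x)\<^sup>2 \<partial>lborel)"
      by (rule nn_integral_\<nu>) measurable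
    also have "\<dots> = (\<integral>\<^sup>+x. (hl_max \<nu> \<phi> x * ?u x)\<^sup>2 \<partial>lborel)"
      by (rule nn_integral_cong_AE, use sq in eventually_elim) (simp only: power_mult_distrib mult.commute)
    finally show ?thesis by simp
  qed
  also have "(\<integral>\<^sup>+x. (hl_max \<mu> g x * ?v x)\<^sup>2 \<partial>lborel) = (\<integral>\<^sup>+x. (hl_max \<mu> g x)\<^sup>2 \<partial>\<mu>)"
  proof -
    have "(\<integral>\<^sup>+x. (hl_max \<mu> g x)\<^sup>2 \<partial>\<mu>) = (\<integral>\<^sup>+x. ennreal (w x) * (hl_max \<mu> g x)\<^sup>2 \<partial>lborel)"
      by (rule nn_integral_\<mu>) measurable
    also have "\<dots> = (\<integral>\<^sup>+x. (hl_max \<mu> g x * ?v x)\<^sup>2 \<partial>lborel)"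
      by (rule nn_integral_cong_AE, use sq in eventually_elim) (simp only: power_mult_distrib mult.commute)
    finally show ?thesis by simp
  qed
  also have "(\<integral>\<^sup>+x. (hl_max \<nu> \<phi> x)\<^sup>2 \<partial>\<nu>) * (\<integral>\<^sup>+x. (hl_max \<mu> g x)\<^sup>2 \<partial>\<mu>)
    \<le> (16 * (\<integral>\<^sup>+t. (\<phi> t)\<^sup>2 \<partial>\<nu>)) * (16 * (\<integral>\<^sup>+t. (g t)\<^sup>2 \<partial>\<mu>))"
    by (intro mult_mono \<nu>.hl_max_strong_type \<mu>.hl_max_strong_type) auto
  also have "\<dots> = (16 * 16) * (\<integral>\<^sup>+t. (\<phi> t)\<^sup>2 \<partial>\<nu>) * (\<integral>\<^sup>+t. (g t)\<^sup>2 \<partial>\<mu>)" by (simp only: mult_ac)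
  finally show ?thesis by simp
qed

text \<open>Duality: the pairing with any \<open>g\<close> is estimated summand by summand, and the
  disjointness of the sets \<open>E n\<close> recombines the integrals. With the operator itself as
  test function one factor of the norm cancels. The constant is 288 = 18 * 16, where 16 is the
  square root of 256.\<close>

lemma sparse_operator_bound:
  fixes Q :: "nat \<Rightarrow> real \<times> real" and E :: "nat \<Rightarrow> real set"
  assumes [measurable]: "\<phi> \<in> borel_measurable borel" "\<And>n. E n \<in> sets borel"
    and Q: "\<And>n. fst (Q n) \<le> snd (Q n)" and E: "\<And>n. E n \<subseteq> {fst (Q n)<..<snd (Q n)}"
      "\<And>n. emeasure lborel {fst (Q n)<..<snd (Q n)} \<le> 2 * emeasure lborel (E n)" "disjoint_family E"
    and s: "\<And>n. fst (Q n) < snd (Q n) \<Longrightarrow> s n \<le> C * ((\<integral>\<^sup>+t\<in>{2 * fst (Q n) - snd (Q n)<..<2 * snd (Q n) - fst (Q n)}. \<phi> t \<partial>\<nu>) / ennreal (snd (Q n) - fst (Q n)))"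
  shows "(\<integral>\<^sup>+x\<in>{a<..<b}. (\<Sum>n. s n * indicator {fst (Q n)<..<snd (Q n)} x)\<^sup>2 \<partial>\<mu>)
    \<le> (288 * C * A)\<^sup>2 * (\<integral>\<^sup>+t. (\<phi> t)\<^sup>2 \<partial>\<nu>)"
proof -
  define I where "I = (\<lambda>n. {fst (Q n)<..<snd (Q n)})"
  have [measurable]: "I n \<in> sets borel" for n by (simp add: I_def)
  define \<Lambda> where "\<Lambda> = (\<lambda>x. \<Sum>n. s n * indicator (I n) x)"
  have [measurable]: "\<Lambda> \<in> borel_measurable borel" unfolding \<Lambda>_def by measurable
  let ?F = "\<integral>\<^sup>+t. (\<phi> t)\<^sup>2 \<partial>\<nu>"
  have pair: "(\<integral>\<^sup>+x. \<Lambda> x * g x \<partial>\<mu>)\<^sup>2 \<le> (288 * C * A)\<^sup>2 * ?F * (\<integral>\<^sup>+t. (g t)\<^sup>2 \<partial>\<mu>)"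
    if [measurable]: "g \<in> borel_measurable borel" for g
  proof -
    let ?P = "\<lambda>x. hl_max \<nu> \<phi> x * hl_max \<mu> g x"
    have "(\<integral>\<^sup>+x. \<Lambda> x * g x \<partial>\<mu>) = (\<integral>\<^sup>+x. (\<Sum>n. s n * (g x * indicator (I n) x)) \<partial>\<mu>)"
    proof (rule nn_integral_cong)
      fix x
      have "\<Lambda> x * g x = (\<Sum>n. s n * indicator (I n) x * g x)" unfolding \<Lambda>_def by (rule ennreal_suminf_multc[symmetric])
      also have "\<dots> = (\<Sum>n. s n * (g x * indicator (I n) x))" by (rule suminf_cong) (simp only: mult_ac)
      finally show "\<Lambda> x * g x = (\<Sum>n. s n * (g x * indicator (I n) x))" .
    qed
    also have "\<dots> = (\<Sum>n. \<integral>\<^sup>+x. s n * (g x * indicator (I n) x) \<partial>\<mu>)"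
      by (rule nn_integral_suminf) measurable
    also have "\<dots> = (\<Sum>n. s n * (\<integral>\<^sup>+x\<in>I n. g x \<partial>\<mu>))" by (subst nn_integral_cmult) auto
    also have "\<dots> \<le> (\<Sum>n. (C * (18 * A)) * (\<integral>\<^sup>+x\<in>E n. ?P x \<partial>lborel))"
    proof (intro suminf_le summableI)
      fix n
      show "s n * (\<integral>\<^sup>+x\<in>I n. g x \<partial>\<mu>) \<le> (C * (18 * A)) * (\<integral>\<^sup>+x\<in>E n. ?P x \<partial>lborel)"
      proof (cases "fst (Q n) < snd (Q n)")
        case True
        have "s n * (\<integral>\<^sup>+x\<in>I n. g x \<partial>\<mu>) \<le> (C * ((\<integral>\<^sup>+t\<in>{2 * fst (Q n) - snd (Q n)<..<2 * snd (Q n) - fst (Q n)}. \<phi> t \<partial>\<nu>) / ennreal (snd (Q n) - fst (Q n)))) * (\<integral>\<^sup>+x\<in>I n. g x \<partial>\<mu>)"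
          by (rule mult_right_mono[OF s[OF True]]) simp
        also have "\<dots> \<le> C * (18 * A * (\<integral>\<^sup>+x\<in>E n. ?P x \<partial>lborel))"
          unfolding mult.assoc[of C] I_def by (intro mult_left_mono sparse_form_summand Q E) auto
        finally show ?thesis by (simp only: mult.assoc)
      next
        case False
        then have "I n = {}" by (simp add: I_def)
        then show ?thesis by simp
      qed
    qed
    also have "\<dots> = (C * (18 * A)) * (\<Sum>n. \<integral>\<^sup>+x\<in>E n. ?P x \<partial>lborel)" by (rule ennreal_suminf_cmult)
    also have "(\<Sum>n. \<integral>\<^sup>+x\<in>E n. ?P x \<partial>lborel) = (\<integral>\<^sup>+x. (\<Sum>n. ?P x * indicator (E n) x) \<partial>lborel)"
      by (rule nn_integral_suminf[symmetric]) measurable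
    also have "\<dots> \<le> (\<integral>\<^sup>+x. ?P x * 1 \<partial>lborel)"
      by (simp only: ennreal_suminf_cmult) (intro nn_integral_mono mult_left_mono suminf_indicator_le_1 E, simp)
    finally have "(\<integral>\<^sup>+x. \<Lambda> x * g x \<partial>\<mu>) \<le> (C * (18 * A)) * (\<integral>\<^sup>+x. ?P x \<partial>lborel)"
      by (simp add: mult_left_mono)
    then have "(\<integral>\<^sup>+x. \<Lambda> x * g x \<partial>\<mu>)\<^sup>2 \<le> ((C * (18 * A)) * (\<integral>\<^sup>+x. ?P x \<partial>lborel))\<^sup>2" by (rule power_mono) simp
    also have "\<dots> = (C * (18 * A))\<^sup>2 * (\<integral>\<^sup>+x. ?P x \<partial>lborel)\<^sup>2" by (rule power_mult_distrib)
    also have "\<dots> \<le> (C * (18 * A))\<^sup>2 * (256 * ?F * (\<integral>\<^sup>+t. (g t)\<^sup>2 \<partial>\<mu>))"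
      by (intro mult_left_mono hl_max_product_bound) auto
    also have "256 = (16::ennreal)\<^sup>2" by simp
    also have "(C * (18 * A))\<^sup>2 * (16\<^sup>2 * ?F * (\<integral>\<^sup>+t. (g t)\<^sup>2 \<partial>\<mu>)) = ((18 * 16) * C * A)\<^sup>2 * ?F * (\<integral>\<^sup>+t. (g t)\<^sup>2 \<partial>\<mu>)"
      by (simp only: power_mult_distrib mult_ac)
    finally show ?thesis by simp
  qed
  \<comment> \<open>The test function is the sparse sum cut off in height and in space, so that its
    norm is finite and may be cancelled; the height cutoff is removed by monotone
    convergence.\<close>
  define g where "g = (\<lambda>k::nat. \<lambda>x. min (\<Lambda> x) (of_nat k) * indicator {a<..<b} x)"
  have [measurable]: "g k \<in> borel_measurable borel" for k unfolding g_def by measurable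
  have Gk: "(\<integral>\<^sup>+t. (g k t)\<^sup>2 \<partial>\<mu>) \<le> (288 * C * A)\<^sup>2 * ?F" for k
  proof (cases "(\<integral>\<^sup>+t. (g k t)\<^sup>2 \<partial>\<mu>) = 0")
    case False
    let ?G = "\<integral>\<^sup>+t. (g k t)\<^sup>2 \<partial>\<mu>"
    have "?G \<le> (\<integral>\<^sup>+t. (of_nat k)\<^sup>2 * indicator {a<..<b} t \<partial>\<mu>)"
      by (intro nn_integral_mono) (auto simp: g_def indicator_def intro!: power_mono)
    also have "\<dots> = (of_nat k)\<^sup>2 * emeasure \<mu> {a<..<b}" by (rule nn_integral_cmult_indicator) (simp add: \<mu>.sets_eq)
    also have "\<dots> < \<infinity>"
      using \<mu>.finite_interval[of a b] by (simp add: ennreal_mult_less_top power_less_top_ennreal of_nat_less_top)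
    finally have fin: "?G \<noteq> top" by simp
    have "?G \<le> (\<integral>\<^sup>+x. \<Lambda> x * g k x \<partial>\<mu>)"
      by (intro nn_integral_mono) (auto simp: g_def indicator_def power2_eq_square intro!: mult_right_mono)
    then have "?G\<^sup>2 \<le> (\<integral>\<^sup>+x. \<Lambda> x * g k x \<partial>\<mu>)\<^sup>2" by (rule power_mono) simp
    also have "\<dots> \<le> (288 * C * A)\<^sup>2 * ?F * ?G" by (rule pair) measurable
    finally have "?G * ?G \<le> ?G * ((288 * C * A)\<^sup>2 * ?F)" by (simp only: power2_eq_square mult.commute)
    then show ?thesis using False fin by (subst (asm) ennreal_mult_le_mult_iff)
  qed simp
  have sup: "(SUP k. (g k x)\<^sup>2) = (\<Lambda> x)\<^sup>2 * indicator {a<..<b} x" for x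
  proof (rule antisym)
    show "(SUP k. (g k x)\<^sup>2) \<le> (\<Lambda> x)\<^sup>2 * indicator {a<..<b} x"
      by (rule SUP_least) (auto simp: g_def indicator_def intro!: power_mono)
    show "(\<Lambda> x)\<^sup>2 * indicator {a<..<b} x \<le> (SUP k. (g k x)\<^sup>2)"
    proof (cases "x \<in> {a<..<b}")
      case True
      show ?thesis
      proof (cases "\<Lambda> x")
        case (real r)
        obtain k :: nat where "r \<le> real k" using real_arch_simple by blast
        then have "g k x = \<Lambda> x" using True real by (simp add: g_def min_def ennreal_of_nat_eq_real_of_nat ennreal_leI)
        then show ?thesis using True by (intro SUP_upper2[of k]) auto
      next
        case top
        have "(SUP k. of_nat k :: ennreal) \<le> (SUP k. (g k x)\<^sup>2)"
        proof (rule SUP_mono)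
          fix k :: nat
          have "(of_nat k :: ennreal) \<le> of_nat (k\<^sup>2)" by (intro of_nat_mono) (simp add: power2_nat_le_eq_le power2_eq_square)
          then show "\<exists>m\<in>UNIV. (of_nat k :: ennreal) \<le> (g m x)\<^sup>2"
            using True top by (intro bexI[of _ k]) (simp_all add: g_def)
        qed
        then have "(SUP k. (g k x)\<^sup>2) = top" unfolding ennreal_SUP_of_nat_eq_top by (simp only: top_unique)
        then show ?thesis by (simp only: top_greatest)
      qed
    qed simp
  qed
  have "(\<integral>\<^sup>+x\<in>{a<..<b}. (\<Lambda> x)\<^sup>2 \<partial>\<mu>) = (\<integral>\<^sup>+x. (SUP k. (g k x)\<^sup>2) \<partial>\<mu>)" by (simp only: sup)
  also have "\<dots> = (SUP k. \<integral>\<^sup>+x. (g k x)\<^sup>2 \<partial>\<mu>)"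
  proof (rule nn_integral_monotone_convergence_SUP)
    show "incseq (\<lambda>k x. (g k x)\<^sup>2)"
      unfolding incseq_def le_fun_def g_def
      by (intro allI impI power_mono mult_right_mono min.mono order_refl of_nat_mono) auto
  qed measurable
  also have "\<dots> \<le> (288 * C * A)\<^sup>2 * ?F" by (intro SUP_least Gk)
  finally show ?thesis by (simp add: \<Lambda>_def I_def)
qed

end

section \<open>The operator on weighted L2\<close>

locale weighted_cz = cz_kernel K B + muckenhoupt_weight w A for K B w A +
  fixes f :: "real \<Rightarrow> complex"
  assumes f_borel [measurable]: "f \<in> borel_measurable borel"
    and f_L2: "(\<integral>\<^sup>+t. ennreal ((cmod (f t))\<^sup>2) * ennreal (w t) \<partial>lborel) < \<infinity>"
begin

text \<open>The density of |f| dx with respect to \<open>\<nu>\<close>. Its square integral against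
  \<open>\<nu>\<close> is the squared weighted norm of \<open>f\<close>, which puts the problem in
  the form of the sparse estimate.\<close>

definition \<phi> :: "real \<Rightarrow> ennreal" where "\<phi> t = ennreal (cmod (f t)) * ennreal (w t)"

lemma borel_measurable_\<phi> [measurable]: "\<phi> \<in> borel_measurable borel"
  unfolding \<phi>_def by measurable

lemma \<phi>_pairing:
  assumes [measurable]: "h \<in> borel_measurable borel"
  shows "(\<integral>\<^sup>+t. \<phi> t * h t \<partial>\<nu>) = (\<integral>\<^sup>+t. ennreal (cmod (f t)) * h t \<partial>lborel)"
proof -
  have "(\<integral>\<^sup>+t. \<phi> t * h t \<partial>\<nu>) = (\<integral>\<^sup>+t. ennreal (inverse (w t)) * (\<phi> t * h t) \<partial>lborel)"
    by (rule nn_integral_\<nu>) measurable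
  also have "\<dots> = (\<integral>\<^sup>+t. ennreal (cmod (f t)) * h t \<partial>lborel)"
  proof (rule nn_integral_cong_AE)
    show "AE t in lborel. ennreal (inverse (w t)) * (\<phi> t * h t) = ennreal (cmod (f t)) * h t"
      using w_inverse
    proof eventually_elim
      case (elim t)
      have "ennreal (inverse (w t)) * (\<phi> t * h t) = (ennreal (w t) * ennreal (inverse (w t))) * (ennreal (cmod (f t)) * h t)"
        by (simp only: \<phi>_def mult_ac)
      then show ?case by (simp only: elim mult_1_left)
    qed
  qed
  finally show ?thesis .
qed

lemma \<phi>_square: "(\<integral>\<^sup>+t. (\<phi> t)\<^sup>2 \<partial>\<nu>) = (\<integral>\<^sup>+t. ennreal ((cmod (f t))\<^sup>2) * ennreal (w t) \<partial>lborel)"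
proof -
  have "(\<integral>\<^sup>+t. (\<phi> t)\<^sup>2 \<partial>\<nu>) = (\<integral>\<^sup>+t. ennreal (cmod (f t)) * \<phi> t \<partial>lborel)"
    unfolding power2_eq_square by (rule \<phi>_pairing) measurable
  also have "\<dots> = (\<integral>\<^sup>+t. ennreal ((cmod (f t))\<^sup>2) * ennreal (w t) \<partial>lborel)"
    by (intro nn_integral_cong) (simp add: \<phi>_def power2_eq_square ennreal_mult mult.assoc)
  finally show ?thesis .
qed

text \<open>The factor 1 / (1 + |t|) matches the decay of the kernel: wherever
  \<open>1 + \<bar>t\<bar> \<le> c * \<bar>x - t\<bar>\<close>, the integrand of the convolution is
  at most \<open>B * c * u t\<close>.\<close>

definition u :: "real \<Rightarrow> real" where "u t = cmod (f t) / (1 + \<bar>t\<bar>)"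

text \<open>Cauchy--Schwarz with respect to \<open>\<nu>\<close> between \<open>\<phi>\<close> and 1
  / (1 + |t|).\<close>

lemma integrable_u: "integrable lborel u"
proof (rule integrableI_bounded)
  show "u \<in> borel_measurable lborel" unfolding u_def by measurable
  let ?h = "\<lambda>t::real. ennreal (1 / (1 + \<bar>t\<bar>))"
  have "(\<integral>\<^sup>+t. ennreal (norm (u t)) \<partial>lborel) = (\<integral>\<^sup>+t. ennreal (cmod (f t)) * ?h t \<partial>lborel)"
    by (intro nn_integral_cong) (simp add: u_def flip: ennreal_mult)
  also have "\<dots> = (\<integral>\<^sup>+t. \<phi> t * ?h t \<partial>\<nu>)" by (rule \<phi>_pairing[symmetric]) measurable
  finally have eq: "(\<integral>\<^sup>+t. ennreal (norm (u t)) \<partial>lborel) = (\<integral>\<^sup>+t. \<phi> t * ?h t \<partial>\<nu>)" .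
  have "(\<integral>\<^sup>+t. \<phi> t * ?h t \<partial>\<nu>)\<^sup>2 \<le> (\<integral>\<^sup>+t. (\<phi> t)\<^sup>2 \<partial>\<nu>) * (\<integral>\<^sup>+t. (?h t)\<^sup>2 \<partial>\<nu>)"
    by (rule Cauchy_Schwarz_nn_integral; measurable)
  also have "(\<integral>\<^sup>+t. (?h t)\<^sup>2 \<partial>\<nu>) = (\<integral>\<^sup>+t. ennreal (inverse (w t)) * (?h t)\<^sup>2 \<partial>lborel)"
    by (rule nn_integral_\<nu>) measurable
  also have "(\<integral>\<^sup>+t. (\<phi> t)\<^sup>2 \<partial>\<nu>) * \<dots> < \<infinity>"
    using f_L2 inverse_weight_tail_finite unfolding \<phi>_square by (simp add: ennreal_mult_less_top)
  finally show "(\<integral>\<^sup>+t. ennreal (norm (u t)) \<partial>lborel) < \<infinity>"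
    unfolding eq by (simp add: power_less_top_ennreal)
qed

lemma f_le_u: "cmod (f t) = (1 + \<bar>t\<bar>) * u t"
  unfolding u_def using abs_ge_zero[of t] by simp

lemma u_nonneg: "u t \<ge> 0" by (simp add: u_def)

lemma locally_integrable_f: "set_integrable lborel {a<..<b} f"
  unfolding set_integrable_def
proof (rule Bochner_Integration.integrable_bound)
  define M where "M = 1 + max \<bar>a\<bar> \<bar>b\<bar>"
  show "integrable lborel (\<lambda>t. M * u t)" using integrable_u by simp
  show "AE t in lborel. norm (indicat_real {a<..<b} t *\<^sub>R f t) \<le> norm (M * u t)"
  proof (rule AE_I2)
    fix t
    show "norm (indicat_real {a<..<b} t *\<^sub>R f t) \<le> norm (M * u t)"
    proof (cases "t \<in> {a<..<b}")
      case True
      then have "1 + \<bar>t\<bar> \<le> M" by (auto simp: M_def)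
      then have "(1 + \<bar>t\<bar>) * u t \<le> M * u t" using u_nonneg by (intro mult_right_mono)
      then show ?thesis using True f_le_u[of t] by simp
    qed simp
  qed
qed measurable

lemma K_f_bound:
  assumes "0 < c" "1 + \<bar>t\<bar> \<le> c * \<bar>x - t\<bar>"
  shows "cmod (K (x - t) *\<^sub>R f t) \<le> B * c * u t"
proof -
  have "\<bar>x - t\<bar> > 0" using assms abs_ge_zero[of t] by (metis abs_ge_zero add_pos_nonneg less_le_trans mult_zero_right not_less_iff_gr_or_eq order_le_less zero_less_one)
  then have ne: "x - t \<noteq> 0" by simp
  have "cmod (K (x - t) *\<^sub>R f t) = \<bar>K (x - t)\<bar> * ((1 + \<bar>t\<bar>) * u t)" by (simp add: f_le_u)
  also have "\<dots> \<le> (B / \<bar>x - t\<bar>) * ((c * \<bar>x - t\<bar>) * u t)"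
    using size[OF ne] assms u_nonneg B_pos by (intro mult_mono mult_right_mono) auto
  also have "\<dots> = B * c * u t" using ne by simp
  finally show ?thesis .
qed

lemma truncated_integrable:
  assumes e: "\<epsilon> > 0"
  shows "set_integrable lborel {t. \<epsilon> < \<bar>x - t\<bar>} (\<lambda>t. K (x - t) *\<^sub>R f t)"
  unfolding set_integrable_def
proof (rule Bochner_Integration.integrable_bound)
  \<comment> \<open>From 1 + |t| <= (1 + |x|) + |x - t|, where the first summand is at most (1 +
    |x|) / \<open>\<epsilon>\<close> times |x - t| beyond distance
    \<open>\<epsilon>\<close>.\<close>
  define c where "c = (1 + \<bar>x\<bar>) / \<epsilon> + 1"
  have c: "c > 0" using e by (auto simp: c_def intro!: add_nonneg_pos divide_nonneg_pos)
  show "integrable lborel (\<lambda>t. B * c * u t)" using integrable_u by simp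
  show "AE t in lborel. norm (indicat_real {t. \<epsilon> < \<bar>x - t\<bar>} t *\<^sub>R K (x - t) *\<^sub>R f t) \<le> norm (B * c * u t)"
  proof (rule AE_I2)
    fix t
    show "norm (indicat_real {t. \<epsilon> < \<bar>x - t\<bar>} t *\<^sub>R K (x - t) *\<^sub>R f t) \<le> norm (B * c * u t)"
    proof (cases "\<epsilon> < \<bar>x - t\<bar>")
      case True
      have "(1 + \<bar>x\<bar>) / \<epsilon> * \<epsilon> \<le> (1 + \<bar>x\<bar>) / \<epsilon> * \<bar>x - t\<bar>" using True e by (intro mult_left_mono) auto
      then have "1 + \<bar>x\<bar> \<le> (1 + \<bar>x\<bar>) / \<epsilon> * \<bar>x - t\<bar>" using e by simp
      moreover have "1 + \<bar>t\<bar> \<le> 1 + \<bar>x\<bar> + \<bar>x - t\<bar>" by linarith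
      ultimately have "1 + \<bar>t\<bar> \<le> c * \<bar>x - t\<bar>" by (simp add: c_def distrib_right)
      then have "cmod (K (x - t) *\<^sub>R f t) \<le> B * c * u t" by (rule K_f_bound[OF c])
      then have "cmod (K (x - t) *\<^sub>R f t) \<le> \<bar>B * c * u t\<bar>" by linarith
      then show ?thesis using True by simp
    qed simp
  qed
qed measurable

text \<open>The contribution from outside the triple of (-N, N). For
  \<open>\<bar>x\<bar> < N\<close> it takes no part in the limit of small truncation levels, and it
  is bounded uniformly in \<open>x\<close> by a multiple of \<open>tail N\<close>, which tends to
  0.\<close>

definition far :: "nat \<Rightarrow> real \<Rightarrow> complex" where
  "far N x = (LBINT t:{t. 3 * real N \<le> \<bar>t\<bar>}. K (x - t) *\<^sub>R f t)"

definition tail :: "nat \<Rightarrow> real" where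
  "tail N = (LBINT t:{t. 3 * real N \<le> \<bar>t\<bar>}. u t)"

lemma tail_tendsto_0: "tail \<longlonglongrightarrow> 0"
proof -
  have "(\<lambda>N. LBINT t. indicator {t. 3 * real N \<le> \<bar>t\<bar>} t *\<^sub>R u t) \<longlonglongrightarrow> (LBINT t::real. 0)"
  proof (rule integral_dominated_convergence[where w=u])
    show "AE t in lborel. (\<lambda>N. indicat_real {t. 3 * real N \<le> \<bar>t\<bar>} t *\<^sub>R u t) \<longlonglongrightarrow> 0"
    proof (rule AE_I2)
      fix t :: real
      obtain M :: nat where M: "\<bar>t\<bar> < real M" using reals_Archimedean2 by blast
      have "indicat_real {t. 3 * real N \<le> \<bar>t\<bar>} t *\<^sub>R u t = 0" if "N \<ge> M" for N
        using M that by (simp add: indicator_def)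
      then show "(\<lambda>N. indicat_real {t. 3 * real N \<le> \<bar>t\<bar>} t *\<^sub>R u t) \<longlonglongrightarrow> 0"
        by (intro tendsto_eventually eventually_sequentiallyI[of M]) auto
    qed
    show "integrable lborel u" by (rule integrable_u)
    show "AE t in lborel. norm (indicat_real {t. 3 * real N \<le> \<bar>t\<bar>} t *\<^sub>R u t) \<le> u t" for N
      using u_nonneg by (intro AE_I2) (auto simp: indicator_def)
  qed (use borel_measurable_integrable[OF integrable_u] in measurable)
  then show ?thesis by (simp add: tail_def[abs_def] set_lebesgue_integral_def)
qed

lemma far_pointwise:
  assumes "\<bar>x\<bar> < real N" "3 * real N \<le> \<bar>t\<bar>" "N \<ge> 1"
  shows "cmod (K (x - t) *\<^sub>R f t) \<le> B * 2 * u t"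
proof (rule K_f_bound)
  have N: "real N \<ge> 1" using assms(3) by simp
  have "\<bar>t\<bar> - \<bar>x\<bar> \<le> \<bar>x - t\<bar>" by linarith
  moreover have "d \<ge> 0 \<Longrightarrow> s - y \<le> d \<Longrightarrow> y < real N \<Longrightarrow> 3 * real N \<le> s \<Longrightarrow> 1 + s \<le> 2 * d" for d s y :: real
    using N by linarith
  ultimately show "1 + \<bar>t\<bar> \<le> 2 * \<bar>x - t\<bar>" using assms(1,2) abs_ge_zero by blast
qed simp

lemma far_integrable:
  assumes "\<bar>x\<bar> < real N" "N \<ge> 1"
  shows "set_integrable lborel {t. 3 * real N \<le> \<bar>t\<bar>} (\<lambda>t. K (x - t) *\<^sub>R f t)"
  unfolding set_integrable_def
proof (rule Bochner_Integration.integrable_bound)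
  show "integrable lborel (\<lambda>t. B * 2 * u t)" using integrable_u by simp
  show "AE t in lborel. norm (indicat_real {t. 3 * real N \<le> \<bar>t\<bar>} t *\<^sub>R K (x - t) *\<^sub>R f t) \<le> norm (B * 2 * u t)"
  proof (rule AE_I2)
    fix t
    show "norm (indicat_real {t. 3 * real N \<le> \<bar>t\<bar>} t *\<^sub>R K (x - t) *\<^sub>R f t) \<le> norm (B * 2 * u t)"
    proof (cases "3 * real N \<le> \<bar>t\<bar>")
      case True
      then have "cmod (K (x - t) *\<^sub>R f t) \<le> \<bar>B * 2 * u t\<bar>" using far_pointwise[OF assms(1) True assms(2)] by linarith
      then show ?thesis using True by simp
    qed simp
  qed
qed measurable

lemma norm_far_le:
  assumes "\<bar>x\<bar> < real N" "N \<ge> 1"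
  shows "cmod (far N x) \<le> 2 * B * tail N"
proof -
  have "cmod (far N x) \<le> (LBINT t. (B * 2) * (indicator {t. 3 * real N \<le> \<bar>t\<bar>} t *\<^sub>R u t))"
    unfolding far_def set_lebesgue_integral_def
  proof (rule Bochner_Integration.integral_norm_bound_integral)
    show "integrable lborel (\<lambda>t. indicat_real {t. 3 * real N \<le> \<bar>t\<bar>} t *\<^sub>R K (x - t) *\<^sub>R f t)"
      using far_integrable[OF assms] by (simp only: set_integrable_def)
    show "integrable lborel (\<lambda>t. (B * 2) * (indicat_real {t. 3 * real N \<le> \<bar>t\<bar>} t *\<^sub>R u t))"
      by (intro integrable_mult_right integrable_mult_indicator integrable_u) simp
    fix t
    show "cmod (indicat_real {t. 3 * real N \<le> \<bar>t\<bar>} t *\<^sub>R K (x - t) *\<^sub>R f t) \<le> (B * 2) * (indicat_real {t. 3 * real N \<le> \<bar>t\<bar>} t *\<^sub>R u t)"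
      using far_pointwise[OF assms(1) _ assms(2), of t] by (cases "3 * real N \<le> \<bar>t\<bar>") auto
  qed
  then show ?thesis by (simp add: tail_def set_lebesgue_integral_def)
qed

definition loc :: "nat \<Rightarrow> real \<Rightarrow> complex" where "loc N = localized f (- real N, real N)"

lemma integrable_loc: "integrable lborel (loc N)"
  unfolding loc_def by (rule integrable_localized[OF locally_integrable_f])

text \<open>For \<open>\<bar>x\<bar> < N\<close> a point with
  \<open>3 * N \<le> \<bar>t\<bar>\<close> is at distance more than \<open>2 * N\<close> from
  \<open>x\<close>, so a truncation at a level below \<open>N\<close> leaves the far part
  untouched.\<close>

lemma trunc_split:
  assumes "\<bar>x\<bar> < real N" "N \<ge> 1" "0 < \<epsilon>" "\<epsilon> < real N"
  shows "trunc f \<epsilon> x = trunc (loc N) \<epsilon> x + far N x"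
proof -
  let ?k = "\<lambda>t. indicat_real {t. \<epsilon> < \<bar>x - t\<bar>} t *\<^sub>R K (x - t) *\<^sub>R loc N t"
  let ?r = "\<lambda>t. indicat_real {t. 3 * real N \<le> \<bar>t\<bar>} t *\<^sub>R K (x - t) *\<^sub>R f t"
  have i: "integrable lborel ?k" "integrable lborel ?r"
    using trunc_integrable[OF integrable_loc assms(3)] far_integrable[OF assms(1,2)] by (simp_all only: set_integrable_def)
  have "trunc f \<epsilon> x = (LBINT t. ?k t + ?r t)"
    unfolding trunc_def set_lebesgue_integral_def
  proof (intro Bochner_Integration.integral_cong refl)
    fix t
    show "indicat_real {t. \<epsilon> < \<bar>x - t\<bar>} t *\<^sub>R K (x - t) *\<^sub>R f t = ?k t + ?r t"
    proof (cases "3 * real N \<le> \<bar>t\<bar>")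
      case True
      then have "\<epsilon> < \<bar>x - t\<bar>" using assms by linarith
      moreover have "t \<notin> {- (3 * real N)<..<3 * real N}" using True by (simp, linarith)
      then have "loc N t = 0" by (simp add: loc_def localized_def)
      ultimately show ?thesis using True by simp
    next
      case False
      then have "t \<in> {- (3 * real N)<..<3 * real N}" by (simp add: abs_less_iff) linarith
      then have "loc N t = f t" by (simp add: loc_def localized_def)
      then show ?thesis using False by simp
    qed
  qed
  also have "\<dots> = trunc (loc N) \<epsilon> x + far N x"
    unfolding trunc_def far_def set_lebesgue_integral_def by (rule Bochner_Integration.integral_add[OF i])
  finally show ?thesis .
qed

lemma AE_loc_converges:
  "AE x in lborel. \<forall>N. \<exists>l. ((\<lambda>\<epsilon>. trunc (loc N) \<epsilon> x) \<longlongrightarrow> l) (at_right 0)"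
  unfolding AE_all_countable by (intro allI trunc_converges_AE integrable_loc)

lemma trunc_tendsto_of_loc:
  assumes l: "((\<lambda>\<epsilon>. trunc (loc N) \<epsilon> x) \<longlongrightarrow> l) (at_right 0)" and N: "\<bar>x\<bar> < real N" "N \<ge> 1"
  shows "((\<lambda>\<epsilon>. trunc f \<epsilon> x) \<longlongrightarrow> l + far N x) (at_right 0)"
proof (rule Lim_transform_eventually)
  show "((\<lambda>\<epsilon>. trunc (loc N) \<epsilon> x + far N x) \<longlongrightarrow> l + far N x) (at_right 0)" by (intro tendsto_intros l)
  have "\<forall>\<^sub>F \<epsilon> in at_right 0. \<epsilon> \<in> {0<..<real N}" using N by (intro eventually_at_right_real) simp
  then show "\<forall>\<^sub>F \<epsilon> in at_right 0. trunc (loc N) \<epsilon> x + far N x = trunc f \<epsilon> x"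
    by eventually_elim (simp add: trunc_split[OF N])
qed

definition Tf :: "real \<Rightarrow> complex" where "Tf x = Lim (at_right 0) (\<lambda>\<epsilon>. trunc f \<epsilon> x)"

lemma AE_trunc_tendsto_Tf: "AE x in lborel. ((\<lambda>\<epsilon>. trunc f \<epsilon> x) \<longlongrightarrow> Tf x) (at_right 0)"
  using AE_loc_converges
proof eventually_elim
  case (elim x)
  obtain M :: nat where "\<bar>x\<bar> < real M" using reals_Archimedean2 by blast
  then have N: "\<bar>x\<bar> < real (M + 1)" "M + 1 \<ge> 1" by auto
  obtain l where "((\<lambda>\<epsilon>. trunc (loc (M + 1)) \<epsilon> x) \<longlongrightarrow> l) (at_right 0)" using elim by blast
  from trunc_tendsto_of_loc[OF this N] show ?case
    unfolding Tf_def using tendsto_Lim[of "at_right (0::real)"] by (metis trivial_limit_at_right_real)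
qed

lemma Tf_le_tmax:
  assumes T: "((\<lambda>\<epsilon>. trunc f \<epsilon> x) \<longlongrightarrow> Tf x) (at_right 0)" and N: "\<bar>x\<bar> < real N" "N \<ge> 1"
  shows "ennreal (cmod (Tf x)) \<le> tmax (loc N) x + ennreal (2 * B * tail N)"
proof -
  have "((\<lambda>\<epsilon>. ennreal (cmod (trunc f \<epsilon> x))) \<longlongrightarrow> ennreal (cmod (Tf x))) (at_right 0)"
    by (intro tendsto_ennrealI tendsto_norm T)
  moreover have "\<forall>\<^sub>F \<epsilon> in at_right 0. ennreal (cmod (trunc f \<epsilon> x)) \<le> tmax (loc N) x + ennreal (2 * B * tail N)"
  proof -
    have "\<forall>\<^sub>F \<epsilon> in at_right 0. \<epsilon> \<in> {0<..<real N}" using N by (intro eventually_at_right_real) simp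
    then show ?thesis
    proof eventually_elim
      case (elim \<epsilon>)
      then have e: "0 < \<epsilon>" "\<epsilon> < real N" by auto
      have "cmod (trunc f \<epsilon> x) \<le> cmod (trunc (loc N) \<epsilon> x) + cmod (far N x)"
        unfolding trunc_split[OF N e] by (rule norm_triangle_ineq)
      then have "ennreal (cmod (trunc f \<epsilon> x)) \<le> ennreal (cmod (trunc (loc N) \<epsilon> x) + cmod (far N x))" by (rule ennreal_leI)
      also have "\<dots> = ennreal (cmod (trunc (loc N) \<epsilon> x)) + ennreal (cmod (far N x))" by simp
      also have "\<dots> \<le> tmax (loc N) x + ennreal (2 * B * tail N)"
        by (intro add_mono tmax_ge e ennreal_leI norm_far_le N)
      finally show ?case .
    qed
  qed
  ultimately show ?thesis by (intro tendsto_upperbound[where F="at_right (0::real)"]) auto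
qed

text \<open>Sparse domination with root (-N, N). The triple averages of \<open>f\<close> are
  averages of \<open>\<phi>\<close> against \<open>\<nu>\<close>, as the sparse estimate requires.
  The right-hand side does not depend on \<open>N\<close>.\<close>

lemma tmax_loc_weighted:
  "(\<integral>\<^sup>+x\<in>{- real N<..<real N}. (tmax (loc N) x)\<^sup>2 \<partial>\<mu>)
    \<le> (288 * ennreal sparse_const * A)\<^sup>2 * (\<integral>\<^sup>+t. ennreal ((cmod (f t))\<^sup>2) * ennreal (w t) \<partial>lborel)"
proof -
  let ?p = "(- real N, real N)"
  have p: "fst ?p \<le> snd ?p" by simp
  have S0: "sparse_const \<ge> 0" using B_pos by (simp add: sparse_const_def)
  obtain Q :: "nat \<Rightarrow> real \<times> real" and E :: "nat \<Rightarrow> real set" where Q: "\<And>n. fst (Q n) \<le> snd (Q n)" "\<And>n. E n \<in> sets borel" "\<And>n. E n \<subseteq> {fst (Q n)<..<snd (Q n)}"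
    "\<And>n. emeasure lborel {fst (Q n)<..<snd (Q n)} \<le> 2 * emeasure lborel (E n)" "disjoint_family E"
    "AE x in lborel. x \<in> {fst ?p<..<snd ?p} \<longrightarrow> tmax (localized f ?p) x
       \<le> (\<Sum>n. ennreal (sparse_const * triple_average f (Q n)) * indicator {fst (Q n)<..<snd (Q n)} x)"
    by (rule sparse_domination[OF locally_integrable_f p], rule that)
  let ?s = "\<lambda>n. ennreal (sparse_const * triple_average f (Q n))"
  let ?\<Lambda> = "\<lambda>x. \<Sum>n. ?s n * indicator {fst (Q n)<..<snd (Q n)} x"
  have s: "?s n \<le> ennreal sparse_const * ((\<integral>\<^sup>+t\<in>{2 * fst (Q n) - snd (Q n)<..<2 * snd (Q n) - fst (Q n)}. \<phi> t \<partial>\<nu>) / ennreal (snd (Q n) - fst (Q n)))"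
    if lt: "fst (Q n) < snd (Q n)" for n
  proof -
    let ?J = "{2 * fst (Q n) - snd (Q n)<..<2 * snd (Q n) - fst (Q n)}"
    have "(\<integral>\<^sup>+t\<in>?J. \<phi> t \<partial>\<nu>) = (\<integral>\<^sup>+t\<in>?J. ennreal (cmod (f t)) \<partial>lborel)" by (rule \<phi>_pairing) simp
    also have "\<dots> = (\<integral>\<^sup>+t. ennreal (cmod (localized f (Q n) t)) \<partial>lborel)"
      by (intro nn_integral_cong) (auto simp: localized_def indicator_def)
    also have "\<dots> = ennreal (LBINT t. cmod (localized f (Q n) t))"
      using integrable_localized[OF locally_integrable_f] by (intro nn_integral_eq_integral) auto
    finally have "(\<integral>\<^sup>+t\<in>?J. \<phi> t \<partial>\<nu>) / ennreal (snd (Q n) - fst (Q n)) = ennreal (triple_average f (Q n))"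
      using lt by (simp add: triple_average_def divide_ennreal)
    then show ?thesis using S0 by (simp add: ennreal_mult')
  qed
  have "(\<integral>\<^sup>+x\<in>{- real N<..<real N}. (tmax (loc N) x)\<^sup>2 \<partial>\<mu>) \<le> (\<integral>\<^sup>+x\<in>{- real N<..<real N}. (?\<Lambda> x)\<^sup>2 \<partial>\<mu>)"
  proof (rule nn_integral_mono_AE)
    have "AE x in \<mu>. x \<in> {- real N<..<real N} \<longrightarrow> tmax (loc N) x \<le> ?\<Lambda> x"
      unfolding \<mu>_def using Q(6) by (subst AE_density) (auto simp: loc_def)
    then show "AE x in \<mu>. (tmax (loc N) x)\<^sup>2 * indicator {- real N<..<real N} x \<le> (?\<Lambda> x)\<^sup>2 * indicator {- real N<..<real N} x"
      by eventually_elim (auto simp: indicator_def intro!: power_mono)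
  qed
  also have "\<dots> \<le> (288 * ennreal sparse_const * A)\<^sup>2 * (\<integral>\<^sup>+t. (\<phi> t)\<^sup>2 \<partial>\<nu>)"
    by (rule sparse_operator_bound[OF _ Q(2,1,3,4,5) s]) measurable
  finally show ?thesis by (simp only: \<phi>_square)
qed

text \<open>On (-N, N) the operator is at most the maximal truncation of the localization plus an
  error tending to 0; Fatou's lemma passes from the uniform bounds on (-N, N) to the line.\<close>

theorem Tf_weighted_bound:
  "(\<integral>\<^sup>+x. ennreal ((cmod (Tf x))\<^sup>2) * ennreal (w x) \<partial>lborel)
    \<le> (288 * ennreal sparse_const * A)\<^sup>2 * (\<integral>\<^sup>+t. ennreal ((cmod (f t))\<^sup>2) * ennreal (w t) \<partial>lborel)"
proof -
  let ?t = "\<lambda>N x. (tmax (loc N) x)\<^sup>2 * indicator {- real N<..<real N} x"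
  have tm [measurable]: "tmax (loc N) \<in> borel_measurable borel" for N
    by (rule borel_measurableI_greater) (simp add: open_tmax_superlevel[OF integrable_loc])
  have "AE x in lborel. ennreal ((cmod (Tf x))\<^sup>2) * ennreal (w x) \<le> liminf (\<lambda>N. ennreal (w x) * ?t N x)"
    using AE_trunc_tendsto_Tf
  proof eventually_elim
    case (elim x)
    \<comment> \<open>The value of the operator less the far error: it stays below the maximal
      truncation for large \<open>N\<close> and tends to the full value.\<close>
    define y where "y = (\<lambda>N. max 0 (cmod (Tf x) - 2 * B * tail N))"
    have "y \<longlonglongrightarrow> max 0 (cmod (Tf x) - 2 * B * 0)" unfolding y_def by (intro tendsto_intros tail_tendsto_0)
    then have ylim: "(\<lambda>N. ennreal (w x) * ennreal ((y N)\<^sup>2)) \<longlonglongrightarrow> ennreal (w x) * ennreal ((cmod (Tf x))\<^sup>2)"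
      by (intro ennreal_tendsto_cmult tendsto_ennrealI tendsto_intros) auto
    obtain M :: nat where M: "\<bar>x\<bar> < real M" using reals_Archimedean2 by blast
    have le: "ennreal (w x) * ennreal ((y N)\<^sup>2) \<le> ennreal (w x) * ?t N x" if "N \<ge> M + 1" for N
    proof (rule mult_left_mono)
      have N: "\<bar>x\<bar> < real N" "N \<ge> 1" using that M by auto
      have T: "ennreal (cmod (Tf x)) \<le> tmax (loc N) x + ennreal (2 * B * tail N)" by (rule Tf_le_tmax[OF elim N])
      have c: "2 * B * tail N \<ge> 0"
        using B_pos u_nonneg unfolding tail_def set_lebesgue_integral_def
        by (intro mult_nonneg_nonneg Bochner_Integration.integral_nonneg) auto
      have "ennreal (y N) \<le> tmax (loc N) x"
      proof (cases "tmax (loc N) x")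
        case (real r)
        then have "ennreal (cmod (Tf x)) \<le> ennreal (r + 2 * B * tail N)" using T c by (simp add: ennreal_plus)
        then have "cmod (Tf x) \<le> r + 2 * B * tail N" using real c by (subst (asm) ennreal_le_iff) auto
        then have "y N \<le> r" using real by (simp add: y_def)
        then show ?thesis using real by (simp add: ennreal_leI)
      qed simp
      then have "(ennreal (y N))\<^sup>2 \<le> (tmax (loc N) x)\<^sup>2" by (rule power_mono) simp
      moreover have "x \<in> {- real N<..<real N}" using N(1) by (auto simp: abs_less_iff)
      ultimately show "ennreal ((y N)\<^sup>2) \<le> ?t N x" by (simp add: ennreal_power y_def)
    qed simp
    have "ennreal ((cmod (Tf x))\<^sup>2) * ennreal (w x) = liminf (\<lambda>N. ennreal (w x) * ennreal ((y N)\<^sup>2))"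
      using lim_imp_Liminf[OF sequentially_bot ylim] by (simp add: mult.commute)
    also have "\<dots> \<le> liminf (\<lambda>N. ennreal (w x) * ?t N x)"
      by (rule Liminf_mono) (rule eventually_sequentiallyI[of "M + 1"], rule le)
    finally show ?case .
  qed
  then have "(\<integral>\<^sup>+x. ennreal ((cmod (Tf x))\<^sup>2) * ennreal (w x) \<partial>lborel) \<le> (\<integral>\<^sup>+x. liminf (\<lambda>N. ennreal (w x) * ?t N x) \<partial>lborel)"
    by (rule nn_integral_mono_AE)
  also have "\<dots> \<le> liminf (\<lambda>N. \<integral>\<^sup>+x. ennreal (w x) * ?t N x \<partial>lborel)"
    by (rule nn_integral_liminf) measurable
  also have "\<dots> \<le> liminf (\<lambda>N. (288 * ennreal sparse_const * A)\<^sup>2 * (\<integral>\<^sup>+t. ennreal ((cmod (f t))\<^sup>2) * ennreal (w t) \<partial>lborel))"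
  proof (intro Liminf_mono always_eventually allI)
    fix N
    have "(\<integral>\<^sup>+x. ennreal (w x) * ?t N x \<partial>lborel) = (\<integral>\<^sup>+x. ?t N x \<partial>\<mu>)" by (rule nn_integral_\<mu>[symmetric]) measurable
    then show "(\<integral>\<^sup>+x. ennreal (w x) * ?t N x \<partial>lborel) \<le> (288 * ennreal sparse_const * A)\<^sup>2 * (\<integral>\<^sup>+t. ennreal ((cmod (f t))\<^sup>2) * ennreal (w t) \<partial>lborel)"
      using tmax_loc_weighted[of N] by simp
  qed
  also have "\<dots> = (288 * ennreal sparse_const * A)\<^sup>2 * (\<integral>\<^sup>+t. ennreal ((cmod (f t))\<^sup>2) * ennreal (w t) \<partial>lborel)"
    by (rule Liminf_const) simp
  finally show ?thesis .
qed

lemma borel_measurable_trunc_f: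
  assumes e: "\<epsilon> > 0"
  shows "trunc f \<epsilon> \<in> borel_measurable borel"
proof (rule borel_measurable_LIMSEQ_metric)
  show "trunc (loc N) \<epsilon> \<in> borel_measurable borel" for N by (rule borel_measurable_trunc[OF integrable_loc e])
  fix x
  obtain M :: nat where M: "max \<bar>x\<bar> \<epsilon> < real M" using reals_Archimedean2 by blast
  have "(\<lambda>N. trunc f \<epsilon> x - trunc (loc N) \<epsilon> x) \<longlonglongrightarrow> 0"
  proof (rule Lim_null_comparison)
    show "\<forall>\<^sub>F N in sequentially. norm (trunc f \<epsilon> x - trunc (loc N) \<epsilon> x) \<le> 2 * B * tail N"
    proof (rule eventually_sequentiallyI[of "M + 1"])
      fix N assume "M + 1 \<le> N"
      then have N: "\<bar>x\<bar> < real N" "N \<ge> 1" "\<epsilon> < real N" using M by auto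
      show "norm (trunc f \<epsilon> x - trunc (loc N) \<epsilon> x) \<le> 2 * B * tail N"
        using trunc_split[OF N(1,2) e N(3)] norm_far_le[OF N(1,2)] by simp
    qed
    show "(\<lambda>N. 2 * B * tail N) \<longlonglongrightarrow> 0" by (rule tendsto_mult_right_zero[OF tail_tendsto_0])
  qed
  from tendsto_diff[OF tendsto_const[of "trunc f \<epsilon> x"] this]
  show "(\<lambda>N. trunc (loc N) \<epsilon> x) \<longlonglongrightarrow> trunc f \<epsilon> x" by simp
qed

text \<open>\<open>Tf\<close> is a \<open>Lim\<close> at every point, also where no limit exists and
  its value is arbitrary. Almost everywhere it is the limit along the levels 1 / (n + 1), which is
  Borel measurable.\<close>

lemma Tf_AE_eq_borel: "\<exists>g\<in>borel_measurable borel. AE x in lborel. Tf x = g x"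
proof (intro bexI)
  define g where "g = (\<lambda>x. lim (\<lambda>n. trunc f (1 / (real n + 1)) x))"
  show "g \<in> borel_measurable borel"
    unfolding g_def by (intro borel_measurable_lim_metric borel_measurable_trunc_f) simp
  have u: "filterlim (\<lambda>n. 1 / (real n + 1)) (at_right 0) sequentially"
  proof (rule tendsto_imp_filterlim_at_right)
    show "(\<lambda>n. 1 / (real n + 1)) \<longlonglongrightarrow> 0"
      using LIMSEQ_inverse_real_of_nat by (simp add: inverse_eq_divide add.commute)
  qed (intro always_eventually allI, simp)
  show "AE x in lborel. Tf x = g x"
    using AE_trunc_tendsto_Tf
  proof eventually_elim
    case (elim x)
    have "(\<lambda>n. trunc f (1 / (real n + 1)) x) \<longlonglongrightarrow> Tf x" by (rule filterlim_compose[OF elim u])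
    then show ?case unfolding g_def by (simp add: limI)
  qed
qed

end

subsection \<open>The weighted estimate\<close>

text \<open>The preimage differs from that of the Borel function only inside a null set, and all
  subsets of null sets are Lebesgue measurable.\<close>

lemma AE_eq_borel_imp_measurable_lebesgue:
  fixes g h :: "real \<Rightarrow> 'b::topological_space"
  assumes g: "g \<in> borel_measurable borel" and eq: "AE x in lborel. h x = g x"
  shows "h \<in> borel_measurable lebesgue"
proof (rule measurableI)
  fix S :: "'b set" assume S: "S \<in> sets borel"
  have [measurable]: "g \<in> measurable lebesgue borel" by (rule measurable_completion) (simp add: g)
  have 1: "Measurable.pred lebesgue (\<lambda>x. g x \<in> S)" using S by measurable
  have 2: "Measurable.pred lebesgue (\<lambda>x. h x \<noteq> g x)" by (rule sets_completion_AE) (simp add: eq)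
  have 3: "Measurable.pred lebesgue (\<lambda>x. h x \<noteq> g x \<and> h x \<in> S)" by (rule sets_completion_AE) (use eq in eventually_elim, simp)
  have "Measurable.pred lebesgue (\<lambda>x. (g x \<in> S \<and> \<not> h x \<noteq> g x) \<or> (h x \<noteq> g x \<and> h x \<in> S))"
    by (rule pred_intros_logic(5)[OF pred_intros_logic(3)[OF 1 pred_intros_logic(2)[OF 2]] 3])
  also have "(\<lambda>x. (g x \<in> S \<and> \<not> h x \<noteq> g x) \<or> (h x \<noteq> g x \<and> h x \<in> S)) = (\<lambda>x. h x \<in> S)" by (intro ext iffI; metis)
  finally show "h -` S \<inter> space lebesgue \<in> sets lebesgue" by (simp add: pred_def vimage_def)
qed simp

lemma lebesgue_measurable_ex_borel_complex:
  fixes f :: "real \<Rightarrow> complex"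
  assumes f: "f \<in> borel_measurable lebesgue"
  obtains g where "g \<in> borel_measurable borel" "AE x in lborel. f x = g x"
proof -
  have "(\<lambda>x. Re (f x)) \<in> borel_measurable lebesgue" "(\<lambda>x. Im (f x)) \<in> borel_measurable lebesgue"
    using f by measurable
  then have "\<exists>r\<in>borel_measurable lborel. AE x in lborel. Re (f x) = r x" "\<exists>i\<in>borel_measurable lborel. AE x in lborel. Im (f x) = i x"
    by (simp_all only: completion_ex_borel_measurable_real)
  then obtain r i where [measurable]: "r \<in> borel_measurable lborel" "i \<in> borel_measurable lborel"
    and ri: "AE x in lborel. Re (f x) = r x" "AE x in lborel. Im (f x) = i x"
    by (elim bexE)
  show ?thesis
  proof (rule that[of "\<lambda>x. Complex (r x) (i x)"])
    have "(\<lambda>x. complex_of_real (r x) + \<i> * complex_of_real (i x)) \<in> borel_measurable lborel" by measurable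
    then show "(\<lambda>x. Complex (r x) (i x)) \<in> borel_measurable borel" by (simp add: Complex_eq)
    show "AE x in lborel. f x = Complex (r x) (i x)" using ri by eventually_elim (simp add: complex_eq_iff)
  qed
qed

lemma weight_measurable:
  assumes "is_weight \<omega>"
  shows "\<omega> \<in> borel_measurable lebesgue"
proof (rule borel_measurable_LIMSEQ_real)
  fix n :: nat
  have "set_integrable lebesgue {- real n..real n} \<omega>" using assms by (simp add: is_weight_def)
  then show "(\<lambda>x. indicat_real {- real n..real n} x *\<^sub>R \<omega> x) \<in> borel_measurable lebesgue"
    unfolding set_integrable_def by (rule borel_measurable_integrable)
next
  fix x
  obtain M :: nat where "\<bar>x\<bar> \<le> real M" using real_arch_simple by blast
  then have "indicat_real {- real n..real n} x *\<^sub>R \<omega> x = \<omega> x" if "n \<ge> M" for n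
    using that by (simp add: abs_le_iff)
  then show "(\<lambda>n. indicat_real {- real n..real n} x *\<^sub>R \<omega> x) \<longlonglongrightarrow> \<omega> x"
    by (intro tendsto_eventually eventually_sequentiallyI[of M])
qed

lemma weighted_L2_norm_eq_nn_integral:
  fixes f :: "real \<Rightarrow> complex"
  assumes "is_weight \<omega>" "f \<in> borel_measurable lebesgue"
  shows "weighted_L2_norm \<omega> f = sqrt (enn2real (\<integral>\<^sup>+x. ennreal ((cmod (f x))\<^sup>2) * ennreal (\<omega> x) \<partial>lborel))"
    and "f \<in> weighted_L2 \<omega> \<longleftrightarrow> (\<integral>\<^sup>+x. ennreal ((cmod (f x))\<^sup>2) * ennreal (\<omega> x) \<partial>lborel) < \<infinity>"
proof -
  let ?h = "\<lambda>x. (cmod (f x))\<^sup>2 * \<omega> x"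
  have m: "?h \<in> borel_measurable lebesgue" using assms(2) weight_measurable[OF assms(1)] by measurable
  have nonneg: "AE x in lebesgue. 0 \<le> ?h x"
    using assms(1)[unfolded is_weight_def, THEN conjunct2] by eventually_elim simp
  have N: "(\<integral>\<^sup>+x. ennreal (?h x) \<partial>lebesgue) = (\<integral>\<^sup>+x. ennreal ((cmod (f x))\<^sup>2) * ennreal (\<omega> x) \<partial>lborel)"
    by (simp only: nn_integral_completion) (simp add: ennreal_mult')
  show "weighted_L2_norm \<omega> f = sqrt (enn2real (\<integral>\<^sup>+x. ennreal ((cmod (f x))\<^sup>2) * ennreal (\<omega> x) \<partial>lborel))"
    unfolding weighted_L2_norm_def by (simp only: integral_eq_nn_integral[OF m nonneg] N)
  have "integrable lebesgue ?h \<longleftrightarrow> (\<integral>\<^sup>+x. ennreal (?h x) \<partial>lebesgue) < \<infinity>"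
  proof
    assume "integrable lebesgue ?h"
    then show "(\<integral>\<^sup>+x. ennreal (?h x) \<partial>lebesgue) < \<infinity>" using nonneg by (simp add: nn_integral_eq_integral)
  qed (use m nonneg in \<open>rule integrableI_nonneg\<close>)
  then show "f \<in> weighted_L2 \<omega> \<longleftrightarrow> (\<integral>\<^sup>+x. ennreal ((cmod (f x))\<^sup>2) * ennreal (\<omega> x) \<partial>lborel) < \<infinity>"
    unfolding weighted_L2_def N using assms(2) by simp
qed

text \<open>Transfer to Borel representatives \<open>w\<close> and \<open>g\<close> of the weight
  and the function. No integral changes, and since each truncated integral is unaffected at every
  \<open>x\<close>, the operator of \<open>f\<close> equals \<open>Tf\<close> everywhere and not
  just almost everywhere.\<close>

lemma (in cz_kernel) A2_estimate:
  fixes f :: "real \<Rightarrow> complex"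
  assumes \<omega>: "A2_weight \<omega>" and f: "f \<in> weighted_L2 \<omega>"
  shows "(AE x in lebesgue. principal_value_exists K f x) \<and> cz_operator K f \<in> weighted_L2 \<omega> \<and>
    weighted_L2_norm \<omega> (cz_operator K f) \<le> (288 * sparse_const) * enn2real (A2_constant \<omega>) * weighted_L2_norm \<omega> f"
proof -
  define A where "A = A2_constant \<omega>"
  have wt: "is_weight \<omega>" and A: "A < \<infinity>" using \<omega> by (simp_all add: A2_weight_def A_def)
  have f_m: "f \<in> borel_measurable lebesgue" using f by (simp add: weighted_L2_def)
  obtain w where w: "w \<in> borel_measurable borel" and w_eq: "AE x in lborel. \<omega> x = w x"
    using completion_ex_borel_measurable_real[OF weight_measurable[OF wt]] by auto
  obtain g where g: "g \<in> borel_measurable borel" and g_eq: "AE x in lborel. f x = g x"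
    using lebesgue_measurable_ex_borel_complex[OF f_m] by blast
  have pos: "AE x in lborel. 0 < \<omega> x" using wt by (simp add: is_weight_def AE_completion_iff)
  \<comment> \<open>Used with \<open>h\<close> the identity and with \<open>h = inverse\<close>; it
    moves from the closed intervals of \<open>A2_constant\<close> to open ones and from
    \<open>\<omega>\<close> to \<open>w\<close>.\<close>
  have open_closed: "(\<integral>\<^sup>+x\<in>{a<..<b}. ennreal (h (w x)) \<partial>lborel) = (\<integral>\<^sup>+x\<in>{a..b}. ennreal (h (\<omega> x)) \<partial>lebesgue)" for a b and h :: "real \<Rightarrow> real"
    unfolding nn_integral_completion
  proof (rule nn_integral_cong_AE)
    show "AE x in lborel. ennreal (h (w x)) * indicator {a<..<b} x = ennreal (h (\<omega> x)) * indicator {a..b} x"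
      using w_eq AE_lborel_singleton[of a] AE_lborel_singleton[of b] by eventually_elim (auto simp: indicator_def)
  qed
  have norm_eq: "(\<integral>\<^sup>+t. ennreal ((cmod (h t))\<^sup>2) * ennreal (w t) \<partial>lborel) = (\<integral>\<^sup>+t. ennreal ((cmod (k t))\<^sup>2) * ennreal (\<omega> t) \<partial>lborel)"
    if "AE x in lborel. k x = h x" for h k :: "real \<Rightarrow> complex"
    by (rule nn_integral_cong_AE, use that w_eq in eventually_elim) simp
  note fN = weighted_L2_norm_eq_nn_integral[OF wt f_m]
  interpret weighted_cz K B w A g
  proof unfold_locales
    show "AE x in lborel. 0 < w x" using pos w_eq by eventually_elim simp
    show "(\<integral>\<^sup>+x\<in>{a<..<b}. ennreal (w x) \<partial>lborel) < \<infinity>" for a b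
    proof -
      have "integrable lebesgue (\<lambda>x. indicat_real {a..b} x *\<^sub>R \<omega> x)"
        using wt by (simp add: is_weight_def set_integrable_def)
      then have "(\<integral>\<^sup>+x. ennreal (norm (indicat_real {a..b} x *\<^sub>R \<omega> x)) \<partial>lebesgue) < \<infinity>"
        by (simp add: integrable_iff_bounded)
      moreover have "(\<integral>\<^sup>+x\<in>{a..b}. ennreal (\<omega> x) \<partial>lebesgue) \<le> (\<integral>\<^sup>+x. ennreal (norm (indicat_real {a..b} x *\<^sub>R \<omega> x)) \<partial>lebesgue)"
        by (intro nn_integral_mono) (auto simp: indicator_def intro: ennreal_leI)
      ultimately show ?thesis unfolding open_closed[where h="\<lambda>y. y"] by (rule le_less_trans[rotated])
    qed
    show "(\<integral>\<^sup>+x\<in>{a<..<b}. ennreal (w x) \<partial>lborel) / ennreal (b - a) *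
        ((\<integral>\<^sup>+x\<in>{a<..<b}. ennreal (inverse (w x)) \<partial>lborel) / ennreal (b - a)) \<le> A" if "a < b" for a b
      unfolding open_closed[where h="\<lambda>y. y"] open_closed[where h=inverse] A_def A2_constant_def
      by (rule SUP_upper2[of "(a, b)"]) (use that in auto)
    show "(\<integral>\<^sup>+t. ennreal ((cmod (g t))\<^sup>2) * ennreal (w t) \<partial>lborel) < \<infinity>"
      using fN(2) f norm_eq[OF g_eq] by simp
  qed (use w g A in auto)
  have K_m: "(\<lambda>t. K (x - t)) \<in> borel_measurable lebesgue" for x
    by (rule measurable_completion) measurable
  have S_m: "{t. \<bar>x - t\<bar> > \<epsilon>} \<in> sets borel" for x \<epsilon> :: real by measurable
  have integrand_m: "(\<lambda>t. indicat_real {t. \<bar>x - t\<bar> > \<epsilon>} t *\<^sub>R K (x - t) *\<^sub>R k t) \<in> borel_measurable lebesgue"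
    if "k \<in> borel_measurable lebesgue" for k :: "real \<Rightarrow> complex" and x \<epsilon>
    using that K_m[of x] S_m[of \<epsilon> x]
    by (intro borel_measurable_scaleR borel_measurable_indicator) auto
  have integrand_borel: "(\<lambda>t. indicat_real {t. \<bar>x - t\<bar> > \<epsilon>} t *\<^sub>R K (x - t) *\<^sub>R g t) \<in> borel_measurable lborel" for x \<epsilon>
    by measurable
  have integrand_eq: "AE t in lebesgue. indicat_real {t. \<bar>x - t\<bar> > \<epsilon>} t *\<^sub>R K (x - t) *\<^sub>R f t = indicat_real {t. \<bar>x - t\<bar> > \<epsilon>} t *\<^sub>R K (x - t) *\<^sub>R g t" for x \<epsilon>
    unfolding AE_completion_iff using g_eq by eventually_elim simp
  have g_m: "g \<in> borel_measurable lebesgue" by (rule measurable_completion) (simp add: g)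
  \<comment> \<open>The exceptional set concerns the integration variable only, so the identity
    holds for all \<open>x\<close> and \<open>\<epsilon>\<close>.\<close>
  have conv: "truncated_convolution K f \<epsilon> x = trunc g \<epsilon> x" for \<epsilon> x
    unfolding truncated_convolution_def trunc_def set_lebesgue_integral_def
    using integral_cong_AE[OF integrand_m[OF f_m] integrand_m[OF g_m] integrand_eq]
      integral_completion[OF integrand_borel] by (rule trans)
  have abs_conv: "set_integrable lebesgue {t. \<bar>x - t\<bar> > \<epsilon>} (\<lambda>t. K (x - t) *\<^sub>R f t)" if "\<epsilon> > 0" for \<epsilon> x
    using truncated_integrable[OF that, of x] unfolding set_integrable_def
    by (subst integrable_cong_AE[OF integrand_m[OF f_m] integrand_m[OF g_m] integrand_eq]) (simp only: integrable_completion[OF integrand_borel])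
  have op: "cz_operator K f = Tf" by (rule ext) (simp add: cz_operator_def Tf_def conv)
  have 1: "AE x in lebesgue. principal_value_exists K f x"
    unfolding AE_completion_iff using AE_trunc_tendsto_Tf
    by eventually_elim (auto simp: principal_value_exists_def conv intro: abs_conv)
  have Tf_m: "Tf \<in> borel_measurable lebesgue"
    using Tf_AE_eq_borel by (elim bexE) (rule AE_eq_borel_imp_measurable_lebesgue)
  note TN = weighted_L2_norm_eq_nn_integral[OF wt Tf_m]
  let ?X = "\<integral>\<^sup>+x. ennreal ((cmod (f x))\<^sup>2) * ennreal (\<omega> x) \<partial>lborel"
  let ?Y = "\<integral>\<^sup>+x. ennreal ((cmod (Tf x))\<^sup>2) * ennreal (\<omega> x) \<partial>lborel"
  have bd: "?Y \<le> (288 * ennreal sparse_const * A)\<^sup>2 * ?X"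
    using Tf_weighted_bound norm_eq[of Tf Tf] norm_eq[OF g_eq] by simp
  have S0: "sparse_const \<ge> 0" using B_pos by (simp add: sparse_const_def)
  have X: "?X < \<infinity>" using fN(2) f by simp
  obtain a where a: "a \<ge> 0" "A = ennreal a" using A by (cases A) auto
  obtain y where y: "y \<ge> 0" "?X = ennreal y" using X by (cases ?X) auto
  have rhs: "(288 * ennreal sparse_const * A)\<^sup>2 * ?X = ennreal ((288 * sparse_const * a)\<^sup>2 * y)"
    using S0 a(1) y(1) unfolding a(2) y(2)
    by (simp add: ennreal_mult ennreal_power[symmetric] flip: ennreal_numeral)
  have Yfin: "?Y < \<infinity>" using bd unfolding rhs by (rule le_less_trans) simp
  have "enn2real ?Y \<le> (288 * sparse_const * a)\<^sup>2 * y"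
    using enn2real_mono[OF bd] S0 a(1) y(1) unfolding rhs by simp
  then have "sqrt (enn2real ?Y) \<le> sqrt ((288 * sparse_const * a)\<^sup>2 * y)" by (rule real_sqrt_le_mono)
  also have "\<dots> = 288 * sparse_const * a * sqrt y" using S0 a(1) by (simp add: real_sqrt_mult)
  finally have "weighted_L2_norm \<omega> Tf \<le> 288 * sparse_const * enn2real A * weighted_L2_norm \<omega> f"
    unfolding TN(1) fN(1) y(2) a(2) using a(1) y(1) by simp
  then show ?thesis using 1 TN(2) Yfin by (simp add: op A_def)
qed

theorem corollary1p1:
  fixes K :: "real \<Rightarrow> real"
  assumes odd: "\<And>x. x \<noteq> 0 \<Longrightarrow> K (- x) = - K x"
    and diff: "\<And>x. x \<noteq> 0 \<Longrightarrow> K differentiable (at x)"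
    and ac: "locally_absolutely_continuous_on (- {0}) (deriv K)"
    and lim: "(K \<longlongrightarrow> 0) at_top"
    and lim': "(deriv K \<longlongrightarrow> 0) at_top"
    and diff2: "AE x in lebesgue. deriv K differentiable (at x)"
    and bound: "in_L_infinity (\<lambda>x. x ^ 3 * deriv (deriv K) x)"
  shows "\<exists>C::real. \<forall>(\<omega> :: real \<Rightarrow> real) (f :: real \<Rightarrow> complex).
           A2_weight \<omega> \<longrightarrow> f \<in> weighted_L2 \<omega> \<longrightarrow>
             (AE x in lebesgue. principal_value_exists K f x) \<and>
             cz_operator K f \<in> weighted_L2 \<omega> \<and>
             weighted_L2_norm \<omega> (cz_operator K f)
               \<le> C * enn2real (A2_constant \<omega>) * weighted_L2_norm \<omega> f"
proof -
  have "\<exists>B>0. \<forall>x. x \<noteq> 0 \<longrightarrow> \<bar>K x\<bar> \<le> B / \<bar>x\<bar> \<and> \<bar>deriv K x\<bar> \<le> B / x\<^sup>2"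
    by (rule kernel_size_bounds; fact)
  then obtain B where B: "B > 0" "\<And>x. x \<noteq> 0 \<Longrightarrow> \<bar>K x\<bar> \<le> B / \<bar>x\<bar> \<and> \<bar>deriv K x\<bar> \<le> B / x\<^sup>2"
    by blast
  interpret cz_kernel K B
  proof
    show "x \<noteq> 0 \<Longrightarrow> (K has_field_derivative deriv K x) (at x)" for x
      using diff by (simp add: DERIV_deriv_iff_real_differentiable)
    show "continuous_on {a..b} (deriv K)" if "0 < a" for a b
    proof (rule absolutely_continuous_on_imp_continuous_on)
      have "{a..b} \<subseteq> - {0}" using that by auto
      then show "absolutely_continuous_on {a..b} (deriv K)" using ac by (simp add: locally_absolutely_continuous_on_def)
    qed
  qed (use B odd in auto)
  \<comment> \<open>The constant is \<open>288 * sparse_const\<close>, which depends on the kernel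
    only through \<open>B\<close>.\<close>
  show ?thesis by (intro exI allI impI) (rule A2_estimate)
qed

end
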